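(* Let $K=U(n)\subset G=GL_n(\mathbb C)$ with Lie algebra $\mathfrak k$ (skew-Hermitian matrices). For each purely imaginary irregular type $A_0$ (i.e. $A_0$ is a diagonal skew-Hermitian matrix with distinct eigenvalues), with initial sector the sector containing the positive real axis and with the branch of $\log(z)$ that is real on the positive real axis, the monodromy map $\nu:\mathfrak g^*\to G^*$ restricts to a (real) Poisson diffeomorphism $$\mathfrak k^*\;\cong\;K^*$$ from the dual of the Lie algebra of $K$, with its standard Poisson structure, to the dual Poisson Lie group $K^*$, with its standard Poisson structure multiplied by the factor $\pi$.
   Context: **Groups.** $G=GL_n(\mathbb C)$, $\mathfrak g=\mathfrak{gl}_n(\mathbb C)$; $B_\pm\subset G$ are the upper ($+$) and lower ($-$) triangular Borel subgroups, $U_\pm\subset B_\pm$ their unipotent subgroups, $T$ the diagonal matrices in $G$, with Lie algebras $\mathfrak b_\pm,\mathfrak u_\pm,\mathfrak t$. $\delta$ denotes taking the diagonal part of a matrix; $\dagger$ is conjugate transpose and $g^{-\dagger}=(g^\dagger)^{-1}$. $\mathfrak g^*\cong\mathfrak g$ and $\mathfrak k^*\cong\mathfrak k$ via $B\leftrightarrow\mathrm{Tr}(B\,\cdot\,)$, so $\mathfrak k^*\subset\mathfrak g^*$. The standard Poisson structure on $\mathfrak k^*$ is $\{f,h\}(B)=\mathrm{Tr}(B[df_B,dh_B])$ with $df_B,dh_B\in T^*_B\mathfrak k^*\cong\mathfrak k$. **The groups $G^*$, $K^*$.** $G^*=\{(b_-,b_+,\Lambda)\in B_-\times B_+\times\mathfrak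 t : \delta(b_-)\delta(b_+)=1,\ \delta(b_+)=\exp(\pi i\Lambda)\}$, a subgroup of $B_-\times B_+\times\mathfrak t$ ($\mathfrak t$ a group under $+$). $K^*\subset G^*$ is the fixed point subgroup of the involution $(b_-,b_+,\Lambda)\mapsto(b_+^{-\dagger},b_-^{-\dagger},-\overline\Lambda)$; taking $b=b_+$ identifies $K^*$ with the group of upper triangular matrices with real positive diagonal entries, and $\mathrm{Lie}(K^* )$ with the upper triangular matrices $Z$ with real diagonal. $\mathrm{Lie}(K^* )$ is identified with the real dual of $\mathfrak k$ by $\langle Z,X\rangle=\mathrm{Im}\,\mathrm{Tr}(ZX)$; hence $T_e^*K^*\cong\mathfrak k$. **Standard Poisson structure on $K^*$.** The right dressing action of $K$ on $K^*$ is $k\cdot b=b'$, where $b'\in K^*$ is determined by $b'^\dagger b'=k\,b^\dagger b\,k^{-1}$. The corresponding infinitesimal action is the Lie algebra homomorphism from $\mathfrak k$ to vector fields on $K^*$ given by $X\mapsto\sigma(X)$ with $\sigma_b(X)=bZ$, where $Z\in\mathrm{Lie}(K^* )$ is determined by $bZb^{-1}+b^{-\dagger}Z^\dagger b^{\dagger}=bXb^{-1}-b^{-\dagger}Xb^{\dagger}$. The standard Poisson bivector $\mathcal P_{K^*}$ is $\mathcal P^\sharp_b=\sigma_b\circ\varphi$, where $\varphi:T_b^*K^*\to T_e^*K^*\cong\mathfrak k$ is dual to the derivative of left multiplication by $b$ and $\mathcal P(\alpha,\beta)=\langle\mathcal P^\sharp(\alpha),\beta\rangle$; thus $\mathcal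 P_{K^*}(\varphi^{-1}(X),\varphi^{-1}(Y))=\mathrm{Im}\,\mathrm{Tr}(ZY)$ at $b$. **Monodromy map $\nu$.** Fix a diagonal matrix $A_0$ with distinct eigenvalues. For $B\in\mathfrak g\cong \mathfrak g^*$ let $\nabla=d-A$, $A=(A_0/z^2+B/z)dz$, on the trivial rank $n$ bundle. The gauge action is $g[A]=gAg^{-1}+(dg)g^{-1}$. Put $Q=-A_0/z=\mathrm{diag}(q_1,\dots,q_n)$. The anti-Stokes directions are the directions at $0$ along which $e^{q_i-q_j}$ decays most rapidly as $z\to0$, for some $i\neq j$; their (even) number is $2l$. (For $A_0$ purely imaginary they are the two halves of the imaginary axis, so $l=1$.) Choose an initial sector $\mathrm{Sect}_0$ at $0$ bounded by two adjacent anti-Stokes directions, and a branch of $\log z$ on it. Label the anti-Stokes directions $d_1,\dots,d_{2l}$ in the positive sense starting on the positive edge of $\mathrm{Sect}_0$; $\mathrm{Sect}_i=\mathrm{Sect}(d_i,d_{i+1})$ is the open sector swept out moving from $d_i$ to $d_{i+1}$ in the positive sense (indices mod $2l$), and $\widehat{\mathrm{Sect}}_i=\mathrm{Sect}(d_i-\pi/2,d_{i+1}+\pi/2)$. There is a unique formal series $\widehat F\in GL_n(\mathbb C[[z]])$ with $\widehat F(0)=1$ and $\widehat F[A_0dz/z^2+\delta(B)dz/z]=A$. There is a canonical invertible holomorphic matrix $\Sigma_i(\widehat F)$ on $\mathrm{Sect}_i$, characterised by $\Sigma_i(\widehat F)[A_0dz/z^2+\delta(B)dz/z]=A$ together with the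 property that it continues to $\widehat{\mathrm{Sect}}_i$ and is asymptotic to $\widehat F$ at $0$ in $\widehat{\mathrm{Sect}}_i$. Put $\Phi_i=\Sigma_i(\widehat F)z^{\delta(B)}e^Q$ on $\mathrm{Sect}_i$, where the branch of $\log z$ on $\mathrm{Sect}_0$ is extended to the other sectors in the negative sense. Let $\theta$ be the direction bisecting $\mathrm{Sect}(d_1,d_l)$ ($\theta=d_1$ if $l=1$), let $\varpi$ be the permutation of $\{1,\dots,n\}$ with $\varpi(i)<\varpi(j)\iff e^{q_i}/e^{q_j}\to0$ as $z\to0$ along $\theta$, and let $P_{ij}=\delta_{\varpi(i)j}$ be the associated permutation matrix. The Stokes matrices $S_\pm\in U_\pm$ are defined by: if $\Phi_l$ is continued in the positive sense to $\mathrm{Sect}_0$ then $\Phi_l=\Phi_0PS_-P^{-1}$; if $\Phi_0$ is continued in the positive sense to $\mathrm{Sect}_l$ then $\Phi_0=\Phi_lPS_+P^{-1}M_0$ with $M_0=\exp(2\pi i\,\delta(B))$. Put $\Lambda=P^{-1}\delta(B)P$. Then $\nu(B)=(b_-,b_+,\Lambda)$ with $b_-=e^{-\pi i\Lambda}S_-^{-1}$ and $b_+=e^{-\pi i\Lambda}S_+e^{2\pi i\Lambda}$. *)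

theory Defs
  imports "HOL-Complex_Analysis.Complex_Analysis"
begin

unbundle no Formal_Power_Series.fps_syntax

section \<open>Complex matrices and the groups involved\<close>

text \<open>
  The indices \<open>1, \<dots>, n\<close> are the elements of a finite linearly ordered type; the order is what
  makes ``upper'' and ``lower'' triangular meaningful. The class \<open>wellorder\<close> is no restriction,
  since a finite linear order is a well-order.
\<close>

type_synonym 'n cmat = "complex^'n^'n"

definition cscale :: "complex \<Rightarrow> 'n cmat \<Rightarrow> 'n::finite cmat" where
  "cscale c A = map_matrix (\<lambda>x. c * x) A"

definition dagger :: "'n cmat \<Rightarrow> 'n::finite cmat" where
  "dagger A = map_matrix cnj (transpose A)"

definition diag_part :: "'n cmat \<Rightarrow> 'n::finite cmat" where
  "diag_part A = (\<chi> i j. if i = j then A $ i $ j else 0)"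

definition diag_mats :: "'n::finite cmat set" where
  "diag_mats = {D. \<forall>i j. i \<noteq> j \<longrightarrow> D $ i $ j = 0}"

text \<open>The matrix exponential, only ever applied to diagonal matrices.\<close>

definition diag_exp :: "'n cmat \<Rightarrow> 'n::finite cmat" where
  "diag_exp D = (\<chi> i j. if i = j then exp (D $ i $ i) else 0)"

definition upper_tri :: "'n::{finite,wellorder} cmat \<Rightarrow> bool" where
  "upper_tri A \<longleftrightarrow> (\<forall>i j. j < i \<longrightarrow> A $ i $ j = 0)"

definition lower_tri :: "'n::{finite,wellorder} cmat \<Rightarrow> bool" where
  "lower_tri A \<longleftrightarrow> (\<forall>i j. i < j \<longrightarrow> A $ i $ j = 0)"

definition B_plus :: "'n::{finite,wellorder} cmat set" where
  "B_plus = {b. invertible b \<and> upper_tri b}"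

definition B_minus :: "'n::{finite,wellorder} cmat set" where
  "B_minus = {b. invertible b \<and> lower_tri b}"

definition U_plus :: "'n::{finite,wellorder} cmat set" where
  "U_plus = {u \<in> B_plus. \<forall>i. u $ i $ i = 1}"

definition U_minus :: "'n::{finite,wellorder} cmat set" where
  "U_minus = {u \<in> B_minus. \<forall>i. u $ i $ i = 1}"

definition G_star :: "('n::{finite,wellorder} cmat \<times> 'n cmat \<times> 'n cmat) set" where
  "G_star = {(bm, bp, L). bm \<in> B_minus \<and> bp \<in> B_plus \<and> L \<in> diag_mats \<and>
     diag_part bm ** diag_part bp = mat 1 \<and>
     diag_part bp = diag_exp (cscale (complex_of_real pi * \<i>) L)}"

definition star_involution ::
  "'n cmat \<times> 'n cmat \<times> 'n cmat \<Rightarrow> 'n cmat \<times> 'n cmat \<times> 'n::{finite,wellorder} cmat" where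
  "star_involution = (\<lambda>(bm, bp, L).
     (matrix_inv (dagger bp), matrix_inv (dagger bm), - map_matrix cnj L))"

definition K_star :: "('n::{finite,wellorder} cmat \<times> 'n cmat \<times> 'n cmat) set" where
  "K_star = {x \<in> G_star. star_involution x = x}"

text \<open>
  The manifold structure of \<open>K_star\<close> is the one transported along the identification
  \<open>(b\<^sub>-, b\<^sub>+, \<Lambda>) \<mapsto> b\<^sub>+\<close> with \<open>K_plus\<close>, which is a relatively open subset of the real vector
  space \<open>lie_K_star\<close>.
\<close>

definition b_plus_of :: "'n cmat \<times> 'n cmat \<times> 'n cmat \<Rightarrow> 'n::finite cmat" where
  "b_plus_of x = fst (snd x)"

definition K_plus :: "'n::{finite,wellorder} cmat set" where
  "K_plus = {b. upper_tri b \<and> (\<forall>i. b $ i $ i \<in> \<real> \<and> 0 < Re (b $ i $ i))}"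

definition lie_K_star :: "'n::{finite,wellorder} cmat set" where
  "lie_K_star = {Z. upper_tri Z \<and> (\<forall>i. Z $ i $ i \<in> \<real>)}"

text \<open>
  The Lie algebra of \<open>U(n)\<close>; its dual is identified with the same set of matrices,
  \<open>B\<close> standing for the functional \<open>X \<mapsto> Tr (B X)\<close>.
\<close>

definition lie_k :: "'n::finite cmat set" where
  "lie_k = {X. dagger X = - X}"


section \<open>Smooth maps and Poisson structures\<close>

text \<open>
  Here \<open>S\<close> is a relatively open subset of a real linear subspace \<open>V\<close>. The derivative within \<open>S\<close> is
  then determined on \<open>V\<close>, the tangent space of \<open>S\<close> at each of its points, and on nothing else.
\<close>

primrec Ck_on :: "nat \<Rightarrow> 'a set \<Rightarrow> 'a set \<Rightarrow>
    ('a::real_normed_vector \<Rightarrow> 'b::real_normed_vector) \<Rightarrow> bool" where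
  "Ck_on 0 V S f \<longleftrightarrow> continuous_on S f"
| "Ck_on (Suc k) V S f \<longleftrightarrow>
     (\<exists>f'. (\<forall>x\<in>S. (f has_derivative f' x) (at x within S)) \<and>
           (\<forall>v\<in>V. Ck_on k V S (\<lambda>x. f' x v)))"

definition smooth_on :: "'a set \<Rightarrow> 'a set \<Rightarrow>
    ('a::real_normed_vector \<Rightarrow> 'b::real_normed_vector) \<Rightarrow> bool" where
  "smooth_on V S f \<longleftrightarrow> (\<forall>k. Ck_on k V S f)"

definition diffeo :: "'a set \<Rightarrow> 'a set \<Rightarrow> 'b set \<Rightarrow> 'b set \<Rightarrow>
    ('a::real_normed_vector \<Rightarrow> 'b::real_normed_vector) \<Rightarrow> bool" where
  "diffeo V S W T F \<longleftrightarrow>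
     bij_betw F S T \<and> smooth_on V S F \<and> smooth_on W T (inv_into S F)"

text \<open>
  A covector at a point of \<open>S\<close> is represented by a functional on the ambient space of which only
  the restriction to the tangent space \<open>V\<close> is relevant, and a bivector field by the function
  \<open>P x \<alpha> \<beta>\<close> of a point and two covectors.
\<close>

type_synonym 'a bivector = "'a \<Rightarrow> ('a \<Rightarrow> real) \<Rightarrow> ('a \<Rightarrow> real) \<Rightarrow> real"

definition poisson_bracket :: "'a set \<Rightarrow> 'a bivector \<Rightarrow>
    ('a \<Rightarrow> real) \<Rightarrow> ('a \<Rightarrow> real) \<Rightarrow> 'a::real_normed_vector \<Rightarrow> real" where
  "poisson_bracket S P f h x =
     P x (frechet_derivative f (at x within S)) (frechet_derivative h (at x within S))"

definition poisson_map :: "'a set \<Rightarrow> 'a bivector \<Rightarrow> 'b set \<Rightarrow> 'b set \<Rightarrow> 'b bivector \<Rightarrow>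
    ('a::real_normed_vector \<Rightarrow> 'b::real_normed_vector) \<Rightarrow> bool" where
  "poisson_map S P W T P' F \<longleftrightarrow>
     (\<forall>f h. smooth_on W T f \<longrightarrow> smooth_on W T h \<longrightarrow>
       (\<forall>x\<in>S. poisson_bracket S P (f \<circ> F) (h \<circ> F) x = poisson_bracket T P' f h (F x)))"

text \<open>
  On \<open>\<kk>\<^sup>*\<close>: a covector \<open>\<alpha>\<close> is the element \<open>X\<close> of \<open>\<kk>\<close> with \<open>\<alpha>(C) = Tr (C X)\<close>. The traces are real
  because the matrices are skew-Hermitian.
\<close>

definition k_covector :: "('n cmat \<Rightarrow> real) \<Rightarrow> 'n::finite cmat" where
  "k_covector \<alpha> =
     (THE X. X \<in> lie_k \<and> (\<forall>C\<in>lie_k. complex_of_real (\<alpha> C) = trace (C ** X)))"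

definition k_dual_poisson :: "'n::finite cmat bivector" where
  "k_dual_poisson B \<alpha> \<beta> =
     (let X = k_covector \<alpha>; Y = k_covector \<beta> in Re (trace (B ** (X ** Y - Y ** X))))"

text \<open>
  On the dual group: the generator \<open>\<sigma>\<^sub>b(X) = b Z\<close> of the right dressing action
  \<open>b'\<^sup>\<dagger> b' = k b\<^sup>\<dagger> b k\<^sup>-\<^sup>1\<close>, and the covector trivialisation \<open>\<phi>\<close> dual to left translation, in terms of
  the pairing \<open>\<langle>Z, X\<rangle> = Im (Tr (Z X))\<close> of \<open>lie_K_star\<close> with \<open>lie_k\<close>.
\<close>

definition dressing_field :: "'n cmat \<Rightarrow> 'n cmat \<Rightarrow> 'n::{finite,wellorder} cmat" where
  "dressing_field X b = b ** (THE Z. Z \<in> lie_K_star \<and>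
     b ** Z ** matrix_inv b + matrix_inv (dagger b) ** dagger Z ** dagger b =
     b ** X ** matrix_inv b - matrix_inv (dagger b) ** X ** dagger b)"

definition covector_to_k :: "'n cmat \<Rightarrow> ('n cmat \<Rightarrow> real) \<Rightarrow> 'n::{finite,wellorder} cmat" where
  "covector_to_k b \<alpha> =
     (THE X. X \<in> lie_k \<and> (\<forall>Z\<in>lie_K_star. Im (trace (Z ** X)) = \<alpha> (b ** Z)))"

definition K_star_poisson :: "'n::{finite,wellorder} cmat bivector" where
  "K_star_poisson b \<alpha> \<beta> = \<beta> (dressing_field (covector_to_k b \<alpha>) b)"


section \<open>Directions and sectors\<close>

text \<open>
  Directions at \<open>0\<close> are given by real angles, not reduced modulo \<open>2\<pi>\<close>. For \<open>b - a \<le> 2\<pi>\<close> an angle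
  interval \<open>(a, b)\<close> thus gives both a sector in the plane and a branch of the logarithm on it.
\<close>

definition sector :: "real \<Rightarrow> real \<Rightarrow> complex set" where
  "sector a b = {rcis r t | r t. 0 < r \<and> a < t \<and> t < b}"

definition sector_log :: "real \<Rightarrow> real \<Rightarrow> complex \<Rightarrow> complex" where
  "sector_log a b z = (THE w. exp w = z \<and> a < Im w \<and> Im w < b)"

definition irr_q :: "'n::finite cmat \<Rightarrow> 'n \<Rightarrow> complex \<Rightarrow> complex" where
  "irr_q A0 i z = - (A0 $ i $ i) / z"

definition irr_Q :: "'n cmat \<Rightarrow> complex \<Rightarrow> 'n::finite cmat" where
  "irr_Q A0 z = (\<chi> i j. if i = j then irr_q A0 i z else 0)"

text \<open>Decay along the ray, at least as fast as along every other ray.\<close>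

definition anti_stokes :: "'n::finite cmat \<Rightarrow> real \<Rightarrow> bool" where
  "anti_stokes A0 t \<longleftrightarrow> (\<exists>i j. i \<noteq> j \<and>
     (let e = (\<lambda>r s. exp (irr_q A0 i (rcis r s) - irr_q A0 j (rcis r s))) in
       ((\<lambda>r. e r t) \<longlongrightarrow> 0) (at_right 0) \<and>
       (\<forall>s. \<forall>r>0. norm (e r t) \<le> norm (e r s))))"

text \<open>
  \<open>d\<close> enumerates the anti-Stokes directions in the positive sense, \<open>2l\<close> of them per turn. The
  initial sector, with its branch of \<open>log z\<close>, is given by the angle interval \<open>(d 0, d 1)\<close>.
  For \<open>n = 1\<close> no exponential \<open>exp (q\<^sub>i - q\<^sub>j)\<close> with \<open>i \<noteq> j\<close> exists; by convention the two
  halves of the imaginary axis are used, which are the anti-Stokes directions for purely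
  imaginary \<open>A0\<close> when \<open>n \<ge> 2\<close>.
\<close>

definition anti_stokes_labelling :: "'n::finite cmat \<Rightarrow> nat \<Rightarrow> (int \<Rightarrow> real) \<Rightarrow> bool" where
  "anti_stokes_labelling A0 l d \<longleftrightarrow>
     0 < l \<and> strict_mono d \<and> (\<forall>k. d (k + 2 * int l) = d k + 2 * pi) \<and>
     range d = (if CARD('n) = 1 then range (\<lambda>k::int. pi / 2 + of_int k * pi)
                else Collect (anti_stokes A0))"


section \<open>The connection and its canonical solutions\<close>

text \<open>The coefficient of \<open>dz\<close> in \<open>(A0/z\<^sup>2 + B/z) dz\<close>.\<close>

definition conn :: "'n cmat \<Rightarrow> 'n cmat \<Rightarrow> complex \<Rightarrow> 'n::finite cmat" where
  "conn A0 B z = cscale (1 / z\<^sup>2) A0 + cscale (1 / z) B"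

definition mat_holomorphic_on :: "(complex \<Rightarrow> 'n::finite cmat) \<Rightarrow> complex set \<Rightarrow> bool" where
  "mat_holomorphic_on X S \<longleftrightarrow> (\<forall>i j. (\<lambda>z. X z $ i $ j) holomorphic_on S)"

definition mat_deriv :: "(complex \<Rightarrow> 'n cmat) \<Rightarrow> complex \<Rightarrow> 'n::finite cmat" where
  "mat_deriv X z = (\<chi> i j. deriv (\<lambda>w. X w $ i $ j) z)"

definition gauge ::
  "(complex \<Rightarrow> 'n cmat) \<Rightarrow> (complex \<Rightarrow> 'n cmat) \<Rightarrow> complex \<Rightarrow> 'n::finite cmat" where
  "gauge g A z = g z ** A z ** matrix_inv (g z) + mat_deriv g z ** matrix_inv (g z)"

text \<open>
  The same for formal series; the matrices are taken over formal Laurent series since the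
  connection has a pole.
\<close>

definition formal_conn :: "'n cmat \<Rightarrow> 'n cmat \<Rightarrow> complex fls^'n::finite^'n" where
  "formal_conn A0 B = map_matrix (\<lambda>c. fls_X_inv\<^sup>2 * fls_const c) A0
                    + map_matrix (\<lambda>c. fls_X_inv * fls_const c) B"

definition formal_gauge ::
  "complex fls^'n^'n \<Rightarrow> complex fls^'n^'n \<Rightarrow> complex fls^'n::finite^'n" where
  "formal_gauge g A = g ** A ** matrix_inv g + map_matrix fls_deriv g ** matrix_inv g"

definition formal_F :: "'n cmat \<Rightarrow> 'n cmat \<Rightarrow> complex fps^'n::finite^'n" where
  "formal_F A0 B = (THE F. invertible F \<and> map_matrix (\<lambda>f. fps_nth f 0) F = mat 1 \<and>
     formal_gauge (map_matrix fps_to_fls F) (formal_conn A0 (diag_part B)) = formal_conn A0 B)"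

text \<open>Asymptotic expansion at \<open>0\<close>, uniformly on proper subsectors.\<close>

definition asymptotic_in :: "(complex \<Rightarrow> 'n cmat) \<Rightarrow> complex fps^'n::finite^'n \<Rightarrow>
    real \<Rightarrow> real \<Rightarrow> bool" where
  "asymptotic_in X F a b \<longleftrightarrow>
     (\<forall>a' b' N. a < a' \<longrightarrow> a' < b' \<longrightarrow> b' < b \<longrightarrow>
       (\<exists>C. \<exists>\<rho>>0. \<forall>z\<in>sector a' b'. norm z < \<rho> \<longrightarrow>
          norm (X z - (\<Sum>k<N. cscale (z ^ k) (map_matrix (\<lambda>f. fps_nth f k) F)))
            \<le> C * norm z ^ N))"

text \<open>
  \<open>X\<close> is \<open>\<Sigma>(F)\<close> for the sector between the adjacent anti-Stokes directions \<open>a\<close> and \<open>b\<close>, together with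
  its continuation to the sector extended by \<open>\<pi>/2\<close> on either side.
\<close>

definition is_canonical_sum ::
  "'n cmat \<Rightarrow> 'n cmat \<Rightarrow> real \<Rightarrow> real \<Rightarrow> (complex \<Rightarrow> 'n::finite cmat) \<Rightarrow> bool" where
  "is_canonical_sum A0 B a b X \<longleftrightarrow>
     (\<forall>z\<in>sector a b. invertible (X z) \<and> gauge X (conn A0 (diag_part B)) z = conn A0 B z) \<and>
     mat_holomorphic_on X (sector (a - pi / 2) (b + pi / 2)) \<and>
     asymptotic_in X (formal_F A0 B) (a - pi / 2) (b + pi / 2)"

text \<open>Determined by its characterisation on the extended sector only.\<close>

definition canonical_sum ::
  "'n cmat \<Rightarrow> 'n cmat \<Rightarrow> real \<Rightarrow> real \<Rightarrow> complex \<Rightarrow> 'n::finite cmat" where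
  "canonical_sum A0 B a b = (SOME X. is_canonical_sum A0 B a b X)"

text \<open>
  The branch of \<open>log z\<close> is extended from \<open>Sect\<^sub>0\<close> in the negative sense, so for \<open>0 < i < 2l\<close> the angle
  interval of \<open>Sect\<^sub>i\<close> carrying the branch is \<open>(d (i - 2l), d (i + 1 - 2l))\<close>, that is
  \<open>(d i - 2\<pi>, d (i + 1) - 2\<pi>)\<close>.
\<close>

definition branch_index :: "nat \<Rightarrow> nat \<Rightarrow> int" where
  "branch_index l i = (if i = 0 then 0 else int i - 2 * int l)"

definition Phi :: "'n cmat \<Rightarrow> nat \<Rightarrow> (int \<Rightarrow> real) \<Rightarrow> 'n cmat \<Rightarrow> nat \<Rightarrow>
    complex \<Rightarrow> 'n::finite cmat" where
  "Phi A0 l d B i z =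
     (let k = branch_index l i in
        canonical_sum A0 B (d k) (d (k + 1)) z
        ** diag_exp (cscale (sector_log (d k) (d (k + 1)) z) (diag_part B))
        ** diag_exp (irr_Q A0 z))"


section \<open>Stokes matrices and the monodromy map\<close>

definition stokes_perm ::
  "'n::{finite,wellorder} cmat \<Rightarrow> nat \<Rightarrow> (int \<Rightarrow> real) \<Rightarrow> 'n \<Rightarrow> 'n" where
  "stokes_perm A0 l d = (THE w. bij w \<and> (\<forall>i j. w i < w j \<longleftrightarrow>
     ((\<lambda>r. exp (irr_q A0 i (rcis r ((d 1 + d (int l)) / 2)))
         / exp (irr_q A0 j (rcis r ((d 1 + d (int l)) / 2)))) \<longlongrightarrow> 0) (at_right 0)))"

definition perm_mat :: "('n \<Rightarrow> 'n) \<Rightarrow> 'n::finite cmat" where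
  "perm_mat w = (\<chi> i j. if w i = j then 1 else 0)"

definition stokes_P :: "'n::{finite,wellorder} cmat \<Rightarrow> nat \<Rightarrow> (int \<Rightarrow> real) \<Rightarrow> 'n cmat" where
  "stokes_P A0 l d = perm_mat (stokes_perm A0 l d)"

text \<open>
  The positive continuations take place on the sectors \<open>(d (-l), d 1)\<close>, from \<open>Sect\<^sub>l\<close> to \<open>Sect\<^sub>0\<close>, and
  \<open>(d 0, d (l + 1))\<close>, from \<open>Sect\<^sub>0\<close> to \<open>Sect\<^sub>l\<close>. Both have opening at most \<open>2\<pi>\<close>, because the
  anti-Stokes directions are symmetric: \<open>d (k + l) = d k + \<pi>\<close>.
\<close>

definition stokes_minus ::
  "'n::{finite,wellorder} cmat \<Rightarrow> nat \<Rightarrow> (int \<Rightarrow> real) \<Rightarrow> 'n cmat \<Rightarrow> 'n cmat" where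
  "stokes_minus A0 l d B = (THE S. S \<in> U_minus \<and>
     (\<exists>X. mat_holomorphic_on X (sector (d (- int l)) (d 1)) \<and>
       (\<forall>z\<in>sector (d (- int l)) (d (- int l + 1)). X z = Phi A0 l d B l z) \<and>
       (\<forall>z\<in>sector (d 0) (d 1).
          X z = Phi A0 l d B 0 z ** stokes_P A0 l d ** S ** matrix_inv (stokes_P A0 l d))))"

definition stokes_plus ::
  "'n::{finite,wellorder} cmat \<Rightarrow> nat \<Rightarrow> (int \<Rightarrow> real) \<Rightarrow> 'n cmat \<Rightarrow> 'n cmat" where
  "stokes_plus A0 l d B = (THE S. S \<in> U_plus \<and>
     (\<exists>X. mat_holomorphic_on X (sector (d 0) (d (int l + 1))) \<and>
       (\<forall>z\<in>sector (d 0) (d 1). X z = Phi A0 l d B 0 z) \<and>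
       (\<forall>z\<in>sector (d (int l)) (d (int l + 1)).
          X z = Phi A0 l d B l z ** stokes_P A0 l d ** S ** matrix_inv (stokes_P A0 l d)
                ** diag_exp (cscale (2 * complex_of_real pi * \<i>) (diag_part B)))))"

definition monodromy_map :: "'n::{finite,wellorder} cmat \<Rightarrow> nat \<Rightarrow> (int \<Rightarrow> real) \<Rightarrow>
    'n cmat \<Rightarrow> 'n cmat \<times> 'n cmat \<times> 'n cmat" where
  "monodromy_map A0 l d B =
     (let P = stokes_P A0 l d;
          L = matrix_inv P ** diag_part B ** P;
          e = (\<lambda>c. diag_exp (cscale (c * complex_of_real pi * \<i>) L))
      in (e (- 1) ** matrix_inv (stokes_minus A0 l d B),
          e (- 1) ** stokes_plus A0 l d B ** e 2,
          L))"


section \<open>Consistency of the conventions\<close>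

lemma skew_diag_Re:
  assumes skew: "dagger A0 = - (A0 :: 'n::finite cmat)"
  shows "Re (A0 $ k $ k) = 0"
proof -
  have "cnj (A0 $ k $ k) = - (A0 $ k $ k)"
    using arg_cong[OF skew, of "\<lambda>M. M $ k $ k"] by (simp add: dagger_def transpose_def)
  then have "Re (cnj (A0 $ k $ k)) = Re (- (A0 $ k $ k))" by simp
  then show ?thesis by simp
qed

lemma re_irr_q_imaginary:
  assumes skew: "dagger A0 = - (A0 :: 'n::finite cmat)" and r: "0 < r"
  shows "Re (irr_q A0 i (rcis r s) - irr_q A0 j (rcis r s))
       = - ((Im (A0 $ i $ i) - Im (A0 $ j $ j)) * sin s / r)"
proof -
  note re0 = skew_diag_Re[OF skew]
  have q: "Re (irr_q A0 k (rcis r s)) = - (Im (A0 $ k $ k) * sin s / r)" for k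
  proof -
    have "Re (irr_q A0 k (rcis r s)) = - (Im (A0 $ k $ k) * (r * sin s) / r\<^sup>2)"
      using r by (simp add: irr_q_def Re_divide re0 rcis_def cis.sel power_mult_distrib
          flip: distrib_left)
    also have "\<dots> = - (Im (A0 $ k $ k) * sin s / r)"
      using r by (simp add: power2_eq_square)
    finally show ?thesis .
  qed
  show ?thesis
    using r by (simp only: minus_complex.sel q) (simp add: field_simps)
qed

lemma abs_sin_eq_1_iff: "\<bar>sin (t::real)\<bar> = 1 \<longleftrightarrow> (\<exists>k::int. t = pi / 2 + of_int k * pi)"
proof -
  have "\<bar>sin t\<bar> = 1 \<longleftrightarrow> (sin t)\<^sup>2 = 1"
    by (metis abs_1 one_power2 power2_eq_iff_nonneg abs_ge_zero power2_abs zero_le_one)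
  also have "\<dots> \<longleftrightarrow> cos t = 0"
    by (simp add: sin_squared_eq)
  also have "\<dots> \<longleftrightarrow> (\<exists>k::int. t = of_int k * pi + pi / 2)"
    using cos_zero_iff_int2 by simp
  finally show ?thesis by (simp add: add.commute)
qed

lemma anti_stokes_imaginary:
  fixes A0 :: "'n::finite cmat"
  assumes skew: "dagger A0 = - A0" and dist: "inj (\<lambda>i. A0 $ i $ i)" and card: "CARD('n) \<noteq> 1"
  shows "Collect (anti_stokes A0) = range (\<lambda>k::int. pi / 2 + of_int k * pi)"
proof -
  define e where "e i j r s = exp (irr_q A0 i (rcis r s) - irr_q A0 j (rcis r s))" for i j r s
  define \<tau> where "\<tau> i j = Im (A0 $ i $ i) - Im (A0 $ j $ j)" for i j
  have ne: "norm (e i j r s) = exp (- (\<tau> i j * sin s / r))" if "0 < r" for i j r s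
    unfolding e_def \<tau>_def norm_exp_eq_Re re_irr_q_imaginary[OF skew that] ..
  note re0 = skew_diag_Re[OF skew]
  have \<tau>0: "\<tau> i j \<noteq> 0" if "i \<noteq> j" for i j
    using injD[OF dist, of i j] that re0 by (auto simp: \<tau>_def complex_eq_iff)
  have as: "anti_stokes A0 t \<longleftrightarrow> (\<exists>i j. i \<noteq> j \<and> ((\<lambda>r. e i j r t) \<longlongrightarrow> 0) (at_right 0) \<and>
       (\<forall>s. \<forall>r>0. norm (e i j r t) \<le> norm (e i j r s)))" for t
    unfolding anti_stokes_def e_def Let_def ..
  have fwd: "\<bar>sin t\<bar> = 1" if "anti_stokes A0 t" for t
  proof -
    obtain i j where ij: "i \<noteq> j" and m: "\<And>s r. 0 < r \<Longrightarrow> norm (e i j r t) \<le> norm (e i j r s)"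
      using \<open>anti_stokes A0 t\<close> as by blast
    have le: "\<tau> i j * sin s \<le> \<tau> i j * sin t" for s
      using m[of 1 s] by (simp add: ne)
    have "\<bar>\<tau> i j\<bar> \<le> \<tau> i j * sin t"
      using le[of "pi / 2"] le[of "- (pi / 2)"] by simp
    also have "\<dots> \<le> \<bar>\<tau> i j\<bar> * \<bar>sin t\<bar>"
      by (metis abs_ge_self abs_mult)
    finally have "1 \<le> \<bar>sin t\<bar>" using \<tau>0[OF ij] by simp
    then show ?thesis using abs_sin_le_one[of t] by linarith
  qed
  have bwd: "anti_stokes A0 t" if t: "\<bar>sin t\<bar> = 1" for t
  proof -
    obtain i j :: 'n where ij: "i \<noteq> j"
    proof -
      have "\<not> (\<forall>i. i = (undefined :: 'n))"
      proof
        assume "\<forall>i. i = (undefined :: 'n)"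
        then have "(UNIV :: 'n set) = {undefined}" by auto
        then have "CARD('n) = card {undefined :: 'n}" by (rule arg_cong)
        then show False using card by simp
      qed
      then show ?thesis using that by blast
    qed
    have "\<exists>i j. i \<noteq> j \<and> \<tau> i j * sin t > 0"
    proof (cases "\<tau> i j * sin t > 0")
      case False
      moreover have "\<tau> i j * sin t \<noteq> 0" using t \<tau>0[OF ij] by auto
      moreover have "\<tau> j i * sin t = - (\<tau> i j * sin t)" by (simp add: \<tau>_def algebra_simps)
      ultimately have "\<tau> j i * sin t > 0" by linarith
      with ij have "j \<noteq> i \<and> \<tau> j i * sin t > 0" by simp
      then show ?thesis by (intro exI)
    next
      case True
      with ij have "i \<noteq> j \<and> \<tau> i j * sin t > 0" by simp
      then show ?thesis by (intro exI)
    qed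
    then obtain i j where ij: "i \<noteq> j" and pos: "\<tau> i j * sin t > 0" by blast
    define c where "c = \<tau> i j * sin t"
    have "((\<lambda>r. exp (- (c / r))) \<longlongrightarrow> 0) (at_right 0)"
    proof (rule filterlim_compose[OF exp_at_bot])
      have "LIM r at_right 0. c * inverse r :> at_top"
        using pos filterlim_tendsto_pos_mult_at_top[OF tendsto_const _ filterlim_inverse_at_top_right]
        unfolding c_def by blast
      then show "LIM r at_right 0. - (c / r) :> at_bot"
        by (simp add: filterlim_uminus_at_bot divide_inverse)
    qed
    then have "((\<lambda>r. norm (e i j r t)) \<longlongrightarrow> 0) (at_right 0)"
      by (rule Lim_transform_eventually)
        (auto simp: eventually_at_right_field ne c_def intro!: exI[of _ 1])
    then have "((\<lambda>r. e i j r t) \<longlongrightarrow> 0) (at_right 0)"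
      using tendsto_norm_zero_iff by blast
    moreover have "norm (e i j r t) \<le> norm (e i j r s)" if "0 < r" for r s
    proof -
      have "\<tau> i j * sin s \<le> \<bar>\<tau> i j\<bar> * \<bar>sin s\<bar>" by (metis abs_ge_self abs_mult)
      also have "\<dots> \<le> \<bar>\<tau> i j\<bar>" using abs_sin_le_one[of s] by (simp add: mult_left_le)
      also have "\<dots> = \<bar>\<tau> i j * sin t\<bar>" using t by (simp add: abs_mult)
      also have "\<dots> = \<tau> i j * sin t" using pos by simp
      finally show ?thesis using that by (simp add: ne divide_right_mono)
    qed
    ultimately show ?thesis using as ij by blast
  qed
  show ?thesis
    using fwd bwd abs_sin_eq_1_iff by (fastforce simp: image_iff)
qed

lemma anti_stokes_labelling_imaginary:
  fixes A0 :: "'n::finite cmat"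
  assumes "dagger A0 = - A0" and "inj (\<lambda>i. A0 $ i $ i)"
  shows "anti_stokes_labelling A0 1 (\<lambda>k. of_int k * pi - pi / 2)"
proof -
  have "range (\<lambda>k::int. of_int k * pi - pi / 2) = range (\<lambda>k::int. pi / 2 + of_int k * pi)"
  proof (intro equalityI subsetI; elim imageE)
    fix x and k :: int
    show "x \<in> range (\<lambda>k::int. pi / 2 + of_int k * pi)" if "x = of_int k * pi - pi / 2"
      using that by (intro image_eqI[of _ _ "k - 1"]) (auto simp: algebra_simps)
    show "x \<in> range (\<lambda>k::int. of_int k * pi - pi / 2)" if "x = pi / 2 + of_int k * pi"
      using that by (intro image_eqI[of _ _ "k + 1"]) (auto simp: algebra_simps)
  qed
  then show ?thesis
    using anti_stokes_imaginary[OF assms]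
    by (auto simp: anti_stokes_labelling_def strict_mono_def algebra_simps)
qed

lemma inverse_eq_matrix_inv:
  assumes "A ** B = mat 1" "B ** A = mat (1 :: 'a::semiring_1)"
  shows "matrix_inv A = B"
proof -
  have "\<exists>A'. A ** A' = mat 1 \<and> A' ** A = mat 1" using assms by blast
  from someI_ex[OF this] have "matrix_inv A ** A = mat 1" unfolding matrix_inv_def by (rule conjunct2)
  then have "mat 1 ** B = matrix_inv A ** (A ** B)" by (simp only: matrix_mul_assoc)
  then show ?thesis by (simp only: assms matrix_mul_lid matrix_mul_rid)
qed

lemma upper_tri_inverse:
  fixes b c :: "'n::{finite,wellorder} cmat"
  assumes b: "upper_tri b" "\<And>i. b $ i $ i \<noteq> 0" and c: "c ** b = mat 1"
  shows "upper_tri c" and "c $ i $ i * b $ i $ i = 1"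
proof -
  have e: "(\<Sum>k\<in>UNIV. c $ i $ k * b $ k $ j) = (if i = j then 1 else 0)" for i j
    using arg_cong[OF c, of "\<lambda>M. M $ i $ j"] by (simp add: matrix_matrix_mult_def mat_def)
  have s: "(\<Sum>k\<in>UNIV. c $ i $ k * b $ k $ j) = c $ i $ j * b $ j $ j"
    if "\<And>k. k < j \<Longrightarrow> c $ i $ k = 0" for i j
  proof -
    have "(\<Sum>k\<in>UNIV. c $ i $ k * b $ k $ j) = (\<Sum>k\<in>{j}. c $ i $ k * b $ k $ j)"
    proof (rule sum.mono_neutral_right)
      show "\<forall>k\<in>UNIV - {j}. c $ i $ k * b $ k $ j = 0"
        using b(1) that unfolding upper_tri_def by (metis DiffD2 insertI1 linorder_neqE mult_eq_0_iff)
    qed auto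
    then show ?thesis by simp
  qed
  have z: "j < i \<Longrightarrow> c $ i $ j = 0" for i j
  proof (induction j rule: less_induct)
    case (less j)
    then have "c $ i $ k = 0" if "k < j" for k using that by auto
    then have "c $ i $ j * b $ j $ j = (\<Sum>k\<in>UNIV. c $ i $ k * b $ k $ j)" by (rule s[symmetric])
    also have "\<dots> = 0" unfolding e using less.prems by simp
    finally show ?case using b(2)[of j] by simp
  qed
  then show "upper_tri c" by (simp add: upper_tri_def)
  have "c $ i $ i * b $ i $ i = (\<Sum>k\<in>UNIV. c $ i $ k * b $ k $ i)" by (rule s[OF z, symmetric])
  then show "c $ i $ i * b $ i $ i = 1" unfolding e by simp
qed

lemma dagger_mult: "dagger (A ** B) = dagger B ** dagger A"
  by (simp add: dagger_def transpose_def matrix_matrix_mult_def vec_eq_iff mult.commute)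

lemma dagger_dagger: "dagger (dagger A) = A"
  by (simp add: dagger_def transpose_def vec_eq_iff)

lemma dagger_one: "dagger (mat 1) = mat 1"
  by (simp add: dagger_def transpose_def mat_def vec_eq_iff)

lemma K_plus_inverse:
  fixes b :: "'n::{finite,wellorder} cmat"
  assumes b: "b \<in> K_plus"
  obtains c where "b ** c = mat 1" "c ** b = mat 1" "upper_tri c"
    "\<And>i. c $ i $ i * b $ i $ i = 1"
proof -
  have u: "upper_tri b" and nz: "\<And>i. b $ i $ i \<noteq> 0"
  proof -
    show "upper_tri b" using b by (simp add: K_plus_def)
    fix i
    have "0 < Re (b $ i $ i)" using b by (simp add: K_plus_def)
    then show "b $ i $ i \<noteq> 0" by auto
  qed
  have "det b = prod (\<lambda>i. b $ i $ i) UNIV"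
    using u by (intro det_upperdiagonal) (auto simp: upper_tri_def)
  then have "invertible b" using nz by (simp add: invertible_det_nz)
  then obtain c where c: "b ** c = mat 1" "c ** b = mat 1" by (auto simp: invertible_def)
  then show ?thesis using that upper_tri_inverse[OF u nz c(2)] by blast
qed

lemma bij_betw_b_plus_of:
  "bij_betw b_plus_of K_star (K_plus :: 'n::{finite,wellorder} cmat set)"
proof (rule bij_betw_imageI)
  have key: "bm = matrix_inv (dagger bp)" "bp \<in> K_plus"
      "L = (\<chi> i j. if i = j then - \<i> * complex_of_real (ln (Re (bp $ i $ i)) / pi) else 0)"
    if "(bm, bp, L) \<in> K_star" for bm bp L :: "'n cmat"
  proof -
    have G: "(bm, bp, L) \<in> G_star" and I: "star_involution (bm, bp, L) = (bm, bp, L)"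
      using that by (auto simp: K_star_def)
    show "bm = matrix_inv (dagger bp)" using I by (simp add: star_involution_def)
    have "- cnj (L $ i $ i) = L $ i $ i" for i
      using I by (auto simp: star_involution_def vec_eq_iff)
    then have "Re (- cnj (L $ i $ i)) = Re (L $ i $ i)" for i by presburger
    then have L: "L $ i $ i = \<i> * complex_of_real (Im (L $ i $ i))" for i
      by (simp add: complex_eq_iff)
    have "diag_part bp = diag_exp (cscale (complex_of_real pi * \<i>) L)"
      using G by (auto simp: G_star_def)
    then have "bp $ i $ i = exp (complex_of_real pi * \<i> * L $ i $ i)" for i
      by (auto simp: vec_eq_iff diag_part_def diag_exp_def cscale_def dest!: spec[of _ i])
    also have "\<dots> i = complex_of_real (exp (- pi * Im (L $ i $ i)))" for i
    proof -
      have "complex_of_real pi * \<i> * L $ i $ i = complex_of_real (- pi * Im (L $ i $ i))"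
        by (subst L) (simp add: complex_eq_iff)
      then show ?thesis by (simp only: exp_of_real)
    qed
    finally have d: "bp $ i $ i = complex_of_real (exp (- pi * Im (L $ i $ i)))" for i .
    show "bp \<in> K_plus" using G d by (auto simp: K_plus_def G_star_def B_plus_def)
    have "L $ i $ j = 0" if "i \<noteq> j" for i j
      using G that by (auto simp: G_star_def diag_mats_def)
    then show "L = (\<chi> i j. if i = j then - \<i> * complex_of_real (ln (Re (bp $ i $ i)) / pi) else 0)"
      using L by (auto simp: vec_eq_iff d)
  qed
  show "inj_on b_plus_of (K_star :: ('n cmat \<times> 'n cmat \<times> 'n cmat) set)"
  proof (rule inj_onI)
    fix x y :: "'n cmat \<times> 'n cmat \<times> 'n cmat"
    assume xy: "x \<in> K_star" "y \<in> K_star" "b_plus_of x = b_plus_of y"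
    obtain bm bp L where x: "x = (bm, bp, L)" by (rule prod_cases3)
    obtain bm' bp' L' where y: "y = (bm', bp', L')" by (rule prod_cases3)
    have "bp = bp'" using xy(3) x y by (simp add: b_plus_of_def)
    then show "x = y"
      using key(1,3)[OF xy(1)[unfolded x]] key(1,3)[OF xy(2)[unfolded y]] x y by metis
  qed
  show "b_plus_of ` K_star = (K_plus :: 'n cmat set)"
  proof (intro equalityI subsetI)
    fix b :: "'n cmat" assume b: "b \<in> K_plus"
    obtain c where c: "b ** c = mat 1" "c ** b = mat 1" "upper_tri c"
      "\<And>i. c $ i $ i * b $ i $ i = 1" using K_plus_inverse[OF b] by blast
    define L :: "'n cmat" where
      "L = (\<chi> i j. if i = j then - \<i> * complex_of_real (ln (Re (b $ i $ i)) / pi) else 0)"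
    have re: "b $ i $ i = complex_of_real (Re (b $ i $ i))" "0 < Re (b $ i $ i)" for i
      using b by (simp_all add: K_plus_def)
    have d: "dagger b ** dagger c = mat 1" "dagger c ** dagger b = mat 1"
      using c by (simp_all add: dagger_one flip: dagger_mult)
    have inv: "matrix_inv (dagger b) = dagger c" "matrix_inv c = b"
      using inverse_eq_matrix_inv d c by blast+
    have i1: "invertible (dagger c)" "invertible b"
      using c d by (auto simp: invertible_def)
    have e: "exp (complex_of_real pi * \<i> * L $ i $ i) = b $ i $ i" for i
    proof -
      have "complex_of_real pi * \<i> * L $ i $ i = complex_of_real (ln (Re (b $ i $ i)))"
        by (simp add: L_def)
      also have "exp \<dots> = complex_of_real (Re (b $ i $ i))"
        using re(2)[of i] by (metis exp_ln exp_of_real)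
      finally show ?thesis by (simp only: re(1)[of i, symmetric])
    qed
    have cnj_b: "cnj (c $ i $ i) * b $ i $ i = 1" for i
      using arg_cong[OF c(4)[of i], of cnj] re(1)[of i] by (metis complex_cnj_complex_of_real
          complex_cnj_mult complex_cnj_one)
    have "upper_tri b" using b by (simp add: K_plus_def)
    moreover have "lower_tri (dagger c)"
      using c(3) by (simp add: upper_tri_def lower_tri_def dagger_def transpose_def)
    moreover have "L \<in> diag_mats" by (simp add: diag_mats_def L_def)
    moreover have "diag_part b = diag_exp (cscale (complex_of_real pi * \<i>) L)"
      using e by (simp add: vec_eq_iff diag_part_def diag_exp_def cscale_def)
    moreover have "diag_part (dagger c) ** diag_part b = mat 1"
    proof -
      have "(\<Sum>k\<in>UNIV. diag_part (dagger c) $ i $ k * diag_part b $ k $ j)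
          = (\<Sum>k\<in>UNIV. if i = k then (if i = j then 1 else 0) else 0)" for i j
        using cnj_b by (intro sum.cong) (auto simp: diag_part_def dagger_def transpose_def)
      then show ?thesis by (simp add: vec_eq_iff matrix_matrix_mult_def mat_def)
    qed
    ultimately have "(dagger c, b, L) \<in> G_star"
      using i1 by (simp add: G_star_def B_plus_def B_minus_def)
    moreover have "star_involution (dagger c, b, L) = (dagger c, b, L)"
    proof -
      have "- map_matrix cnj L = L" by (simp add: vec_eq_iff L_def)
      then show ?thesis using inv by (simp add: star_involution_def dagger_dagger)
    qed
    ultimately show "b \<in> b_plus_of ` K_star"
      by (intro image_eqI[of _ _ "(dagger c, b, L)"]) (auto simp: b_plus_of_def K_star_def)
  next
    fix b :: "'n cmat" assume "b \<in> b_plus_of ` K_star"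
    then obtain bm L where "(bm, b, L) \<in> K_star" by (auto simp: b_plus_of_def)
    then show "b \<in> K_plus" by (rule key(2))
  qed
qed

end

theory Submission
  imports Defs
begin

text \<open>
In the coordinate $u = -\log z$, with $a = -A_0$ and $b = -B$, the equation becomes $\Phi' = (a e^u + b)\Phi$,
whose solutions are entire. The canonical solution on the initial sector is the one with
$\Phi \sim \exp(u\,\delta(b) + e^u a)$ as $u \to +\infty$ along the reals. Since $u \mapsto u + \pi i$ exchanges
$a$ and $-a$, the matrices $b_\pm$ are, up to the ordering permutation, the connection matrices $c_{low}$, $c_{up}$
between the canonical solutions for $a$ and $-a$ a half-turn apart. For skew-Hermitian $a$, $b$ the canonical
solution is unitary on the real axis, hence $c_{up} = c_{low}^{-\dagger}$ and the monodromy data lie in $K^*$.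

Let $y$ be the logarithmic derivative of $\Phi$ in a direction $\beta$. If the induced tangent vector at $b_+$ is the
dressing vector of $X$, then $\Phi (y - X) \Phi^{-1}$ is $2\pi i$-periodic and bounded enough to be an entire function
of $e^u$. Its value $G$ at $e^u = 0$ satisfies $\beta = [G, b]$, and integrating $\mathrm{Tr}(\gamma\,\cdot)$ over a period
identifies $\mathrm{Tr}(\gamma G)$ with the pairing of $X$ with the derivative in the direction $\gamma$. This gives the
Poisson property with the factor $\pi$ and, for $X = 0$, the injectivity of the derivative. Likewise, for two
residues with the same $b_+$ the quotient of the canonical solutions is an entire function of $e^u$ tending to $1$ at
infinity, whence injectivity. A bound for $b$ in terms of the connection matrices gives properness, so the image is open
(invariance of domain) and closed in the convex set $K^*$. Smoothness of the map and of
its inverse follows from holomorphic dependence on the residue, applied to $B \mapsto c_{up}^{-1} c_{low}$, which on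
$\mathfrak k^*$ is conjugate to $b_+^\dagger b_+$.
\<close>

subsection \<open>Norms and products of complex matrices\<close>

text \<open>The obstacle is analytic: the canonical solutions have to be controlled for all
  \<open>\<bar>Im u\<bar> < pi\<close>. With x = e^u and imaginary eigenvalues of a, the
  exponentials exp(x (a_i - a_j)) have constant modulus on horizontal lines of the x-plane.
  Estimates are therefore carried in from infinity along x + t, t \<ge> 0, where only powers of x
  intervene. At the edges \<open>\<bar>Im u\<bar> = pi\<close> the asymptotics fail; there
  boundedness is extracted from the triangularity of the connection matrices, and this suffices for
  the integral over a period. In that integral Tr(\<gamma> G) is multiplied by 2 pi i, while the
  boundary terms give 2 i times an imaginary part: this is the source of the factor pi. Derivatives
  in the residue are estimated by Cauchy's inequality, which is why limits are taken uniformly over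
  complex residues near the skew-Hermitian ones. In general \<open>clow\<close> alone cannot be
  inverted holomorphically, since its complex derivative at skew-Hermitian residues has triangular
  values only; the product \<open>Mt\<close> of both connection matrices can.\<close>

lemmas mm_assoc = matrix_mul_assoc

lemma cscale_nth [simp]: "cscale c A $ i $ j = c * A $ i $ j"
 by (simp add: cscale_def)

lemma dagger_nth [simp]: "dagger A $ i $ j = cnj (A $ j $ i)"
 by (simp add: dagger_def transpose_def)

lemma diag_part_nth: "diag_part A $ i $ j = (if i = j then A $ i $ j else 0)"
 by (simp add: diag_part_def)

lemma cmat_eqI: "(!!i j. A $ i $ j = B $ i $ j) ==> A = (B :: 'n::finite cmat)"
 by (simp add: vec_eq_iff)

lemma mm_nth: "(A ** B) $ i $ j = (\<Sum>k\<in>UNIV. A $ i $ k * B $ k $ j)"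
 by (simp add: matrix_matrix_mult_def)

lemma norm_cmat_sq: "(norm (A :: 'n::finite cmat))^2 = (\<Sum>i\<in>UNIV. \<Sum>j\<in>UNIV. (cmod (A $ i $ j))^2)"
 by (simp add: norm_vec_def L2_set_def sum_nonneg)

lemma cmod_entry_le: "cmod (A $ i $ j) <= norm (A :: 'n::finite cmat)"
 by (rule order_trans[OF Finite_Cartesian_Product.norm_nth_le Finite_Cartesian_Product.norm_nth_le])

lemma norm_cmat_le_sum: "norm (A :: 'n::finite cmat) <= (\<Sum>i\<in>UNIV. \<Sum>j\<in>UNIV. cmod (A $ i $ j))"
proof -
 have "norm A <= (\<Sum>i\<in>UNIV. norm (A $ i))" unfolding norm_vec_def[of A] by (rule L2_set_le_sum) simp
 also have "... <= (\<Sum>i\<in>UNIV. \<Sum>j\<in>UNIV. cmod (A $ i $ j))"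
  unfolding norm_vec_def by (intro sum_mono L2_set_le_sum) simp
 finally show ?thesis .
qed

lemma norm_cmat_le_entries:
 assumes "!!i j. cmod (A $ i $ j) <= c"
 shows "norm (A :: 'n::finite cmat) <= real (CARD('n))^2 * c"
proof -
 have "norm A <= (\<Sum>i\<in>(UNIV::'n set). \<Sum>j\<in>(UNIV::'n set). c)" by (intro order_trans[OF norm_cmat_le_sum] sum_mono assms)
 thus ?thesis by (simp add: power2_eq_square algebra_simps)
qed

lemma norm_cscale: "norm (cscale c A) = cmod c * norm (A :: 'n::finite cmat)"
proof (rule power2_eq_imp_eq)
 show "(norm (cscale c A))^2 = (cmod c * norm A)^2" unfolding power_mult_distrib norm_cmat_sq
  by (simp add: norm_mult power_mult_distrib sum_distrib_left)
qed auto

lemma norm_matrix_mult_le: "norm (A ** B) <= norm (A :: 'n::finite cmat) * norm (B :: 'n::finite cmat)"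
proof (rule power2_le_imp_le)
 have e: "(cmod ((A ** B) $ i $ j))^2 <= (\<Sum>k\<in>UNIV. (cmod (A $ i $ k))^2) * (\<Sum>k\<in>UNIV. (cmod (B $ k $ j))^2)" for i j
 proof -
  have "cmod ((A ** B) $ i $ j) <= (\<Sum>k\<in>UNIV. \<bar>cmod (A $ i $ k)\<bar> * \<bar>cmod (B $ k $ j)\<bar>)"
   unfolding mm_nth by (rule order_trans[OF norm_sum]) (simp add: norm_mult)
  also have "... <= L2_set (\<lambda>k. cmod (A $ i $ k)) UNIV * L2_set (\<lambda>k. cmod (B $ k $ j)) UNIV"
   by (rule L2_set_mult_ineq[where f="\<lambda>k. cmod (A $ i $ k)" and g="\<lambda>k. cmod (B $ k $ j)"])
  finally have "(cmod ((A ** B) $ i $ j))^2 <= (L2_set (\<lambda>k. cmod (A $ i $ k)) UNIV * L2_set (\<lambda>k. cmod (B $ k $ j)) UNIV)^2"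
   by (rule power_mono) simp
  thus ?thesis by (simp add: power_mult_distrib L2_set_def sum_nonneg)
 qed
 have "(norm (A ** B))^2 <= (\<Sum>i\<in>UNIV. \<Sum>j\<in>UNIV. (\<Sum>k\<in>UNIV. (cmod (A $ i $ k))^2) * (\<Sum>k\<in>UNIV. (cmod (B $ k $ j))^2))"
  unfolding norm_cmat_sq[of "A ** B"] by (intro sum_mono e)
 also have "... = (\<Sum>i\<in>UNIV. \<Sum>k\<in>UNIV. (cmod (A $ i $ k))^2) * (\<Sum>j\<in>UNIV. \<Sum>k\<in>UNIV. (cmod (B $ k $ j))^2)"
  by (simp add: sum_product)
 also have "(\<Sum>j\<in>UNIV. \<Sum>k\<in>UNIV. (cmod (B $ k $ j))^2) = (norm B)^2" unfolding norm_cmat_sq by (rule sum.swap)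
 finally show "(norm (A ** B))^2 <= (norm A * norm B)^2" by (simp add: norm_cmat_sq power_mult_distrib)
qed simp

lemma bounded_bilinear_mm: "bounded_bilinear ((**) :: 'n::finite cmat => 'n cmat => 'n cmat)"
proof (rule bounded_bilinear.intro)
 show "\<exists>K. \<forall>a b. norm (a ** b) <= norm (a :: 'n cmat) * norm (b :: 'n cmat) * K"
  by (intro exI[of _ 1]) (simp add: norm_matrix_mult_le)
qed (auto simp: vec_eq_iff mm_nth algebra_simps sum.distrib scaleR_sum_right)

lemma bounded_bilinear_cscale: "bounded_bilinear (cscale :: complex => 'n cmat => 'n::finite cmat)"
proof (rule bounded_bilinear.intro)
 show "\<exists>K. \<forall>a b. norm (cscale a b) <= norm a * norm (b :: 'n cmat) * K" by (intro exI[of _ 1]) (simp add: norm_cscale)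
qed (auto simp: vec_eq_iff algebra_simps)

interpretation mm: bounded_bilinear "(**) :: 'n::finite cmat => 'n cmat => 'n cmat" by (rule bounded_bilinear_mm)

interpretation cs: bounded_bilinear "cscale :: complex => 'n cmat => 'n::finite cmat"
 by (rule bounded_bilinear_cscale)

lemma cscale_one [simp]: "cscale 1 A = A" by (simp add: vec_eq_iff)
lemma cscale_cscale [simp]: "cscale c (cscale d A) = cscale (c * d) A" by (simp add: vec_eq_iff)
lemma cscale_of_real: "cscale (of_real r) A = r *\<^sub>R A" by (simp add: vec_eq_iff) (simp add: scaleR_conv_of_real)
lemma cscale_mm_left [simp]: "cscale c A ** B = cscale c (A ** B)"
 by (simp add: vec_eq_iff mm_nth sum_distrib_left mult.assoc)
lemma cscale_mm_right [simp]: "A ** cscale c B = cscale c (A ** B)"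
 by (simp add: vec_eq_iff mm_nth sum_distrib_left mult.left_commute)
lemma cscale_uminus_one: "cscale (- 1) A = - A" by (simp add: vec_eq_iff)

lemma bounded_linear_entry: "bounded_linear (\<lambda>A :: 'n::finite cmat. A $ i $ j)"
 by (intro bounded_linear_compose[OF bounded_linear_vec_nth] bounded_linear_vec_nth)

lemma bounded_linear_trace: "bounded_linear (trace :: 'n::finite cmat => complex)"
 unfolding trace_def by (intro bounded_linear_sum bounded_linear_entry)

lemma cnj_trace: "cnj (trace A) = trace (dagger A)"
 by (simp add: trace_def)

lemma trace_cscale: "trace (cscale c A) = c * trace A"
 by (simp add: trace_def sum_distrib_left)

lemma trace_mm_commute: "trace (A ** B) = trace (B ** (A :: 'n::finite cmat))"
 by (simp add: trace_def mm_nth mult.commute) (rule sum.swap)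

lemma norm_dagger [simp]: "norm (dagger A) = norm (A :: 'n::finite cmat)"
proof -
 have "(norm (dagger A))^2 = (norm A)^2" unfolding norm_cmat_sq by (simp) (rule sum.swap)
 thus ?thesis by (simp add: power2_eq_iff_nonneg)
qed

lemma dagger_add: "dagger (A + B) = dagger A + dagger B" by (simp add: vec_eq_iff)
lemma dagger_minus: "dagger (A - B) = dagger A - dagger B" by (simp add: vec_eq_iff)
lemma dagger_uminus: "dagger (- A) = - dagger A" by (simp add: vec_eq_iff)
lemma dagger_cscale: "dagger (cscale c A) = cscale (cnj c) (dagger A)" by (simp add: vec_eq_iff)
lemma dagger_scaleR: "dagger (r *\<^sub>R A) = r *\<^sub>R dagger A" by (simp add: vec_eq_iff)

lemma bounded_linear_dagger: "bounded_linear (dagger :: 'n::finite cmat => _)"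
 by (rule bounded_linear_intro[where K=1]) (auto simp: dagger_add dagger_scaleR)

lemma norm_sq_trace: "complex_of_real ((norm A)^2) = trace (dagger A ** (A :: 'n::finite cmat))"
proof -
 have "trace (dagger A ** A) = (\<Sum>i\<in>UNIV. \<Sum>k\<in>UNIV. complex_of_real ((cmod (A $ k $ i))^2))"
  unfolding trace_def mm_nth by (intro sum.cong refl) (simp only: dagger_nth complex_norm_square mult.commute)
 also have "... = (\<Sum>i\<in>UNIV. \<Sum>k\<in>UNIV. complex_of_real ((cmod (A $ i $ k))^2))" by (rule sum.swap)
 finally show ?thesis unfolding norm_cmat_sq of_real_sum ..
qed

section \<open>Unitary matrices\<close>

definition unitary :: "'n::finite cmat => bool" where
 "unitary U \<longleftrightarrow> dagger U ** U = mat 1 & U ** dagger U = mat 1"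

lemma unitaryI: "dagger U ** U = mat 1 ==> unitary U"
 by (simp add: unitary_def matrix_left_right_inverse)

lemma norm_unitary_left:
 assumes "unitary U" shows "norm (U ** A) = norm (A :: 'n::finite cmat)"
proof -
 have "dagger (U ** A) ** (U ** A) = dagger A ** (dagger U ** U) ** A" by (simp add: dagger_mult mm_assoc)
 hence "complex_of_real ((norm (U ** A))^2) = complex_of_real ((norm A)^2)"
  unfolding norm_sq_trace using assms by (simp add: unitary_def)
 thus ?thesis unfolding of_real_eq_iff by (simp add: power2_eq_iff_nonneg)
qed

lemma unitary_dagger: "unitary U ==> unitary (dagger U)"
 by (simp add: unitary_def dagger_dagger)

lemma norm_unitary_right:
 assumes "unitary U" shows "norm (A ** U) = norm (A :: 'n::finite cmat)"
proof -
 have "norm (A ** U) = norm (dagger U ** dagger A)" by (metis norm_dagger dagger_mult)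
 thus ?thesis using norm_unitary_left[OF unitary_dagger[OF assms]] by simp
qed

lemma norm_unitary: "unitary (U :: 'n::finite cmat) ==> norm U = norm (mat 1 :: 'n cmat)"
 using norm_unitary_left[of U "mat 1"] by simp

lemma unitary_mult: "unitary U ==> unitary V ==> unitary (U ** V)"
proof (rule unitaryI)
 assume "unitary U" "unitary V"
 hence "dagger V ** (dagger U ** U) ** V = mat 1" by (simp add: unitary_def)
 thus "dagger (U ** V) ** (U ** V) = mat 1" by (simp add: dagger_mult mm_assoc)
qed

section \<open>Diagonal matrices and their exponentials\<close>

lemma diag_mm_left: "D \<in> diag_mats ==> (D ** A) $ i $ j = D $ i $ i * A $ i $ j"
proof -
 assume "D \<in> diag_mats"
 hence "(\<Sum>k\<in>UNIV. D $ i $ k * A $ k $ j) = (\<Sum>k\<in>UNIV. if i = k then D $ i $ i * A $ i $ j else 0)"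
  by (intro sum.cong) (auto simp: diag_mats_def)
 thus ?thesis by (simp add: mm_nth)
qed

lemma diag_mm_right: "D \<in> diag_mats ==> (A ** D) $ i $ j = A $ i $ j * D $ j $ j"
proof -
 assume "D \<in> diag_mats"
 hence "(\<Sum>k\<in>UNIV. A $ i $ k * D $ k $ j) = (\<Sum>k\<in>UNIV. if k = j then A $ i $ j * D $ j $ j else 0)"
  by (intro sum.cong) (auto simp: diag_mats_def)
 thus ?thesis by (simp add: mm_nth)
qed

lemma diag_part_diag [simp]: "diag_part A \<in> diag_mats" by (simp add: diag_mats_def diag_part_nth)
lemma diag_exp_diag [simp]: "diag_exp A \<in> diag_mats" by (simp add: diag_mats_def diag_exp_def)
lemma cscale_diag [simp]: "A \<in> diag_mats ==> cscale c A \<in> diag_mats" by (simp add: diag_mats_def)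
lemma uminus_diag [simp]: "A \<in> diag_mats ==> - A \<in> diag_mats" by (simp add: diag_mats_def)
lemma add_diag [simp]: "A \<in> diag_mats ==> B \<in> diag_mats ==> A + B \<in> diag_mats" by (simp add: diag_mats_def)
lemma diag_exp_nth: "diag_exp A $ i $ j = (if i = j then exp (A $ i $ i) else 0)" by (simp add: diag_exp_def)
lemma mat_one_nth: "(mat 1 :: 'n::finite cmat) $ i $ j = (if i = j then 1 else 0)" by (simp add: mat_def)

lemma diag_exp_add: "diag_exp (A + B) = diag_exp A ** diag_exp B"
 by (rule cmat_eqI) (simp add: diag_mm_left diag_exp_nth exp_add)

lemma diag_exp_zero [simp]: "diag_exp 0 = mat 1"
 by (rule cmat_eqI) (simp add: diag_exp_nth mat_one_nth)

lemma diag_exp_inverse: "diag_exp A ** diag_exp (- A) = mat 1" "diag_exp (- A) ** diag_exp A = mat 1"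
 by (simp_all flip: diag_exp_add)


subsection \<open>Complex differentiation of matrix functions\<close>

text \<open>Stated as a real Frechet derivative that multiplies h by a fixed matrix, so that the
  product and chain rules for bounded bilinear maps apply directly; \<open>has_mderiv_iff\<close>
  returns to the complex derivatives of the entries.\<close>

definition has_mderiv :: "(complex => 'n::finite cmat) => 'n cmat => complex => bool" where
 "has_mderiv X X' z \<longleftrightarrow> (X has_derivative (\<lambda>h. cscale h X')) (at z)"

lemma has_mderiv_iff:
 "has_mderiv X X' z \<longleftrightarrow> (\<forall>i j. ((\<lambda>z. X z $ i $ j) has_field_derivative X' $ i $ j) (at z))"
proof
 assume X: "has_mderiv X X' z"
 show "\<forall>i j. ((\<lambda>z. X z $ i $ j) has_field_derivative X' $ i $ j) (at z)"
 proof (intro allI)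
  fix i j
  have "((\<lambda>z. X z $ i $ j) has_derivative (\<lambda>h. cscale h X' $ i $ j)) (at z)"
   by (rule bounded_linear.has_derivative[OF bounded_linear_entry X[unfolded has_mderiv_def]])
  thus "((\<lambda>z. X z $ i $ j) has_field_derivative X' $ i $ j) (at z)"
   unfolding has_field_derivative_def by (simp add: mult.commute[of _ "X' $ i $ j"])
 qed
next
 assume e: "\<forall>i j. ((\<lambda>z. X z $ i $ j) has_field_derivative X' $ i $ j) (at z)"
 define E :: "'a => 'a => 'a cmat" where "E i j = (\<chi> k l. if k = i & l = j then 1 else 0)" for i j
 have rep: "(\<Sum>i\<in>UNIV. \<Sum>j\<in>UNIV. cscale (Y $ i $ j) (E i j)) = Y" for Y :: "'a cmat"
 proof (rule cmat_eqI)
  fix k l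
  have "(\<Sum>i\<in>UNIV. \<Sum>j\<in>UNIV. cscale (Y $ i $ j) (E i j)) $ k $ l
   = (\<Sum>i\<in>UNIV. \<Sum>j\<in>UNIV. if k = i then (if l = j then Y $ i $ j else 0) else 0)"
   by (simp add: E_def) (intro sum.cong refl; auto)
  also have "... = (\<Sum>i\<in>UNIV. if k = i then Y $ i $ l else 0)" by (intro sum.cong refl) simp
  also have "... = Y $ k $ l" by simp
  finally show "(\<Sum>i\<in>UNIV. \<Sum>j\<in>UNIV. cscale (Y $ i $ j) (E i j)) $ k $ l = Y $ k $ l" .
 qed
 have "((\<lambda>z. \<Sum>i\<in>UNIV. \<Sum>j\<in>UNIV. cscale (X z $ i $ j) (E i j)) has_derivative
   (\<lambda>h. \<Sum>i\<in>UNIV. \<Sum>j\<in>UNIV. cscale (h * X' $ i $ j) (E i j))) (at z)"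
 proof (intro has_derivative_sum)
  fix i j
  show "((\<lambda>z. cscale (X z $ i $ j) (E i j)) has_derivative (\<lambda>h. cscale (h * X' $ i $ j) (E i j))) (at z)"
   by (rule bounded_linear.has_derivative[OF cs.bounded_linear_left])
    (use e in \<open>simp add: has_field_derivative_def mult.commute[of _ "X' $ i $ j"]\<close>)
 qed
 moreover have "(\<lambda>h. \<Sum>i\<in>UNIV. \<Sum>j\<in>UNIV. cscale (h * X' $ i $ j) (E i j)) = (\<lambda>h. cscale h X')"
  using rep[of "cscale _ X'"] by (auto simp: fun_eq_iff)
 ultimately show "has_mderiv X X' z" unfolding has_mderiv_def by (simp add: rep)
qed

lemma has_mderiv_mult:
 assumes "has_mderiv X X' z" "has_mderiv Y Y' z"
 shows "has_mderiv (\<lambda>z. X z ** Y z) (X' ** Y z + X z ** Y') z" unfolding has_mderiv_def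
 by (rule has_derivative_eq_rhs[OF mm.FDERIV[OF assms[unfolded has_mderiv_def]]]) (simp add: fun_eq_iff cs.add_right add.commute)

lemma has_mderiv_const: "has_mderiv (\<lambda>_. C) 0 z"
 by (simp add: has_mderiv_def cs.zero_right)

lemma has_mderiv_add:
 "has_mderiv X X' z ==> has_mderiv Y Y' z ==> has_mderiv (\<lambda>z. X z + Y z) (X' + Y') z"
 unfolding has_mderiv_def by (rule has_derivative_eq_rhs[OF has_derivative_add]) (auto simp: cs.add_right)

lemma has_mderiv_diff:
 "has_mderiv X X' z ==> has_mderiv Y Y' z ==> has_mderiv (\<lambda>z. X z - Y z) (X' - Y') z"
 unfolding has_mderiv_def by (rule has_derivative_eq_rhs[OF has_derivative_diff]) (auto simp: cs.diff_right)

lemma has_mderiv_sum: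
 "(!!k. k \<in> K ==> has_mderiv (X k) (X' k) z) ==> has_mderiv (\<lambda>z. \<Sum>k\<in>K. X k z) (\<Sum>k\<in>K. X' k) z"
 unfolding has_mderiv_def by (rule has_derivative_eq_rhs[OF has_derivative_sum]) (auto simp: cs.sum_right)

lemma has_mderiv_cscale:
 assumes "(f has_field_derivative f') (at z)" "has_mderiv X X' z"
 shows "has_mderiv (\<lambda>z. cscale (f z) (X z)) (cscale f' (X z) + cscale (f z) X') z"
 using assms unfolding has_mderiv_iff by (auto intro!: derivative_eq_intros)

lemma has_mderiv_chain:
 assumes "has_mderiv X X' (f z)" "(f has_field_derivative f') (at z)"
 shows "has_mderiv (\<lambda>z. X (f z)) (cscale f' X') z" unfolding has_mderiv_iff
proof (intro allI)
 fix i j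
 have "((\<lambda>z. X (f z) $ i $ j) has_field_derivative X' $ i $ j * f') (at z)"
  by (rule DERIV_chain2[of "\<lambda>z. X z $ i $ j", OF _ assms(2)]) (use assms(1) in \<open>simp add: has_mderiv_iff\<close>)
 thus "((\<lambda>z. X (f z) $ i $ j) has_field_derivative cscale f' X' $ i $ j) (at z)" by (simp add: mult.commute)
qed

lemma has_mderiv_continuous: "has_mderiv X X' z ==> isCont X z"
 unfolding has_mderiv_def by (rule has_derivative_continuous)

lemma has_mderiv_vector:
 assumes "has_mderiv X X' (p t)" "(p has_vector_derivative p') (at t within S)"
 shows "((\<lambda>t. X (p t)) has_vector_derivative (cscale p' X')) (at t within S)"
proof -
 have "((\<lambda>t. X (p t)) has_derivative (\<lambda>h. cscale (h *\<^sub>R p') X')) (at t within S)"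
  using has_derivative_compose[OF assms(2)[unfolded has_vector_derivative_def] assms(1)[unfolded has_mderiv_def]] .
 thus ?thesis by (simp add: has_vector_derivative_def cs.scaleR_left)
qed

lemma has_mderiv_unique: "has_mderiv X X' z ==> has_mderiv X X'' z ==> X' = X''"
 unfolding has_mderiv_iff by (metis DERIV_unique cmat_eqI)

lemma has_mderiv_mat_deriv: "has_mderiv X X' z ==> mat_deriv X z = X'"
 unfolding has_mderiv_iff mat_deriv_def by (intro cmat_eqI) (simp add: DERIV_imp_deriv)

lemma has_mderiv_zero_constant:
 assumes "convex S" "open S" "!!z. z \<in> S ==> has_mderiv X 0 z" "z \<in> S" "w \<in> S"
 shows "X z = X w"
proof -
 have "!!z. z \<in> S ==> (X has_derivative (\<lambda>h. 0)) (at z within S)"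
  using assms(3) by (auto simp: has_mderiv_def cs.zero_right intro: has_derivative_at_withinI)
 thus ?thesis using has_derivative_zero_unique[OF assms(1)] assms(4,5) by metis
qed

lemma mat_holomorphic_iff:
 assumes "open S"
 shows "mat_holomorphic_on X S \<longleftrightarrow> (\<forall>z\<in>S. \<exists>X'. has_mderiv X X' z)"
proof
 assume X: "mat_holomorphic_on X S"
 show "\<forall>z\<in>S. \<exists>X'. has_mderiv X X' z"
 proof
  fix z assume "z \<in> S"
  hence "has_mderiv X (\<chi> i j. deriv (\<lambda>w. X w $ i $ j) z) z"
   unfolding has_mderiv_iff using X assms by (auto simp: mat_holomorphic_on_def intro: holomorphic_derivI)
  thus "\<exists>X'. has_mderiv X X' z" ..
 qed
next
 assume X: "\<forall>z\<in>S. \<exists>X'. has_mderiv X X' z"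
 show "mat_holomorphic_on X S" unfolding mat_holomorphic_on_def holomorphic_on_open[OF assms] using X unfolding has_mderiv_iff by blast
qed

lemma mm_left_inverse_unique:
 assumes "A ** B = mat 1" "C ** A = mat (1::complex)"
 shows "C = (B :: 'n::finite cmat)" by (metis assms mm_assoc matrix_mul_lid matrix_mul_rid)

subsection \<open>The fundamental solution in the logarithmic coordinate\<close>

text \<open>Comparison of the coefficients of u^m in \<Phi>' = (a e^u + b) \<Phi>, with e^u expanded
  at 0; the inner sum is the Cauchy product of the exponential series with the solution.\<close>

fun fco :: "'n cmat => 'n cmat => nat => 'n::finite cmat" where
 "fco a b 0 = mat 1" | "fco a b (Suc m) = cscale (1 / of_nat (Suc m))
   (b ** fco a b m + a ** (\<Sum>k\<le>m. cscale (1 / fact k) (fco a b (m - k))))"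

text \<open>The solution of $\Phi' = (a e^u + b) \Phi$ with value $1$ at $u = 0$, as a power series in $u$.\<close>

definition fsol :: "'n cmat => 'n cmat => complex => 'n::finite cmat" where
 "fsol a b u = (\<Sum>m. cscale (u ^ m) (fco a b m))"

definition lcoef :: "'n cmat => 'n cmat => complex => 'n::finite cmat" where
 "lcoef a b u = cscale (exp u) a + b"

text \<open>One step of the recursion multiplies the bound by at most \<kappa> / (1 + p). For p
  below the ceiling of \<kappa> this factor is estimated by 1 + \<kappa>, and from there on it is at
  most 1, so the bound becomes constant. As r is arbitrary, the radius of convergence is infinite; a
  and b enter only through K.\<close>

lemma fco_bound:
 fixes a b :: "'n::finite cmat"
 assumes K: "norm a <= K" "norm b <= K" and r: "0 < r" and \<kappa>: "\<kappa> = r * K * (1 + exp r)"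
 shows "norm (fco a b m) * r ^ m <= norm (mat 1 :: 'n cmat) * (1 + \<kappa>) ^ (min m (nat \<lceil>\<kappa>\<rceil>))"
proof (induction m rule: less_induct)
 case (less m)
 define c where "c = norm (mat 1 :: 'n cmat)"
 have K0: "0 <= K" using K(1) norm_ge_zero order_trans by blast
 have \<kappa>0: "0 <= \<kappa>" using K0 r by (simp add: \<kappa>)
 show ?case
 proof (cases m)
  case 0 thus ?thesis by simp
 next
  case (Suc p)
  define S where "S = c * (1 + \<kappa>) ^ (min p (nat \<lceil>\<kappa>\<rceil>))"
  have S0: "0 <= S" using \<kappa>0 by (simp add: S_def c_def)
  have IH: "norm (fco a b j) * r ^ j <= S" if "j <= p" for j
  proof -
   have "norm (fco a b j) * r ^ j <= c * (1 + \<kappa>) ^ (min j (nat \<lceil>\<kappa>\<rceil>))"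
    using less[of j] that Suc by (simp add: c_def)
   also have "... <= S" unfolding S_def
    by (intro mult_left_mono power_increasing) (use that \<kappa>0 in \<open>auto simp: c_def min_def\<close>)
   finally show ?thesis .
  qed
  have "norm (a ** (\<Sum>k\<le>p. cscale (1 / fact k) (fco a b (p - k)))) * r ^ p
    <= K * (\<Sum>k\<le>p. (1 / fact k) * norm (fco a b (p - k))) * r ^ p"
  proof (intro mult_right_mono order_trans[OF norm_matrix_mult_le] mult_mono K)
   show "norm (\<Sum>k\<le>p. cscale (1 / fact k) (fco a b (p - k))) <= (\<Sum>k\<le>p. 1 / fact k * norm (fco a b (p - k)))"
    by (intro order_trans[OF norm_sum] sum_mono) (simp add: norm_cscale norm_divide)
  qed (use K0 r in auto)
  also have "... = K * (\<Sum>k\<le>p. (r ^ k / fact k) * (norm (fco a b (p - k)) * r ^ (p - k)))"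
   by (simp add: sum_distrib_left sum_distrib_right) (intro sum.cong refl, simp flip: power_add)
  also have "... <= K * (\<Sum>k\<le>p. (r ^ k / fact k) * S)" by (intro mult_left_mono sum_mono IH) (use K0 r in auto)
  also have "... = K * ((\<Sum>k\<le>p. r ^ k / fact k) * S)" by (simp add: sum_distrib_right)
  also have "... <= K * (exp r * S)"
  proof (intro mult_left_mono mult_right_mono)
   have "(\<Sum>k\<le>p. r ^ k / fact k) <= (\<Sum>k. r ^ k / fact k)"
    by (rule sum_le_suminf) (use r summable_exp_generic[of r] in \<open>auto simp: divide_inverse mult.commute\<close>)
   thus "(\<Sum>k\<le>p. r ^ k / fact k) <= exp r" by (simp add: exp_def divide_inverse mult.commute)
  qed (use K0 S0 in auto)
  finally have 1: "norm (a ** (\<Sum>k\<le>p. cscale (1 / fact k) (fco a b (p - k)))) * r ^ p <= K * (exp r * S)" .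
  have "norm (b ** fco a b p) * r ^ p <= K * (norm (fco a b p) * r ^ p)"
   using mult_right_mono[OF order_trans[OF norm_matrix_mult_le mult_right_mono[OF K(2)]], of "fco a b p" "r ^ p"] r
   by (simp add: mult.assoc)
  also have "... <= K * S" using IH[of p] K0 by (simp add: mult_left_mono)
  finally have 2: "norm (b ** fco a b p) * r ^ p <= K * S" .
  have "norm (fco a b m) * r ^ m = (r / (1 + real p)) *
    (norm (b ** fco a b p + a ** (\<Sum>k\<le>p. cscale (1 / fact k) (fco a b (p - k)))) * r ^ p)"
   by (simp add: Suc norm_cscale norm_divide) (simp add: norm_of_nat[of "Suc p", simplified] field_simps)
  also have "... <= (r / (1 + real p)) * (K * S + K * (exp r * S))"
  proof (rule mult_left_mono)
   show "norm (b ** fco a b p + a ** (\<Sum>k\<le>p. cscale (1 / fact k) (fco a b (p - k)))) * r ^ p <= K * S + K * (exp r * S)"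
    using 1 2 mult_right_mono[OF norm_triangle_ineq[of "b ** fco a b p" "a ** (\<Sum>k\<le>p. cscale (1 / fact k) (fco a b (p - k)))"], of "r ^ p"] r
    by (simp add: algebra_simps)
  qed (use r in auto)
  also have "... = \<kappa> / (1 + real p) * S" by (simp add: \<kappa> algebra_simps add_divide_distrib)
  also have "... <= c * (1 + \<kappa>) ^ (min m (nat \<lceil>\<kappa>\<rceil>))"
  proof (cases "p < nat \<lceil>\<kappa>\<rceil>")
   case True
   have "\<kappa> / (1 + real p) * S <= (1 + \<kappa>) * S"
    by (rule mult_right_mono[OF _ S0]) (use \<kappa>0 in \<open>simp add: field_simps\<close>)
   also have "... = c * (1 + \<kappa>) ^ (min m (nat \<lceil>\<kappa>\<rceil>))" using True by (simp add: S_def Suc min_def)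
   finally show ?thesis .
  next
   case False
   hence "\<kappa> <= real p" by linarith
   hence "\<kappa> / (1 + real p) * S <= 1 * S" by (intro mult_right_mono[OF _ S0]) (simp add: field_simps)
   also have "... = c * (1 + \<kappa>) ^ (min m (nat \<lceil>\<kappa>\<rceil>))" using False by (simp add: S_def Suc min_def)
   finally show ?thesis .
  qed
  finally show ?thesis by (simp add: c_def)
 qed
qed

lemma fco_term_bound:
 fixes K \<rho> :: real
 assumes "0 <= K" "0 <= \<rho>"
 obtains C where "!!(a::'n::finite cmat) b u m. norm a <= K ==> norm b <= K ==> cmod u <= \<rho> ==>
  norm (cscale (u ^ m) (fco a b m)) <= C * (1/2) ^ m"
proof -
 \<comment> \<open>Twice the radius produces the geometric ratio 1/2; the summand 1 keeps r positive
   when \<rho> = 0.\<close>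
 define r where "r = 2 * \<rho> + 1"
 define \<kappa> where "\<kappa> = r * K * (1 + exp r)"
 define C where "C = norm (mat 1 :: 'n cmat) * (1 + \<kappa>) ^ (nat \<lceil>\<kappa>\<rceil>)"
 have r: "0 < r" "2 * \<rho> <= r" using assms by (simp_all add: r_def)
 have \<kappa>0: "0 <= \<kappa>" using assms r by (simp add: \<kappa>_def)
 have "norm (cscale (u ^ m) (fco a b m)) <= C * (1/2) ^ m"
  if "norm a <= K" "norm b <= K" "cmod u <= \<rho>" for a b :: "'n cmat" and u m
 proof -
  have "norm (fco a b m) * r ^ m <= norm (mat 1 :: 'n cmat) * (1 + \<kappa>) ^ (min m (nat \<lceil>\<kappa>\<rceil>))"
   by (rule fco_bound[OF that(1,2) r(1)]) (rule \<kappa>_def)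
  also have "... <= C" unfolding C_def by (intro mult_left_mono power_increasing) (use \<kappa>0 in auto)
  finally have C: "norm (fco a b m) * r ^ m <= C" .
  have "norm (cscale (u ^ m) (fco a b m)) <= (r / 2) ^ m * norm (fco a b m)" unfolding norm_cscale norm_power
   by (intro mult_right_mono power_mono) (use that(3) r in auto)
  also have "... = (norm (fco a b m) * r ^ m) * (1/2) ^ m" by (simp add: power_divide)
  also have "... <= C * (1/2) ^ m" by (rule mult_right_mono[OF C]) simp
  finally show ?thesis .
 qed
 thus ?thesis by (rule that)
qed

lemma fsol_uniform_limit:
 assumes "0 <= K" "0 <= \<rho>"
 shows "uniform_limit {p. norm (fst p) <= K & norm (fst (snd p)) <= K & cmod (snd (snd p)) <= \<rho>}
   (\<lambda>N p. \<Sum>m<N. cscale (snd (snd p) ^ m) (fco (fst p :: 'n::finite cmat) (fst (snd p)) m))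
   (\<lambda>p. fsol (fst p) (fst (snd p)) (snd (snd p))) sequentially"
proof -
 obtain C where C: "!!(a::'n::finite cmat) b u m. norm a <= K ==> norm b <= K ==> cmod u <= \<rho> ==>
  norm (cscale (u ^ m) (fco a b m)) <= C * (1/2) ^ m" using fco_term_bound[OF assms] by blast
 show ?thesis unfolding fsol_def
 proof (rule Weierstrass_m_test[where M="\<lambda>m. C * (1/2) ^ m"])
  show "summable (\<lambda>m. C * (1/2) ^ m)" by (intro summable_mult) simp
 qed (use C in auto)
qed

lemma fco_term_bound_single:
 obtains C where "!!m. norm (cscale (u ^ m) (fco a b m :: 'n::finite cmat)) <= C * (1/2) ^ m"
proof (rule fco_term_bound[where 'n='n])
 show "0 <= max (norm a) (norm b)" by (simp add: le_max_iff_disj)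
 show "0 <= cmod u" by simp
 fix C
 assume C: "!!(a'::'n cmat) b' u' m. norm a' <= max (norm a) (norm b) ==> norm b' <= max (norm a) (norm b) ==>
   cmod u' <= cmod u ==> norm (cscale (u' ^ m) (fco a' b' m)) <= C * (1/2) ^ m"
 show thesis by (rule that[of C], rule C) auto
qed

lemma fsol_sums: "(\<lambda>m. cscale (u ^ m) (fco a b m)) sums fsol a b u"
proof -
 obtain C where C: "!!m. norm (cscale (u ^ m) (fco a b m)) <= C * (1/2) ^ m" by (rule fco_term_bound_single[of u a b]) blast
 have "summable (\<lambda>m. cscale (u ^ m) (fco a b m))" by (rule summable_comparison_test'[where N=0 and g="\<lambda>m. C * (1/2) ^ m"])
   (use C in \<open>auto intro!: summable_mult\<close>)
 thus ?thesis unfolding fsol_def by (rule summable_sums)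
qed

lemma fsol_nth_sums: "(\<lambda>m. fco a b m $ i $ j * u ^ m) sums (fsol a b u $ i $ j)"
 using bounded_linear.sums[OF bounded_linear_entry fsol_sums, of u a b i j] by (simp add: mult.commute)

lemma fsol_zero [simp]: "fsol a b 0 = mat 1"
proof -
 have "(\<lambda>m. cscale (0 ^ m) (fco a b m)) sums (\<Sum>m\<in>{0}. cscale (0 ^ m) (fco a b m))"
  by (rule sums_finite) (auto simp: cs.zero_left power_0_left)
 hence "(\<lambda>m. cscale (0 ^ m) (fco a b m)) sums mat 1" by simp
 thus ?thesis using fsol_sums[of 0 a b] sums_unique2 by blast
qed

lemma has_mderiv_fsol: "has_mderiv (fsol a b) (lcoef a b u ** fsol a b u) u"
 unfolding has_mderiv_iff
proof (intro allI)
 fix i j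
 let ?c = "\<lambda>m. fco a b m $ i $ j"
 have sm: "summable (\<lambda>m. fco a b m $ k $ l * x ^ m)" for k l x using fsol_nth_sums by (rule sums_summable)
 have f: "(\<lambda>x. fsol a b x $ i $ j) = (\<lambda>x. \<Sum>m. ?c m * x ^ m)" by (rule ext) (rule sums_unique[OF fsol_nth_sums])
 have d: "((\<lambda>x. \<Sum>m. ?c m * x ^ m) has_field_derivative (\<Sum>m. diffs ?c m * u ^ m)) (at u)"
  by (rule termdiffs_strong_converges_everywhere) (rule sm)
 have expsums: "(\<lambda>k. (1 / fact k) * u ^ k) sums exp u" using exp_converges[of u] by (simp add: scaleR_conv_of_real divide_inverse)
 \<comment> \<open>The power series of e^u \<Phi>, a Cauchy product of two absolutely convergent
   series, in the shape of the inner sum of \<open>fco\<close>.\<close>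
 have conv: "(\<lambda>m. (\<Sum>k\<le>m. (1 / fact k) * fco a b (m - k) $ k' $ j) * u ^ m) sums (exp u * fsol a b u $ k' $ j)" for k'
 proof -
  have n1: "summable (\<lambda>k. norm ((1 / fact k) * u ^ k :: complex))"
   using summable_norm_exp[of u] by (simp add: scaleR_conv_of_real divide_inverse)
  obtain C where C: "!!m. norm (cscale (u ^ m) (fco a b m)) <= C * (1/2) ^ m" by (rule fco_term_bound_single[of u a b]) blast
  have n2: "summable (\<lambda>m. norm (fco a b m $ k' $ j * u ^ m))"
  proof (rule summable_comparison_test'[where N=0 and g="\<lambda>m. C * (1/2) ^ m"])
   show "norm (norm (fco a b m $ k' $ j * u ^ m)) <= C * (1/2) ^ m" for m
    using order_trans[OF cmod_entry_le C, of m k' j] by (simp add: mult.commute)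
  qed (auto intro!: summable_mult)
  have "(\<lambda>m. \<Sum>k\<le>m. ((1 / fact k) * u ^ k) * (fco a b (m - k) $ k' $ j * u ^ (m - k))) sums
    ((\<Sum>k. (1 / fact k) * u ^ k) * (\<Sum>m. fco a b m $ k' $ j * u ^ m))" by (rule Cauchy_product_sums[OF n1 n2])
  also have "(\<Sum>k. (1 / fact k) * u ^ k) = exp u" using expsums by (rule sums_unique[symmetric])
  also have "(\<Sum>m. fco a b m $ k' $ j * u ^ m) = fsol a b u $ k' $ j" using fsol_nth_sums by (rule sums_unique[symmetric])
  also have "(\<lambda>m. \<Sum>k\<le>m. ((1 / fact k) * u ^ k) * (fco a b (m - k) $ k' $ j * u ^ (m - k)))
    = (\<lambda>m. (\<Sum>k\<le>m. (1 / fact k) * fco a b (m - k) $ k' $ j) * u ^ m)"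
  proof (rule ext)
   fix m
   have "((1 / fact k) * u ^ k) * (fco a b (m - k) $ k' $ j * u ^ (m - k))
     = (1 / fact k) * fco a b (m - k) $ k' $ j * u ^ m" if "k <= m" for k
   proof -
    have "u ^ m = u ^ k * u ^ (m - k)" using that by (simp flip: power_add)
    thus ?thesis by simp
   qed
   thus "(\<Sum>k\<le>m. ((1 / fact k) * u ^ k) * (fco a b (m - k) $ k' $ j * u ^ (m - k)))
    = (\<Sum>k\<le>m. (1 / fact k) * fco a b (m - k) $ k' $ j) * u ^ m" unfolding sum_distrib_right by (intro sum.cong refl) simp
  qed
  finally show ?thesis .
 qed
 have e: "diffs ?c m * u ^ m = (\<Sum>k'\<in>UNIV. b $ i $ k' * (fco a b m $ k' $ j * u ^ m))
   + (\<Sum>k'\<in>UNIV. a $ i $ k' * ((\<Sum>k\<le>m. (1 / fact k) * fco a b (m - k) $ k' $ j) * u ^ m))" for m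
 proof -
  have "diffs ?c m = (b ** fco a b m + a ** (\<Sum>k\<le>m. cscale (1 / fact k) (fco a b (m - k)))) $ i $ j"
   unfolding diffs_def by (simp del: of_nat_Suc)
  thus ?thesis by (simp add: mm_nth algebra_simps sum_distrib_left)
 qed
 have s: "(\<lambda>m. diffs ?c m * u ^ m) sums
   ((\<Sum>k'\<in>UNIV. b $ i $ k' * fsol a b u $ k' $ j) + (\<Sum>k'\<in>UNIV. a $ i $ k' * (exp u * fsol a b u $ k' $ j)))"
  unfolding e by (intro sums_add sums_sum sums_mult fsol_nth_sums conv)
 have "(\<Sum>k'\<in>UNIV. b $ i $ k' * fsol a b u $ k' $ j) + (\<Sum>k'\<in>UNIV. a $ i $ k' * (exp u * fsol a b u $ k' $ j))
   = (lcoef a b u ** fsol a b u) $ i $ j"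
  unfolding lcoef_def by (simp add: mm.add_left mm_nth) (simp add: mult.left_commute sum_distrib_left)
 hence "(\<Sum>m. diffs ?c m * u ^ m) = (lcoef a b u ** fsol a b u) $ i $ j" using sums_unique[OF s] by simp
 thus "((\<lambda>x. fsol a b x $ i $ j) has_field_derivative (lcoef a b u ** fsol a b u) $ i $ j) (at u)" unfolding f using d by simp
qed

text \<open>The inverse of a solution satisfies Y' = - Y (a e^u + b). Transposed, this is the
  original equation for the negative transposes of a and b, so the power series \<open>fsol\<close>
  provides it.\<close>

definition isol :: "'n cmat => 'n cmat => complex => 'n::finite cmat" where
 "isol a b u = transpose (fsol (- transpose a) (- transpose b) u)"

lemma has_mderiv_isol: "has_mderiv (isol a b) (- (isol a b u ** lcoef a b u)) u"
 unfolding has_mderiv_iff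
proof (intro allI)
 fix i j
 have "((\<lambda>z. fsol (- transpose a) (- transpose b) z $ j $ i) has_field_derivative
  (lcoef (- transpose a) (- transpose b) u ** fsol (- transpose a) (- transpose b) u) $ j $ i) (at u)"
  using has_mderiv_fsol[of "- transpose a" "- transpose b" u] unfolding has_mderiv_iff by blast
 moreover have "(lcoef (- transpose a) (- transpose b) u ** fsol (- transpose a) (- transpose b) u) $ j $ i
   = (- (isol a b u ** lcoef a b u)) $ i $ j" by (simp add: mm_nth isol_def transpose_def lcoef_def flip: sum_negf)
    (intro sum.cong refl, simp add: algebra_simps)
 ultimately show "((\<lambda>z. isol a b z $ i $ j) has_field_derivative (- (isol a b u ** lcoef a b u)) $ i $ j) (at u)"
  by (simp add: isol_def transpose_def)
qed

lemma isol_zero [simp]: "isol a b 0 = mat 1"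
 by (simp add: isol_def transpose_mat)

lemma isol_fsol [simp]: "isol a b u ** fsol a b u = mat 1"
proof -
 have "has_mderiv (\<lambda>u. isol a b u ** fsol a b u) 0 z" for z
 proof -
  have "has_mderiv (\<lambda>u. isol a b u ** fsol a b u)
    (- (isol a b z ** lcoef a b z) ** fsol a b z + isol a b z ** (lcoef a b z ** fsol a b z)) z"
   by (intro has_mderiv_mult has_mderiv_isol has_mderiv_fsol)
  thus ?thesis by (simp add: mm.minus_left mm_assoc)
 qed
 hence "isol a b u ** fsol a b u = isol a b 0 ** fsol a b 0" by (intro has_mderiv_zero_constant[of UNIV]) auto
 thus ?thesis by simp
qed

lemma fsol_isol [simp]: "fsol a b u ** isol a b u = mat 1"
 using isol_fsol matrix_left_right_inverse by blast

lemma isol_fsol' [simp]: "isol a b u ** (fsol a b u ** X) = X" "fsol a b u ** (isol a b u ** X) = X"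
 by (simp_all add: mm_assoc)

lemma lcoef_solution:
 assumes S: "convex S" "open S" and X: "!!u. u \<in> S ==> has_mderiv X (lcoef a b u ** X u) u"
  and uv: "u \<in> S" "v \<in> S"
 shows "X u = fsol a b u ** (isol a b v ** X v)"
proof -
 have "has_mderiv (\<lambda>u. isol a b u ** X u) 0 z" if "z \<in> S" for z
 proof -
  have "has_mderiv (\<lambda>u. isol a b u ** X u) (- (isol a b z ** lcoef a b z) ** X z + isol a b z ** (lcoef a b z ** X z)) z"
   by (intro has_mderiv_mult has_mderiv_isol X that)
  thus ?thesis by (simp add: mm.minus_left mm_assoc)
 qed
 hence "isol a b u ** X u = isol a b v ** X v" using has_mderiv_zero_constant[OF S] uv by blast
 thus ?thesis by (metis isol_fsol'(2))
qed

text \<open>Translating u by c multiplies e^u by e^c, which can be absorbed into a. For c = pi i or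
  - pi i this exchanges a and - a.\<close>

lemma fsol_shift: "fsol a b (u + c) = fsol (cscale (exp c) a) b u ** fsol a b c"
proof -
 have "has_mderiv (\<lambda>u. fsol a b (u + c)) (lcoef (cscale (exp c) a) b z ** fsol a b (z + c)) z" for z
 proof -
  have "has_mderiv (\<lambda>u. fsol a b (u + c)) (cscale 1 (lcoef a b (z + c) ** fsol a b (z + c))) z"
   by (rule has_mderiv_chain[OF has_mderiv_fsol]) (auto intro!: derivative_eq_intros)
  thus ?thesis by (simp add: lcoef_def exp_add)
 qed
 from lcoef_solution[of UNIV "\<lambda>u. fsol a b (u + c)", OF _ _ this, of u 0]
 show ?thesis by simp
qed

lemma fco_cnj: "map_matrix cnj (fco a b m) = fco (map_matrix cnj a) (map_matrix cnj b) m"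
proof (induction m rule: less_induct)
 case (less m)
 show ?case
 proof (cases m)
  case 0 thus ?thesis by (simp add: mat_def vec_eq_iff)
 next
  case (Suc p)
  have IH: "fco (map_matrix cnj a) (map_matrix cnj b) k $ i $ j = cnj (fco a b k $ i $ j)" if "k <= p" for k i j
   using less[of k] that Suc by (simp add: vec_eq_iff)
  show ?thesis by (rule cmat_eqI) (simp add: Suc mm_nth IH)
 qed
qed

lemma fsol_cnj: "map_matrix cnj (fsol a b (cnj u)) = fsol (map_matrix cnj a) (map_matrix cnj b) u"
proof (rule cmat_eqI)
 fix i j
 have "(\<lambda>m. cnj (fco a b m $ i $ j * cnj u ^ m)) sums cnj (fsol a b (cnj u) $ i $ j)" unfolding sums_cnj by (rule fsol_nth_sums)
 moreover have "cnj (fco a b m $ i $ j * cnj u ^ m) = fco (map_matrix cnj a) (map_matrix cnj b) m $ i $ j * u ^ m" for m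
  by (simp flip: fco_cnj)
 ultimately have "(\<lambda>m. fco (map_matrix cnj a) (map_matrix cnj b) m $ i $ j * u ^ m) sums cnj (fsol a b (cnj u) $ i $ j)"
  by (simp only:)
 hence "cnj (fsol a b (cnj u) $ i $ j) = fsol (map_matrix cnj a) (map_matrix cnj b) u $ i $ j"
  using fsol_nth_sums sums_unique2 by blast
 thus "map_matrix cnj (fsol a b (cnj u)) $ i $ j = fsol (map_matrix cnj a) (map_matrix cnj b) u $ i $ j" by simp
qed

text \<open>For a skew-Hermitian matrix, complex conjugation is the same as negative transposition,
  so conjugating the coefficients of \<open>fsol\<close> yields the very series that defines
  \<open>isol\<close>.\<close>

lemma dagger_fsol:
 assumes "dagger a = - a" "dagger b = - b"
 shows "dagger (fsol a b (cnj u)) = isol a b u"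
proof -
 have e: "map_matrix cnj x = - transpose x" if "dagger x = - x" for x :: "'a cmat"
  using arg_cong[OF that, of transpose] by (simp add: vec_eq_iff transpose_def)
 have "dagger (fsol a b (cnj u)) = transpose (map_matrix cnj (fsol a b (cnj u)))" by (simp add: vec_eq_iff transpose_def)
 thus ?thesis by (simp add: fsol_cnj e assms isol_def)
qed

lemma unitary_fsol:
 assumes "dagger a = - a" "dagger b = - b"
 shows "unitary (fsol a b (of_real t))" using dagger_fsol[OF assms, of "of_real t"] by (intro unitaryI) simp

subsection \<open>The formal solution\<close>

definition comm :: "'n cmat => 'n cmat => 'n::finite cmat" where
 "comm A B = A ** B - B ** A"

text \<open>The defect of order k: with z = e^(-u) and F the sum of the F_k z^k, the formal gauge
  equation reads [a, F_(k+1)] = - \<open>fres b k\<close> F_k.\<close>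

definition fres :: "'n cmat => nat => 'n cmat => 'n::finite cmat" where
 "fres b k F = cscale (of_nat k) F + b ** F - F ** diag_part b"

definition foff :: "'n cmat => 'n cmat => 'n::finite cmat" where
 "foff a N = (\<chi> i j. if i = j then 0 else - N $ i $ j / (a $ i $ i - a $ j $ j))"

text \<open>The commutator with a determines only the off-diagonal entries of the next coefficient,
  by \<open>foff\<close>. Its diagonal is free at this order and is fixed by solvability of the next
  one: the defect of order k + 1 must have zero diagonal.\<close>

primrec fF :: "'n cmat => 'n cmat => nat => 'n::finite cmat" where
 "fF a b 0 = mat 1" | "fF a b (Suc k) = foff a (fres b k (fF a b k))
   - cscale (1 / of_nat (Suc k)) (diag_part (b ** foff a (fres b k (fF a b k))))"

lemma comm_nth_diag: "a \<in> diag_mats ==> comm a F $ i $ j = (a $ i $ i - a $ j $ j) * F $ i $ j"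
 by (simp add: comm_def diag_mm_left diag_mm_right algebra_simps)

lemma fres_diag:
 assumes "!!i. G $ i $ i = 0" "F = G - cscale (1 / of_nat (Suc k)) (diag_part (b ** G))"
 shows "fres b (Suc k) F $ i $ i = 0"
proof -
 have F: "F $ i $ j = G $ i $ j - (if i = j then (b ** G) $ i $ i / of_nat (Suc k) else 0)" for i j by (simp add: assms(2) diag_part_nth)
 have "(b ** F) $ i $ i = (b ** G) $ i $ i - b $ i $ i * ((b ** G) $ i $ i / of_nat (Suc k))"
 proof -
  have "(b ** F) $ i $ i = (\<Sum>k\<in>UNIV. b $ i $ k * G $ k $ i)
    - (\<Sum>l\<in>UNIV. if l = i then b $ i $ i * ((b ** G) $ i $ i / of_nat (Suc k)) else 0)"
   unfolding mm_nth[of b F] F sum_subtractf[symmetric] by (intro sum.cong refl) (auto simp: algebra_simps)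
  thus ?thesis by (simp add: mm_nth)
 qed
 moreover have "F $ i $ i = - (b ** G) $ i $ i / of_nat (Suc k)" by (simp add: F assms(1))
 ultimately show ?thesis by (simp add: fres_def diag_mm_right diag_part_nth del: of_nat_Suc)
qed

lemma comm_fF:
 assumes a: "a \<in> diag_mats" "inj (\<lambda>i. a $ i $ i)"
 shows "comm a (fF a b (Suc k)) = - fres b k (fF a b k)"
proof (rule cmat_eqI)
 fix i j
 have ne: "a $ i $ i ~= a $ j $ j" if "i ~= j" using a(2) that by (auto dest: injD)
 show "comm a (fF a b (Suc k)) $ i $ j = (- fres b k (fF a b k)) $ i $ j"
 proof (cases "i = j")
  case False
  thus ?thesis using ne a(1) by (simp add: comm_nth_diag foff_def diag_part_nth)
 next
  case True
  have "fres b k (fF a b k) $ i $ i = 0"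
  proof (cases k)
   case 0
   thus ?thesis by (simp add: fres_def cs.zero_left diag_part_nth)
  next
   case (Suc p)
   show ?thesis unfolding Suc by (rule fres_diag[where G="foff a (fres b p (fF a b p))"]) (auto simp: foff_def)
  qed
  thus ?thesis using True a(1) by (simp add: comm_nth_diag)
 qed
qed

text \<open>Off the diagonal the commutator with a is injective. The diagonal entries are forced by
  the next equation: the vanishing diagonal of the defect of order k + 1 is k + 1 times the diagonal
  entry plus off-diagonal terms that are already known.\<close>

lemma fF_unique:
 assumes a: "a \<in> diag_mats" "inj (\<lambda>i. a $ i $ i)"
  and G: "G 0 = mat 1" "!!k. comm a (G (Suc k)) = - fres b k (G k)"
 shows "G k = fF a b k"
proof (induction k)
 case 0 thus ?case by (simp add: G)
next
 case (Suc k)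
 have c: "comm a (G (Suc k)) = comm a (fF a b (Suc k))" using Suc G(2) comm_fF[OF a] by simp
 have off: "G (Suc k) $ i $ j = fF a b (Suc k) $ i $ j" if "i ~= j" for i j
  using arg_cong[OF c, of "\<lambda>M. M $ i $ j"] a that by (auto simp: comm_nth_diag dest: injD)
 have d0: "fres b (Suc k) M $ i $ i = of_nat (Suc k) * M $ i $ i + (\<Sum>j\<in>UNIV-{i}. b $ i $ j * M $ j $ i)" for M i
 proof -
  have "(b ** M) $ i $ i = b $ i $ i * M $ i $ i + (\<Sum>j\<in>UNIV-{i}. b $ i $ j * M $ j $ i)"
   unfolding mm_nth by (rule sum.remove) auto
  thus ?thesis by (simp add: fres_def diag_mm_right diag_part_nth del: of_nat_Suc)
 qed
 have diag: "G (Suc k) $ i $ i = fF a b (Suc k) $ i $ i" for i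
 proof -
  have "fres b (Suc k) (G (Suc k)) $ i $ i = 0"
   using arg_cong[OF G(2)[of "Suc k"], of "\<lambda>M. M $ i $ i"] a(1) by (simp add: comm_nth_diag)
  moreover have "fres b (Suc k) (fF a b (Suc k)) $ i $ i = 0"
   using arg_cong[OF comm_fF[OF a, of b "Suc k"], of "\<lambda>M. M $ i $ i"] a(1) by (simp add: comm_nth_diag del: fF.simps)
  moreover have "(\<Sum>j\<in>UNIV-{i}. b $ i $ j * G (Suc k) $ j $ i) = (\<Sum>j\<in>UNIV-{i}. b $ i $ j * fF a b (Suc k) $ j $ i)"
   by (intro sum.cong refl) (simp add: off del: fF.simps)
  moreover have "x = y" if "x + s = 0" "y + t = 0" "s = t" for x y s t :: complex using that by (metis add_right_cancel)
  ultimately have "of_nat (Suc k) * G (Suc k) $ i $ i = of_nat (Suc k) * fF a b (Suc k) $ i $ i" unfolding d0 by blast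
  thus ?thesis by (simp del: of_nat_Suc fF.simps)
 qed
 show ?case by (rule cmat_eqI) (metis off diag)
qed

lemma foff_bound:
 obtains c where "0 <= c" "!!N :: 'n::finite cmat. norm (foff a N) <= c * norm N"
proof -
 define g where "g = (\<Sum>i\<in>UNIV. \<Sum>j\<in>UNIV. 1 / cmod (a $ i $ i - a $ j $ j))"
 have g: "1 / cmod (a $ i $ i - a $ j $ j) <= g" for i j
 proof -
  have "1 / cmod (a $ i $ i - a $ j $ j) <= (\<Sum>j\<in>UNIV. 1 / cmod (a $ i $ i - a $ j $ j))"
   by (rule member_le_sum[of j UNIV "\<lambda>j. 1 / cmod (a $ i $ i - a $ j $ j)"]) auto
  also have "... <= g" unfolding g_def
   by (rule member_le_sum[of i UNIV "\<lambda>i. \<Sum>j\<in>UNIV. 1 / cmod (a $ i $ i - a $ j $ j)"]) (auto intro: sum_nonneg)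
  finally show ?thesis .
 qed
 have g0: "0 <= g" unfolding g_def by (intro sum_nonneg) auto
 have "norm (foff a N) <= (real (CARD('n))^2 * g) * norm N" for N :: "'n cmat"
 proof -
  have "cmod (foff a N $ i $ j) <= g * norm N" for i j
  proof (cases "i = j")
   case False
   hence "cmod (foff a N $ i $ j) = (1 / cmod (a $ i $ i - a $ j $ j)) * cmod (N $ i $ j)" by (simp add: foff_def norm_divide)
   also have "... <= g * norm N" by (rule mult_mono[OF g cmod_entry_le g0]) simp
   finally show ?thesis .
  qed (use g0 in \<open>simp add: foff_def\<close>)
  from norm_cmat_le_entries[OF this] show ?thesis by (simp add: mult.assoc)
 qed
 thus ?thesis using that[of "real (CARD('n))^2 * g"] g0 by simp
qed

lemma norm_diag_part_le: "norm (diag_part A) <= norm (A :: 'n::finite cmat)"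
proof -
 have "(norm (diag_part A))^2 <= (norm A)^2" unfolding norm_cmat_sq by (intro sum_mono) (simp add: diag_part_nth)
 thus ?thesis using power2_le_imp_le by force
qed

text \<open>Uniform over bounded b, because all error estimates built on these coefficients have to
  be locally uniform in the residue.\<close>

lemma fF_bound: "\<exists>C. \<forall>b :: 'n::finite cmat. norm b <= K --> norm (fF a b k) <= C"
proof (induction k)
 case 0
 thus ?case by auto
next
 case (Suc k)
 then obtain C where C: "!!b :: 'n cmat. norm b <= K ==> norm (fF a b k) <= C" by blast
 obtain c where c: "0 <= c" "!!N :: 'n cmat. norm (foff a N) <= c * norm N" by (rule foff_bound[of a]) blast
 define R where "R = real k * C + K * C + C * K"
 have "norm (fF a b (Suc k)) <= c * R + K * (c * R)" if b: "norm b <= K" for b :: "'n cmat"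
 proof -
  have K0: "0 <= K" using b norm_ge_zero order_trans by blast
  have C0: "0 <= C" using C[OF b] norm_ge_zero order_trans by blast
  have "norm (fres b k (fF a b k)) <= norm (cscale (of_nat k) (fF a b k)) + norm (b ** fF a b k) + norm (fF a b k ** diag_part b)"
   unfolding fres_def by (intro order_trans[OF norm_triangle_ineq4] add_mono norm_triangle_ineq order_refl)
  also have "... <= R" unfolding R_def norm_cscale
  proof (intro add_mono)
   show "cmod (of_nat k) * norm (fF a b k) <= real k * C" using C[OF b] by (simp add: mult_left_mono)
   show "norm (b ** fF a b k) <= K * C" by (intro order_trans[OF norm_matrix_mult_le] mult_mono b C K0) auto
   show "norm (fF a b k ** diag_part b) <= C * K"
    by (intro order_trans[OF norm_matrix_mult_le] mult_mono order_trans[OF norm_diag_part_le b] C[OF b] C0) auto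
  qed
  finally have f: "norm (foff a (fres b k (fF a b k))) <= c * R" using c by (meson order_trans mult_left_mono)
  have "norm (cscale (1 / of_nat (Suc k)) (diag_part (b ** foff a (fres b k (fF a b k))))) <= 1 * norm (b ** foff a (fres b k (fF a b k)))"
   unfolding norm_cscale by (intro mult_mono norm_diag_part_le) (auto simp: norm_divide simp del: of_nat_Suc)
  also have "... <= K * (c * R)" using order_trans[OF norm_matrix_mult_le mult_mono[OF b f K0]] by simp
  finally show ?thesis using f by (simp del: of_nat_Suc) (rule order_trans[OF norm_triangle_ineq4], simp)
 qed
 thus ?case by blast
qed

text \<open>The formal solution truncated after order $m$ in $z = e^{-u}$.\<close>

definition asE :: "nat => 'n cmat => 'n cmat => complex => 'n::finite cmat" where
 "asE m a b u = (\<Sum>k\<le>m. cscale (exp (- of_nat k * u)) (fF a b k))"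

text \<open>The left side is the derivative of \<open>asE m a b\<close>. By the recursion the sums
  telescope, so truncation leaves a single error term in the gauge equation, of order e^(-m
  u).\<close>

lemma asE_remainder:
 assumes a: "a \<in> diag_mats" "inj (\<lambda>i. a $ i $ i)"
 shows "(\<Sum>k\<le>m. cscale (- of_nat k * exp (- of_nat k * u)) (fF a b k)) =
  lcoef a b u ** asE m a b u - asE m a b u ** lcoef a (diag_part b) u + cscale (exp (- of_nat m * u)) (comm a (fF a b (Suc m)))"
proof (induction m)
 case 0
 show ?case using comm_fF[OF a, of b 0] by (simp add: asE_def fres_def cs.zero_left lcoef_def mm.add_left mm.add_right del: fF.simps)
   (simp add: algebra_simps)
next
 case (Suc m)
 have "- fres b (Suc m) (fF a b (Suc m)) = comm a (fF a b (Suc (Suc m)))" using comm_fF[OF a] by metis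
 hence r: "cscale (of_nat (Suc m)) (fF a b (Suc m)) = - comm a (fF a b (Suc (Suc m)))
   - b ** fF a b (Suc m) + fF a b (Suc m) ** diag_part b" unfolding fres_def by (simp add: algebra_simps del: fF.simps of_nat_Suc)
 have e1: "exp (- of_nat (Suc m) * u) * exp u = exp (- of_nat m * u)" by (simp add: algebra_simps flip: exp_add)
 have "lcoef a b u ** cscale (exp (- of_nat (Suc m) * u)) (fF a b (Suc m))
   - cscale (exp (- of_nat (Suc m) * u)) (fF a b (Suc m)) ** lcoef a (diag_part b) u
  = cscale (exp (- of_nat m * u)) (comm a (fF a b (Suc m)))
   + cscale (exp (- of_nat (Suc m) * u)) (b ** fF a b (Suc m) - fF a b (Suc m) ** diag_part b)"
  unfolding lcoef_def comm_def e1[symmetric]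
  by (simp add: mm.add_left mm.add_right cs.diff_right cs.add_right algebra_simps del: fF.simps of_nat_Suc)
 moreover have "cscale (- of_nat (Suc m) * exp (- of_nat (Suc m) * u)) (fF a b (Suc m))
   = - cscale (exp (- of_nat (Suc m) * u)) (cscale (of_nat (Suc m)) (fF a b (Suc m)))"
  by (simp add: mult.commute cs.minus_left del: fF.simps of_nat_Suc)
 moreover have "... = cscale (exp (- of_nat (Suc m) * u)) (comm a (fF a b (Suc (Suc m))))
   + cscale (exp (- of_nat (Suc m) * u)) (b ** fF a b (Suc m) - fF a b (Suc m) ** diag_part b)"
  unfolding r by (simp add: cs.diff_right cs.add_right cs.minus_right del: fF.simps of_nat_Suc)
 moreover have "asE (Suc m) a b u = asE m a b u + cscale (exp (- of_nat (Suc m) * u)) (fF a b (Suc m))"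
  by (simp add: asE_def del: fF.simps of_nat_Suc)
 ultimately show ?case using Suc.IH by (simp add: mm.add_left mm.add_right algebra_simps del: fF.simps of_nat_Suc)
qed

lemma has_mderiv_asE:
 assumes a: "a \<in> diag_mats" "inj (\<lambda>i. a $ i $ i)"
 shows "has_mderiv (asE m a b) (lcoef a b u ** asE m a b u - asE m a b u ** lcoef a (diag_part b) u
   + cscale (exp (- of_nat m * u)) (comm a (fF a b (Suc m)))) u"
proof -
 have "has_mderiv (\<lambda>u. asE m a b u) (\<Sum>k\<le>m. cscale (- of_nat k * exp (- of_nat k * u)) (fF a b k) + cscale (exp (- of_nat k * u)) 0) u"
  unfolding asE_def by (intro has_mderiv_sum has_mderiv_cscale has_mderiv_const) (auto intro!: derivative_eq_intros)
 thus ?thesis unfolding cs.zero_right add_0_right asE_remainder[OF a] .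
qed

text \<open>For z = e^(-u), a = - A0 and b = - B this is z^\<delta>(B) e^Q, the exponential factor
  of the formal solution.\<close>

definition Dd :: "'n cmat => 'n cmat => complex => 'n::finite cmat" where
 "Dd a b u = diag_exp (cscale u (diag_part b) + cscale (exp u) a)"

definition Di :: "'n cmat => 'n cmat => complex => 'n::finite cmat" where
 "Di a b u = diag_exp (- (cscale u (diag_part b) + cscale (exp u) a))"

lemma Dd_Di [simp]: "Dd a b u ** Di a b u = mat 1" "Di a b u ** Dd a b u = mat 1"
 unfolding Dd_def Di_def by (rule diag_exp_inverse)+

lemma Dd_Di' [simp]: "Dd a b u ** (Di a b u ** X) = X" "Di a b u ** (Dd a b u ** X) = X"
 by (simp_all add: mm_assoc)

lemma Dd_diag [simp]: "Dd a b u \<in> diag_mats" "Di a b u \<in> diag_mats"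
 by (simp_all add: Dd_def Di_def)

lemma Dd_nth: "Dd a b u $ i $ i = exp (u * b $ i $ i + exp u * a $ i $ i)"
 "Di a b u $ i $ i = exp (- (u * b $ i $ i + exp u * a $ i $ i))" by (simp_all add: Dd_def Di_def diag_exp_nth diag_part_nth)

lemma diag_mats_offdiag: "D \<in> diag_mats ==> i ~= j ==> D $ i $ j = 0"
 by (simp add: diag_mats_def)

lemma has_mderiv_Dd:
 assumes a: "a \<in> diag_mats"
 shows "has_mderiv (Dd a b) (lcoef a (diag_part b) u ** Dd a b u) u" "has_mderiv (Di a b) (- (Di a b u ** lcoef a (diag_part b) u)) u"
proof -
 have l: "lcoef a (diag_part b) u \<in> diag_mats" using a by (simp add: lcoef_def)
 show "has_mderiv (Dd a b) (lcoef a (diag_part b) u ** Dd a b u) u" unfolding has_mderiv_iff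
 proof (intro allI)
  fix i j
  show "((\<lambda>z. Dd a b z $ i $ j) has_field_derivative (lcoef a (diag_part b) u ** Dd a b u) $ i $ j) (at u)"
  proof (cases "i = j")
   case False
   thus ?thesis using l by (simp add: diag_mm_left diag_mats_offdiag[OF Dd_diag(1)])
  next
   case True
   show ?thesis unfolding True diag_mm_left[OF l] Dd_nth
    by (auto intro!: derivative_eq_intros simp: lcoef_def diag_part_nth algebra_simps)
  qed
 qed
 show "has_mderiv (Di a b) (- (Di a b u ** lcoef a (diag_part b) u)) u" unfolding has_mderiv_iff
 proof (intro allI)
  fix i j
  show "((\<lambda>z. Di a b z $ i $ j) has_field_derivative (- (Di a b u ** lcoef a (diag_part b) u)) $ i $ j) (at u)"
  proof (cases "i = j")
   case False
   thus ?thesis using l by (simp add: diag_mm_right diag_mats_offdiag[OF Dd_diag(2)])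
  next
   case True
   show ?thesis unfolding True unfolding vector_uminus_component diag_mm_right[OF l] Dd_nth
    by (auto intro!: derivative_eq_intros simp: lcoef_def diag_part_nth algebra_simps)
  qed
 qed
qed

text \<open>Multiplied by the truncated formal solution, a solution g of the dual equation becomes
  constant up to the truncation error. The limit of the product is the constant that compares g with
  the formal solution.\<close>

lemma has_mderiv_gED:
 assumes a: "a \<in> diag_mats" "inj (\<lambda>i. a $ i $ i)" and g: "has_mderiv g (- (g u ** lcoef a b u)) u"
 shows "has_mderiv (\<lambda>u. g u ** asE m a b u ** Dd a b u)
   (cscale (exp (- of_nat m * u)) (g u ** comm a (fF a b (Suc m)) ** Dd a b u)) u"
proof -
 let ?L = "lcoef a b u" and ?l = "lcoef a (diag_part b) u" and ?R = "cscale (exp (- of_nat m * u)) (comm a (fF a b (Suc m)))"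
 have "has_mderiv (\<lambda>u. g u ** asE m a b u ** Dd a b u)
   ((- (g u ** ?L) ** asE m a b u + g u ** (?L ** asE m a b u - asE m a b u ** ?l + ?R)) ** Dd a b u
    + g u ** asE m a b u ** (?l ** Dd a b u)) u" by (intro has_mderiv_mult g has_mderiv_asE[OF a] has_mderiv_Dd[OF a(1)])
 moreover have "(- (g u ** ?L) ** asE m a b u + g u ** (?L ** asE m a b u - asE m a b u ** ?l + ?R)) ** Dd a b u
    + g u ** asE m a b u ** (?l ** Dd a b u) = cscale (exp (- of_nat m * u)) (g u ** comm a (fF a b (Suc m)) ** Dd a b u)"
  by (simp add: mm.minus_left mm.diff_left mm.diff_right mm.add_left mm.add_right mm_assoc del: fF.simps)
 ultimately show ?thesis by simp
qed

lemma asE_bound: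
 "\<exists>C\<ge>0. \<forall>b :: 'n::finite cmat. \<forall>u. norm b <= K --> 0 <= Re u --> norm (asE m a b u - mat 1) <= C * exp (- Re u)"
proof -
 have "\<forall>k. \<exists>C. \<forall>b :: 'n cmat. norm b <= K --> norm (fF a b k) <= C" using fF_bound by blast
 then obtain C where C: "!!k (b :: 'n cmat). norm b <= K ==> norm (fF a b k) <= C k" by metis
 define c where "c = (\<Sum>k=1..m. \<bar>C k\<bar>)"
 have "norm (asE m a b u - mat 1) <= c * exp (- Re u)" if b: "norm b <= K" and u: "0 <= Re u" for b :: "'n cmat" and u
 proof -
  have "{..m} = insert 0 {1..m}" by auto
  hence "asE m a b u - mat 1 = (\<Sum>k=1..m. cscale (exp (- of_nat k * u)) (fF a b k))" by (simp add: asE_def del: fF.simps(2))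
  also have "norm ... <= (\<Sum>k=1..m. \<bar>C k\<bar> * exp (- Re u))"
  proof (rule order_trans[OF norm_sum], rule sum_mono)
   fix k assume k: "k \<in> {1..m}"
   have "1 * Re u <= real k * Re u" by (rule mult_right_mono) (use k u in auto)
   hence "cmod (exp (- of_nat k * u)) <= exp (- Re u)" by (simp add: norm_exp_eq_Re)
   thus "norm (cscale (exp (- of_nat k * u)) (fF a b k)) <= \<bar>C k\<bar> * exp (- Re u)"
    unfolding norm_cscale mult.commute[of "\<bar>C k\<bar>"] by (rule mult_mono) (use C[OF b, of k] in auto)
  qed
  finally show ?thesis by (simp add: c_def sum_distrib_right)
 qed
 moreover have "0 <= c" unfolding c_def by (intro sum_nonneg) simp
 ultimately show ?thesis by blast
qed

subsection \<open>Asymptotic normalisation along the positive axis\<close>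

definition irr :: "'n::finite cmat => bool" where
 "irr a \<longleftrightarrow> a \<in> diag_mats & (\<forall>i. Re (a $ i $ i) = 0) & inj (\<lambda>i. a $ i $ i)"

text \<open>Contains the skew-Hermitian matrices and is open, so that holomorphic dependence on the residue makes sense.\<close>

definition tube :: "'n::finite cmat set" where
 "tube = {b. \<forall>i. \<bar>Re (b $ i $ i)\<bar> < 1/8}"

lemma irr_uminus [simp]: "irr (- a) \<longleftrightarrow> irr a"
proof -
 have "inj (\<lambda>i. - (a $ i $ i)) \<longleftrightarrow> inj (\<lambda>i. a $ i $ i)" by (simp add: inj_def)
 moreover have "- a \<in> diag_mats \<longleftrightarrow> a \<in> diag_mats" by (simp add: diag_mats_def)
 ultimately show ?thesis by (simp add: irr_def)
qed

lemma irrD: "irr a ==> a \<in> diag_mats" "irr a ==> Re (a $ i $ i) = 0" "irr a ==> inj (\<lambda>i. a $ i $ i)"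
 by (simp_all add: irr_def)

lemma irr_transpose: "irr a ==> transpose a = a"
proof (rule cmat_eqI)
 fix i j assume "irr a"
 thus "transpose a $ i $ j = a $ i $ j" by (cases "i = j") (auto simp: transpose_def irr_def diag_mats_def)
qed

lemma irr_dagger: "irr a ==> dagger a = - a"
proof (rule cmat_eqI)
 fix i j assume "irr a"
 thus "dagger a $ i $ j = (- a) $ i $ j" by (cases "i = j") (auto simp: irr_def diag_mats_def complex_eq_iff)
qed

lemma tube_transpose: "b \<in> tube ==> - transpose b \<in> tube"
 by (auto simp: tube_def transpose_def)

lemma norm_transpose [simp]: "norm (transpose A) = norm (A :: 'n::finite cmat)"
proof -
 have "(norm (transpose A))^2 = (norm A)^2" unfolding norm_cmat_sq transpose_def by (simp) (rule sum.swap)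
 thus ?thesis by (simp add: power2_eq_iff_nonneg)
qed

lemma conj_entry:
 "(Di a b u ** M ** Dd a b u) $ i $ j = M $ i $ j * exp (u * (b $ j $ j - b $ i $ i) + exp u * (a $ j $ j - a $ i $ i))"
 "(Dd a b u ** M ** Di a b u) $ i $ j = M $ i $ j * exp (u * (b $ i $ i - b $ j $ j) + exp u * (a $ i $ i - a $ j $ j))"
 by (simp_all add: diag_mm_left diag_mm_right Dd_nth algebra_simps flip: exp_add)

text \<open>Such weights appear when a matrix is conjugated by \<open>Dd\<close>. Since a is
  imaginary, the modulus of exp(e^u (a_j - a_i)) depends only on Im e^u, so it is controlled where
  Im e^u is bounded. The residue contributes at most e^(Re u / 4) up to a constant, which is less
  than what one order of the formal expansion gains.\<close>

lemma weight_bound: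
 assumes a: "irr a" and b: "b \<in> tube" "norm b <= K"
  and u: "0 <= Re u" "\<bar>Im u\<bar> <= pi" "\<bar>Im (exp u)\<bar> <= \<eta>"
 shows "cmod (exp (u * (b $ j $ j - b $ i $ i) + exp u * (a $ j $ j - a $ i $ i)))
  <= exp (2 * pi * K + 2 * norm a * \<eta>) * exp (Re u / 4)"
proof -
 have be: "\<bar>Im (b $ k $ k)\<bar> <= K" for k using order_trans[OF abs_Im_le_cmod order_trans[OF cmod_entry_le b(2)]] .
 have ae: "\<bar>Im (a $ k $ k)\<bar> <= norm a" for k using order_trans[OF abs_Im_le_cmod cmod_entry_le] .
 have bd: "\<bar>Im (b $ j $ j) - Im (b $ i $ i)\<bar> <= 2 * K" using be[of i] be[of j] by linarith
 have ad: "\<bar>Im (a $ j $ j) - Im (a $ i $ i)\<bar> <= 2 * norm a" using ae[of i] ae[of j] by linarith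
 \<comment> \<open>The bound 1/8 in \<open>tube\<close> enters here and is the origin of the
   exponent 1/4.\<close>
 have "Re (b $ j $ j) - Re (b $ i $ i) <= 1 / 4"
 proof -
  have "\<bar>Re (b $ j $ j)\<bar> < 1 / 8" "\<bar>Re (b $ i $ i)\<bar> < 1 / 8" using b(1) by (simp_all add: tube_def)
  thus ?thesis by linarith
 qed
 hence 1: "Re u * (Re (b $ j $ j) - Re (b $ i $ i)) <= Re u / 4"
  using u(1) by (metis mult_left_mono mult.right_neutral times_divide_eq_right)
 have 2: "\<bar>Im u * (Im (b $ j $ j) - Im (b $ i $ i))\<bar> <= pi * (2 * K)" unfolding abs_mult by (rule mult_mono[OF u(2) bd]) auto
 have 3: "\<bar>Im (exp u) * (Im (a $ j $ j) - Im (a $ i $ i))\<bar> <= \<eta> * (2 * norm a)"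
  unfolding abs_mult by (rule mult_mono[OF u(3) ad]) (use u(3) in auto)
 have "Re (u * (b $ j $ j - b $ i $ i) + exp u * (a $ j $ j - a $ i $ i))
   = Re u * (Re (b $ j $ j) - Re (b $ i $ i)) - Im u * (Im (b $ j $ j) - Im (b $ i $ i)) - Im (exp u) * (Im (a $ j $ j) - Im (a $ i $ i))"
  using irrD(2)[OF a] by simp
 also have "... <= 2 * pi * K + 2 * norm a * \<eta> + Re u / 4" using 1 2 3 by (simp add: algebra_simps abs_le_iff)
 finally show ?thesis by (simp add: norm_exp_eq_Re flip: exp_add)
qed

lemma conj_bound:
 assumes a: "irr a" and b: "b \<in> tube" "norm b <= K"
  and u: "0 <= Re u" "\<bar>Im u\<bar> <= pi" "\<bar>Im (exp u)\<bar> <= \<eta>"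
 shows "norm (Di a b u ** M ** Dd a b u)
  <= real (CARD('n))^2 * (exp (2 * pi * K + 2 * norm a * \<eta>) * exp (Re u / 4) * norm (M :: 'n::finite cmat))"
  "norm (Dd a b u ** M ** Di a b u) <= real (CARD('n))^2 * (exp (2 * pi * K + 2 * norm a * \<eta>) * exp (Re u / 4) * norm M)"
proof -
 have "cmod ((Di a b u ** M ** Dd a b u) $ i $ j) <= exp (2 * pi * K + 2 * norm a * \<eta>) * exp (Re u / 4) * norm M" for i j
  unfolding conj_entry norm_mult mult.commute[of "cmod (M $ i $ j)"] by (rule mult_mono[OF weight_bound[OF assms] cmod_entry_le]) auto
 thus "norm (Di a b u ** M ** Dd a b u) <= real (CARD('n))^2 * (exp (2 * pi * K + 2 * norm a * \<eta>) * exp (Re u / 4) * norm M)"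
  by (rule norm_cmat_le_entries)
 have "cmod ((Dd a b u ** M ** Di a b u) $ i $ j) <= exp (2 * pi * K + 2 * norm a * \<eta>) * exp (Re u / 4) * norm M" for i j
  unfolding conj_entry norm_mult mult.commute[of "cmod (M $ i $ j)"] by (rule mult_mono[OF weight_bound[OF assms] cmod_entry_le]) auto
 thus "norm (Dd a b u ** M ** Di a b u) <= real (CARD('n))^2 * (exp (2 * pi * K + 2 * norm a * \<eta>) * exp (Re u / 4) * norm M)"
  by (rule norm_cmat_le_entries)
qed

text \<open>Gronwall's inequality without exponentials. If S is the maximum of the norm of f, then S
  is at most the norm of f s plus S/2, because k grows by at most 1/2; hence S is at most twice the
  initial norm, and this is inserted once more into the mean value bound.\<close>

lemma gronwall_half:
 fixes f :: "real => 'a::real_normed_vector"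
 assumes f: "!!t. s <= t ==> t <= e ==> (f has_vector_derivative f' t) (at t)"
  and \<kappa>: "!!t. s <= t ==> t <= e ==> (k has_vector_derivative \<kappa> t) (at t)"
  and bd: "!!t. s <= t ==> t <= e ==> norm (f' t) <= \<kappa> t * norm (f t)"
  and pos: "!!t. s <= t ==> t <= e ==> 0 <= \<kappa> t"
  and half: "k e - k s <= 1/2" and t: "s <= t" "t <= e"
 shows "norm (f t - f s) <= 2 * (k t - k s) * norm (f s)"
proof -
 have cf: "continuous_on {s..e} f" and ck: "continuous_on {s..e} k"
  using f \<kappa> by (auto intro!: continuous_at_imp_continuous_on has_vector_derivative_continuous)
 have "continuous_on {s..e} (\<lambda>x. norm (f x))" by (intro continuous_intros cf)
 then obtain x where x: "s <= x" "x <= e" "!!y. s <= y ==> y <= e ==> norm (f y) <= norm (f x)"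
  using continuous_attains_sup[of "{s..e}" "\<lambda>x. norm (f x)"] t by auto
 define S where "S = norm (f x)"
 have S0: "0 <= S" by (simp add: S_def)
 have est: "norm (f y - f s) <= S * (k y - k s)" if y: "s <= y" "y <= e" for y
 proof (cases "s = y")
  case False
  have "norm (f y - f s) <= S * k y - S * k s"
  proof (rule differentiable_bound_general[where f'=f' and \<phi>'="\<lambda>t. S * \<kappa> t"])
   show "s < y" using False y by simp
   show "continuous_on {s..y} f" "continuous_on {s..y} (\<lambda>t. S * k t)"
    using y by (auto intro!: continuous_intros intro: continuous_on_subset[OF cf] continuous_on_subset[OF ck])
   fix z assume z: "s < z" "z < y"
   show "(f has_vector_derivative f' z) (at z)" using f z y by auto
   show "((\<lambda>t. S * k t) has_vector_derivative S * \<kappa> z) (at z)"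
    using \<kappa>[of z] z y by (auto intro!: derivative_eq_intros simp: has_real_derivative_iff_has_vector_derivative[symmetric])
   have "norm (f' z) <= \<kappa> z * norm (f z)" using bd z y by auto
   also have "... <= \<kappa> z * S" using x(3)[of z] pos[of z] z y by (intro mult_left_mono) (auto simp: S_def)
   finally show "norm (f' z) <= S * \<kappa> z" by (simp add: mult.commute)
  qed
  thus ?thesis by (simp add: algebra_simps)
 qed simp
 have kmono: "k y <= k e" if "s <= y" "y <= e" for y
 proof (rule DERIV_nonneg_imp_nondecreasing[OF that(2)])
  fix z assume "y <= z" "z <= e"
  thus "\<exists>D. (k has_real_derivative D) (at z) & 0 <= D"
   using \<kappa>[of z] pos[of z] that by (auto simp: has_real_derivative_iff_has_vector_derivative)
 qed
 have ks: "k s <= k y" if "s <= y" "y <= e" for y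
 proof (rule DERIV_nonneg_imp_nondecreasing[OF that(1)])
  fix z assume "s <= z" "z <= y"
  thus "\<exists>D. (k has_real_derivative D) (at z) & 0 <= D"
   using \<kappa>[of z] pos[of z] that by (auto simp: has_real_derivative_iff_has_vector_derivative)
 qed
 have "S <= norm (f s) + norm (f x - f s)" unfolding S_def by norm
 also have "norm (f x - f s) <= S * (k x - k s)" by (rule est[OF x(1,2)])
 also have "... <= S * (1/2)" using kmono[OF x(1,2)] half S0 by (intro mult_left_mono) auto
 finally have "S <= 2 * norm (f s)" by simp
 hence "S * (k t - k s) <= 2 * norm (f s) * (k t - k s)" using ks[OF t] by (intro mult_right_mono) auto
 thus ?thesis using est[OF t] by (simp add: algebra_simps)
qed

lemma exp_decay_tendsto: "0 < p ==> ((\<lambda>t::real. exp (- p * t)) \<longlongrightarrow> 0) at_top"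
 by (rule filterlim_compose[OF exp_at_bot])
  (simp add: filterlim_uminus_at_bot filterlim_tendsto_pos_mult_at_top[OF tendsto_const _ filterlim_ident])

lemma exp_decay_le:
 fixes p C \<epsilon> :: real
 assumes "0 < p" "0 <= C" "0 < \<epsilon>"
 obtains t0 where "0 <= t0" "!!t. t0 <= t ==> C * exp (- p * t) <= \<epsilon>"
proof -
 have "((\<lambda>t::real. C * exp (- p * t)) \<longlongrightarrow> C * 0) at_top"
  by (intro tendsto_mult tendsto_const exp_decay_tendsto) (use assms(1) in simp)
 hence "\<forall>\<^sub>F t in at_top. C * exp (- p * t) < \<epsilon>" using assms(3) by (auto dest: order_tendstoD)
 then obtain T where "!!t. T <= t ==> C * exp (- p * t) < \<epsilon>" unfolding eventually_at_top_linorder by blast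
 thus ?thesis using that[of "max T 0"] by force
qed

text \<open>M stands for the value g(u) of a dual solution. Even after conjugation by
  \<open>Dd\<close> the correction E - 1, with E = \<open>asE m a b u\<close>, is small for large Re
  u, so M D and M E D have comparable norms. The derivative of g E D is then bounded by a multiple
  of g E D that decays as soon as m > 0, with constants valid for all g and all bounded b in the
  tube.\<close>

lemma gED_estimate:
 assumes a: "irr (a :: 'n::finite cmat)" and \<eta>: "0 <= \<eta>"
 shows "\<exists>A t0. 0 <= A & 0 <= t0 & (\<forall>b\<in>tube. norm b <= K --> (\<forall>u (M :: 'n cmat).
   t0 <= Re u --> \<bar>Im u\<bar> <= pi --> \<bar>Im (exp u)\<bar> <= \<eta> -->
   norm (cscale (exp (- of_nat m * u)) (M ** comm a (fF a b (Suc m)) ** Dd a b u))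
    <= A * exp (- (real m - 1/4) * Re u) * norm (M ** asE m a b u ** Dd a b u) &
   norm (M ** Dd a b u - M ** asE m a b u ** Dd a b u) <= A * exp (- Re u / 2) * norm (M ** asE m a b u ** Dd a b u)))"
proof -
 define c where "c = real (CARD('n))^2 * exp (2 * pi * K + 2 * norm a * \<eta>)"
 have c0: "0 <= c" by (simp add: c_def)
 obtain C1 where C1: "0 <= C1" "!!b :: 'n cmat. !!u. norm b <= K ==> 0 <= Re u ==> norm (asE m a b u - mat 1) <= C1 * exp (- Re u)"
  using asE_bound[of K m a] by blast
 obtain C2 where C2: "!!b :: 'n cmat. norm b <= K ==> norm (fF a b (Suc m)) <= C2"
  using fF_bound[of K a "Suc m"] by blast
 define C3 where "C3 = 2 * norm a * \<bar>C2\<bar>"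
 have cm: "norm (comm a (fF a b (Suc m))) <= C3" if "norm b <= K" for b :: "'n cmat"
 proof -
  have "norm (comm a (fF a b (Suc m))) <= norm a * norm (fF a b (Suc m)) + norm (fF a b (Suc m)) * norm a"
   unfolding comm_def by (intro order_trans[OF norm_triangle_ineq4] add_mono norm_matrix_mult_le)
  also have "... <= 2 * norm a * \<bar>C2\<bar>"
   using mult_left_mono[OF order_trans[OF C2[OF that] abs_ge_self], of "2 * norm a"] by (simp add: algebra_simps)
  finally show ?thesis by (simp add: C3_def)
 qed
 obtain t0 where t0: "0 <= t0" "!!t. t0 <= t ==> (c * C1) * exp (- (1/2) * t) <= 1/2"
  using exp_decay_le[of "1/2" "c * C1" "1/2"] c0 C1(1) by auto
 define A where "A = 2 * (c * C1) + 2 * (c * C3)"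
 have A0: "0 <= A" using c0 C1(1) by (simp add: A_def C3_def)
 show ?thesis
 proof (rule exI[of _ A], rule exI[of _ t0], intro conjI A0 t0(1) ballI impI allI)
  fix b M :: "'n cmat" and u
  assume b: "b \<in> tube" "norm b <= K" and u: "t0 <= Re u" "\<bar>Im u\<bar> <= pi" "\<bar>Im (exp u)\<bar> <= \<eta>"
  have Re0: "0 <= Re u" using u(1) t0(1) by simp
  let ?D = "Dd a b u" and ?I = "Di a b u"
  let ?N = "norm (M ** asE m a b u ** ?D)"
  have cb: "norm (?I ** X ** ?D) <= c * exp (Re u / 4) * norm X" for X
   using conj_bound(1)[OF a b Re0 u(2,3)] by (simp add: c_def mult.assoc)
  have Eb: "norm (?I ** (asE m a b u - mat 1) ** ?D) <= c * C1 * exp (- Re u / 2)"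
  proof -
   have "norm (?I ** (asE m a b u - mat 1) ** ?D) <= c * exp (Re u / 4) * (C1 * exp (- Re u))"
    by (rule order_trans[OF cb mult_left_mono[OF C1(2)[OF b(2) Re0]]]) (use c0 in simp)
   also have "... = c * C1 * exp (- (3/4) * Re u)" by (simp add: algebra_simps flip: exp_add)
   also have "... <= c * C1 * exp (- Re u / 2)" using Re0 c0 C1(1) by (intro mult_left_mono) auto
   finally show ?thesis .
  qed
  have split: "M ** asE m a b u ** ?D - M ** ?D = (M ** ?D) ** (?I ** (asE m a b u - mat 1) ** ?D)"
   by (simp add: mm.diff_left mm.diff_right flip: mm_assoc)
  have d: "norm (M ** asE m a b u ** ?D - M ** ?D) <= norm (M ** ?D) * (c * C1 * exp (- Re u / 2))"
   unfolding split by (rule order_trans[OF norm_matrix_mult_le mult_left_mono[OF Eb]]) simp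
  also have "... <= norm (M ** ?D) * (1/2)" using t0(2)[OF u(1)] by (intro mult_left_mono) auto
  finally have MD: "norm (M ** ?D) <= 2 * ?N" by norm
  have "norm (M ** ?D) * (c * C1 * exp (- Re u / 2)) <= 2 * ?N * (c * C1 * exp (- Re u / 2))"
   by (rule mult_right_mono[OF MD]) (use c0 C1(1) in simp)
  also have "... <= A * exp (- Re u / 2) * ?N"
  proof -
   have "(2 * (c * C1)) * (exp (- Re u / 2) * ?N) <= A * (exp (- Re u / 2) * ?N)"
    by (rule mult_right_mono) (use c0 C1(1) in \<open>auto simp: A_def C3_def\<close>)
   thus ?thesis by (simp add: algebra_simps)
  qed
  finally have e: "norm (M ** ?D) * (c * C1 * exp (- Re u / 2)) <= A * exp (- Re u / 2) * ?N" .
  show "norm (M ** ?D - M ** asE m a b u ** ?D) <= A * exp (- Re u / 2) * ?N"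
   unfolding norm_minus_commute[of "M ** ?D"] by (rule order_trans[OF d e])
  have "M ** comm a (fF a b (Suc m)) ** ?D = (M ** ?D) ** (?I ** comm a (fF a b (Suc m)) ** ?D)" by (simp flip: mm_assoc)
  hence "norm (M ** comm a (fF a b (Suc m)) ** ?D) <= norm (M ** ?D) * norm (?I ** comm a (fF a b (Suc m)) ** ?D)"
   by (simp only: norm_matrix_mult_le)
  also have "... <= (2 * ?N) * (c * exp (Re u / 4) * C3)"
   by (intro mult_mono MD order_trans[OF cb mult_left_mono[OF cm[OF b(2)]]]) (use c0 in auto)
  finally have "norm (cscale (exp (- of_nat m * u)) (M ** comm a (fF a b (Suc m)) ** ?D))
    <= exp (- real m * Re u) * ((2 * ?N) * (c * exp (Re u / 4) * C3))" unfolding norm_cscale norm_exp_eq_Re by (intro mult_mono) auto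
  also have "... = 2 * (c * C3) * exp (- (real m - 1/4) * Re u) * ?N"
  proof -
   have "exp (- (real m - 1/4) * Re u) = exp (- real m * Re u) * exp (Re u / 4)" by (simp add: algebra_simps flip: exp_add)
   thus ?thesis by simp
  qed
  also have "... <= A * exp (- (real m - 1/4) * Re u) * ?N"
   by (intro mult_right_mono) (use c0 C1(1) in \<open>auto simp: A_def\<close>)
  finally show "norm (cscale (exp (- of_nat m * u)) (M ** comm a (fF a b (Suc m)) ** ?D)) <= A * exp (- (real m - 1/4) * Re u) * ?N" .
 qed
qed

text \<open>A solution g of the dual equation together with its connection constant L to the formal
  solution, read off on the real axis.\<close>

definition lsol :: "'n cmat => 'n cmat => (complex => 'n cmat) => 'n::finite cmat => bool" where
 "lsol a b g L \<longleftrightarrow> (\<forall>u. has_mderiv g (- (g u ** lcoef a b u)) u) &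
   ((\<lambda>t. g (complex_of_real t) ** Dd a b (of_real t)) \<longlongrightarrow> L) at_top"

text \<open>On the real axis \<open>Im (exp u)\<close> = 0, so \<open>gED_estimate\<close> makes the
  relative growth rate of g E D integrable and the Cauchy criterion holds. That A and t0 serve for
  all g and all bounded b, and that the errors are relative to the norm of L, is what later gives
  holomorphy of the limit in b.\<close>

lemma real_limit_estimate:
 assumes a: "irr (a :: 'n::finite cmat)" and m: "0 < m"
 shows "\<exists>A t0. 0 <= A & 0 <= t0 & (\<forall>b\<in>tube. norm b <= K --> (\<forall>g.
   (\<forall>u. has_mderiv g (- (g u ** lcoef a b u)) u) -->
   (\<exists>L. lsol a b g L & norm L <= 2 * norm (g (of_real t0) ** asE m a b (of_real t0) ** Dd a b (of_real t0)) &
    (\<forall>t\<ge>t0. norm (g (of_real t) ** asE m a b (of_real t) ** Dd a b (of_real t) - L)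
      <= A * exp (- (real m - 1/4) * t) * norm L &
      norm (g (of_real t) ** Dd a b (of_real t) - L) <= A * exp (- t / 2) * norm L))))"
proof -
 define p where "p = real m - 1/4"
 have p: "3/4 <= p" using m by (simp add: p_def)
 obtain A t1 where A0: "0 <= A" "0 <= t1" and est: "\<forall>b\<in>tube. norm b <= K --> (\<forall>u (M :: 'n cmat).
   t1 <= Re u --> \<bar>Im u\<bar> <= pi --> \<bar>Im (exp u)\<bar> <= 0 -->
   norm (cscale (exp (- of_nat m * u)) (M ** comm a (fF a b (Suc m)) ** Dd a b u))
    <= A * exp (- (real m - 1/4) * Re u) * norm (M ** asE m a b u ** Dd a b u) &
   norm (M ** Dd a b u - M ** asE m a b u ** Dd a b u) <= A * exp (- Re u / 2) * norm (M ** asE m a b u ** Dd a b u))"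
  using gED_estimate[OF a order_refl, of K m] by (elim exE conjE) (rule that)
 have A1: "norm (cscale (exp (- of_nat m * u)) (M ** comm a (fF a b (Suc m)) ** Dd a b u))
    <= A * exp (- p * Re u) * norm (M ** asE m a b u ** Dd a b u)"
  and A2: "norm (M ** Dd a b u - M ** asE m a b u ** Dd a b u) <= A * exp (- Re u / 2) * norm (M ** asE m a b u ** Dd a b u)"
  if "b \<in> tube" "norm b <= K" "t1 <= Re u" "\<bar>Im u\<bar> <= pi" "\<bar>Im (exp u)\<bar> <= 0" for b u M
  using est[rule_format, OF that, of M] unfolding p_def by - (erule conjunct1, erule conjunct2)
 obtain t2 where t2: "0 <= t2" "!!t. t2 <= t ==> (A / p) * exp (- p * t) <= 1/4"
  using exp_decay_le[of p "A / p" "1/4"] p A0 by auto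
 define t0 where "t0 = max t1 t2"
 have t0: "0 <= t0" "t1 <= t0" "t2 <= t0" using t2 by (auto simp: t0_def)
 define A' where "A' = 2 * A + 4 * (A / p)"
 have A'0: "0 <= A'" using A0 p by (simp add: A'_def)
 have "\<exists>L. lsol a b g L & norm L <= 2 * norm (g (of_real t0) ** asE m a b (of_real t0) ** Dd a b (of_real t0)) &
    (\<forall>t\<ge>t0. norm (g (of_real t) ** asE m a b (of_real t) ** Dd a b (of_real t) - L) <= A' * exp (- p * t) * norm L &
      norm (g (of_real t) ** Dd a b (of_real t) - L) <= A' * exp (- t / 2) * norm L)"
  if b: "b \<in> tube" "norm b <= K" and g: "!!u. has_mderiv g (- (g u ** lcoef a b u)) u" for b g
 proof -
  define f where "f t = g (of_real t) ** asE m a b (of_real t) ** Dd a b (of_real t)" for t :: real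
  define f' where "f' t = cscale (exp (- of_nat m * of_real t)) (g (of_real t) ** comm a (fF a b (Suc m)) ** Dd a b (of_real t))" for t :: real
  have fd: "(f has_vector_derivative f' t) (at t)" for t
  proof -
   have "((\<lambda>t. complex_of_real t) has_vector_derivative 1) (at t)"
    by (auto intro!: derivative_eq_intros simp: has_vector_derivative_def scaleR_conv_of_real)
   from has_mderiv_vector[OF has_mderiv_gED[OF irrD(1)[OF a] irrD(3)[OF a] g] this]
   show ?thesis unfolding f_def f'_def by simp
  qed
  have f'b: "norm (f' t) <= A * exp (- p * t) * norm (f t)" if "t0 <= t" for t
   using A1[OF b, of "of_real t" "g (of_real t)"] that t0 unfolding f_def f'_def by (simp add: Im_exp del: fF.simps)
  have est: "norm (f t - f s) <= 2 * ((A / p) * exp (- p * s)) * norm (f s)" if st: "t0 <= s" "s <= t" for s t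
  proof -
   have "norm (f t - f s) <= 2 * (- (A / p) * exp (- p * t) - - (A / p) * exp (- p * s)) * norm (f s)"
   proof (rule gronwall_half[where f'=f' and \<kappa>="\<lambda>t. A * exp (- p * t)" and e=t])
    fix x assume x: "s <= x" "x <= t"
    show "((\<lambda>t. - (A / p) * exp (- p * t)) has_vector_derivative A * exp (- p * x)) (at x)"
     unfolding has_real_derivative_iff_has_vector_derivative[symmetric] using p by (auto intro!: derivative_eq_intros)
    show "norm (f' x) <= A * exp (- p * x) * norm (f x)" using f'b x st by simp
   next
    have "(A / p) * exp (- p * s) <= 1/4" using t2(2)[of s] st t0 by simp
    moreover have "0 <= (A / p) * exp (- p * t)" using A0 p by simp
    ultimately show "- (A / p) * exp (- p * t) - - (A / p) * exp (- p * s) <= 1/2" unfolding mult_minus_left by linarith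
   qed (use fd st A0 in auto)
   also have "... <= 2 * ((A / p) * exp (- p * s)) * norm (f s)" using A0 p by (intro mult_right_mono) auto
   finally show ?thesis .
  qed
  have fb: "norm (f t) <= 2 * norm (f t0)" if "t0 <= t" for t
  proof -
   have "norm (f t - f t0) <= 2 * (1/4) * norm (f t0)"
    by (rule order_trans[OF est[OF order_refl that]], intro mult_right_mono mult_left_mono t2(2)) (use t0 in auto)
   thus ?thesis by norm
  qed
  have lim0: "((\<lambda>s. 2 * ((A / p) * exp (- p * s)) * (2 * norm (f t0))) \<longlongrightarrow> 2 * ((A / p) * 0) * (2 * norm (f t0))) at_top"
   by (intro tendsto_mult tendsto_const exp_decay_tendsto) (use p in simp)
  have "Cauchy (\<lambda>n. f (real n))"
  proof (rule metric_CauchyI)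
   fix e :: real assume e: "0 < e"
   have "\<forall>\<^sub>F s in at_top. 2 * ((A / p) * exp (- p * s)) * (2 * norm (f t0)) < e / 2"
    by (rule order_tendstoD(2)[OF lim0]) (use e in simp)
   then obtain T where T: "!!s. T <= s ==> 2 * ((A / p) * exp (- p * s)) * (2 * norm (f t0)) < e / 2"
    unfolding eventually_at_top_linorder by blast
   define N where "N = nat \<lceil>max T t0\<rceil>"
   have N: "T <= real N" "t0 <= real N" unfolding N_def by linarith+
   have close: "norm (f (real n) - f (real N)) < e / 2" if "N <= n" for n
   proof -
    have "norm (f (real n) - f (real N)) <= 2 * ((A / p) * exp (- p * real N)) * norm (f (real N))"
     using est[of "real N" "real n"] N that by simp
    also have "... <= 2 * ((A / p) * exp (- p * real N)) * (2 * norm (f t0))"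
     by (rule mult_left_mono[OF fb[OF N(2)]]) (use A0 p in auto)
    finally show ?thesis using T[OF N(1)] by simp
   qed
   thus "\<exists>M. \<forall>m\<ge>M. \<forall>n\<ge>M. dist (f (real m)) (f (real n)) < e"
    by (intro exI[of _ N]) (metis dist_norm dist_triangle_half_l dist_commute)
  qed
  then obtain L where L: "(\<lambda>n. f (real n)) \<longlonglongrightarrow> L" using Cauchy_convergent_iff convergent_def by blast
  have estL: "norm (L - f s) <= 2 * ((A / p) * exp (- p * s)) * norm (f s)" if "t0 <= s" for s
  proof (rule tendsto_upperbound)
   show "((\<lambda>n. norm (f (real n) - f s)) \<longlongrightarrow> norm (L - f s)) sequentially" by (intro tendsto_intros L)
   show "\<forall>\<^sub>F n in sequentially. norm (f (real n) - f s) <= 2 * ((A / p) * exp (- p * s)) * norm (f s)"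
    using eventually_ge_at_top[of "nat \<lceil>s\<rceil>"] by eventually_elim (intro est that, linarith)
  qed simp
  have fL: "norm (f s) <= 2 * norm L" and Lf: "norm L <= 2 * norm (f s)" if "t0 <= s" for s
  proof -
   have "norm (L - f s) <= 2 * (1/4) * norm (f s)"
    by (rule order_trans[OF estL[OF that]], intro mult_right_mono mult_left_mono t2(2)) (use t0 that in auto)
   thus "norm (f s) <= 2 * norm L" "norm L <= 2 * norm (f s)" by norm+
  qed
  have r1: "norm (f t - L) <= 4 * (A / p) * exp (- p * t) * norm L" if "t0 <= t" for t
  proof -
   have "norm (f t - L) <= 2 * ((A / p) * exp (- p * t)) * (2 * norm L)" unfolding norm_minus_commute[of "f t"]
    by (rule order_trans[OF estL[OF that] mult_left_mono[OF fL[OF that]]]) (use A0 p in auto)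
   thus ?thesis by (simp add: algebra_simps)
  qed
  have r1': "norm (f t - L) <= A' * exp (- p * t) * norm L" if "t0 <= t" for t
   by (rule order_trans[OF r1[OF that]], intro mult_right_mono) (use A0 p in \<open>auto simp: A'_def\<close>)
  have r2: "norm (g (of_real t) ** Dd a b (of_real t) - L) <= A' * exp (- t / 2) * norm L" if "t0 <= t" for t
  proof -
   have "norm (g (of_real t) ** Dd a b (of_real t) - f t) <= A * exp (- t / 2) * norm (f t)"
    using A2[OF b, of "of_real t" "g (of_real t)"] that t0 by (simp add: f_def Im_exp)
   also have "... <= A * exp (- t / 2) * (2 * norm L)" by (rule mult_left_mono[OF fL[OF that]]) (use A0 in auto)
   finally have 1: "norm (g (of_real t) ** Dd a b (of_real t) - f t) <= 2 * A * exp (- t / 2) * norm L" by simp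
   have "norm (f t - L) <= 4 * (A / p) * exp (- p * t) * norm L" by (rule r1[OF that])
   also have "... <= 4 * (A / p) * exp (- t / 2) * norm L"
   proof (intro mult_right_mono mult_left_mono)
    have "(1/2) * t <= p * t" by (rule mult_right_mono) (use p that t0 in auto)
    thus "exp (- p * t) <= exp (- t / 2)" by simp
   qed (use A0 p in auto)
   finally have 2: "norm (f t - L) <= 4 * (A / p) * exp (- t / 2) * norm L" .
   have "norm (g (of_real t) ** Dd a b (of_real t) - L) <= norm (g (of_real t) ** Dd a b (of_real t) - f t) + norm (f t - L)" by norm
   also have "... <= 2 * A * exp (- t / 2) * norm L + 4 * (A / p) * exp (- t / 2) * norm L" by (rule add_mono[OF 1 2])
   finally show ?thesis by (simp add: A'_def algebra_simps)
  qed
  have lim: "((\<lambda>t. g (complex_of_real t) ** Dd a b (of_real t)) \<longlongrightarrow> L) at_top"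
  proof -
   have z: "((\<lambda>t. A' * exp (- (1/2) * t) * norm L) \<longlongrightarrow> A' * 0 * norm L) at_top"
    by (intro tendsto_mult tendsto_const exp_decay_tendsto) simp
   have "((\<lambda>t. norm (g (complex_of_real t) ** Dd a b (of_real t) - L)) \<longlongrightarrow> 0) at_top"
   proof (rule tendsto_sandwich[OF _ _ tendsto_const])
    show "((\<lambda>t. A' * exp (- t / 2) * norm L) \<longlongrightarrow> 0) at_top" using z by simp
    show "\<forall>\<^sub>F t in at_top. norm (g (complex_of_real t) ** Dd a b (of_real t) - L) <= A' * exp (- t / 2) * norm L"
     using eventually_ge_at_top[of t0] by eventually_elim (rule r2)
   qed simp
   thus ?thesis by (simp add: tendsto_norm_zero_iff LIM_zero_iff)
  qed
  show ?thesis by (rule exI[of _ L]) (use lim g r1' r2 Lf[OF order_refl] in \<open>auto simp: lsol_def f_def\<close>)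
 qed
 thus ?thesis unfolding p_def using A'0 t0(1) by blast
qed

text \<open>The value at u = 0 that a solution must have in order to be asymptotic to
  \<open>Dd\<close> along the positive axis.\<close>

definition C0 :: "'n cmat => 'n cmat => 'n::finite cmat" where
 "C0 a b = Lim at_top (\<lambda>t. isol a b (complex_of_real t) ** Dd a b (of_real t))"

text \<open>The inverse of \<open>C0\<close>, obtained as the limit belonging to the transposed
  equation; multiplying the two limits shows that \<open>C0\<close> is invertible.\<close>

definition Ci :: "'n cmat => 'n cmat => 'n::finite cmat" where
 "Ci a b = transpose (C0 (- a) (- transpose b))"

definition Phi0 :: "'n cmat => 'n cmat => complex => 'n::finite cmat" where
 "Phi0 a b u = fsol a b u ** C0 a b"

definition Gi :: "'n cmat => 'n cmat => complex => 'n::finite cmat" where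
 "Gi a b u = Ci a b ** isol a b u"

lemma lsol_unique: "lsol a b g L ==> lsol a b g L' ==> L = L'"
 unfolding lsol_def by (rule tendsto_unique[OF trivial_limit_at_top_linorder,
    of "\<lambda>t. g (complex_of_real t) ** Dd a b (of_real t)"]) blast+

lemma lsol_isol:
 assumes a: "irr a" and b: "b \<in> tube"
 shows "lsol a b (isol a b) (C0 a b)"
proof -
 obtain L where L: "lsol a b (isol a b) L" using real_limit_estimate[OF a zero_less_one, of "norm b"] b has_mderiv_isol by blast
 hence "C0 a b = L" unfolding C0_def lsol_def by (intro tendsto_Lim) auto
 thus ?thesis using L by simp
qed

lemma lsol_mult_left: "lsol a b g L ==> lsol a b (\<lambda>u. M ** g u) (M ** L)"
proof -
 assume "lsol a b g L"
 hence 1: "!!u. has_mderiv g (- (g u ** lcoef a b u)) u"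
  and 2: "((\<lambda>t. g (complex_of_real t) ** Dd a b (of_real t)) \<longlongrightarrow> L) at_top" by (auto simp: lsol_def)
 have "has_mderiv (\<lambda>u. M ** g u) (- (M ** g u ** lcoef a b u)) u" for u using has_mderiv_mult[OF has_mderiv_const[of M u] 1[of u]]
  by (simp add: mm.zero_left mm.minus_right mm_assoc)
 moreover have "((\<lambda>t. M ** g (complex_of_real t) ** Dd a b (of_real t)) \<longlongrightarrow> M ** L) at_top"
  using mm.tendsto[OF tendsto_const 2, of M] by (simp add: mm_assoc)
 ultimately show ?thesis by (simp add: lsol_def)
qed

lemma Dd_transpose:
 "Dd (- a) (- transpose b) u = Di a b u" unfolding Dd_def Di_def
 by (rule arg_cong[of _ _ diag_exp]) (simp add: vec_eq_iff diag_part_nth transpose_def)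

lemma transpose_diag: "D \<in> diag_mats ==> transpose D = D"
proof (rule cmat_eqI)
 fix i j assume "D \<in> diag_mats"
 thus "transpose D $ i $ j = D $ i $ j" by (cases "i = j") (auto simp: transpose_def diag_mats_def)
qed

lemma transpose_uminus: "transpose (- A) = - transpose A"
 by (simp add: vec_eq_iff transpose_def)

lemma isol_transpose: "irr a ==> transpose (isol (- a) (- transpose b) u) = fsol a b u"
 by (simp add: isol_def irr_transpose transpose_transpose transpose_uminus)

lemma Ci_C0:
 assumes a: "irr a" and b: "b \<in> tube"
 shows "Ci a b ** C0 a b = mat 1" "C0 a b ** Ci a b = mat 1"
  and "((\<lambda>t. Di a b (complex_of_real t) ** fsol a b (of_real t)) \<longlongrightarrow> Ci a b) at_top"
proof -
 have 1: "((\<lambda>t. isol a b (complex_of_real t) ** Dd a b (of_real t)) \<longlongrightarrow> C0 a b) at_top"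
  using lsol_isol[OF a b] by (simp add: lsol_def)
 have 2: "((\<lambda>t. isol (- a) (- transpose b) (complex_of_real t) ** Dd (- a) (- transpose b) (of_real t))
   \<longlongrightarrow> C0 (- a) (- transpose b)) at_top"
  using lsol_isol[of "- a" "- transpose b"] a tube_transpose[OF b] by (simp add: lsol_def)
 have bt: "bounded_linear (transpose :: 'a cmat => _)"
 proof (rule bounded_linear_intro[where K=1])
  show "norm (transpose x) <= norm x * 1" for x :: "'a cmat" by simp
 qed (auto simp: vec_eq_iff transpose_def)
 have "((\<lambda>t. transpose (isol (- a) (- transpose b) (complex_of_real t) ** Dd (- a) (- transpose b) (of_real t)))
   \<longlongrightarrow> Ci a b) at_top" unfolding Ci_def by (rule bounded_linear.tendsto[OF bt 2])
 thus 3: "((\<lambda>t. Di a b (complex_of_real t) ** fsol a b (of_real t)) \<longlongrightarrow> Ci a b) at_top"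
  by (simp add: matrix_transpose_mul Dd_transpose transpose_diag isol_transpose[OF a])
 have "((\<lambda>t. (Di a b (complex_of_real t) ** fsol a b (of_real t)) ** (isol a b (complex_of_real t) ** Dd a b (of_real t)))
   \<longlongrightarrow> Ci a b ** C0 a b) at_top" by (rule mm.tendsto[OF 3 1])
 moreover have "(Di a b u ** fsol a b u) ** (isol a b u ** Dd a b u) = mat 1" for u by (simp flip: mm_assoc)
 ultimately show *: "Ci a b ** C0 a b = mat 1" using tendsto_unique[OF trivial_limit_at_top_linorder tendsto_const] by fastforce
 thus "C0 a b ** Ci a b = mat 1" using matrix_left_right_inverse by blast
qed

lemma Gi_Phi0:
 assumes "irr a" "b \<in> tube"
 shows "Gi a b u ** Phi0 a b u = mat 1" "Phi0 a b u ** Gi a b u = mat 1"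
proof -
 have "Gi a b u ** Phi0 a b u = Ci a b ** (isol a b u ** fsol a b u) ** C0 a b" by (simp only: Gi_def Phi0_def mm_assoc)
 thus "Gi a b u ** Phi0 a b u = mat 1" by (simp add: Ci_C0[OF assms])
 thus "Phi0 a b u ** Gi a b u = mat 1" using matrix_left_right_inverse by blast
qed

lemma lsol_Gi: "irr a ==> b \<in> tube ==> lsol a b (Gi a b) (mat 1)"
 using lsol_mult_left[OF lsol_isol, of a b "Ci a b"] Ci_C0(1)[of a b] unfolding Gi_def by simp

lemma has_mderiv_Phi0: "has_mderiv (Phi0 a b) (lcoef a b u ** Phi0 a b u) u"
 using has_mderiv_mult[OF has_mderiv_fsol[of a b u] has_mderiv_const[of "C0 a b" u]]
 unfolding Phi0_def by (simp add: mm.zero_right mm_assoc)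

lemma has_mderiv_Gi: "irr a ==> b \<in> tube ==> has_mderiv (Gi a b) (- (Gi a b u ** lcoef a b u)) u"
 using lsol_Gi by (auto simp: lsol_def)

lemma Gi_real_estimate:
 assumes a: "irr (a :: 'n::finite cmat)" and m: "0 < m"
 shows "\<exists>A t0. 0 <= A & 0 <= t0 & (\<forall>b\<in>tube. norm b <= K --> (\<forall>t\<ge>t0.
   norm (Gi a b (of_real t) ** asE m a b (of_real t) ** Dd a b (of_real t) - mat 1) <= A * exp (- (real m - 1/4) * t)))"
proof -
 obtain A t0 where A: "0 <= A" "0 <= t0" and est: "\<forall>b\<in>tube. norm b <= K --> (\<forall>g.
   (\<forall>u. has_mderiv g (- (g u ** lcoef a b u)) u) -->
   (\<exists>L. lsol a b g L & norm L <= 2 * norm (g (of_real t0) ** asE m a b (of_real t0) ** Dd a b (of_real t0)) &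
    (\<forall>t\<ge>t0. norm (g (of_real t) ** asE m a b (of_real t) ** Dd a b (of_real t) - L)
      <= A * exp (- (real m - 1/4) * t) * norm L &
      norm (g (of_real t) ** Dd a b (of_real t) - L) <= A * exp (- t / 2) * norm L)))"
  using real_limit_estimate[OF a m, of K] by (elim exE conjE) (rule that)
 have "norm (Gi a b (of_real t) ** asE m a b (of_real t) ** Dd a b (of_real t) - mat 1)
   <= (A * norm (mat 1 :: 'n cmat)) * exp (- (real m - 1/4) * t)" if b: "b \<in> tube" "norm b <= K" and t: "t0 <= t" for b t
 proof -
  obtain L where L: "lsol a b (Gi a b) L" "\<forall>t\<ge>t0. norm (Gi a b (of_real t) ** asE m a b (of_real t) ** Dd a b (of_real t) - L)
      <= A * exp (- (real m - 1/4) * t) * norm L &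
      norm (Gi a b (of_real t) ** Dd a b (of_real t) - L) <= A * exp (- t / 2) * norm L"
   using est[rule_format, OF b, of "Gi a b"] has_mderiv_Gi[OF a b(1)] by blast
  have "L = mat 1" by (rule lsol_unique[OF L(1) lsol_Gi[OF a b(1)]])
  thus ?thesis using L(2)[rule_format, OF t] by (simp add: mult_ac)
 qed
 thus ?thesis using A by (intro exI[of _ "A * norm (mat 1 :: 'n cmat)"] exI[of _ t0]) auto
qed

lemma exp_neg_of_nat_mult: "cmod (exp (- of_nat m * u)) = (1 / exp (Re u)) ^ m"
proof -
 have "cmod (exp (- of_nat m * u)) = exp (real m * (- Re u))" by (simp add: norm_exp_eq_Re)
 also have "... = exp (- Re u) ^ m" by (rule exp_of_nat_mult)
 finally show ?thesis by (simp add: exp_minus inverse_eq_divide)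
qed

text \<open>In the plane of x = e^u the path from T to T + i y has the fixed length of y, while the
  derivative of g E D with respect to x is of order T^(-2). So the limit 1 on the real axis is also
  the limit on every horizontal line.\<close>

lemma vertical_limit:
 assumes a: "irr (a :: 'n::finite cmat)" and b: "b \<in> tube" and m: "2 <= m"
 shows "\<exists>A T0. 0 < T0 & 0 <= A & (\<forall>T\<ge>T0.
   norm (Gi a b (Ln (Complex T y)) ** asE m a b (Ln (Complex T y)) ** Dd a b (Ln (Complex T y)) - mat 1) <= A / T)"
proof -
 define j where "j u = Gi a b u ** asE m a b u ** Dd a b u" for u
 define R where "R u = cscale (exp (- of_nat m * u)) (Gi a b u ** comm a (fF a b (Suc m)) ** Dd a b u)" for u
 have m0: "0 < m" using m by simp
 obtain A1 t1 where A1: "0 <= A1" "0 <= t1" and est1: "!!t. t1 <= t ==>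
   norm (j (of_real t) - mat 1) <= A1 * exp (- (real m - 1/4) * t)"
  using Gi_real_estimate[OF a m0, of "norm b"] b unfolding j_def by blast
 obtain A2 t2 where A2: "0 <= A2" "0 <= t2" and est2: "!!u. t2 <= Re u ==> \<bar>Im u\<bar> <= pi ==> \<bar>Im (exp u)\<bar> <= \<bar>y\<bar> ==>
   norm (R u) <= A2 * exp (- (real m - 1/4) * Re u) * norm (j u)"
  using gED_estimate[OF a abs_ge_zero[of y], of "norm b" m] b unfolding j_def R_def by blast
 define N where "N = norm (mat 1 :: 'n cmat)"
 define T0 where "T0 = Max {1, exp t1, exp t2, 2 * A2 * \<bar>y\<bar>}"
 have "norm (j (Ln (Complex T y)) - mat 1) <= (2 * A2 * \<bar>y\<bar> * (N + A1) + A1) / T" if "T0 <= T" for T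
 proof -
  have T: "1 <= T" "exp t1 <= T" "exp t2 <= T" "2 * A2 * \<bar>y\<bar> <= T" using that by (simp_all add: T0_def)
  have lT: "t1 <= ln T" "t2 <= ln T" "0 <= ln T" using T by (auto simp: ln_ge_iff)
  define x where "x s = of_real T + \<i> * of_real (sgn y * s)" for s
  have Re_x [simp]: "Re (x s) = T" and Im_x [simp]: "Im (x s) = sgn y * s" for s by (simp_all add: x_def)
  have x0: "x s ~= 0" "x s \<notin> \<real>\<^sub>\<le>\<^sub>0" for s
   using T(1) by (auto simp: complex_eq_iff complex_nonpos_Reals_iff)
  have xT: "T <= cmod (x s)" for s using complex_Re_le_cmod[of "x s"] by simp
  have ReLn: "Re (Ln (x s)) = ln (cmod (x s))" for s using x0 by simp
  have ReT: "ln T <= Re (Ln (x s))" for s unfolding ReLn using xT[of s] T(1) by (subst ln_le_cancel_iff) auto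
  have dec: "exp (- (real m - 1/4) * r) <= 1 / T" if "ln T <= r" for r
  proof -
   \<comment> \<open>This is where the order m has to be at least 2.\<close>
   have "1 * ln T <= (real m - 1/4) * r" by (rule mult_mono) (use m that lT in auto)
   hence "- (real m - 1/4) * r <= - ln T" unfolding mult_minus_left by linarith
   hence "exp (- (real m - 1/4) * r) <= exp (- ln T)" unfolding exp_le_cancel_iff .
   also have "exp (- ln T) = 1 / T" using T(1) by (simp add: exp_minus inverse_eq_divide)
   finally show ?thesis .
  qed
  define f where "f s = j (Ln (x s))" for s
  define f' where "f' s = cscale (\<i> * of_real (sgn y) / x s) (R (Ln (x s)))" for s
  have fd: "(f has_vector_derivative f' s) (at s)" for s
  proof -
   have "((\<lambda>s. Ln (x s)) has_vector_derivative (\<i> * of_real (sgn y)) * inverse (x s)) (at s)"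
   proof -
    have 1: "(x has_vector_derivative \<i> * of_real (sgn y)) (at s)"
     unfolding x_def by (auto intro!: derivative_eq_intros simp: has_vector_derivative_def scaleR_conv_of_real)
    have 2: "(Ln has_field_derivative inverse (x s)) (at (x s))" by (rule has_field_derivative_Ln[OF x0(2)])
    show ?thesis using field_vector_diff_chain_at[OF 1 2] by (simp add: o_def)
   qed
   from has_mderiv_vector[OF has_mderiv_gED[OF irrD(1)[OF a] irrD(3)[OF a] has_mderiv_Gi[OF a b]] this]
   show ?thesis unfolding f_def f'_def j_def R_def by (simp add: divide_inverse del: fF.simps)
  qed
  have fb: "norm (f' s) <= A2 / T^2 * norm (f s)" if s: "0 <= s" "s <= \<bar>y\<bar>" for s
  proof -
   have "norm (R (Ln (x s))) <= A2 * exp (- (real m - 1/4) * Re (Ln (x s))) * norm (f s)" unfolding f_def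
   proof (rule est2)
    show "t2 <= Re (Ln (x s))" using ReT[of s] lT by linarith
    show "\<bar>Im (Ln (x s))\<bar> <= pi" using mpi_less_Im_Ln[OF x0(1), of s] Im_Ln_le_pi[OF x0(1), of s] by linarith
    show "\<bar>Im (exp (Ln (x s)))\<bar> <= \<bar>y\<bar>" using s x0 by (auto simp: sgn_if)
   qed
   also have "... <= A2 * (1 / T) * norm (f s)" by (intro mult_right_mono mult_left_mono dec ReT) (use A2 in auto)
   finally have 1: "norm (R (Ln (x s))) <= A2 * (1 / T) * norm (f s)" .
   have 2: "cmod (\<i> * of_real (sgn y) / x s) <= 1 / T"
   proof -
    have "cmod (\<i> * of_real (sgn y) / x s) <= 1 / cmod (x s)" by (simp add: norm_divide norm_mult divide_right_mono sgn_if)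
    also have "... <= 1 / T" using xT T(1) by (intro divide_left_mono) (auto intro!: mult_pos_pos simp: x0)
    finally show ?thesis .
   qed
   have "norm (f' s) <= (1 / T) * (A2 * (1 / T) * norm (f s))"
    unfolding f'_def norm_cscale by (rule mult_mono[OF 2 1]) (use T in auto)
   thus ?thesis by (simp add: power2_eq_square)
  qed
  have "norm (f \<bar>y\<bar> - f 0) <= 2 * (A2 / T^2 * \<bar>y\<bar> - A2 / T^2 * 0) * norm (f 0)"
  proof (rule gronwall_half[where f'=f' and \<kappa>="\<lambda>_. A2 / T^2" and e="\<bar>y\<bar>"])
   fix s
   show "((\<lambda>s. A2 / T^2 * s) has_vector_derivative A2 / T^2) (at s)"
    unfolding has_real_derivative_iff_has_vector_derivative[symmetric] by (auto intro!: derivative_eq_intros)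
  next
   have "2 * (A2 * \<bar>y\<bar>) <= T * 1" using T(4) by simp
   also have "... <= T * T" using T(1) by (intro mult_left_mono) auto
   finally show "A2 / T^2 * \<bar>y\<bar> - A2 / T^2 * 0 <= 1 / 2" using T(1) by (simp add: divide_simps power2_eq_square)
  qed (use fd fb A2 in auto)
  also have "... <= 2 * (A2 * \<bar>y\<bar> / T) * (N + A1)"
  proof (rule mult_mono)
   have "A2 * \<bar>y\<bar> * 1 <= A2 * \<bar>y\<bar> * T" using A2 T(1) by (intro mult_left_mono) auto
   thus "2 * (A2 / T^2 * \<bar>y\<bar> - A2 / T^2 * 0) <= 2 * (A2 * \<bar>y\<bar> / T)"
    using T(1) by (simp add: divide_simps power2_eq_square)
   have "norm (f 0 - mat 1) <= A1 * (1 / T)" using order_trans[OF est1[OF lT(1)] mult_left_mono[OF dec[OF order_refl] A1(1)]] T(1)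
    by (simp add: f_def x_def Ln_of_real)
   also have "... <= A1" using mult_left_mono[of "1 / T" 1 A1] A1 T(1) by simp
   finally show "norm (f 0) <= N + A1" unfolding N_def by norm
  qed (use A2 T in auto)
  finally have 1: "norm (f \<bar>y\<bar> - f 0) <= 2 * (A2 * \<bar>y\<bar> / T) * (N + A1)" .
  have 2: "norm (f 0 - mat 1) <= A1 * (1 / T)" using order_trans[OF est1[OF lT(1)] mult_left_mono[OF dec[OF order_refl] A1(1)]] T(1)
   by (simp add: f_def x_def Ln_of_real)
  have "x \<bar>y\<bar> = Complex T y" by (simp add: complex_eq_iff sgn_if)
  hence "norm (j (Ln (Complex T y)) - mat 1) <= norm (f \<bar>y\<bar> - f 0) + norm (f 0 - mat 1)"
   using norm_triangle_ineq[of "f \<bar>y\<bar> - f 0" "f 0 - mat 1"] by (simp add: f_def)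
  also have "... <= 2 * (A2 * \<bar>y\<bar> / T) * (N + A1) + A1 * (1 / T)" by (rule add_mono[OF 1 2])
  also have "... = (2 * A2 * \<bar>y\<bar> * (N + A1) + A1) / T" by (simp add: add_divide_distrib)
  finally show ?thesis .
 qed
 moreover have "0 < T0" unfolding T0_def by (rule less_le_trans[OF zero_less_one]) simp
 moreover have "0 <= 2 * A2 * \<bar>y\<bar> * (N + A1) + A1" using A1 A2 by (simp add: N_def)
 ultimately show ?thesis unfolding j_def by blast
qed

subsection \<open>Asymptotics in sectors\<close>

text \<open>The constant is sin(\<epsilon>/2). The worst case is an angle pi - \<epsilon> with both
  lengths equal, as the decomposition into the squares of their sum and difference shows.\<close>

lemma sector_separation:
 assumes "0 < \<epsilon>" "\<epsilon> <= pi"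
 obtains c where "0 < c" "c <= 1"
  "!!u t. \<bar>Im u\<bar> <= pi - \<epsilon> ==> 0 <= t ==> c * (exp (Re u) + t) <= cmod (exp u + of_real t)"
  "!!u t. \<bar>Im u\<bar> <= pi - \<epsilon> ==> 0 <= t ==> exp u + of_real t \<notin> \<real>\<^sub>\<le>\<^sub>0"
proof -
 define k where "k = cos \<epsilon>"
 have k1: "k < 1" unfolding k_def using cos_monotone_0_pi[of 0 \<epsilon>] assms by simp
 have k2: "-1 <= k" by (simp add: k_def)
 define c where "c = sqrt ((1 - k) / 2)"
 have c0: "0 < c" using k1 by (simp add: c_def)
 have c1: "c <= 1" using k2 by (simp add: c_def real_le_lsqrt)
 have est: "c * (exp (Re u) + t) <= cmod (exp u + of_real t)" if u: "\<bar>Im u\<bar> <= pi - \<epsilon>" and t: "0 <= t" for u t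
 proof -
  let ?r = "exp (Re u)"
  have "cos (pi - \<epsilon>) <= cos \<bar>Im u\<bar>" using u assms by (intro cos_monotone_0_pi_le) auto
  hence ck: "- k <= cos (Im u)" by (simp add: k_def)
  have "(cmod (exp u + of_real t))^2 = (?r * cos (Im u) + t)^2 + (?r * sin (Im u))^2"
   by (simp add: cmod_power2 Re_exp Im_exp)
  also have "... = ?r^2 * ((cos (Im u))^2 + (sin (Im u))^2) + 2 * ?r * t * cos (Im u) + t^2" by algebra
  also have "... = ?r^2 + 2 * ?r * t * cos (Im u) + t^2" by simp
  finally have e: "(cmod (exp u + of_real t))^2 = ?r^2 + 2 * ?r * t * cos (Im u) + t^2" .
  have "2 * ?r * t * (- k) <= 2 * ?r * t * cos (Im u)" by (rule mult_left_mono[OF ck]) (use t in simp)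
  moreover have "?r^2 + 2 * ?r * t * (- k) + t^2 = (1 - k) / 2 * (?r + t)^2 + (1 + k) / 2 * (?r - t)^2"
   by (simp add: power2_eq_square field_simps)
  moreover have "0 <= (1 + k) / 2 * (?r - t)^2" using k2 by simp
  ultimately have "(1 - k) / 2 * (?r + t)^2 <= (cmod (exp u + of_real t))^2" using e by linarith
  moreover have "(c * (?r + t))^2 = (1 - k) / 2 * (?r + t)^2" using k1 by (simp add: c_def power_mult_distrib)
  ultimately have "(c * (?r + t))^2 <= (cmod (exp u + of_real t))^2" by linarith
  thus ?thesis by (rule power2_le_imp_le) simp
 qed
 have neg: "exp u + of_real t \<notin> \<real>\<^sub>\<le>\<^sub>0" if u: "\<bar>Im u\<bar> <= pi - \<epsilon>" and t: "0 <= t" for u t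
 proof
  assume "exp u + of_real t \<in> \<real>\<^sub>\<le>\<^sub>0"
  hence *: "Im (exp u) = 0" "Re (exp u) + t <= 0" by (auto simp: complex_nonpos_Reals_iff)
  hence "sin (Im u) = 0" by (simp add: Im_exp)
  moreover have "\<bar>Im u\<bar> < pi" using u assms by simp
  ultimately have "Im u = 0" using sin_gt_zero[of "Im u"] sin_gt_zero[of "- Im u"]
   by (cases "Im u = 0") (auto simp: abs_if split: if_splits)
  hence "Re (exp u) = exp (Re u)" by (simp add: Re_exp)
  thus False using *(2) t by (simp add: add_pos_nonneg not_le[symmetric]) (smt (verit) exp_gt_zero)
 qed
 show ?thesis using that[OF c0 c1 est neg] by blast
qed

text \<open>The estimate at u is brought in from infinity along the horizontal line x = e^u + t, t
  \<ge> 0, which stays away from the cut. On it the weights exp(x (a_k - a_l)) have constant modulus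
  because a is imaginary, so conjugation by \<open>Dd\<close> costs only a power of x, and
  integrating the truncation error along the line gives the full order e^(-m Re u).\<close>

lemma sector_J:
 assumes a: "irr (a :: 'n::finite cmat)" and m: "2 <= m" and \<epsilon>: "0 < \<epsilon>" "\<epsilon> <= pi" and K: "0 <= K"
 shows "\<exists>C R. 0 <= C & 0 <= R & (\<forall>b\<in>tube. norm b <= K --> (\<forall>u. \<bar>Im u\<bar> <= pi - \<epsilon> --> R <= Re u -->
   norm (Dd a b u ** Gi a b u ** asE m a b u - mat 1) <= C * exp (- real m * Re u)))"
proof -
 obtain c where c: "0 < c" "c <= 1"
  "!!u t. \<bar>Im u\<bar> <= pi - \<epsilon> ==> 0 <= t ==> c * (exp (Re u) + t) <= cmod (exp u + of_real t)"
  "!!u t. \<bar>Im u\<bar> <= pi - \<epsilon> ==> 0 <= t ==> exp u + of_real t \<notin> \<real>\<^sub>\<le>\<^sub>0"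
  by (rule sector_separation[OF \<epsilon>]) (rule that)
 obtain q where q: "m = Suc (Suc q)" using m by (metis Suc_le_D numeral_2_eq_2 Suc_le_mono)
 obtain C1 where C1: "0 <= C1" "!!b :: 'n cmat. !!u. norm b <= K ==> 0 <= Re u ==> norm (asE m a b u - mat 1) <= C1 * exp (- Re u)"
  using asE_bound[of K m a] by blast
 obtain C2 where C2: "!!b :: 'n cmat. norm b <= K ==> norm (fF a b (Suc m)) <= C2"
  using fF_bound[of K a "Suc m"] by blast
 define C3 where "C3 = 2 * norm a * \<bar>C2\<bar>"
 have C30: "0 <= C3" by (simp add: C3_def)
 have cm: "norm (comm a (fF a b (Suc m))) <= C3" if "norm b <= K" for b :: "'n cmat"
 proof -
  have "norm (comm a (fF a b (Suc m))) <= norm a * norm (fF a b (Suc m)) + norm (fF a b (Suc m)) * norm a"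
   unfolding comm_def by (intro order_trans[OF norm_triangle_ineq4] add_mono norm_matrix_mult_le)
  also have "... <= 2 * norm a * \<bar>C2\<bar>"
   using mult_left_mono[OF order_trans[OF C2[OF that] abs_ge_self], of "2 * norm a"] by (simp add: algebra_simps)
  finally show ?thesis by (simp add: C3_def)
 qed
 define n2 where "n2 = real (CARD('n))^2"
 define N where "N = norm (mat 1 :: 'n cmat)"
 have N0: "0 <= N" "0 <= n2" by (simp_all add: N_def n2_def)
 define W where "W = exp (4 * pi * K) / c"
 have W0: "0 <= W" using c by (simp add: W_def)
 define B where "B = W * (2 * C3) * (1 / c) ^ Suc m"
 have B0: "0 <= B" using W0 C30 c by (simp add: B_def)
 \<comment> \<open>Chosen so that c e^(Re u) dominates 2 C1, which makes E - 1 at most 1/2, and 2 n2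
   B, which makes the integral inequality for J a contraction by 1/2.\<close>
 define R where "R = ln (1 + 2 * C1 + 2 * n2 * B) - ln c"
 define C where "C = n2 * (B * (2 * (N + 1)))"
 have C0: "0 <= C" using B0 N0 by (simp add: C_def)
 have lnc: "ln c <= 0" using c by simp
 have R0: "0 <= R" unfolding R_def using lnc C1(1) B0 N0 by (smt (verit) ln_ge_zero mult_nonneg_nonneg)
 have "norm (Dd a b u0 ** Gi a b u0 ** asE m a b u0 - mat 1) <= C * exp (- real m * Re u0)"
  if b: "b \<in> tube" "norm b <= K" and u0: "\<bar>Im u0\<bar> <= pi - \<epsilon>" "R <= Re u0" for b u0
 proof -
  define r where "r = exp (Re u0)"
  have r0: "0 < r" by (simp add: r_def)
  have rR: "(1 + 2 * C1 + 2 * n2 * B) <= c * r"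
  proof -
   have pos: "0 < 1 + 2 * C1 + 2 * n2 * B" using C1(1) B0 N0 by (simp add: add_pos_nonneg)
   have "ln (1 + 2 * C1 + 2 * n2 * B) <= ln (c * r)" using u0(2) c r0 by (simp add: R_def ln_mult r_def)
   thus ?thesis using pos c r0 by simp
  qed
  have cr1: "1 <= c * r" "2 * C1 <= c * r" "2 * n2 * B <= c * r" using rR C1(1) mult_nonneg_nonneg[OF N0(2) B0] by linarith+
  have r1: "1 <= r" using cr1(1) c r0 by (smt (verit) mult_left_le_one_le)
  define x where "x t = exp u0 + of_real t" for t
  define U where "U t = Ln (x t)" for t
  have xc: "c * (r + t) <= cmod (x t)" and xn: "x t \<notin> \<real>\<^sub>\<le>\<^sub>0" if "0 <= t" for t
   using c(3,4)[OF u0(1) that] by (simp_all add: x_def r_def)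
  have xle: "cmod (x t) <= r + t" if "0 <= t" for t
   using norm_triangle_ineq[of "exp u0" "of_real t"] that by (simp add: x_def r_def norm_exp_eq_Re)
  have x0: "x t ~= 0" if "0 <= t" for t using xn[OF that] by auto
  have xcr: "c * r <= cmod (x t)" if "0 <= t" for t
   using order_trans[OF _ xc[OF that], of "c * r"] c that by (simp add: distrib_left)
  have expU: "exp (U t) = x t" if "0 <= t" for t using x0[OF that] by (simp add: U_def)
  have ReU: "Re (U t) = ln (cmod (x t))" if "0 <= t" for t using x0[OF that] by (simp add: U_def)
  have eReU: "exp (Re (U t)) = cmod (x t)" if "0 <= t" for t using x0[OF that] by (simp add: ReU[OF that])
  have ReU0: "0 <= Re (U t)" if "0 <= t" for t using xcr[OF that] cr1 by (simp add: ReU[OF that])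
  have ImU: "\<bar>Im (U t)\<bar> <= pi" if "0 <= t" for t
   using mpi_less_Im_Ln[OF x0[OF that]] Im_Ln_le_pi[OF x0[OF that]] unfolding U_def by linarith
  have U0: "U 0 = u0" using u0(1) \<epsilon> by (simp add: U_def x_def Ln_exp abs_le_iff)
  define j where "j t = Gi a b (U t) ** asE m a b (U t) ** Dd a b (U t)" for t
  define G where "G t = Dd a b (U t) ** Gi a b (U t)" for t
  \<comment> \<open>The far value j T, conjugated with the weights of the near point s. The
    difference J s - \<open>?c s T\<close> is an integral of the derivative of j with all weights
    taken at s.\<close>
  let ?c = "\<lambda>s T. Dd a b (U s) ** j T ** Di a b (U s)"
  define J where "J t = G t ** asE m a b (U t)" for t
  have Jj: "J t = Dd a b (U t) ** j t ** Di a b (U t)" for t by (simp add: J_def j_def G_def flip: mm_assoc)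
  have GJ: "norm (G t) <= 2 * norm (J t)" if t: "0 <= t" for t
  proof -
   have "C1 * exp (- Re (U t)) = C1 / cmod (x t)" by (simp add: exp_minus eReU[OF t] divide_inverse)
   also have "... <= 1/2" using cr1(2) xcr[OF t] x0[OF t] by (simp add: divide_simps)
   finally have "norm (asE m a b (U t) - mat 1) <= 1/2" using C1(2)[OF b(2) ReU0[OF t]] by linarith
   hence "norm (G t ** (asE m a b (U t) - mat 1)) <= norm (G t) * (1/2)"
    by (rule order_trans[OF norm_matrix_mult_le mult_left_mono]) simp
   moreover have "J t = G t + G t ** (asE m a b (U t) - mat 1)" by (simp add: J_def mm.diff_right)
   ultimately show ?thesis using norm_triangle_ineq4[of "J t" "G t ** (asE m a b (U t) - mat 1)"] by simp
  qed
  have Ud: "(U has_vector_derivative 1 / x t) (at t)" if t: "0 <= t" for t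
  proof -
   have 1: "(x has_vector_derivative 1) (at t)"
    unfolding x_def by (auto intro!: derivative_eq_intros simp: has_vector_derivative_def scaleR_conv_of_real)
   have 2: "(Ln has_field_derivative inverse (x t)) (at (x t))" by (rule has_field_derivative_Ln[OF xn[OF t]])
   show ?thesis using field_vector_diff_chain_at[OF 1 2] unfolding U_def by (simp add: o_def divide_inverse)
  qed
  define X where "X t = cscale (1 / x t) (cscale (exp (- of_nat m * U t)) (G t ** comm a (fF a b (Suc m))))" for t
  have jd: "(j has_vector_derivative (Di a b (U t) ** X t ** Dd a b (U t))) (at t)" if t: "0 <= t" for t
  proof -
   have "Di a b (U t) ** X t ** Dd a b (U t)
    = cscale (1 / x t) (cscale (exp (- of_nat m * U t)) (Gi a b (U t) ** comm a (fF a b (Suc m)) ** Dd a b (U t)))"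
    by (simp add: X_def G_def del: fF.simps flip: mm_assoc)
   thus ?thesis using has_mderiv_vector[OF has_mderiv_gED[OF irrD(1)[OF a] irrD(3)[OF a] has_mderiv_Gi[OF a b(1)]] Ud[OF t]]
    unfolding j_def by simp
  qed
  have Xb: "norm (X t) <= (2 * norm (J t)) * C3 * (1 / c) ^ Suc m * (1 / (r + t)) ^ Suc m" if t: "0 <= t" for t
  proof -
   have rt: "0 < r + t" using r0 t by simp
   have ix: "1 / cmod (x t) <= (1 / c) * (1 / (r + t))" using xc[OF t] c rt x0[OF t] by (simp add: divide_simps mult.commute)
   have "norm (X t) = (1 / cmod (x t)) ^ Suc m * norm (G t ** comm a (fF a b (Suc m)))"
   proof -
    have "cmod (exp (- of_nat m * U t)) = (1 / cmod (x t)) ^ m" by (simp only: exp_neg_of_nat_mult eReU[OF t])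
    thus ?thesis by (simp only: X_def norm_cscale norm_divide norm_one power_Suc mult_ac)
   qed
   also have "... <= ((1 / c) * (1 / (r + t))) ^ Suc m * ((2 * norm (J t)) * C3)"
    by (intro mult_mono power_mono ix order_trans[OF norm_matrix_mult_le mult_mono] GJ t cm b) (use rt c in auto)
   also have "... = (2 * norm (J t)) * C3 * (1 / c) ^ Suc m * (1 / (r + t)) ^ Suc m" by (simp only: power_mult_distrib mult_ac)
   finally show ?thesis .
  qed
  define w where "w t k l = exp (U t * (b $ k $ k - b $ l $ l) + x t * (a $ k $ k - a $ l $ l))" for t k l
  let ?e = "\<lambda>k l t. exp (U t * (b $ l $ l - b $ k $ k) + x t * (a $ l $ l - a $ k $ k))"
  \<comment> \<open>Changing the weights from t to s: the part from a has modulus 1 because x s - x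
    t is real, and the part from b costs at most one power of the ratio of the distances.\<close>
  have wrat: "cmod (w s k l * ?e k l t) <= W * ((r + t) / (r + s))" if s: "0 <= s" "s <= t" for s t k l
  proof -
   have t: "0 <= t" using s by simp
   have be: "\<bar>Im (b $ i $ i)\<bar> <= K" for i using order_trans[OF abs_Im_le_cmod order_trans[OF cmod_entry_le b(2)]] .
   have rb: "\<bar>Re (b $ i $ i)\<bar> < 1/8" for i using b(1) by (simp add: tube_def)
   define \<beta> where "\<beta> = b $ k $ k - b $ l $ l"
   define \<alpha> where "\<alpha> = a $ k $ k - a $ l $ l"
   have I\<beta>: "\<bar>Im \<beta>\<bar> <= 2 * K" using be[of k] be[of l] unfolding \<beta>_def minus_complex.sel by linarith
   have R\<beta>: "\<bar>Re \<beta>\<bar> <= 1" using rb[of k] rb[of l] unfolding \<beta>_def minus_complex.sel by linarith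
   have R\<alpha>: "Re \<alpha> = 0" using irrD(2)[OF a] by (simp add: \<alpha>_def)
   have "w s k l * ?e k l t = exp ((U s - U t) * \<beta> + (x s - x t) * \<alpha>)"
    unfolding w_def \<alpha>_def \<beta>_def by (simp flip: exp_add add: algebra_simps)
   moreover have "Re ((U s - U t) * \<beta> + (x s - x t) * \<alpha>)
    = (Re (U s) - Re (U t)) * Re \<beta> - (Im (U s) - Im (U t)) * Im \<beta>" by (simp add: R\<alpha> x_def)
   moreover have "... <= \<bar>Re (U s) - Re (U t)\<bar> + 4 * pi * K"
   proof -
    have "(Re (U s) - Re (U t)) * Re \<beta> <= \<bar>Re (U s) - Re (U t)\<bar> * \<bar>Re \<beta>\<bar>" by (metis abs_ge_self abs_mult)
    also have "... <= \<bar>Re (U s) - Re (U t)\<bar>" using R\<beta> by (simp add: mult_left_le)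
    finally have 1: "(Re (U s) - Re (U t)) * Re \<beta> <= \<bar>Re (U s) - Re (U t)\<bar>" .
    have "\<bar>(Im (U s) - Im (U t)) * Im \<beta>\<bar> <= (2 * pi) * (2 * K)"
     unfolding abs_mult by (rule mult_mono[OF _ I\<beta>]) (use ImU[OF s(1)] ImU[OF t] in \<open>auto simp: abs_le_iff\<close>)
    thus ?thesis using 1 by (simp add: abs_le_iff)
   qed
   ultimately have "cmod (w s k l * ?e k l t) <= exp (\<bar>Re (U s) - Re (U t)\<bar>) * exp (4 * pi * K)"
    by (simp add: norm_exp_eq_Re flip: exp_add)
   also have "exp (\<bar>Re (U s) - Re (U t)\<bar>) <= (1 / c) * ((r + t) / (r + s))"
   proof -
    have rs: "0 < r + s" "0 < r + t" using r0 s by auto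
    have "exp (Re (U s) - Re (U t)) = cmod (x s) / cmod (x t)" by (simp add: exp_diff eReU s t)
    also have "... <= (r + s) / (c * (r + t))" by (rule frac_le) (use xle[OF s(1)] xc[OF t] c rs in auto)
    also have "... = (1 / c) * ((r + s) / (r + t))" by simp
    also have "... <= (1 / c) * ((r + t) / (r + s))" using rs s c by (intro mult_left_mono frac_le) auto
    finally have 1: "exp (Re (U s) - Re (U t)) <= (1 / c) * ((r + t) / (r + s))" .
    have "exp (Re (U t) - Re (U s)) = cmod (x t) / cmod (x s)" by (simp add: exp_diff eReU s t)
    also have "... <= (r + t) / (c * (r + s))" by (rule frac_le) (use xle[OF t] xc[OF s(1)] c rs in auto)
    also have "... = (1 / c) * ((r + t) / (r + s))" by simp
    finally have 2: "exp (Re (U t) - Re (U s)) <= (1 / c) * ((r + t) / (r + s))" .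
    show ?thesis using 1 2 by (auto simp: abs_if)
   qed
   finally show ?thesis by (simp add: W_def mult.commute)
  qed
  have main: "norm (J s - ?c s T) <= n2 * (B * S * (1 / (r + s)) ^ m)"
   if s: "0 <= s" "s <= T" and S: "!!t. s <= t ==> t <= T ==> norm (J t) <= S" for s T S
  proof -
   have S0: "0 <= S" using S[of s] s by (meson norm_ge_zero order_refl order_trans)
   have rs: "0 < r + s" using r0 s by simp
   let ?f = "\<lambda>k l t. w s k l * (Di a b (U t) ** X t ** Dd a b (U t)) $ k $ l"
   \<comment> \<open>A primitive of B S (r + t)^(-m) / (r + s), where m = q + 2. Of the m + 1 powers
     in X one is lost to the weights; integration and the factor 1 / (r + s) together still leave (r
     + s)^(-m), and m \<ge> 2 makes the contribution at infinity harmless.\<close>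
   define \<phi> where "\<phi> t = - (B * S / (r + s)) / real (Suc q) * (1 / (r + t)) ^ Suc q" for t
   have ent: "cmod ((J s - ?c s T) $ k $ l) <= B * S * (1 / (r + s)) ^ m" for k l
   proof (cases "s = T")
    case True
    thus ?thesis using Jj[of s] B0 S0 rs by simp
   next
    case False
    define f where "f t = w s k l * j t $ k $ l" for t
    have eq: "(J s - ?c s T) $ k $ l = f s - f T" unfolding Jj[of s] vector_minus_component conj_entry f_def w_def expU[OF s(1)]
     by (simp add: algebra_simps)
    have "norm (f T - f s) <= \<phi> T - \<phi> s"
    proof (rule differentiable_bound_general[where f'="\<lambda>t. ?f k l t"
       and \<phi>'="\<lambda>t. B * S / (r + s) * (1 / (r + t)) ^ Suc (Suc q)"])
     show "s < T" using s False by simp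
     have fd: "(f has_vector_derivative ?f k l t) (at t)" if "0 <= t" for t unfolding f_def
      by (intro has_vector_derivative_mult_right bounded_linear.has_vector_derivative[OF bounded_linear_entry jd] that)
     have pd: "(\<phi> has_vector_derivative B * S / (r + s) * (1 / (r + t)) ^ Suc (Suc q)) (at t)" if t: "0 <= t" for t
     proof -
      have rt: "r + t ~= 0" using r0 t by simp
      have d1: "((\<lambda>t. 1 / (r + t)) has_real_derivative - ((1 / (r + t)) * (1 / (r + t)))) (at t)"
       using rt by (auto intro!: derivative_eq_intros simp: power2_eq_square divide_simps)
      have "((\<lambda>t. (1 / (r + t)) ^ Suc q) has_real_derivative
        real (Suc q) * ((1 / (r + t)) ^ q * - ((1 / (r + t)) * (1 / (r + t))))) (at t)"
       by (rule DERIV_cong[OF DERIV_power[OF d1, of "Suc q"]]) (simp only: diff_Suc_Suc diff_zero of_nat_Suc mult_ac One_nat_def)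
      hence "(\<phi> has_real_derivative - (B * S / (r + s)) / real (Suc q) *
        (real (Suc q) * ((1 / (r + t)) ^ q * - ((1 / (r + t)) * (1 / (r + t)))))) (at t)" unfolding \<phi>_def by (rule DERIV_cmult)
      moreover have "- (B * S / (r + s)) / real (Suc q) * (real (Suc q) * ((1 / (r + t)) ^ q * - ((1 / (r + t)) * (1 / (r + t)))))
        = B * S / (r + s) * (1 / (r + t)) ^ Suc (Suc q)" by (simp del: of_nat_Suc)
      ultimately show ?thesis by (simp only: has_real_derivative_iff_has_vector_derivative)
     qed
     show "continuous_on {s..T} f" "continuous_on {s..T} \<phi>"
      by (intro continuous_at_imp_continuous_on ballI has_vector_derivative_continuous[OF fd]
        has_vector_derivative_continuous[OF pd]; use s in simp)+
     fix t assume t: "s < t" "t < T"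
     have t0: "0 <= t" using t s by simp
     have rt: "0 < r + t" using r0 t0 by simp
     show "(f has_vector_derivative ?f k l t) (at t)" by (rule fd[OF t0])
     show "(\<phi> has_vector_derivative B * S / (r + s) * (1 / (r + t)) ^ Suc (Suc q)) (at t)" by (rule pd[OF t0])
     have "?f k l t = X t $ k $ l * (w s k l * ?e k l t)" unfolding conj_entry expU[OF t0] by (simp add: mult_ac)
     also have "cmod ... <= ((2 * S) * C3 * (1 / c) ^ Suc m * (1 / (r + t)) ^ Suc m) * (W * ((r + t) / (r + s)))"
      unfolding norm_mult[of "X t $ k $ l"]
     proof (rule mult_mono)
      have "cmod (X t $ k $ l) <= (2 * norm (J t)) * C3 * (1 / c) ^ Suc m * (1 / (r + t)) ^ Suc m"
       by (rule order_trans[OF cmod_entry_le Xb[OF t0]])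
      also have "... <= (2 * S) * C3 * (1 / c) ^ Suc m * (1 / (r + t)) ^ Suc m"
       using S[of t] t C30 c rt by (intro mult_right_mono mult_left_mono) auto
      finally show "cmod (X t $ k $ l) <= (2 * S) * C3 * (1 / c) ^ Suc m * (1 / (r + t)) ^ Suc m" .
      show "cmod (w s k l * ?e k l t) <= W * ((r + t) / (r + s))" by (rule wrat) (use s t in auto)
     qed (use S0 C30 c rt in auto)
     also have "... = B * S / (r + s) * (1 / (r + t)) ^ m" using rt rs by (simp add: B_def)
     finally show "norm (?f k l t) <= B * S / (r + s) * (1 / (r + t)) ^ Suc (Suc q)" by (simp add: q)
    qed
    also have "... <= - \<phi> s"
    proof -
     have "0 <= (B * S / (r + s)) / real (Suc q) * (1 / (r + T)) ^ Suc q"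
      using B0 S0 rs r0 s by (intro mult_nonneg_nonneg divide_nonneg_nonneg zero_le_power) auto
     thus ?thesis by (simp add: \<phi>_def)
    qed
    also have "- \<phi> s = B * S * (1 / (r + s)) ^ m / real (Suc q)" by (simp add: \<phi>_def q)
    also have "... <= B * S * (1 / (r + s)) ^ m / 1" by (rule divide_left_mono) (use B0 S0 rs in auto)
    finally show ?thesis unfolding eq by (simp add: norm_minus_commute)
   qed
   show ?thesis using norm_cmat_le_entries[OF ent] by (simp add: n2_def)
  qed
  obtain A T0 where A: "0 < T0" "0 <= A" "!!T. T0 <= T ==>
    norm (Gi a b (Ln (Complex T (Im (exp u0)))) ** asE m a b (Ln (Complex T (Im (exp u0)))) ** Dd a b (Ln (Complex T (Im (exp u0)))) - mat 1) <= A / T"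
   using vertical_limit[OF a b(1) m, of "Im (exp u0)"] by blast
  have jT: "norm (j T - mat 1) <= A / (T - r)" if "T0 + r <= T" for T
  proof -
   have "\<bar>Re (exp u0)\<bar> <= r" using abs_Re_le_cmod[of "exp u0"] by (simp add: r_def norm_exp_eq_Re)
   hence RT: "T - r <= Re (exp u0) + T" by linarith
   have "x T = Complex (Re (exp u0) + T) (Im (exp u0))" by (simp add: x_def complex_eq_iff)
   hence "norm (j T - mat 1) <= A / (Re (exp u0) + T)" using A(3)[of "Re (exp u0) + T"] RT that by (simp add: j_def U_def)
   also have "... <= A / (T - r)" by (rule divide_left_mono) (use RT that A in auto)
   finally show ?thesis .
  qed
  define V where "V = n2 * (exp (2 * pi * K + 2 * norm a * \<bar>Im (exp u0)\<bar>) * A)"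
  have V0: "0 <= V" using N0 A by (simp add: V_def)
  \<comment> \<open>At the far end the weights cost a fourth root of the modulus of x, here
    estimated by a square root, against the decay A / (T - r) from
    \<open>vertical_limit\<close>.\<close>
  have conjT: "norm (?c s T - mat 1) <= V * (sqrt (r + T) / (T - r))" if T: "T0 + r <= T" and s: "0 <= s" "s <= T" for s T
  proof -
   have "Dd a b (U s) ** (j T - mat 1) ** Di a b (U s) = ?c s T - mat 1" by (simp add: mm.diff_left mm.diff_right)
   hence "norm (?c s T - mat 1)
     <= n2 * (exp (2 * pi * K + 2 * norm a * \<bar>Im (exp u0)\<bar>) * exp (Re (U s) / 4) * norm (j T - mat 1))"
    using conj_bound(2)[OF a b ReU0[OF s(1)] ImU[OF s(1)], of "\<bar>Im (exp u0)\<bar>" "j T - mat 1"] expU[OF s(1)]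
    by (simp add: x_def n2_def)
   also have "... <= n2 * (exp (2 * pi * K + 2 * norm a * \<bar>Im (exp u0)\<bar>) * sqrt (r + T) * (A / (T - r)))"
   proof (intro mult_left_mono mult_mono jT T)
    have "exp (Re (U s) / 4) <= exp (Re (U s) / 2)" using ReU0[OF s(1)] by simp
    also have "... = sqrt (exp (Re (U s)))" by (rule real_sqrt_unique[symmetric]) (simp_all add: power2_eq_square flip: exp_add)
    also have "... <= sqrt (r + T)" unfolding eReU[OF s(1)] using xle[OF s(1)] s by simp
    finally show "exp (Re (U s) / 4) <= sqrt (r + T)" .
   qed (use N0 r0 s in auto)
   also have "... = V * (sqrt (r + T) / (T - r))" by (simp add: V_def)
   finally show ?thesis .
  qed
  have lim: "((\<lambda>T. V * (sqrt (r + T) / (T - r))) \<longlongrightarrow> 0) at_top"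
  proof -
   have "((\<lambda>T. sqrt (r / T^2 + 1 / T) / (1 - r / T)) \<longlongrightarrow> sqrt (0 + 0) / (1 - 0)) at_top"
    by (intro tendsto_intros tendsto_divide_0[OF tendsto_const] filterlim_at_top_imp_at_infinity
      filterlim_pow_at_top filterlim_ident) auto
   moreover have "\<forall>\<^sub>F T in at_top. sqrt (r / T^2 + 1 / T) / (1 - r / T) = sqrt (r + T) / (T - r)"
    using eventually_gt_at_top[of r]
   proof eventually_elim
    case (elim T)
    have T0: "0 < T" using elim r0 by simp
    have "r / T^2 + 1 / T = (r + T) / T^2" using T0 by (simp add: power2_eq_square field_simps)
    hence "sqrt (r / T^2 + 1 / T) = sqrt (r + T) / T" using T0 by (simp add: real_sqrt_divide)
    thus ?case using T0 elim by (simp add: field_simps)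
   qed
   ultimately have "((\<lambda>T. sqrt (r + T) / (T - r)) \<longlongrightarrow> 0) at_top" using Lim_transform_eventually by fastforce
   from tendsto_mult_left[OF this, of V] show ?thesis by simp
  qed
  have "\<forall>\<^sub>F T in at_top. V * (sqrt (r + T) / (T - r)) < 1" by (rule order_tendstoD(2)[OF lim]) simp
  then obtain T1 where T1: "!!T. T1 <= T ==> V * (sqrt (r + T) / (T - r)) < 1"
   unfolding eventually_at_top_linorder by blast
  define T2 where "T2 = max T1 (T0 + r)"
  have T20: "0 <= T2" using A(1) r0 by (simp add: T2_def)
  have n2B: "n2 * (B * (1 / (r + s)) ^ m) <= 1/2" if s: "0 <= s" for s
  proof -
   have rs: "1 <= r + s" using r1 s by simp
   have "(1 / (r + s)) ^ m <= 1 / (r + s)" using power_decreasing[of 1 m "1 / (r + s)"] m rs by simp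
   also have "... <= 1 / r" using s r0 by (simp add: frac_le)
   finally have "n2 * (B * (1 / (r + s)) ^ m) <= n2 * (B * (1 / r))" using N0 B0 by (intro mult_left_mono) auto
   also have "... <= 1/2"
   proof -
    have "c * r <= 1 * r" by (rule mult_right_mono) (use c r0 in auto)
    hence "2 * n2 * B <= r" using cr1(3) by linarith
    thus ?thesis using r0 by (simp add: field_simps)
   qed
   finally show ?thesis .
  qed
  have fin: "norm (J 0 - mat 1) <= C * (1 / r) ^ m + V * (sqrt (r + T) / (T - r))" if T: "T2 <= T" for T
  proof -
   have T': "T0 + r <= T" "T1 <= T" "0 <= T" using T T20 by (auto simp: T2_def)
   have "continuous_on {0..T} J"
   proof -
    have "continuous_on {0..T} j" by (intro continuous_at_imp_continuous_on ballI has_vector_derivative_continuous[OF jd]) simp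
    moreover have "isCont (\<lambda>t. Dd a b (U t)) t" "isCont (\<lambda>t. Di a b (U t)) t" if "0 <= t" for t
     using has_mderiv_vector[OF has_mderiv_Dd(1)[OF irrD(1)[OF a]] Ud[OF that]]
      has_mderiv_vector[OF has_mderiv_Dd(2)[OF irrD(1)[OF a]] Ud[OF that]] by (blast intro: has_vector_derivative_continuous)+
    hence "continuous_on {0..T} (\<lambda>t. Dd a b (U t))" "continuous_on {0..T} (\<lambda>t. Di a b (U t))"
     by (auto intro!: continuous_at_imp_continuous_on)
    ultimately show ?thesis unfolding Jj by (intro mm.continuous_on)
   qed
   hence "continuous_on {0..T} (\<lambda>t. norm (J t))" by (intro continuous_intros)
   then obtain s where s: "0 <= s" "s <= T" "!!t. 0 <= t ==> t <= T ==> norm (J t) <= norm (J s)"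
    using continuous_attains_sup[of "{0..T}" "\<lambda>t. norm (J t)"] T' by auto
   \<comment> \<open>An a priori bound for the maximum of J: S \<le> S/2 + 1 + N. Only with it does
     the integral estimate at 0 yield the order m.\<close>
   define S where "S = norm (J s)"
   have 1: "norm (?c s T - mat 1) <= 1" using conjT[OF T'(1) s(1,2)] T1[OF T'(2)] by linarith
   have "norm (J s - ?c s T) <= n2 * (B * S * (1 / (r + s)) ^ m)" by (rule main) (use s in \<open>auto simp: S_def\<close>)
   also have "... = n2 * (B * (1 / (r + s)) ^ m) * S" by simp
   also have "... <= 1/2 * S" by (rule mult_right_mono[OF n2B[OF s(1)]]) (simp add: S_def)
   finally have 2: "norm (J s - ?c s T) <= 1/2 * S" .
   have "S <= norm (J s - ?c s T) + norm (?c s T - mat 1) + N" unfolding S_def N_def by norm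
   also have "... <= 1/2 * S + 1 + N" by (intro add_mono 1 2 order_refl)
   finally have S: "S <= 2 * (N + 1)" by simp
   have "norm (J 0 - ?c 0 T) <= n2 * (B * (2 * (N + 1)) * (1 / (r + 0)) ^ m)"
    by (rule main) (use s(3) S T' in \<open>auto simp: S_def intro: order_trans\<close>)
   hence 3: "norm (J 0 - ?c 0 T) <= C * (1 / r) ^ m" by (simp add: C_def mult.assoc)
   have 4: "norm (?c 0 T - mat 1) <= V * (sqrt (r + T) / (T - r))" by (rule conjT) (use T' in auto)
   have "norm (J 0 - mat 1) <= norm (J 0 - ?c 0 T) + norm (?c 0 T - mat 1)" by norm
   thus ?thesis using 3 4 by linarith
  qed
  have "norm (J 0 - mat 1) <= C * (1 / r) ^ m + 0"
  proof (rule tendsto_lowerbound)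
   show "((\<lambda>T. C * (1 / r) ^ m + V * (sqrt (r + T) / (T - r))) \<longlongrightarrow> C * (1 / r) ^ m + 0) at_top"
    by (intro tendsto_add tendsto_const lim)
   show "\<forall>\<^sub>F T in at_top. norm (J 0 - mat 1) <= C * (1 / r) ^ m + V * (sqrt (r + T) / (T - r))"
    using eventually_ge_at_top[of T2] by eventually_elim (rule fin)
  qed simp
  moreover have "(1 / r) ^ m = exp (- real m * Re u0)" by (simp add: r_def exp_minus divide_inverse power_inverse exp_of_nat_mult)
  ultimately show ?thesis by (simp add: J_def G_def U0)
 qed
 thus ?thesis using C0 R0 by blast
qed

text \<open>The sum \<Sigma>(F) in the coordinate u: the canonical solution with its exponential
  factor removed.\<close>

definition Hf :: "'n cmat => 'n cmat => complex => 'n::finite cmat" where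
 "Hf a b u = Phi0 a b u ** Di a b u"

definition Hi :: "'n cmat => 'n cmat => complex => 'n::finite cmat" where
 "Hi a b u = Dd a b u ** Gi a b u"

lemma Hf_Hi:
 assumes "irr a" "b \<in> tube"
 shows "Hf a b u ** Hi a b u = mat 1" "Hi a b u ** Hf a b u = mat 1"
proof -
 have "Hf a b u ** Hi a b u = Phi0 a b u ** (Di a b u ** Dd a b u) ** Gi a b u" by (simp only: Hf_def Hi_def mm_assoc)
 thus "Hf a b u ** Hi a b u = mat 1" by (simp add: Gi_Phi0[OF assms])
 thus "Hi a b u ** Hf a b u = mat 1" using matrix_left_right_inverse by blast
qed

text \<open>\<open>sector_J\<close> says that Hi E is close to 1. Then Hf - E = - Hf (Hi E - 1),
  used first with the crude bound 1/2 to bound Hf and then with the full order; the same argument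
  with Hf - 1 bounds Hi.\<close>

lemma sector_H:
 assumes a: "irr (a :: 'n::finite cmat)" and \<epsilon>: "0 < \<epsilon>" "\<epsilon> <= pi" and K: "0 <= K" and m: "2 <= m"
 shows "\<exists>C R. 0 <= C & 0 <= R & (\<forall>b\<in>tube. norm b <= K --> (\<forall>u. \<bar>Im u\<bar> <= pi - \<epsilon> --> R <= Re u -->
   norm (Hf a b u - asE m a b u) <= C * exp (- real m * Re u) & norm (Hf a b u) <= C & norm (Hi a b u) <= C &
   norm (Hf a b u - mat 1) <= C * exp (- Re u) & norm (Hi a b u - mat 1) <= C * exp (- Re u)))"
proof -
 obtain C R where C: "0 <= C" "0 <= R" and J: "\<forall>b\<in>tube. norm b <= K --> (\<forall>u. \<bar>Im u\<bar> <= pi - \<epsilon> --> R <= Re u -->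
   norm (Dd a b u ** Gi a b u ** asE m a b u - mat 1) <= C * exp (- real m * Re u))"
  using sector_J[OF a m \<epsilon> K] by (elim exE conjE) (rule that)
 obtain C1 where C1: "0 <= C1" "!!b :: 'n cmat. !!u. norm b <= K ==> 0 <= Re u ==> norm (asE m a b u - mat 1) <= C1 * exp (- Re u)"
  using asE_bound[of K m a] by blast
 define N where "N = norm (mat 1 :: 'n cmat)"
 have N0: "0 <= N" by (simp add: N_def)
 define E where "E = 2 * (N + C1)"
 define F where "F = E * C + C1"
 have EF: "0 <= E" "0 <= F" using N0 C1 C by (auto simp: E_def F_def)
 obtain t1 where t1: "0 <= t1" "!!t. t1 <= t ==> C * exp (- 1 * t) <= 1/2"
  using exp_decay_le[of 1 C "1/2"] C by auto
 obtain t2 where t2: "0 <= t2" "!!t. t2 <= t ==> F * exp (- 1 * t) <= 1/2"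
  using exp_decay_le[of 1 F "1/2"] EF by auto
 define C' where "C' = E * C + E + F + 2 * N + 2 * N * F"
 have C'0: "0 <= C'" "E * C <= C'" "E <= C'" "F <= C'" "2 * N <= C'" "2 * N * F <= C'"
  using EF C N0 mult_nonneg_nonneg[OF EF(1) C(1)] mult_nonneg_nonneg[OF N0 EF(2)] by (auto simp: C'_def)
 define R' where "R' = max R (max t1 t2)"
 have R': "0 <= R'" using C by (simp add: R'_def)
 have "norm (Hf a b u - asE m a b u) <= C' * exp (- real m * Re u) &
   norm (Hf a b u) <= C' & norm (Hi a b u) <= C' &
   norm (Hf a b u - mat 1) <= C' * exp (- Re u) & norm (Hi a b u - mat 1) <= C' * exp (- Re u)"
  if b: "b \<in> tube" "norm b <= K" and u: "\<bar>Im u\<bar> <= pi - \<epsilon>" "R' <= Re u" for b u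
 proof -
  have Re: "R <= Re u" "t1 <= Re u" "t2 <= Re u" "0 <= Re u" using u(2) R' by (auto simp: R'_def)
  let ?J = "Hi a b u ** asE m a b u" and ?E = "asE m a b u" and ?H = "Hf a b u" and ?I = "Hi a b u"
  have dm: "exp (- real m * Re u) <= exp (- Re u)" using mult_right_mono[of 1 "real m" "Re u"] m Re by simp
  have j: "norm (?J - mat 1) <= C * exp (- real m * Re u)" using J[rule_format, OF b u(1) Re(1)] by (simp add: Hi_def)
  also have j': "... <= C * exp (- Re u)" by (rule mult_left_mono[OF dm C(1)])
  also have "... <= 1/2" using t1(2)[OF Re(2)] by simp
  finally have jh: "norm (?J - mat 1) <= 1/2" .
  have HE: "?H - ?E = - (?H ** (?J - mat 1))" by (simp add: mm.diff_right mm_assoc Hf_Hi[OF a b(1)])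
  have "C1 * exp (- Re u) <= C1 * 1" using C1 Re by (intro mult_left_mono) auto
  hence e1: "norm (?E - mat 1) <= C1" using C1(2)[OF b(2) Re(4)] by linarith
  have eN: "norm ?E <= N + C1" using norm_triangle_ineq[of "mat 1" "?E - mat 1"] e1 by (simp add: N_def)
  have "norm (?H - ?E) <= norm ?H * (1/2)"
   unfolding HE norm_minus_cancel by (rule order_trans[OF norm_matrix_mult_le mult_left_mono[OF jh]]) simp
  hence H: "norm ?H <= E" using norm_triangle_ineq[of ?E "?H - ?E"] eN by (simp add: E_def)
  have d: "norm (?H - ?E) <= E * (C * exp (- real m * Re u))"
   unfolding HE norm_minus_cancel by (rule order_trans[OF norm_matrix_mult_le mult_mono[OF H j]]) (use EF in auto)
  also have "... <= E * (C * exp (- Re u))" by (rule mult_left_mono[OF j' EF(1)])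
  finally have d': "norm (?H - ?E) <= E * C * exp (- Re u)" by simp
  have h1: "norm (?H - mat 1) <= F * exp (- Re u)" using norm_triangle_ineq[of "?H - ?E" "?E - mat 1"] d' C1(2)[OF b(2) Re(4)]
   by (simp add: F_def distrib_right)
  hence h2: "norm (?H - mat 1) <= 1/2" using t2(2)[OF Re(3)] by simp
  have IH: "?I - mat 1 = - (?I ** (?H - mat 1))" by (simp add: mm.diff_right Hf_Hi[OF a b(1)])
  have "norm (?I - mat 1) <= norm ?I * (1/2)"
   unfolding IH norm_minus_cancel by (rule order_trans[OF norm_matrix_mult_le mult_left_mono[OF h2]]) simp
  hence I: "norm ?I <= 2 * N" using norm_triangle_ineq[of "mat 1" "?I - mat 1"] by (simp add: N_def)
  have i1: "norm (?I - mat 1) <= 2 * N * (F * exp (- Re u))"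
   unfolding IH norm_minus_cancel by (rule order_trans[OF norm_matrix_mult_le mult_mono[OF I h1]]) (use N0 in auto)
  show ?thesis
  proof (intro conjI)
   show "norm (?H - ?E) <= C' * exp (- real m * Re u)"
    using order_trans[OF d] mult_right_mono[OF C'0(2), of "exp (- real m * Re u)"] by simp
   show "norm ?H <= C'" "norm ?I <= C'" using H I C'0 by linarith+
   show "norm (?H - mat 1) <= C' * exp (- Re u)" by (rule order_trans[OF h1 mult_right_mono[OF C'0(4)]]) simp
   show "norm (?I - mat 1) <= C' * exp (- Re u)"
    using order_trans[OF i1] mult_right_mono[OF C'0(6), of "exp (- Re u)"] by (simp add: mult.assoc)
  qed
 qed
 thus ?thesis using C'0(1) R' by blast
qed

definition sector_bounds :: "'n::finite cmat => real => real => real => real => bool" where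
 "sector_bounds a \<epsilon> K C R \<longleftrightarrow> 0 <= C & 0 <= R &
   (\<forall>b\<in>tube. norm b <= K --> (\<forall>u. \<bar>Im u\<bar> <= pi - \<epsilon> --> R <= Re u -->
    norm (Hf a b u) <= C & norm (Hi a b u) <= C &
    norm (Hf a b u - mat 1) <= C * exp (- Re u) & norm (Hi a b u - mat 1) <= C * exp (- Re u)))"

lemma sector_bounds_exist: "irr a ==> 0 < \<epsilon> ==> \<epsilon> <= pi ==> 0 <= K ==> \<exists>C R. sector_bounds a \<epsilon> K C R"
 using sector_H[OF _ _ _ _ order_refl, of a \<epsilon> K] unfolding sector_bounds_def by metis

lemma sector_boundsD:
 assumes "sector_bounds a \<epsilon> K C R"
 shows "0 <= C" "0 <= R"
  and "b \<in> tube ==> norm b <= K ==> \<bar>Im u\<bar> <= pi - \<epsilon> ==> R <= Re u ==>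
   norm (Hf a b u) <= C & norm (Hi a b u) <= C &
   norm (Hf a b u - mat 1) <= C * exp (- Re u) & norm (Hi a b u - mat 1) <= C * exp (- Re u)"
 using assms by (auto simp: sector_bounds_def)

subsection \<open>The connection matrices\<close>

text \<open>\<open>clow\<close> belongs to the translation of u by - pi i and \<open>cup\<close> to
  that by pi i, see \<open>Phi0_shift\<close>. The names do not refer to triangularity: under the
  ordering permutation \<open>clow\<close> becomes the upper triangular b_+.\<close>

definition clow :: "'n cmat => 'n cmat => 'n::finite cmat" where
 "clow a b = Ci (- a) b ** fsol a b (- (\<i> * pi)) ** C0 a b"

definition cup :: "'n cmat => 'n cmat => 'n::finite cmat" where
 "cup a b = Ci (- a) b ** fsol a b (\<i> * pi) ** C0 a b"

lemma tube_skew: "dagger b = - b ==> b \<in> tube"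
 by (simp add: tube_def skew_diag_Re)

lemma exp_pm_pi: "exp (u - \<i> * pi) = - exp u" "exp (u + \<i> * pi) = - exp u" "exp (- (\<i> * pi)) = - 1"
 by (simp_all add: exp_diff exp_add exp_minus mult.commute)

lemma Phi0_shift_aux:
 assumes a: "irr a" and b: "b \<in> tube" and p: "exp p = - 1"
 shows "Phi0 a b (u + p) = Phi0 (- a) b u ** (Ci (- a) b ** fsol a b p ** C0 a b)"
proof -
 have f: "fsol a b (u + p) = fsol (- a) b u ** fsol a b p" using fsol_shift[of a b u p] by (simp add: p cscale_uminus_one)
 have "Phi0 (- a) b u ** (Ci (- a) b ** fsol a b p ** C0 a b) = fsol (- a) b u ** (C0 (- a) b ** Ci (- a) b) ** fsol a b p ** C0 a b"
  by (simp only: Phi0_def mm_assoc)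
 thus ?thesis using Ci_C0(2)[of "- a" b] a b by (simp add: Phi0_def f)
qed

lemma Phi0_shift:
 assumes "irr a" and "b \<in> tube"
 shows "Phi0 a b (u - \<i> * pi) = Phi0 (- a) b u ** clow a b" "Phi0 a b (u + \<i> * pi) = Phi0 (- a) b u ** cup a b"
 using Phi0_shift_aux[OF assms, of "- (\<i> * pi)" u] Phi0_shift_aux[OF assms, of "\<i> * pi" u]
 by (simp_all add: exp_pm_pi clow_def cup_def mult.commute)

lemma tendsto_entry: "(f \<longlongrightarrow> L) F ==> ((\<lambda>x. (f x :: 'n::finite cmat) $ i $ j) \<longlongrightarrow> L $ i $ j) F"
 by (intro tendsto_vec_nth)

lemma Hf_Dd: "Hf a b u ** Dd a b u = Phi0 a b u"
 by (simp add: Hf_def flip: mm_assoc)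

text \<open>The left side does not depend on u, which can therefore be sent to infinity. On Im u = -
  pi/2 both u and u + pi i lie well inside the sectors where the two canonical sums are known to
  tend to 1.\<close>

lemma clow_entry:
 assumes a: "irr a" and b: "b \<in> tube"
 shows "clow a b $ i $ j = (Hi (- a) b (u + \<i> * pi) ** Hf a b u) $ i $ j
   * exp (u * (b $ j $ j - b $ i $ i) - \<i> * pi * b $ i $ i + exp u * (a $ j $ j - a $ i $ i))"
proof -
 have a': "irr (- a)" using a by simp
 have "Phi0 a b u = Phi0 (- a) b (u + \<i> * pi) ** clow a b" using Phi0_shift(1)[OF a b, of "u + \<i> * pi"] by simp
 hence "Gi (- a) b (u + \<i> * pi) ** Phi0 a b u = clow a b" by (simp add: mm_assoc Gi_Phi0[OF a' b])
 moreover have "Gi (- a) b (u + \<i> * pi) ** Phi0 a b u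
   = Di (- a) b (u + \<i> * pi) ** (Hi (- a) b (u + \<i> * pi) ** Hf a b u) ** Dd a b u"
 proof -
  have h: "Di (- a) b v ** (Hi (- a) b v ** X) = Gi (- a) b v ** X" for v X by (simp add: Hi_def mm_assoc)
  show ?thesis unfolding Hf_Dd[symmetric, of a b u] by (simp only: h mm_assoc[symmetric])
 qed
 ultimately have "clow a b = Di (- a) b (u + \<i> * pi) ** (Hi (- a) b (u + \<i> * pi) ** Hf a b u) ** Dd a b u" by simp
 thus ?thesis by (simp only: diag_mm_left diag_mm_right Dd_diag Dd_nth exp_pm_pi) (simp add: algebra_simps flip: exp_add)
qed

lemma sector_H_tendsto:
 assumes a: "irr a" and b: "b \<in> tube" and \<theta>: "\<bar>\<theta>\<bar> < pi"
 shows "((\<lambda>t. Hf a b (Complex t \<theta>)) \<longlongrightarrow> mat 1) at_top" "((\<lambda>t. Hi a b (Complex t \<theta>)) \<longlongrightarrow> mat 1) at_top"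
proof -
 obtain C R where S: "sector_bounds a (pi - \<bar>\<theta>\<bar>) (norm b) C R"
  using sector_bounds_exist[OF a, of "pi - \<bar>\<theta>\<bar>" "norm b"] \<theta> by auto
 note H' = sector_boundsD(3)[OF S b order_refl]
 have z: "((\<lambda>t. C * exp (- 1 * t)) \<longlongrightarrow> C * 0) at_top"
  by (intro tendsto_mult tendsto_const exp_decay_tendsto) simp
 have e: "norm (Hf a b (Complex t \<theta>) - mat 1) <= C * exp (- 1 * t)" "norm (Hi a b (Complex t \<theta>) - mat 1) <= C * exp (- 1 * t)"
  if "R <= t" for t using H'[of "Complex t \<theta>"] that by auto
 have ev: "\<forall>\<^sub>F t in at_top. R <= t" by (rule eventually_ge_at_top)
 have "((\<lambda>t. norm (Hf a b (Complex t \<theta>) - mat 1)) \<longlongrightarrow> 0) at_top"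
  by (rule tendsto_sandwich[OF _ eventually_mono[OF ev e(1)] tendsto_const]) (use z in auto)
 thus "((\<lambda>t. Hf a b (Complex t \<theta>)) \<longlongrightarrow> mat 1) at_top" by (simp add: tendsto_norm_zero_iff LIM_zero_iff)
 have "((\<lambda>t. norm (Hi a b (Complex t \<theta>) - mat 1)) \<longlongrightarrow> 0) at_top"
  by (rule tendsto_sandwich[OF _ eventually_mono[OF ev e(2)] tendsto_const]) (use z in auto)
 thus "((\<lambda>t. Hi a b (Complex t \<theta>)) \<longlongrightarrow> mat 1) at_top" by (simp add: tendsto_norm_zero_iff LIM_zero_iff)
qed

lemma clow_diag:
 assumes a: "irr a" and b: "b \<in> tube"
 shows "clow a b $ i $ i = exp (- (\<i> * pi * b $ i $ i))"
proof -
 have a': "irr (- a)" using a by simp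
 have s: "Complex t (- (pi / 2)) + \<i> * pi = Complex t (pi / 2)" for t by (simp add: complex_eq_iff)
 have "((\<lambda>t. Hi (- a) b (Complex t (pi / 2)) ** Hf a b (Complex t (- (pi / 2)))) \<longlongrightarrow> mat 1 ** mat 1) at_top"
  by (intro mm.tendsto sector_H_tendsto a a' b) auto
 hence "((\<lambda>t. (Hi (- a) b (Complex t (pi / 2)) ** Hf a b (Complex t (- (pi / 2)))) $ i $ i * exp (- (\<i> * pi * b $ i $ i))) \<longlongrightarrow> 1 * exp (- (\<i> * pi * b $ i $ i))) at_top"
  by (intro tendsto_mult tendsto_const) (drule tendsto_entry[where i=i and j=i], simp add: mat_one_nth)
 moreover have "(Hi (- a) b (Complex t (pi / 2)) ** Hf a b (Complex t (- (pi / 2)))) $ i $ i * exp (- (\<i> * pi * b $ i $ i)) = clow a b $ i $ i" for t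
  using clow_entry[OF a b, of i i "Complex t (- (pi / 2))"] by (simp add: s)
 ultimately have "((\<lambda>t::real. clow a b $ i $ i) \<longlongrightarrow> exp (- (\<i> * pi * b $ i $ i))) at_top" by simp
 thus ?thesis using tendsto_unique[OF trivial_limit_at_top_linorder tendsto_const] by blast
qed

text \<open>On Im u = - pi/2, at u = t - i pi/2, the factor exp(e^u (a_j - a_i)) equals exp(- e^t
  \<delta>) with \<delta> > 0. So the weight in \<open>clow_entry\<close> stays bounded while the
  off-diagonal entry of the product tends to 0.\<close>

lemma clow_triangular:
 assumes a: "irr a" and b: "dagger b = - b" and ij: "Im (a $ j $ j) < Im (a $ i $ i)"
 shows "clow a b $ i $ j = 0"
proof -
 have bt: "b \<in> tube" by (rule tube_skew[OF b])
 have a': "irr (- a)" using a by simp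
 have ne: "i ~= j" using ij by auto
 define \<delta> where "\<delta> = Im (a $ i $ i) - Im (a $ j $ j)"
 have \<delta>: "0 < \<delta>" using ij by (simp add: \<delta>_def)
 have s: "Complex t (- (pi / 2)) + \<i> * pi = Complex t (pi / 2)" for t by (simp add: complex_eq_iff)
 define w where "w t = exp (Complex t (- (pi / 2)) * (b $ j $ j - b $ i $ i) - \<i> * pi * b $ i $ i
   + exp (Complex t (- (pi / 2))) * (a $ j $ j - a $ i $ i))" for t
 define Q where "Q = exp (pi / 2 * (Im (b $ j $ j) - Im (b $ i $ i)) + pi * Im (b $ i $ i))"
 have wb: "cmod (w t) <= Q" if t: "0 <= t" for t
 proof -
  have "Re (Complex t (- (pi / 2)) * (b $ j $ j - b $ i $ i) - \<i> * pi * b $ i $ i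
   + exp (Complex t (- (pi / 2))) * (a $ j $ j - a $ i $ i))
   = pi / 2 * (Im (b $ j $ j) - Im (b $ i $ i)) + pi * Im (b $ i $ i) - exp t * \<delta>"
   by (simp add: skew_diag_Re[OF b] irrD(2)[OF a] Re_exp Im_exp \<delta>_def algebra_simps)
  also have "... <= pi / 2 * (Im (b $ j $ j) - Im (b $ i $ i)) + pi * Im (b $ i $ i)" using \<delta> by simp
  finally show ?thesis by (simp add: w_def Q_def norm_exp_eq_Re)
 qed
 have "((\<lambda>t. Hi (- a) b (Complex t (pi / 2)) ** Hf a b (Complex t (- (pi / 2)))) \<longlongrightarrow> mat 1 ** mat 1) at_top"
  by (intro mm.tendsto sector_H_tendsto a a' bt) auto
 hence "((\<lambda>t. (Hi (- a) b (Complex t (pi / 2)) ** Hf a b (Complex t (- (pi / 2)))) $ i $ j) \<longlongrightarrow> 0) at_top"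
  using ne by (auto simp: mat_one_nth dest: tendsto_entry[where i=i and j=j])
 hence z: "((\<lambda>t. cmod ((Hi (- a) b (Complex t (pi / 2)) ** Hf a b (Complex t (- (pi / 2)))) $ i $ j) * Q) \<longlongrightarrow> 0 * Q) at_top"
  by (intro tendsto_mult tendsto_const tendsto_norm_zero)
 have "cmod (clow a b $ i $ j) <= 0"
 proof (rule tendsto_lowerbound)
  show "((\<lambda>t. cmod ((Hi (- a) b (Complex t (pi / 2)) ** Hf a b (Complex t (- (pi / 2)))) $ i $ j) * Q) \<longlongrightarrow> 0) at_top"
   using z by simp
  show "\<forall>\<^sub>F t in at_top. cmod (clow a b $ i $ j)
    <= cmod ((Hi (- a) b (Complex t (pi / 2)) ** Hf a b (Complex t (- (pi / 2)))) $ i $ j) * Q" using eventually_ge_at_top[of 0]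
  proof eventually_elim
   case (elim t)
   have "clow a b $ i $ j = (Hi (- a) b (Complex t (pi / 2)) ** Hf a b (Complex t (- (pi / 2)))) $ i $ j * w t"
    using clow_entry[OF a bt, of i j "Complex t (- (pi / 2))"] by (simp only: s w_def)
   thus ?case by (simp only: norm_mult) (rule mult_left_mono[OF wb[OF elim]], simp)
  qed
 qed simp
 thus ?thesis by simp
qed

lemma isol_real_skew:
 assumes "dagger a = - a" "dagger b = - b"
 shows "isol a b (of_real t) = dagger (fsol a b (of_real t))" using dagger_fsol[OF assms, of "of_real t"] by simp

lemma unitary_Dd:
 assumes a: "irr a" and b: "dagger b = - b"
 shows "unitary (Dd a b (of_real t))" "Di a b (of_real t) = dagger (Dd a b (of_real t))"
proof -
 show *: "Di a b (of_real t) = dagger (Dd a b (of_real t))"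
 proof (rule cmat_eqI)
  fix i j
  have ba: "cnj (b $ i $ i) = - (b $ i $ i)" "cnj (a $ i $ i) = - (a $ i $ i)" for i
   using skew_diag_Re[OF b, of i] irrD(2)[OF a, of i] by (simp_all add: complex_eq_iff)
  show "Di a b (of_real t) $ i $ j = dagger (Dd a b (of_real t)) $ i $ j"
   by (cases "i = j") (simp_all add: Dd_nth diag_mats_offdiag[OF Dd_diag(2)] diag_mats_offdiag[OF Dd_diag(1)] ba exp_cnj flip: exp_of_real)
 qed
 show "unitary (Dd a b (of_real t))" by (rule unitaryI) (simp flip: *)
qed

lemma unitary_C0:
 assumes a: "irr a" and b: "dagger b = - b"
 shows "unitary (C0 a b)" "Ci a b = dagger (C0 a b)"
proof -
 have bt: "b \<in> tube" by (rule tube_skew[OF b])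
 have l: "((\<lambda>t. isol a b (complex_of_real t) ** Dd a b (of_real t)) \<longlongrightarrow> C0 a b) at_top"
  using lsol_isol[OF a bt] by (simp add: lsol_def)
 have u: "unitary (isol a b (complex_of_real t) ** Dd a b (of_real t))" for t unfolding isol_real_skew[OF irr_dagger[OF a] b]
  by (intro unitary_mult unitary_dagger unitary_fsol irr_dagger a b unitary_Dd)
 have "((\<lambda>t. dagger (isol a b (complex_of_real t) ** Dd a b (of_real t)) ** (isol a b (complex_of_real t) ** Dd a b (of_real t)))
   \<longlongrightarrow> dagger (C0 a b) ** C0 a b) at_top" by (intro mm.tendsto l bounded_linear.tendsto[OF bounded_linear_dagger])
 hence *: "dagger (C0 a b) ** C0 a b = mat 1"
  using u unfolding unitary_def by (auto intro: tendsto_unique[OF trivial_limit_at_top_linorder _ tendsto_const])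
 thus "unitary (C0 a b)" by (rule unitaryI)
 show "Ci a b = dagger (C0 a b)" using mm_left_inverse_unique[OF Ci_C0(2)[OF a bt] *] by simp
qed

text \<open>By \<open>dagger_fsol\<close> the adjoint of the solution at - pi i is the inverse of
  the solution at pi i, and the normalising factors \<open>C0\<close> are unitary.\<close>

lemma cup_clow:
 assumes a: "irr a" and b: "dagger b = - b"
 shows "dagger (clow a b) ** cup a b = mat 1" "cup a b ** dagger (clow a b) = mat 1"
proof -
 have a': "irr (- a)" using a by simp
 have bt: "b \<in> tube" by (rule tube_skew[OF b])
 have f: "dagger (fsol a b (- (\<i> * pi))) = isol a b (\<i> * pi)" using dagger_fsol[OF irr_dagger[OF a] b, of "\<i> * pi"] by simp
 have "dagger (clow a b) = Ci a b ** isol a b (\<i> * pi) ** C0 (- a) b"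
  by (simp add: clow_def dagger_mult f unitary_C0(2)[OF a b] unitary_C0(2)[OF a' b] dagger_dagger mm_assoc)
 hence "dagger (clow a b) ** cup a b = Ci a b ** isol a b (\<i> * pi) ** (C0 (- a) b ** Ci (- a) b) ** fsol a b (\<i> * pi) ** C0 a b"
  by (simp only: cup_def mm_assoc)
 also have "... = Ci a b ** (isol a b (\<i> * pi) ** fsol a b (\<i> * pi)) ** C0 a b"
  by (simp add: Ci_C0[OF a' bt] mm_assoc del: isol_fsol)
 finally show "dagger (clow a b) ** cup a b = mat 1" by (simp add: Ci_C0[OF a bt])
 thus "cup a b ** dagger (clow a b) = mat 1" using matrix_left_right_inverse by blast
qed

subsection \<open>Sectors, labellings and the ordering permutation\<close>

lemma sector_eq: "sector \<alpha> \<beta> = exp ` {w. \<alpha> < Im w & Im w < \<beta>}"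
proof (intro equalityI subsetI)
 fix z assume "z \<in> sector \<alpha> \<beta>"
 then obtain r t where z: "z = rcis r t" "0 < r" "\<alpha> < t" "t < \<beta>" by (auto simp: sector_def)
 have "exp (Complex (ln r) t) = z" using z by (simp add: exp_eq_polar rcis_def)
 thus "z \<in> exp ` {w. \<alpha> < Im w & Im w < \<beta>}" using z by (intro image_eqI[of _ _ "Complex (ln r) t"]) auto
next
 fix z assume "z \<in> exp ` {w. \<alpha> < Im w & Im w < \<beta>}"
 then obtain w where w: "z = exp w" "\<alpha> < Im w" "Im w < \<beta>" by auto
 hence "z = rcis (exp (Re w)) (Im w)" by (simp add: exp_eq_polar rcis_def)
 thus "z \<in> sector \<alpha> \<beta>" using w unfolding sector_def by (intro CollectI exI[of _ "exp (Re w)"] exI[of _ "Im w"]) auto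
qed

lemma exp_in_sector: "\<alpha> < Im w ==> Im w < \<beta> ==> exp w \<in> sector \<alpha> \<beta>"
 by (auto simp: sector_eq)

lemma sector_logE:
 assumes "z \<in> sector \<alpha> \<beta>" obtains w where "z = exp w" "\<alpha> < Im w" "Im w < \<beta>"
 using assms by (auto simp: sector_eq)

lemma sector_log_exp:
 assumes "\<alpha> < Im w" "Im w < \<beta>" "\<beta> - \<alpha> <= 2 * pi"
 shows "sector_log \<alpha> \<beta> (exp w) = w" unfolding sector_log_def
proof (rule the_equality)
 show "exp w = exp w & \<alpha> < Im w & Im w < \<beta>" using assms by simp
 fix v assume v: "exp v = exp w & \<alpha> < Im v & Im v < \<beta>"
 then obtain n :: int where n: "v = w + of_real (of_int (2 * n) * pi) * \<i>" using exp_eq[of v w] by blast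
 hence "Im v - Im w = 2 * pi * of_int n" by simp
 moreover have "\<bar>Im v - Im w\<bar> < 2 * pi" using v assms by (auto simp: abs_less_iff)
 ultimately have "\<bar>real_of_int n\<bar> < 1" by (simp add: abs_mult)
 hence "n = 0" by linarith
 thus "v = w" using n by simp
qed

lemma open_sector:
 assumes "\<beta> - \<alpha> <= 2 * pi" shows "open (sector \<alpha> \<beta>)" unfolding sector_eq
proof (rule open_mapping_thm3)
 have "open {w. \<alpha> < Im w}" "open {w. Im w < \<beta>}" by (rule open_halfspace_Im_gt open_halfspace_Im_lt)+
 moreover have "{w. \<alpha> < Im w & Im w < \<beta>} = {w. \<alpha> < Im w} \<inter> {w. Im w < \<beta>}" by auto
 ultimately show "open {w. \<alpha> < Im w & Im w < \<beta>}" by (simp add: open_Int)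
 show "inj_on exp {w. \<alpha> < Im w & Im w < \<beta>}"
  by (rule inj_on_inverseI[of _ "sector_log \<alpha> \<beta>"]) (use assms sector_log_exp in auto)
qed (intro holomorphic_intros)

lemma convex_strip: "convex {w. \<alpha> < Im w & Im w < \<beta>}" and open_strip: "open {w. \<alpha> < Im w & Im w < \<beta>}"
proof -
 have "{w. \<alpha> < Im w & Im w < \<beta>} = {w. \<alpha> < Im w} \<inter> {w. Im w < \<beta>}" by auto
 thus "convex {w. \<alpha> < Im w & Im w < \<beta>}" "open {w. \<alpha> < Im w & Im w < \<beta>}"
  by (auto intro!: convex_Int convex_halfspace_Im_gt convex_halfspace_Im_lt open_Int open_halfspace_Im_gt open_halfspace_Im_lt)
qed

lemma connected_sector: "connected (sector \<alpha> \<beta>)"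
 unfolding sector_eq by (rule connected_continuous_image[OF _ convex_connected[OF convex_strip]]) (intro continuous_intros)

text \<open>Rotation by the mid-angle of the sector reduces its branch to the principal
  logarithm.\<close>

lemma sector_log_deriv:
 assumes z: "z \<in> sector \<alpha> \<beta>" and le: "\<beta> - \<alpha> <= 2 * pi"
 shows "(sector_log \<alpha> \<beta> has_field_derivative 1 / z) (at z)"
proof -
 define \<gamma> where "\<gamma> = (\<alpha> + \<beta>) / 2"
 have key: "Ln (y * exp (- (\<i> * of_real \<gamma>))) + \<i> * of_real \<gamma> = sector_log \<alpha> \<beta> y & y * exp (- (\<i> * of_real \<gamma>)) \<notin> \<real>\<^sub>\<le>\<^sub>0"
  if y: "y \<in> sector \<alpha> \<beta>" for y
 proof -
  obtain w where w: "y = exp w" "\<alpha> < Im w" "Im w < \<beta>" using y by (rule sector_logE)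
  have *: "- pi < Im (w - \<i> * of_real \<gamma>)" "Im (w - \<i> * of_real \<gamma>) < pi" using w le by (auto simp: \<gamma>_def field_simps)
  have e: "y * exp (- (\<i> * of_real \<gamma>)) = exp (w - \<i> * of_real \<gamma>)" by (simp add: w exp_diff exp_minus divide_inverse)
  have L: "Ln (exp (w - \<i> * of_real \<gamma>)) = w - \<i> * of_real \<gamma>" using * by (intro Ln_exp) auto
  have "exp (w - \<i> * of_real \<gamma>) \<notin> \<real>\<^sub>\<le>\<^sub>0"
  proof
   assume "exp (w - \<i> * of_real \<gamma>) \<in> \<real>\<^sub>\<le>\<^sub>0"
   hence "exp (w - \<i> * of_real \<gamma>) = 0 \<or> Im (Ln (exp (w - \<i> * of_real \<gamma>))) = pi"
    by (metis Im_Ln_eq_pi complex_nonpos_Reals_iff complex_eq_iff zero_complex.sel order_le_less)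
   thus False using * L by auto
  qed
  thus ?thesis using sector_log_exp[OF w(2,3) le] unfolding e L by (simp add: w)
 qed
 have "((\<lambda>y. Ln (y * exp (- (\<i> * of_real \<gamma>))) + \<i> * of_real \<gamma>) has_field_derivative 1 / z) (at z)"
 proof -
  have z0: "z ~= 0" using z by (auto elim: sector_logE)
  show ?thesis using key[OF z] z0 by (auto intro!: derivative_eq_intros simp: field_simps)
 qed
 thus ?thesis by (rule has_field_derivative_transform_within_open[OF _ open_sector[OF le] z]) (use key in auto)
qed

text \<open>Both d and the sequence pi/2 + k pi enumerate the same set increasingly, so they differ
  by a shift of the index. The position of the positive axis between d 0 and d 1 fixes the shift,
  and periodicity fixes l.\<close>

lemma labelling_imaginary:
 assumes A0: "A0 \<in> diag_mats" "dagger A0 = - A0" "inj (\<lambda>i. A0 $ i $ i)"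
  and d: "anti_stokes_labelling (A0 :: 'n::finite cmat) l d" "d 0 < 0" "0 < d 1"
 shows "l = 1" "d k = of_int k * pi - pi / 2"
proof -
 have rng: "range d = range (\<lambda>k::int. pi / 2 + of_int k * pi)"
  using d(1) anti_stokes_imaginary[OF A0(2,3)] by (auto simp: anti_stokes_labelling_def split: if_splits)
 have mono: "strict_mono d" and per: "!!k. d (k + 2 * int l) = d k + 2 * pi" using d(1) by (auto simp: anti_stokes_labelling_def)
 have "\<exists>e. d k = pi / 2 + of_int e * pi" for k using rangeI[of d k] unfolding rng by blast
 then obtain e :: "int => int" where e: "!!k. d k = pi / 2 + of_int (e k) * pi" by metis
 have emono: "e i < e j" if "i < j" for i j using strict_monoD[OF mono that] unfolding e by simp
 have esurj: "\<exists>i. e i = j" for j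
 proof -
  have "pi / 2 + of_int j * pi \<in> range d" unfolding rng by blast
  then obtain i where "pi / 2 + of_int j * pi = d i" by blast
  thus ?thesis by (intro exI[of _ i]) (simp add: e)
 qed
 have e0: "e 0 <= -1"
 proof -
  have "(1 / 2 + of_int (e 0)) * pi < 0" using d(2) by (simp add: e algebra_simps)
  hence "1 / 2 + real_of_int (e 0) < 0" by (simp add: mult_less_0_iff)
  thus ?thesis by linarith
 qed
 have e1: "0 <= e 1"
 proof -
  have "0 < (1 / 2 + of_int (e 1)) * pi" using d(3) by (simp add: e algebra_simps)
  hence "0 < 1 / 2 + real_of_int (e 1)" by (simp add: zero_less_mult_iff)
  thus ?thesis by linarith
 qed
 have step: "e (k + 1) = e k + 1" for k
 proof (rule ccontr)
  assume "e (k + 1) ~= e k + 1"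
  hence lt: "e k + 1 < e (k + 1)" using emono[of k "k + 1"] by linarith
  obtain i where i: "e i = e k + 1" using esurj by blast
  have "k < i" using emono[of i k] i by (metis linorder_neqE_linordered_idom less_add_one order_less_asym)
  moreover have "i < k + 1" using emono[of "k + 1" i] i lt by (metis linorder_neqE_linordered_idom order_less_asym order_less_irrefl)
  ultimately show False by linarith
 qed
 have e00: "e 0 = - 1" using step[of 0] e0 e1 by simp
 have ek: "e k = k - 1" for k
 proof (induction k rule: int_induct[where k=0])
  case base thus ?case by (simp add: e00)
 next
  case (step1 i) thus ?case using step[of i] by simp
 next
  case (step2 i) thus ?case using step[of "i - 1"] by simp
 qed
 show "d k = of_int k * pi - pi / 2" by (simp add: e ek algebra_simps)
 have "d (2 * int l) = d 0 + 2 * pi" using per[of 0] by simp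
 hence "real_of_int (2 * int l) * pi = 2 * pi" unfolding e ek by (simp add: algebra_simps)
 thus "l = 1" by simp
qed

text \<open>Existence: w i is the element in position r i of the ordered index type, where r i
  counts the indices with larger imaginary part. Uniqueness: the order condition determines how many
  elements lie below the value at i, and this number determines the value.\<close>

lemma stokes_perm_imaginary:
 fixes A0 :: "'n::{finite,wellorder} cmat"
 assumes A0: "dagger A0 = - A0" "inj (\<lambda>i. A0 $ i $ i)" and d: "d 1 = pi / 2"
 shows "bij (stokes_perm A0 1 d)" "stokes_perm A0 1 d i < stokes_perm A0 1 d j \<longleftrightarrow> Im (A0 $ j $ j) < Im (A0 $ i $ i)"
proof -
 have th: "(d 1 + d (int 1)) / 2 = pi / 2" using d by simp
 have lim: "((\<lambda>r. exp (irr_q A0 i (rcis r (pi / 2))) / exp (irr_q A0 j (rcis r (pi / 2)))) \<longlongrightarrow> 0) (at_right 0)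
   \<longleftrightarrow> Im (A0 $ j $ j) < Im (A0 $ i $ i)" for i j
 proof -
  define \<tau> where "\<tau> = Im (A0 $ i $ i) - Im (A0 $ j $ j)"
  define f where "f r = exp (irr_q A0 i (rcis r (pi / 2))) / exp (irr_q A0 j (rcis r (pi / 2)))" for r
  have nf: "norm (f r) = exp (- (\<tau> / r))" if "0 < r" for r unfolding f_def exp_diff[symmetric] norm_exp_eq_Re
   using re_irr_q_imaginary[OF A0(1) that, of i "pi / 2" j] by (simp add: \<tau>_def)
  have ev: "\<forall>\<^sub>F r in at_right (0::real). 0 < r" by (simp add: eventually_at_right_less)
  show ?thesis unfolding f_def[symmetric]
  proof
   assume "Im (A0 $ j $ j) < Im (A0 $ i $ i)"
   hence pos: "0 < \<tau>" by (simp add: \<tau>_def)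
   have "((\<lambda>r. exp (- (\<tau> / r))) \<longlongrightarrow> 0) (at_right 0)"
   proof (rule filterlim_compose[OF exp_at_bot])
    have "LIM r at_right 0. \<tau> * inverse r :> at_top"
     using pos filterlim_tendsto_pos_mult_at_top[OF tendsto_const _ filterlim_inverse_at_top_right] by blast
    thus "LIM r at_right 0. - (\<tau> / r) :> at_bot" by (simp add: filterlim_uminus_at_bot divide_inverse)
   qed
   hence "((\<lambda>r. norm (f r)) \<longlongrightarrow> 0) (at_right 0)"
    by (rule Lim_transform_eventually) (use ev in eventually_elim, simp add: nf)
   thus "(f \<longlongrightarrow> 0) (at_right 0)" using tendsto_norm_zero_iff by blast
  next
   assume "(f \<longlongrightarrow> 0) (at_right 0)"
   hence "((\<lambda>r. norm (f r)) \<longlongrightarrow> 0) (at_right 0)" by (rule tendsto_norm_zero)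
   hence "\<forall>\<^sub>F r in at_right 0. norm (f r) < 1" by (rule order_tendstoD) simp
   with ev have "\<forall>\<^sub>F r in at_right 0. 0 < r & norm (f r) < 1" by eventually_elim simp
   then obtain r where r: "0 < r" "norm (f r) < 1" using eventually_happens' trivial_limit_at_right_real by blast
   hence "0 < \<tau> / r" by (simp add: nf)
   thus "Im (A0 $ j $ j) < Im (A0 $ i $ i)" using r(1) by (simp add: zero_less_divide_iff \<tau>_def)
  qed
 qed
 define Q where "Q w \<longleftrightarrow> bij w & (\<forall>i j. w i < w j \<longleftrightarrow> Im (A0 $ j $ j) < Im (A0 $ i $ i))" for w :: "'n => 'n"
 have sp: "stokes_perm A0 1 d = (THE w. Q w)" unfolding stokes_perm_def th lim Q_def ..
 have Imne: "Im (A0 $ i $ i) ~= Im (A0 $ j $ j)" if "i ~= j" for i j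
  using that injD[OF A0(2), of i j] skew_diag_Re[OF A0(1)] by (auto simp: complex_eq_iff)
 define r where "r i = card {k. Im (A0 $ i $ i) < Im (A0 $ k $ k)}" for i
 have rless: "r i < r j \<longleftrightarrow> Im (A0 $ j $ j) < Im (A0 $ i $ i)" for i j
 proof
  assume "Im (A0 $ j $ j) < Im (A0 $ i $ i)"
  thus "r i < r j" unfolding r_def by (intro psubset_card_mono) auto
 next
  assume ij: "r i < r j"
  show "Im (A0 $ j $ j) < Im (A0 $ i $ i)"
  proof (rule ccontr)
   assume "\<not> Im (A0 $ j $ j) < Im (A0 $ i $ i)"
   hence "r j <= r i" unfolding r_def by (intro card_mono) auto
   thus False using ij by simp
  qed
 qed
 define xs where "xs = sorted_list_of_set (UNIV :: 'n set)"
 have xs: "length xs = CARD('n)" "sorted xs" "distinct xs" by (simp_all add: xs_def)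
 have rn: "r i < CARD('n)" for i
 proof -
  have "i \<notin> {k. Im (A0 $ i $ i) < Im (A0 $ k $ k)}" by simp
  thus ?thesis unfolding r_def by (intro psubset_card_mono) auto
 qed
 define w where "w i = xs ! r i" for i
 have wless: "w i < w j \<longleftrightarrow> r i < r j" for i j
 proof
  assume "r i < r j"
  thus "w i < w j" unfolding w_def using xs rn by (metis sorted_wrt_nth_less strict_sorted_iff)
 next
  assume lt: "w i < w j"
  show "r i < r j"
  proof (rule ccontr)
   assume "\<not> r i < r j"
   hence "w j <= w i" unfolding w_def using xs rn by (intro sorted_nth_mono) auto
   thus False using lt by simp
  qed
 qed
 have "inj w"
 proof (rule injI)
  fix i j assume "w i = w j"
  hence "\<not> w i < w j" "\<not> w j < w i" by auto
  thus "i = j" using Imne[of i j] unfolding wless rless by linarith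
 qed
 hence "bij w" by (simp add: finite_UNIV_inj_surj bij_def)
 hence Qw: "Q w" unfolding Q_def using wless rless by blast
 have uniq: "v = w" if "Q v" for v
 proof -
  have cd: "card {x. x < u i} = r i" if "Q u" for u i
  proof -
   have "{x. x < u i} = u ` {k. u k < u i}" using that unfolding Q_def by (auto simp: bij_def surj_def image_iff) metis
   hence "card {x. x < u i} = card {k. u k < u i}" using that unfolding Q_def bij_def by (metis card_image inj_on_subset subset_UNIV)
   also have "{k. u k < u i} = {k. Im (A0 $ i $ i) < Im (A0 $ k $ k)}" using that unfolding Q_def by auto
   finally show ?thesis by (simp add: r_def)
  qed
  have ci: "x = y" if "card {z. z < x} = card {z. z < (y::'n)}" for x y
  proof (rule ccontr)
   assume "x ~= y"
   then consider "x < y" | "y < x" by force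
   thus False
   proof cases
    case 1 hence "card {z. z < x} < card {z. z < y}" by (intro psubset_card_mono) auto
    thus False using that by simp
   next
    case 2 hence "card {z. z < y} < card {z. z < x}" by (intro psubset_card_mono) auto
    thus False using that by simp
   qed
  qed
  show ?thesis by (rule ext, rule ci) (simp add: cd[OF that] cd[OF Qw])
 qed
 have "Q (stokes_perm A0 1 d)" unfolding sp by (rule theI[of Q, OF Qw uniq])
 thus "bij (stokes_perm A0 1 d)" "stokes_perm A0 1 d i < stokes_perm A0 1 d j \<longleftrightarrow> Im (A0 $ j $ j) < Im (A0 $ i $ i)"
  by (auto simp: Q_def)
qed

section \<open>Conjugation by the ordering permutation\<close>

definition conjP :: "('n => 'n) => 'n cmat => 'n::finite cmat" where
 "conjP w M = matrix_inv (perm_mat w) ** M ** perm_mat w"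

lemma perm_mat_inv:
 assumes w: "bij w"
 shows "perm_mat w ** transpose (perm_mat w) = mat 1" "transpose (perm_mat w) ** perm_mat w = mat 1"
  "matrix_inv (perm_mat w) = transpose (perm_mat w)"
proof -
 show 1: "perm_mat w ** transpose (perm_mat w) = mat 1"
 proof (rule cmat_eqI)
  fix i j
  have "(perm_mat w ** transpose (perm_mat w)) $ i $ j = (\<Sum>k\<in>UNIV. if w i = k then (if w j = k then 1 else 0) else 0)"
   unfolding mm_nth by (intro sum.cong refl) (auto simp: perm_mat_def transpose_def)
  also have "... = (if w j = w i then 1 else 0)" by simp
  finally show "(perm_mat w ** transpose (perm_mat w)) $ i $ j = mat 1 $ i $ j"
   using bij_is_inj[OF w] by (auto simp: mat_one_nth dest: injD)
 qed
 thus 2: "transpose (perm_mat w) ** perm_mat w = mat 1" using matrix_left_right_inverse by blast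
 show "matrix_inv (perm_mat w) = transpose (perm_mat w)" by (rule inverse_eq_matrix_inv[OF 1 2])
qed

lemma conjP_nth:
 assumes w: "bij w" shows "conjP w M $ w i $ w j = M $ i $ j"
proof -
 have "(M ** perm_mat w) $ k $ w j = (\<Sum>l\<in>UNIV. if l = j then M $ k $ l else 0)" for k
  unfolding mm_nth using bij_is_inj[OF w] by (intro sum.cong refl) (auto simp: perm_mat_def dest: injD)
 hence e: "(M ** perm_mat w) $ k $ w j = M $ k $ j" for k by simp
 have "conjP w M $ w i $ w j = (\<Sum>k\<in>UNIV. if k = i then (M ** perm_mat w) $ k $ w j else 0)"
  unfolding conjP_def perm_mat_inv(3)[OF w] mm_assoc[symmetric] mm_nth[of "transpose _"]
  using bij_is_inj[OF w] by (intro sum.cong refl) (auto simp: perm_mat_def transpose_def dest: injD)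
 thus ?thesis by (simp add: e)
qed

lemma conjP_eqI:
 fixes M N :: "'n::finite cmat"
 assumes w: "bij w" "!!i j. M $ w i $ w j = N $ w i $ w j" shows "M = N"
proof (rule cmat_eqI)
 fix i j
 obtain k l where "i = w k" "j = w l" using bij_is_surj[OF w(1)] by (metis surjD)
 thus "M $ i $ j = N $ i $ j" using w(2) by simp
qed

lemma conjP_mult: "bij w ==> conjP w (M ** N) = conjP w M ** conjP w N"
proof -
 assume w: "bij w"
 have "conjP w M ** conjP w N = matrix_inv (perm_mat w) ** M ** (perm_mat w ** transpose (perm_mat w)) ** N ** perm_mat w"
  by (simp only: conjP_def perm_mat_inv(3)[OF w] mm_assoc)
 thus ?thesis by (simp add: perm_mat_inv(1)[OF w] conjP_def mm_assoc)
qed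

lemma conjP_one: "bij w ==> conjP w (mat 1) = mat 1"
 by (simp add: conjP_def perm_mat_inv)

lemma conjP_dagger: "bij w ==> conjP w (dagger M) = dagger (conjP w M)"
 by (rule conjP_eqI) (auto simp: conjP_nth)

lemma conjP_diag: "bij w ==> D \<in> diag_mats ==> conjP w D \<in> diag_mats"
proof -
 assume w: "bij w" and D: "D \<in> diag_mats"
 have "conjP w D $ i $ j = 0" if ij: "i ~= j" for i j
 proof -
  obtain k l where "i = w k" "j = w l" using bij_is_surj[OF w] by (metis surjD)
  thus ?thesis using D ij by (cases "k = l") (auto simp: diag_mats_def conjP_nth[OF w])
 qed
 thus ?thesis by (simp add: diag_mats_def)
qed

lemma conjP_diag_exp: "bij w ==> conjP w (diag_exp D) = diag_exp (conjP w D)"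
proof (rule conjP_eqI)
 fix i j assume w: "bij w"
 show "conjP w (diag_exp D) $ w i $ w j = diag_exp (conjP w D) $ w i $ w j"
  unfolding diag_exp_nth inj_eq[OF bij_is_inj[OF w]] by (simp add: conjP_nth[OF w] diag_exp_nth)
qed

lemma bounded_linear_conjP: "bounded_linear (conjP w :: 'n::finite cmat => _)"
 unfolding conjP_def by (intro bounded_linear_compose[OF mm.bounded_linear_left] mm.bounded_linear_right)

lemma conjP_cscale: "bij w ==> conjP w (cscale c M) = cscale c (conjP w M)"
 by (rule conjP_eqI) (auto simp: conjP_nth)

lemma conjP_inverse:
 "bij w ==> perm_mat w ** conjP w M ** matrix_inv (perm_mat w) = M"
proof -
 assume w: "bij w"
 have "perm_mat w ** conjP w M ** matrix_inv (perm_mat w)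
   = (perm_mat w ** transpose (perm_mat w)) ** M ** (perm_mat w ** transpose (perm_mat w))"
  by (simp only: conjP_def perm_mat_inv(3)[OF w] mm_assoc)
 thus ?thesis by (simp add: perm_mat_inv(1)[OF w])
qed

subsection \<open>The formal gauge transformation\<close>

lemma matrix_mult_distrib_right: "(A + B) ** C = A ** C + B ** (C :: 'a::comm_ring_1^'n::finite^'n)"
 by (simp add: vec_eq_iff matrix_matrix_mult_def distrib_right sum.distrib)

text \<open>Neumann series for F = 1 - N. As N has zero constant term, its k-th power vanishes below
  order k, so each coefficient of the series is a finite sum.\<close>

lemma formal_inverse:
 fixes F :: "complex fps^'n::finite^'n"
 assumes F0: "map_matrix (\<lambda>f. fps_nth f 0) F = mat 1"
 shows "invertible F"
  and "matrix_inv (map_matrix fps_to_fls F) ** map_matrix fps_to_fls F = mat 1"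
  and "map_matrix fps_to_fls F ** matrix_inv (map_matrix fps_to_fls F) = mat 1"
proof -
 define N where "N = mat 1 - F"
 have N0: "fps_nth (N $ i $ j) 0 = 0" for i j
  using arg_cong[OF F0, of "\<lambda>M. M $ i $ j"] by (simp add: N_def mat_def split: if_splits)
 define pw where "pw k = ((**) N ^^ k) (mat 1)" for k
 have pw_Suc: "pw (Suc k) = N ** pw k" for k by (simp add: pw_def)
 have pw0: "fps_nth (pw k $ i $ j) m = 0" if "m < k" for k m i j using that
 proof (induction k arbitrary: m i j)
  case (Suc k)
  have "fps_nth (N $ i $ l * pw k $ l $ j) m = 0" for l unfolding fps_mult_nth
  proof (rule sum.neutral, rule ballI)
   fix q assume "q \<in> {0..m}"
   thus "fps_nth (N $ i $ l) q * fps_nth (pw k $ l $ j) (m - q) = 0" using N0[of i l] Suc by (cases "q = 0") auto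
  qed
  thus ?case by (simp add: pw_Suc matrix_matrix_mult_def fps_sum_nth)
 qed simp
 define X where "X = (\<chi> i j. Abs_fps (\<lambda>m. fps_nth ((\<Sum>k\<le>m. pw k) $ i $ j) m))"
 have Xm: "fps_nth (X $ i $ j) q = fps_nth ((\<Sum>k\<le>m. pw k) $ i $ j) q" if "q <= m" for i j q m
 proof -
  have "(\<Sum>k\<le>m. fps_nth (pw k $ i $ j) q) = (\<Sum>k\<le>q. fps_nth (pw k $ i $ j) q)"
   by (rule sum.mono_neutral_right) (use that pw0 in auto)
  thus ?thesis by (simp add: X_def fps_sum_nth)
 qed
 have tele: "F ** (\<Sum>k\<le>m. pw k) = mat 1 - pw (Suc m)" for m
 proof (induction m)
  case 0
  show ?case by (simp add: pw_def N_def)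
 next
  case (Suc m)
  have "F ** pw (Suc m) = pw (Suc m) - pw (Suc (Suc m))"
   unfolding pw_Suc[of "Suc m"] N_def by (simp add: vec_eq_iff matrix_matrix_mult_def left_diff_distrib sum_subtractf mat_def if_distrib[of "\<lambda>x. x * _"] cong: if_cong)
  thus ?case using Suc by (simp add: matrix_add_ldistrib)
 qed
 have "F ** X = mat 1"
 proof (rule vec_eq_iff[THEN iffD2], rule allI, rule vec_eq_iff[THEN iffD2], rule allI, rule fps_ext)
  fix i j m
  have "fps_nth ((F ** X) $ i $ j) m = fps_nth ((F ** (\<Sum>k\<le>m. pw k)) $ i $ j) m"
  proof -
   have "(\<Sum>q=0..m. fps_nth (F $ i $ k) q * fps_nth (X $ k $ j) (m - q))
     = (\<Sum>q=0..m. fps_nth (F $ i $ k) q * fps_nth ((\<Sum>k\<le>m. pw k) $ k $ j) (m - q))" for k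
    by (intro sum.cong refl arg_cong2[where f="(*)"] Xm) simp
   thus ?thesis by (simp add: matrix_matrix_mult_def fps_sum_nth fps_mult_nth del: sum_component)
  qed
  also have "... = fps_nth (mat 1 $ i $ j) m" unfolding tele using pw0[of m "Suc m" i j] by simp
  finally show "fps_nth ((F ** X) $ i $ j) m = fps_nth (mat 1 $ i $ j) m" .
 qed
 have hom: "map_matrix fps_to_fls (A ** B) = map_matrix fps_to_fls A ** map_matrix fps_to_fls B" for A B :: "complex fps^'n^'n"
 proof -
  have "fps_to_fls (\<Sum>k\<in>S. f k) = (\<Sum>k\<in>S. fps_to_fls (f k))" for f :: "'n => complex fps" and S
   by (induction S rule: infinite_finite_induct) (auto simp: fps_to_fls_plus)
  thus ?thesis by (simp add: vec_eq_iff matrix_matrix_mult_def fls_times_fps_to_fls)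
 qed
 have one: "map_matrix fps_to_fls (mat 1 :: complex fps^'n^'n) = mat 1" by (simp add: vec_eq_iff mat_def)
 let ?g = "map_matrix fps_to_fls F" and ?h = "map_matrix fps_to_fls X"
 have gh: "?g ** ?h = mat 1" using \<open>F ** X = mat 1\<close> by (simp add: one flip: hom)
 hence hg: "?h ** ?g = mat 1" using matrix_left_right_inverse by blast
 hence "map_matrix fps_to_fls (X ** F) = map_matrix fps_to_fls (mat 1 :: complex fps^'n^'n)" by (simp add: hom one)
 hence "X ** F = mat 1" by (simp add: vec_eq_iff)
 thus "invertible F" using \<open>F ** X = mat 1\<close> by (auto simp: invertible_def)
 have "matrix_inv ?g = ?h" by (rule inverse_eq_matrix_inv[OF gh hg])
 thus "matrix_inv ?g ** ?g = mat 1" "?g ** matrix_inv ?g = mat 1" using gh hg by simp_all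
qed

text \<open>Multiplication by the gauge matrix on the right and by z^2 removes the inverse and the
  poles. The coefficients of z^(k+1) then give the recursion of \<open>fF\<close> for - A0 and - B,
  and that of z^0 is an identity because the constant term is 1.\<close>

lemma formal_gauge_iff:
 fixes F :: "complex fps^'n::finite^'n"
 assumes F0: "map_matrix (\<lambda>f. fps_nth f 0) F = mat 1" and A0: "A0 \<in> diag_mats"
 shows "formal_gauge (map_matrix fps_to_fls F) (formal_conn A0 (diag_part B)) = formal_conn A0 B
   \<longleftrightarrow> (\<forall>k. comm (- A0) (map_matrix (\<lambda>f. fps_nth f (Suc k)) F) = - fres (- B) k (map_matrix (\<lambda>f. fps_nth f k) F))"
proof -
 let ?g = "map_matrix fps_to_fls F" and ?A = "formal_conn A0 (diag_part B)" and ?C = "formal_conn A0 B"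
 let ?F = "\<lambda>k. map_matrix (\<lambda>f. fps_nth f k) F"
 note inv = formal_inverse(2,3)[OF F0]
 have 1: "formal_gauge ?g ?A = ?C \<longleftrightarrow> ?g ** ?A + map_matrix fls_deriv ?g = ?C ** ?g" (is "?L \<longleftrightarrow> ?R")
 proof
  assume ?L
  hence "(?g ** ?A + map_matrix fls_deriv ?g) ** matrix_inv ?g = ?C" by (simp add: formal_gauge_def matrix_mult_distrib_right)
  hence "?C ** ?g = (?g ** ?A + map_matrix fls_deriv ?g) ** (matrix_inv ?g ** ?g)" by (simp only: mm_assoc)
  thus ?R by (simp add: inv)
 next
  assume ?R
  hence "(?g ** ?A + map_matrix fls_deriv ?g) ** matrix_inv ?g = ?C ** (?g ** matrix_inv ?g)" by (simp only: mm_assoc)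
  thus ?L by (simp add: formal_gauge_def matrix_mult_distrib_right inv)
 qed
 have ps: "fps_to_fls (\<Sum>k\<in>S. f k) = (\<Sum>k\<in>S. fps_to_fls (f k))" for f :: "'n => complex fps" and S
  by (induction S rule: infinite_finite_induct) (auto simp: fps_to_fls_plus)
 define LL where "LL i j = (\<Sum>k\<in>UNIV. F $ i $ k * fps_const (A0 $ k $ j))
   + fps_X * (\<Sum>k\<in>UNIV. F $ i $ k * fps_const (diag_part B $ k $ j)) + fps_X^2 * fps_deriv (F $ i $ j)" for i j
 define RR where "RR i j = (\<Sum>k\<in>UNIV. fps_const (A0 $ i $ k) * F $ k $ j)
   + fps_X * (\<Sum>k\<in>UNIV. fps_const (B $ i $ k) * F $ k $ j)" for i j
 have XX: "fls_X * fls_X_inv = (1 :: complex fls)" by (simp add: fls_X_times_conv_shift)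
 have x1: "(fls_X^2 :: complex fls) * (fls_X_inv^2) = 1" "(fls_X^2 :: complex fls) * fls_X_inv = fls_X"
  by (simp_all add: power2_eq_square mult.assoc) (simp_all add: XX flip: mult.assoc)
 have l: "fls_X^2 * (?g ** ?A + map_matrix fls_deriv ?g) $ i $ j = fps_to_fls (LL i j)" for i j
 proof -
  have "fls_X^2 * (fps_to_fls (F $ i $ k) * (fls_X_inv^2 * fls_const (A0 $ k $ j) + fls_X_inv * fls_const (diag_part B $ k $ j)))
    = (fls_X^2 * fls_X_inv^2) * (fps_to_fls (F $ i $ k) * fls_const (A0 $ k $ j))
     + (fls_X^2 * fls_X_inv) * (fps_to_fls (F $ i $ k) * fls_const (diag_part B $ k $ j))" for k by (simp add: algebra_simps)
  hence "fls_X^2 * (?g ** ?A) $ i $ j = (\<Sum>k\<in>UNIV. fps_to_fls (F $ i $ k) * fls_const (A0 $ k $ j))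
    + (\<Sum>k\<in>UNIV. fls_X * (fps_to_fls (F $ i $ k) * fls_const (diag_part B $ k $ j)))"
   by (simp add: matrix_matrix_mult_def formal_conn_def sum_distrib_left x1 sum.distrib)
  thus ?thesis by (simp add: LL_def fps_to_fls_plus fls_times_fps_to_fls ps distrib_left fls_deriv_fps_to_fls
     fps_to_fls_power sum_distrib_left)
 qed
 have r: "fls_X^2 * (?C ** ?g) $ i $ j = fps_to_fls (RR i j)" for i j
 proof -
  have "fls_X^2 * ((fls_X_inv^2 * fls_const (A0 $ i $ k) + fls_X_inv * fls_const (B $ i $ k)) * fps_to_fls (F $ k $ j))
    = (fls_X^2 * fls_X_inv^2) * (fls_const (A0 $ i $ k) * fps_to_fls (F $ k $ j))
     + (fls_X^2 * fls_X_inv) * (fls_const (B $ i $ k) * fps_to_fls (F $ k $ j))" for k by (simp add: algebra_simps)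
  hence "fls_X^2 * (?C ** ?g) $ i $ j = (\<Sum>k\<in>UNIV. fls_const (A0 $ i $ k) * fps_to_fls (F $ k $ j))
    + (\<Sum>k\<in>UNIV. fls_X * (fls_const (B $ i $ k) * fps_to_fls (F $ k $ j)))"
   by (simp add: matrix_matrix_mult_def formal_conn_def sum_distrib_left x1 sum.distrib)
  thus ?thesis by (simp add: RR_def fps_to_fls_plus fls_times_fps_to_fls ps sum_distrib_left)
 qed
 have 2: "?R \<longleftrightarrow> (\<forall>i j. LL i j = RR i j)"
 proof -
  have "?R \<longleftrightarrow> (\<forall>i j. fls_X^2 * (?g ** ?A + map_matrix fls_deriv ?g) $ i $ j = fls_X^2 * (?C ** ?g) $ i $ j)"
   by (simp add: vec_eq_iff)
  thus ?thesis unfolding l r by simp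
 qed
 have L0: "fps_nth (LL i j) 0 = (?F 0 ** A0) $ i $ j" and R0: "fps_nth (RR i j) 0 = (A0 ** ?F 0) $ i $ j" for i j
  by (simp_all add: LL_def RR_def fps_sum_nth mm_nth fps_X_power_mult_nth fps_mult_left_const_nth fps_mult_right_const_nth)
 have LS: "fps_nth (LL i j) (Suc k) = (?F (Suc k) ** A0 + ?F k ** diag_part B + cscale (of_nat k) (?F k)) $ i $ j"
  and RS: "fps_nth (RR i j) (Suc k) = (A0 ** ?F (Suc k) + B ** ?F k) $ i $ j" for i j k
 proof -
  show "fps_nth (RR i j) (Suc k) = (A0 ** ?F (Suc k) + B ** ?F k) $ i $ j" by (simp add: RR_def fps_sum_nth mm_nth)
  have "fps_nth (fps_X^2 * fps_deriv (F $ i $ j)) (Suc k) = of_nat k * fps_nth (F $ i $ j) k"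
   by (cases k) (simp_all add: fps_X_power_mult_nth)
  thus "fps_nth (LL i j) (Suc k) = (?F (Suc k) ** A0 + ?F k ** diag_part B + cscale (of_nat k) (?F k)) $ i $ j"
   by (simp add: LL_def fps_sum_nth mm_nth)
 qed
 have F0': "?F 0 = mat 1" by (rule F0)
 have "(\<forall>i j. LL i j = RR i j) \<longleftrightarrow> (\<forall>k. ?F (Suc k) ** A0 + ?F k ** diag_part B + cscale (of_nat k) (?F k) = A0 ** ?F (Suc k) + B ** ?F k)"
 proof
  assume "\<forall>i j. LL i j = RR i j"
  thus "\<forall>k. ?F (Suc k) ** A0 + ?F k ** diag_part B + cscale (of_nat k) (?F k) = A0 ** ?F (Suc k) + B ** ?F k"
   by (intro allI cmat_eqI) (metis LS RS)
 next
  assume h: "\<forall>k. ?F (Suc k) ** A0 + ?F k ** diag_part B + cscale (of_nat k) (?F k) = A0 ** ?F (Suc k) + B ** ?F k"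
  show "\<forall>i j. LL i j = RR i j"
  proof (intro allI fps_ext)
   fix i j n
   show "fps_nth (LL i j) n = fps_nth (RR i j) n"
   proof (cases n)
    case 0 thus ?thesis unfolding 0 L0 R0 F0' by simp
   next
    case (Suc k) thus ?thesis unfolding Suc LS RS using h by simp
   qed
  qed
 qed
 also have "... \<longleftrightarrow> (\<forall>k. comm (- A0) (?F (Suc k)) = - fres (- B) k (?F k))"
 proof (intro all_cong1)
  fix k
  have "diag_part (- B) = - diag_part B" by (simp add: vec_eq_iff diag_part_nth)
  hence "comm (- A0) (?F (Suc k)) = - fres (- B) k (?F k) \<longleftrightarrow>
    ?F (Suc k) ** A0 - A0 ** ?F (Suc k) = B ** ?F k - ?F k ** diag_part B - cscale (of_nat k) (?F k)"
   by (simp add: comm_def fres_def mm.minus_left mm.minus_right algebra_simps)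
  thus "?F (Suc k) ** A0 + ?F k ** diag_part B + cscale (of_nat k) (?F k) = A0 ** ?F (Suc k) + B ** ?F k
   \<longleftrightarrow> comm (- A0) (?F (Suc k)) = - fres (- B) k (?F k)" by (simp add: algebra_simps)
 qed
 finally show ?thesis using 1 2 by simp
qed

lemma formal_F_nth:
 assumes A0: "A0 \<in> diag_mats" "inj (\<lambda>i. A0 $ i $ i)"
 shows "map_matrix (\<lambda>f. fps_nth f k) (formal_F A0 B) = fF (- A0) (- B) k"
proof -
 define Q where "Q F \<longleftrightarrow> invertible F & map_matrix (\<lambda>f. fps_nth f 0) F = mat 1 &
   formal_gauge (map_matrix fps_to_fls F) (formal_conn A0 (diag_part B)) = formal_conn A0 B" for F
 have a: "- A0 \<in> diag_mats" "inj (\<lambda>i. (- A0) $ i $ i)" using A0 by (auto simp: inj_def)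
 define F where "F = (\<chi> i j. Abs_fps (\<lambda>k. fF (- A0) (- B) k $ i $ j))"
 have Fk: "map_matrix (\<lambda>f. fps_nth f k) F = fF (- A0) (- B) k" for k by (rule cmat_eqI) (simp add: F_def)
 have F0: "map_matrix (\<lambda>f. fps_nth f 0) F = mat 1" unfolding Fk by simp
 have QF: "Q F" unfolding Q_def using formal_inverse(1)[OF F0] F0 formal_gauge_iff[OF F0 A0(1), of B] comm_fF[OF a, of "- B"]
  unfolding Fk by blast
 have coef: "map_matrix (\<lambda>f. fps_nth f k) F' = fF (- A0) (- B) k" if "Q F'" for F' k
 proof (rule fF_unique[OF a, where G="\<lambda>k. map_matrix (\<lambda>f. fps_nth f k) F'"])
  show F0': "map_matrix (\<lambda>f. fps_nth f 0) F' = mat 1" using that by (simp add: Q_def)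
  show "comm (- A0) (map_matrix (\<lambda>f. fps_nth f (Suc k)) F') = - fres (- B) k (map_matrix (\<lambda>f. fps_nth f k) F')" for k
   using formal_gauge_iff[OF F0' A0(1), of B] that unfolding Q_def by blast
 qed
 have "F' = F" if "Q F'" for F'
 proof (rule vec_eq_iff[THEN iffD2], rule allI, rule vec_eq_iff[THEN iffD2], rule allI, rule fps_ext)
  fix i j k
  show "fps_nth (F' $ i $ j) k = fps_nth (F $ i $ j) k"
   using arg_cong[OF trans[OF coef[OF that, of k] Fk[of k, symmetric]], of "\<lambda>M. M $ i $ j"] by simp
 qed
 hence "Q (The Q)" using QF by (intro theI[of Q])
 thus ?thesis using coef unfolding formal_F_def Q_def by blast
qed

subsection \<open>Canonical sums and Stokes matrices\<close>

lemma has_mderiv_Hf: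
 assumes c: "c \<in> diag_mats"
 shows "has_mderiv (Hf c b) (lcoef c b u ** Hf c b u - Hf c b u ** lcoef c (diag_part b) u) u"
 using has_mderiv_mult[OF has_mderiv_Phi0[of c b u] has_mderiv_Dd(2)[OF c, of b u]] unfolding Hf_def by (simp add: mm.minus_right mm_assoc)

text \<open>Multiplying a by \<zeta> divides the k-th coefficient by \<zeta>^k. With \<zeta> = e^(i
  s) this carries the formal solution over to a rotated sector.\<close>

lemma fF_rotate:
 assumes a: "a \<in> diag_mats" "inj (\<lambda>i. a $ i $ i)" and c: "c = cscale \<zeta> a" "irr c"
 shows "cscale (\<zeta> ^ k) (fF c b k) = fF a b k"
proof (rule fF_unique[OF a, where G="\<lambda>k. cscale (\<zeta> ^ k) (fF c b k)"])
 fix k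
 have fres_scale: "fres b k (cscale x F) = cscale x (fres b k F)" for x F by (simp add: fres_def cs.add_right cs.diff_right mult.commute)
 have "comm c F = cscale \<zeta> (comm a F)" for F by (simp add: c(1) comm_def cs.diff_right)
 hence "comm a (cscale (\<zeta> ^ Suc k) F) = cscale (\<zeta> ^ k) (comm c F)" for F by (simp add: comm_def cs.diff_right mult.commute)
 thus "comm a (cscale (\<zeta> ^ Suc k) (fF c b (Suc k))) = - fres b k (cscale (\<zeta> ^ k) (fF c b k))"
  unfolding fres_scale using comm_fF[OF irrD(1)[OF c(2)] irrD(3)[OF c(2)], of b k] by (simp add: cs.minus_right del: fF.simps)
qed simp

context
 fixes A0 B a b c :: "'n::finite cmat" and s :: real
 assumes A0: "A0 \<in> diag_mats" "dagger A0 = - A0" "inj (\<lambda>i. A0 $ i $ i)"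
  and B: "dagger B = - B" and ab: "a = - A0" "b = - B"
  and c: "c = cscale (exp (\<i> * of_real s)) a" "irr c"
begin

text \<open>The parameter s rotates the picture: the sector centred at the angle - s corresponds to
  u near the real axis for the matrix c = e^(i s) a. The values used are s = 0 for the initial
  sector and s = pi for the opposite one, whose branch is continued in the negative sense.\<close>

lemma conn_lcoef:
 assumes z: "z = exp w" and u: "u = - w - \<i> * of_real s"
 shows "cscale (- z) (conn A0 B z) = lcoef c b u" "cscale (- z) (conn A0 (diag_part B) z) = lcoef c (diag_part b) u"
  "cscale (- (1 / z)) (lcoef c b u) = conn A0 B z" "cscale (- (1 / z)) (lcoef c (diag_part b) u) = conn A0 (diag_part B) z"
proof -
 have "exp u * exp (\<i> * of_real s) = 1 / z" by (simp add: z u exp_diff exp_minus inverse_eq_divide)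
 hence "cscale (exp u) c = cscale (1 / z) a" by (simp add: c(1))
 hence l: "lcoef c b' u = cscale (1 / z) a + b'" for b' by (simp add: lcoef_def)
 have d: "diag_part b = - diag_part B" by (simp add: ab vec_eq_iff diag_part_nth)
 have z0: "z ~= 0" by (simp add: z)
 show "cscale (- z) (conn A0 B z) = lcoef c b u" "cscale (- z) (conn A0 (diag_part B) z) = lcoef c (diag_part b) u"
  "cscale (- (1 / z)) (lcoef c b u) = conn A0 B z" "cscale (- (1 / z)) (lcoef c (diag_part b) u) = conn A0 (diag_part B) z"
  unfolding l conn_def d unfolding ab by (rule cmat_eqI; use z0 in \<open>simp add: field_simps power2_eq_square\<close>)+
qed

lemma cscale_gauge: "cscale x (M ** N - N' ** P) = cscale x M ** N - N' ** cscale x P" for M N N' P :: "'n cmat"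
 by (simp add: cs.diff_right)

definition Xs :: "complex => 'n cmat" where
 "Xs z = Hf c b (- sector_log (- s - pi) (- s + pi) z - \<i> * of_real s)"

lemma Xs_exp: "- s - pi < Im w ==> Im w < - s + pi ==> Xs (exp w) = Hf c b (- w - \<i> * of_real s)"
 by (simp add: Xs_def sector_log_exp)

lemma b_tube: "b \<in> tube"
 using tube_skew[of b] B by (simp add: ab dagger_uminus)

lemma has_mderiv_Xs:
 assumes z: "z \<in> sector (- s - pi) (- s + pi)"
 shows "has_mderiv Xs (conn A0 B z ** Xs z - Xs z ** conn A0 (diag_part B) z) z"
proof -
 obtain w where w: "z = exp w" "- s - pi < Im w" "Im w < - s + pi" using z by (rule sector_logE)
 define u where "u = - w - \<i> * of_real s"
 have Xz: "Xs z = Hf c b u" unfolding w(1) u_def by (rule Xs_exp[OF w(2,3)])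
 have lw: "- sector_log (- s - pi) (- s + pi) z - \<i> * of_real s = u" using w by (simp add: sector_log_exp u_def)
 have "((\<lambda>z. - sector_log (- s - pi) (- s + pi) z - \<i> * of_real s) has_field_derivative (- (1 / z))) (at z)"
  using sector_log_deriv[OF z] by (auto intro!: derivative_eq_intros)
 from has_mderiv_chain[OF has_mderiv_Hf[OF irrD(1)[OF c(2)]] this]
 have "has_mderiv Xs (cscale (- (1 / z)) (lcoef c b u ** Hf c b u - Hf c b u ** lcoef c (diag_part b) u)) z" unfolding Xs_def[abs_def] lw .
 thus ?thesis unfolding Xz using conn_lcoef(3,4)[OF w(1) u_def] by (simp only: cscale_gauge)
qed

text \<open>Existence of the canonical sum. The extended sector has opening 2 pi and corresponds
  exactly to \<open>\<bar>Im u\<bar> < pi\<close>, the range of \<open>sector_H\<close>.\<close>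

lemma Xs_canonical: "is_canonical_sum A0 B (- s - pi / 2) (- s + pi / 2) Xs"
 unfolding is_canonical_sum_def
proof (intro conjI ballI)
 have op: "open (sector (- s - pi) (- s + pi))" by (rule open_sector) simp
 have e: "- s - pi / 2 - pi / 2 = - s - pi" "- s + pi / 2 + pi / 2 = - s + pi" by simp_all
 show "mat_holomorphic_on Xs (sector (- s - pi / 2 - pi / 2) (- s + pi / 2 + pi / 2))"
  unfolding e mat_holomorphic_iff[OF op] using has_mderiv_Xs by blast
 show "asymptotic_in Xs (formal_F A0 B) (- s - pi / 2 - pi / 2) (- s + pi / 2 + pi / 2)" unfolding e asymptotic_in_def
 proof (intro allI impI)
  fix \<alpha> \<beta> and N :: nat assume \<alpha>\<beta>: "- s - pi < \<alpha>" "\<alpha> < \<beta>" "\<beta> < - s + pi"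
  define \<epsilon> where "\<epsilon> = min (\<alpha> - (- s - pi)) (- s + pi - \<beta>)"
  have \<epsilon>: "0 < \<epsilon>" "\<epsilon> <= pi" using \<alpha>\<beta> by (auto simp: \<epsilon>_def min_def)
  \<comment> \<open>\<open>sector_H\<close> requires order at least 2; the surplus terms of index N
    to m are moved into the constant.\<close>
  define m where "m = max 2 N"
  have m: "2 <= m" "N <= m" by (auto simp: m_def)
  obtain C R where C: "0 <= C" "0 <= R" and H: "!!u. \<bar>Im u\<bar> <= pi - \<epsilon> ==> R <= Re u ==>
    norm (Hf c b u - asE m c b u) <= C * exp (- real m * Re u)"
   using sector_H[OF c(2) \<epsilon> norm_ge_zero[of b] m(1)] b_tube by blast
  define F where "F k = map_matrix (\<lambda>f. fps_nth f k) (formal_F A0 B)" for k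
  have Fk: "F k = cscale (exp (\<i> * of_real s) ^ k) (fF c b k)" for k unfolding F_def formal_F_nth[OF A0(1,3)]
   using fF_rotate[of a c "exp (\<i> * of_real s)" k b] A0 c ab by (simp add: inj_def)
  define C' where "C' = C + (\<Sum>k=N..m. norm (F k))"
  have "norm (Xs z - (\<Sum>k<N. cscale (z ^ k) (F k))) <= C' * norm z ^ N"
   if z: "z \<in> sector \<alpha> \<beta>" "norm z < exp (- R)" for z
  proof -
   obtain w where w: "z = exp w" "\<alpha> < Im w" "Im w < \<beta>" using z(1) by (rule sector_logE)
   define u where "u = - w - \<i> * of_real s"
   have Rew: "Re w < - R" using z(2) by (simp add: w)
   have z1: "norm z <= 1" using Rew C by (simp add: w)
   have iu: "\<bar>Im u\<bar> <= pi - \<epsilon>" using w by (auto simp: u_def \<epsilon>_def abs_le_iff min_def)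
   have Ru: "R <= Re u" using Rew by (simp add: u_def)
   have "exp (- real m * Re u) = norm z ^ m" by (simp add: u_def w flip: exp_of_nat_mult)
   hence h: "norm (Hf c b u - asE m c b u) <= C * norm z ^ m" using H[OF iu Ru] by simp
   have "exp (- of_nat k * u) = z ^ k * exp (\<i> * of_real s) ^ k" for k
    by (simp add: u_def w algebra_simps exp_add flip: exp_of_nat_mult)
   hence aE: "asE m c b u = (\<Sum>k\<le>m. cscale (z ^ k) (F k))" by (simp add: asE_def Fk)
   have "{..m} = {..<N} \<union> {N..m}" using m by auto
   hence spl: "(\<Sum>k\<le>m. cscale (z ^ k) (F k)) = (\<Sum>k<N. cscale (z ^ k) (F k)) + (\<Sum>k=N..m. cscale (z ^ k) (F k))"
    by (simp add: sum.union_disjoint[of "{..<N}" "{N..m}"] ivl_disj_int)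
   have "norm (\<Sum>k=N..m. cscale (z ^ k) (F k)) <= (\<Sum>k=N..m. norm z ^ N * norm (F k))"
    by (rule order_trans[OF norm_sum], rule sum_mono) (auto simp: norm_cscale norm_power intro!: mult_right_mono power_decreasing z1)
   hence t: "norm (\<Sum>k=N..m. cscale (z ^ k) (F k)) <= (\<Sum>k=N..m. norm (F k)) * norm z ^ N"
    by (simp only: sum_distrib_right mult.commute[of "norm z ^ N"])
   have "C * norm z ^ m <= C * norm z ^ N" by (intro mult_left_mono power_decreasing z1 m C) auto
   moreover have "Xs z = Hf c b u" unfolding w(1) u_def by (rule Xs_exp) (use w \<alpha>\<beta> in auto)
   ultimately show ?thesis using h t norm_triangle_ineq[of "Hf c b u - asE m c b u" "\<Sum>k=N..m. cscale (z ^ k) (F k)"]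
    unfolding aE spl C'_def distrib_right by simp
  qed
  thus "\<exists>C. \<exists>\<rho>>0. \<forall>z\<in>sector \<alpha> \<beta>. norm z < \<rho> -->
     norm (Xs z - (\<Sum>k<N. cscale (z ^ k) (map_matrix (\<lambda>f. fps_nth f k) (formal_F A0 B)))) <= C * norm z ^ N"
   unfolding F_def by (intro exI[of _ C'] exI[of _ "exp (- R)"]) auto
 qed
 fix z assume "z \<in> sector (- s - pi / 2) (- s + pi / 2)"
 then obtain w where w: "z = exp w" "- s - pi / 2 < Im w" "Im w < - s + pi / 2" by (rule sector_logE)
 have z': "z \<in> sector (- s - pi) (- s + pi)" unfolding w(1) using w pi_gt_zero by (intro exp_in_sector) linarith+
 have Xz: "Xs z = Hf c b (- w - \<i> * of_real s)" unfolding w(1) using w pi_gt_zero by (intro Xs_exp) linarith+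
 show "invertible (Xs z)" unfolding Xz invertible_def using Hf_Hi[OF c(2) b_tube] by blast
 have iv: "Xs z ** matrix_inv (Xs z) = mat 1"
  unfolding Xz using inverse_eq_matrix_inv[OF Hf_Hi[OF c(2) b_tube]] Hf_Hi[OF c(2) b_tube] by simp
 have "gauge Xs (conn A0 (diag_part B)) z = conn A0 B z ** (Xs z ** matrix_inv (Xs z))"
  unfolding gauge_def has_mderiv_mat_deriv[OF has_mderiv_Xs[OF z']] by (simp add: mm.diff_left mm_assoc)
 thus "gauge Xs (conn A0 (diag_part B)) z = conn A0 B z" by (simp add: iv)
qed

text \<open>The quotient of X by \<open>Hf\<close> is a constant matrix K conjugated by
  \<open>Dd\<close>. On the real u-axis this conjugation multiplies the entries of K by numbers of
  modulus 1, since b and c are skew-Hermitian, while the quotient tends to 1; hence K = 1.\<close>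

lemma canonical_unique:
 assumes X: "is_canonical_sum A0 B (- s - pi / 2) (- s + pi / 2) X"
  and w: "- s - pi / 2 < Im w" "Im w < - s + pi / 2"
 shows "X (exp w) = Hf c b (- w - \<i> * of_real s)"
proof -
 define Y where "Y v = X (exp (- (v + \<i> * of_real s)))" for v
 define S where "S = {v. - (pi / 2) < Im v & Im v < pi / 2}"
 have S: "convex S" "open S" unfolding S_def by (rule convex_strip open_strip)+
 have e: "- s - pi / 2 - pi / 2 = - s - pi" "- s + pi / 2 + pi / 2 = - s + pi" by simp_all
 have op: "open (sector (- s - pi) (- s + pi))" by (rule open_sector) simp
 have hol: "\<exists>X'. has_mderiv X X' z" if "z \<in> sector (- s - pi) (- s + pi)" for z
  using X that mat_holomorphic_iff[OF op] unfolding is_canonical_sum_def e by blast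
 have Yd: "has_mderiv Y (lcoef c b v ** Y v - Y v ** lcoef c (diag_part b) v) v" if v: "v \<in> S" for v
 proof -
  define w where "w = - (v + \<i> * of_real s)"
  define z where "z = exp w"
  have w1: "- s - pi / 2 < Im w" "Im w < - s + pi / 2" using v by (auto simp: S_def w_def)
  have z1: "z \<in> sector (- s - pi / 2) (- s + pi / 2)" unfolding z_def by (rule exp_in_sector[OF w1])
  have z2: "z \<in> sector (- s - pi) (- s + pi)" unfolding z_def using w1 pi_gt_zero by (intro exp_in_sector) linarith+
  obtain X' where X': "has_mderiv X X' z" using hol[OF z2] by blast
  have iv: "invertible (X z)" and g: "gauge X (conn A0 (diag_part B)) z = conn A0 B z" using X z1 by (auto simp: is_canonical_sum_def)
  obtain Q where Q: "X z ** Q = mat 1" "Q ** X z = mat 1" using iv by (auto simp: invertible_def)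
  have mi: "matrix_inv (X z) = Q" by (rule inverse_eq_matrix_inv[OF Q])
  have "(X z ** conn A0 (diag_part B) z + X') ** Q ** X z = conn A0 B z ** X z"
   using g unfolding gauge_def has_mderiv_mat_deriv[OF X'] mi by (simp add: mm.add_left)
  hence "X z ** conn A0 (diag_part B) z + X' = conn A0 B z ** X z" by (simp add: Q flip: mm_assoc)
  hence X'': "X' = conn A0 B z ** X z - X z ** conn A0 (diag_part B) z" by (simp add: algebra_simps)
  have "((\<lambda>v. exp (- (v + \<i> * of_real s))) has_field_derivative - z) (at v)"
   unfolding z_def w_def by (auto intro!: derivative_eq_intros)
  from has_mderiv_chain[OF _ this, of X X'] X'
  have "has_mderiv Y (cscale (- z) X') v" unfolding Y_def z_def w_def by simp
  moreover have "v = - w - \<i> * of_real s" by (simp add: w_def)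
  note conn_lcoef(1,2)[OF z_def this]
  hence "cscale (- z) X' = lcoef c b v ** X z - X z ** lcoef c (diag_part b) v" unfolding X'' by (simp only: cscale_gauge)
  ultimately show ?thesis by (simp add: Y_def z_def w_def)
 qed
 define K where "K v = Gi c b v ** Y v ** Dd c b v" for v
 have K0: "K v = K 0" if "v \<in> S" for v
 proof (rule has_mderiv_zero_constant[OF S _ that])
  fix v assume v: "v \<in> S"
  have "has_mderiv (\<lambda>v. Gi c b v ** Y v ** Dd c b v)
   ((- (Gi c b v ** lcoef c b v) ** Y v + Gi c b v ** (lcoef c b v ** Y v - Y v ** lcoef c (diag_part b) v)) ** Dd c b v
    + Gi c b v ** Y v ** (lcoef c (diag_part b) v ** Dd c b v)) v"
   by (intro has_mderiv_mult has_mderiv_Gi[OF c(2) b_tube] Yd[OF v] has_mderiv_Dd irrD(1) c(2))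
  thus "has_mderiv K 0 v" unfolding K_def by (simp add: mm.minus_left mm.diff_left mm.diff_right mm.add_left mm_assoc)
 qed (simp add: S_def)
 have YK: "Hi c b v ** Y v = Dd c b v ** K 0 ** Di c b v" if "v \<in> S" for v
  using K0[OF that] unfolding K_def Hi_def by (metis Dd_Di(1) mm_assoc matrix_mul_rid)
 have lim: "((\<lambda>t. Hi c b (of_real t) ** Y (of_real t)) \<longlongrightarrow> mat 1 ** mat 1) at_top"
 proof (rule mm.tendsto)
  show "((\<lambda>t. Hi c b (complex_of_real t)) \<longlongrightarrow> mat 1) at_top"
   using sector_H_tendsto(2)[OF c(2) b_tube, of 0] by (simp add: complex_of_real_def)
  have as: "asymptotic_in X (formal_F A0 B) (- s - pi) (- s + pi)" using X unfolding is_canonical_sum_def e by blast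
  have "\<exists>C. \<exists>\<rho>>0. \<forall>z\<in>sector (- s - 1) (- s + 1). norm z < \<rho> -->
     norm (X z - (\<Sum>k<Suc 0. cscale (z ^ k) (map_matrix (\<lambda>f. fps_nth f k) (formal_F A0 B)))) <= C * norm z ^ Suc 0"
   by (rule as[unfolded asymptotic_in_def, rule_format]) (use pi_gt3 in linarith)+
  then obtain C \<rho> where C: "0 < \<rho>" "!!z. z \<in> sector (- s - 1) (- s + 1) ==> norm z < \<rho> ==>
     norm (X z - mat 1) <= C * norm z" unfolding formal_F_nth[OF A0(1,3)] by auto
  have est: "norm (Y (of_real t) - mat 1) <= C * exp (- 1 * t)" if "- ln \<rho> < t" for t
  proof -
   have "exp (- t) < \<rho>" using that C(1) by (metis exp_less_mono exp_ln minus_less_iff)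
   thus ?thesis unfolding Y_def
    using C(2)[of "exp (- (of_real t + \<i> * of_real s))"] exp_in_sector[of "- s - 1" "- (of_real t + \<i> * of_real s)" "- s + 1"]
    by (simp add: norm_exp_eq_Re)
  qed
  have z: "((\<lambda>t. C * exp (- 1 * t)) \<longlongrightarrow> C * 0) at_top"
   by (intro tendsto_mult tendsto_const exp_decay_tendsto) simp
  have "((\<lambda>t. norm (Y (of_real t) - mat 1)) \<longlongrightarrow> 0) at_top"
   by (rule tendsto_sandwich[OF _ eventually_mono[OF eventually_gt_at_top est] tendsto_const]) (use z in auto)
  thus "((\<lambda>t. Y (complex_of_real t)) \<longlongrightarrow> mat 1) at_top" by (simp add: tendsto_norm_zero_iff LIM_zero_iff)
 qed
 have rS: "complex_of_real t \<in> S" for t by (simp add: S_def)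
 have "K 0 $ i $ j = mat 1 $ i $ j" for i j
 proof -
  have l: "((\<lambda>t. (Dd c b (of_real t) ** K 0 ** Di c b (of_real t)) $ i $ j) \<longlongrightarrow> mat 1 $ i $ j) at_top"
   using tendsto_entry[OF lim, of i j] YK[OF rS] by simp
  show ?thesis
  proof (cases "i = j")
   case True
   hence "((\<lambda>t::real. K 0 $ i $ j) \<longlongrightarrow> mat 1 $ i $ j) at_top" using l unfolding conj_entry by simp
   thus ?thesis using tendsto_unique[OF trivial_limit_at_top_linorder tendsto_const] by blast
  next
   case False
   have "Re (b $ k $ k) = 0" "Re (c $ k $ k) = 0" for k using skew_diag_Re[OF B] irrD(2)[OF c(2)] by (auto simp: ab)
   hence "cmod ((Dd c b (of_real t) ** K 0 ** Di c b (of_real t)) $ i $ j) = cmod (K 0 $ i $ j)" for t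
    unfolding conj_entry by (simp add: norm_mult norm_exp_eq_Re Re_exp Im_exp)
   hence "((\<lambda>t::real. cmod (K 0 $ i $ j)) \<longlongrightarrow> cmod (mat 1 $ i $ j :: complex)) at_top" using tendsto_norm[OF l] by simp
   hence "cmod (K 0 $ i $ j) = cmod (mat 1 $ i $ j :: complex)"
    using tendsto_unique[OF trivial_limit_at_top_linorder tendsto_const] by blast
   thus ?thesis using False by (simp add: mat_one_nth)
  qed
 qed
 hence K1: "K 0 = mat 1" by (rule cmat_eqI)
 define v where "v = - w - \<i> * of_real s"
 have vS: "v \<in> S" using w by (simp add: v_def S_def)
 have "Hi c b v ** Y v = mat 1" using YK[OF vS] K1 by simp
 hence "Hf c b v ** (Hi c b v ** Y v) = Hf c b v" by simp
 hence "Y v = Hf c b v" by (simp add: mm_assoc Hf_Hi[OF c(2) b_tube])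
 thus ?thesis by (simp add: Y_def v_def)
qed

lemma canonical_sum_exp:
 assumes "- s - pi / 2 < Im w" "Im w < - s + pi / 2"
 shows "canonical_sum A0 B (- s - pi / 2) (- s + pi / 2) (exp w) = Hf c b (- w - \<i> * of_real s)"
 by (rule canonical_unique[OF _ assms]) (unfold canonical_sum_def, rule someI[of _ Xs], rule Xs_canonical)

lemma Phi_tail:
 "diag_exp (cscale w (diag_part B)) ** diag_exp (irr_Q A0 (exp w)) = Dd a b (- w)"
proof -
 have "cscale w (diag_part B) + irr_Q A0 (exp w) = cscale (- w) (diag_part b) + cscale (exp (- w)) a"
  using A0(1) by (simp add: vec_eq_iff irr_Q_def irr_q_def ab diag_part_nth diag_mats_def exp_minus divide_inverse)
 thus ?thesis by (simp add: Dd_def flip: diag_exp_add)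
qed

end

lemma mat_identity_sector:
 assumes S: "\<beta> - \<alpha> <= 2 * pi" and X: "mat_holomorphic_on X (sector \<alpha> \<beta>)" "mat_holomorphic_on Y (sector \<alpha> \<beta>)"
  and U: "\<alpha> <= \<alpha>'" "\<alpha>' < \<beta>'" "\<beta>' <= \<beta>" and eq: "!!z. z \<in> sector \<alpha>' \<beta>' ==> X z = Y z"
  and z: "z \<in> sector \<alpha> \<beta>"
 shows "X z = Y z"
proof (rule cmat_eqI)
 fix i j
 have sub: "sector \<alpha>' \<beta>' \<subseteq> sector \<alpha> \<beta>" using U by (force simp: sector_eq)
 have ne: "sector \<alpha>' \<beta>' ~= {}" using exp_in_sector[of \<alpha>' "Complex 0 ((\<alpha>' + \<beta>') / 2)" \<beta>'] U by auto
 show "X z $ i $ j = Y z $ i $ j"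
  by (rule analytic_continuation_open[OF open_sector open_sector[OF S] ne connected_sector sub, of "\<lambda>z. X z $ i $ j" "\<lambda>z. Y z $ i $ j"])
   (use X eq z U S in \<open>auto simp: mat_holomorphic_on_def\<close>)
qed

lemma mat_holomorphic_log:
 assumes S: "\<beta> - \<alpha> <= 2 * pi" and X: "!!u. \<exists>X'. has_mderiv X X' u"
 shows "mat_holomorphic_on (\<lambda>z. X (- sector_log \<alpha> \<beta> z) ** M) (sector \<alpha> \<beta>)"
 unfolding mat_holomorphic_iff[OF open_sector[OF S]]
proof
 fix z assume z: "z \<in> sector \<alpha> \<beta>"
 obtain X' where X': "has_mderiv X X' (- sector_log \<alpha> \<beta> z)" using X by blast
 have "((\<lambda>z. - sector_log \<alpha> \<beta> z) has_field_derivative - (1 / z)) (at z)"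
  by (rule DERIV_minus[OF sector_log_deriv[OF z S]])
 from has_mderiv_mult[OF has_mderiv_chain[OF X' this] has_mderiv_const]
 show "\<exists>Y'. has_mderiv (\<lambda>z. X (- sector_log \<alpha> \<beta> z) ** M) Y' z" by blast
qed

section \<open>The Stokes matrices and the monodromy data for imaginary irregular type\<close>

context
 fixes A0 B a b E Ei :: "'n::{finite,wellorder} cmat" and d :: "int => real" and w :: "'n => 'n"
 assumes A0: "A0 \<in> diag_mats" "dagger A0 = - A0" "inj (\<lambda>i. A0 $ i $ i)"
  and B: "dagger B = - B" and ab: "a = - A0" "b = - B"
  and d: "!!k. d k = of_int k * pi - pi / 2" and w: "w = stokes_perm A0 1 d"
  and E: "E = diag_exp (cscale (\<i> * of_real pi) (diag_part b))" "Ei = diag_exp (- cscale (\<i> * of_real pi) (diag_part b))"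
begin

lemma irr_a: "irr a" "irr (- a)"
 using A0 skew_diag_Re[OF A0(2)] by (auto simp: ab irr_def inj_def)

lemma b_skew: "dagger b = - b" "b \<in> tube" "dagger b = - b"
 using B tube_skew[of b] by (auto simp: ab dagger_uminus)

lemma w_perm: "bij w" "w i < w j \<longleftrightarrow> Im (A0 $ j $ j) < Im (A0 $ i $ i)"
 using stokes_perm_imaginary[OF A0(2,3), of d] d unfolding w by simp_all

lemma EEi: "E ** Ei = mat 1" "Ei ** E = mat 1" "E \<in> diag_mats" "Ei \<in> diag_mats"
 by (simp_all add: E diag_exp_inverse)

lemma E_nth: "E $ i $ i = exp (\<i> * pi * b $ i $ i)" "Ei $ i $ i = exp (- (\<i> * pi * b $ i $ i))"
 by (simp_all add: E diag_exp_nth diag_part_nth)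

lemma Phi_zero:
 assumes "- (pi / 2) < Im v" "Im v < pi / 2"
 shows "Phi A0 1 d B 0 (exp v) = Phi0 a b (- v)"
proof -
 have c: "a = cscale (exp (\<i> * of_real 0)) a" by simp
 have "canonical_sum A0 B (- 0 - pi / 2) (- 0 + pi / 2) (exp v) = Hf a b (- v - \<i> * of_real 0)"
  by (rule canonical_sum_exp[OF A0 B ab c irr_a(1)]) (use assms in auto)
 moreover have "sector_log (- (pi / 2)) (pi / 2) (exp v) = v" by (rule sector_log_exp) (use assms in auto)
 ultimately show ?thesis using Phi_tail[OF A0 B ab c irr_a(1), of v] by (simp add: Phi_def branch_index_def d Hf_Dd flip: mm_assoc)
qed

text \<open>On the opposite sector the argument is translated by - pi i. This replaces a by - a in
  \<open>Dd\<close> and leaves the constant factor E = exp(pi i \<delta>(b)), half of the formal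
  monodromy.\<close>

lemma Phi_one:
 assumes "- (3 * pi / 2) < Im v" "Im v < - (pi / 2)"
 shows "Phi A0 1 d B 1 (exp v) = Phi0 (- a) b (- v - \<i> * pi) ** E"
proof -
 have c: "- a = cscale (exp (\<i> * of_real pi)) a" by (simp add: mult.commute cscale_uminus_one)
 have e: "- pi - pi / 2 = - (3 * pi / 2)" "- pi + pi / 2 = - (pi / 2)" by simp_all
 have "canonical_sum A0 B (- pi - pi / 2) (- pi + pi / 2) (exp v) = Hf (- a) b (- v - \<i> * of_real pi)"
  by (rule canonical_sum_exp[OF A0 B ab c irr_a(2)]) (use assms in auto)
 moreover have "sector_log (- (3 * pi / 2)) (- (pi / 2)) (exp v) = v" by (rule sector_log_exp) (use assms in auto)
 moreover have "Dd a b (- v) = Dd (- a) b (- v - \<i> * pi) ** E" unfolding Dd_def E diag_exp_add[symmetric]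
  by (rule arg_cong[of _ _ diag_exp]) (simp add: vec_eq_iff exp_pm_pi algebra_simps)
 moreover have "d (-1) = - (3 * pi / 2)" "d 0 = - (pi / 2)" by (simp_all add: d)
 ultimately have "Phi A0 1 d B 1 (exp v) = Hf (- a) b (- v - \<i> * pi) ** (Dd (- a) b (- v - \<i> * pi) ** E)"
  using Phi_tail[OF A0 B ab c irr_a(2), of v] unfolding e by (simp add: Phi_def branch_index_def flip: mm_assoc)
 thus ?thesis by (simp add: mm_assoc Hf_Dd)
qed

lemma Phi0_cancel: "Phi0 a b u ** M = Phi0 a b u ** N ==> M = N"
proof -
 assume h: "Phi0 a b u ** M = Phi0 a b u ** N"
 have "(Gi a b u ** Phi0 a b u) ** M = (Gi a b u ** Phi0 a b u) ** N"
  using arg_cong[OF h, of "\<lambda>X. Gi a b u ** X"] by (simp only: mm_assoc)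
 thus "M = N" by (simp add: Gi_Phi0(1)[OF irr_a(1) b_skew(2)])
qed

lemma d_values: "d (- int 1) = - (3 * pi / 2)" "d (- int 1 + 1) = - (pi / 2)" "d 0 = - (pi / 2)" "d 1 = pi / 2"
  "d (int 1) = pi / 2" "d (int 1 + 1) = 3 * pi / 2" by (simp_all add: d)

lemma conjP_inv: "perm_mat w ** (conjP w M ** matrix_inv (perm_mat w)) = M"
 "perm_mat w ** (conjP w M ** (matrix_inv (perm_mat w) ** X)) = M ** X" using conjP_inverse[OF w_perm(1), of M] by (simp_all add: mm_assoc)

lemma stokes_P_w: "stokes_P A0 1 d = perm_mat w"
 by (simp add: stokes_P_def w)

lemma conjP_cancel: "Phi0 a b u ** perm_mat w ** S ** matrix_inv (perm_mat w) = Phi0 a b u ** M ==> S = conjP w M"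
proof -
 assume "Phi0 a b u ** perm_mat w ** S ** matrix_inv (perm_mat w) = Phi0 a b u ** M"
 hence M: "perm_mat w ** S ** transpose (perm_mat w) = M"
  by - (rule Phi0_cancel[of u], simp only: mm_assoc perm_mat_inv(3)[OF w_perm(1)])
 have "conjP w M = (transpose (perm_mat w) ** perm_mat w) ** S ** (transpose (perm_mat w) ** perm_mat w)"
  unfolding M[symmetric] conjP_def perm_mat_inv(3)[OF w_perm(1)] by (simp only: mm_assoc)
 thus ?thesis by (simp add: perm_mat_inv[OF w_perm(1)])
qed

lemma clow_lower: "w i < w j ==> clow a b $ j $ i = 0"
 by (rule clow_triangular[OF irr_a(1) b_skew(1)]) (simp add: w_perm(2) ab)

lemma cnj_E: "cnj (clow a b $ i $ i) * E $ i $ i = 1" "Ei $ i $ i * clow a b $ i $ i * (E $ i $ i * E $ i $ i) = 1"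
proof -
 have "cnj (b $ i $ i) = - (b $ i $ i)" using skew_diag_Re[OF b_skew(1), of i] by (simp add: complex_eq_iff)
 thus "cnj (clow a b $ i $ i) * E $ i $ i = 1" unfolding clow_diag[OF irr_a(1) b_skew(2)] E_nth by (simp add: exp_cnj exp_minus)
 show "Ei $ i $ i * clow a b $ i $ i * (E $ i $ i * E $ i $ i) = 1"
  unfolding clow_diag[OF irr_a(1) b_skew(2)] E_nth by (simp flip: exp_add)
qed

lemma U_conjP:
 assumes "!!i. M $ i $ i = 1" "M ** N = mat 1"
 shows "(!!i j. w i < w j ==> M $ i $ j = 0) ==> conjP w M \<in> U_minus"
  and "(!!i j. w j < w i ==> M $ i $ j = 0) ==> conjP w M \<in> U_plus"
proof -
 have "conjP w M ** conjP w N = mat 1" using assms(2) by (simp add: conjP_one[OF w_perm(1)] flip: conjP_mult[OF w_perm(1)])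
 hence i: "invertible (conjP w M)" using matrix_left_right_inverse by (auto simp: invertible_def)
 have ww: "w (inv w i) = i" for i by (rule surj_f_inv_f[OF bij_is_surj[OF w_perm(1)]])
 hence wi: "inv w i = inv w j \<longleftrightarrow> i = j" for i j by metis
 have e: "conjP w M $ i $ j = M $ inv w i $ inv w j" for i j using conjP_nth[OF w_perm(1), of M "inv w i" "inv w j"] by (simp only: ww)
 show "(!!i j. w i < w j ==> M $ i $ j = 0) ==> conjP w M \<in> U_minus"
  using i by (simp add: U_minus_def B_minus_def lower_tri_def e ww wi assms(1))
 show "(!!i j. w j < w i ==> M $ i $ j = 0) ==> conjP w M \<in> U_plus"
  using i by (simp add: U_plus_def B_plus_def upper_tri_def e ww wi assms(1))
qed

lemma cup_inv: "cup a b ** dagger (clow a b) = mat 1" "dagger (clow a b) ** cup a b = mat 1"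
  "clow a b ** dagger (cup a b) = mat 1" "dagger (cup a b) ** clow a b = mat 1"
proof -
 show 1: "cup a b ** dagger (clow a b) = mat 1" "dagger (clow a b) ** cup a b = mat 1" by (rule cup_clow[OF irr_a(1) b_skew(1)])+
 show "clow a b ** dagger (cup a b) = mat 1" "dagger (cup a b) ** clow a b = mat 1"
  using arg_cong[OF 1(1), of dagger] arg_cong[OF 1(2), of dagger] by (simp_all add: dagger_mult dagger_dagger dagger_one)
qed

lemma diag_scale:
 "cscale (- 1 * complex_of_real pi * \<i>) (diag_part B) = cscale (\<i> * of_real pi) (diag_part b)"
 "cscale (2 * complex_of_real pi * \<i>) (diag_part B)
  = - cscale (\<i> * of_real pi) (diag_part b) + - cscale (\<i> * of_real pi) (diag_part b)"
 by (rule cmat_eqI, simp add: ab diag_part_nth complex_eq_iff)+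

lemma cancels:
 "E ** Ei = mat 1" "E ** (Ei ** X) = X" "Ei ** E = mat 1" "Ei ** (E ** X) = X"
 "cup a b ** dagger (clow a b) = mat 1" "cup a b ** (dagger (clow a b) ** X) = X"
 "dagger (clow a b) ** cup a b = mat 1" "dagger (clow a b) ** (cup a b ** X) = X"
 "clow a b ** dagger (cup a b) = mat 1" "clow a b ** (dagger (cup a b) ** X) = X"
 "dagger (cup a b) ** clow a b = mat 1" "dagger (cup a b) ** (clow a b ** X) = X" by (simp_all add: EEi cup_inv mm_assoc)

text \<open>\<open>Phi0 a b\<close> is entire in u, so it provides the continuation from one sector
  to the other up to a constant right factor. On the opposite sector the half-turn produces
  \<open>cup\<close>, which cancels against the adjoint of \<open>clow\<close> in that
  factor.\<close>

lemma stokes_minus_eq: "stokes_minus A0 1 d B = conjP w (dagger (clow a b) ** E)"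
 unfolding stokes_minus_def d_values stokes_P_w
proof (rule the_equality)
 let ?M = "dagger (clow a b) ** E"
 let ?X = "\<lambda>z. Phi0 a b (- sector_log (- (3 * pi / 2)) (pi / 2) z) ** ?M"
 let ?P = "\<lambda>S X. mat_holomorphic_on X (sector (- (3 * pi / 2)) (pi / 2)) &
  (\<forall>z\<in>sector (- (3 * pi / 2)) (- (pi / 2)). X z = Phi A0 1 d B 1 z) &
  (\<forall>z\<in>sector (- (pi / 2)) (pi / 2). X z = Phi A0 1 d B 0 z ** perm_mat w ** S ** matrix_inv (perm_mat w))"
 have S: "pi / 2 - - (3 * pi / 2) <= 2 * pi" by simp
 have hol: "mat_holomorphic_on ?X (sector (- (3 * pi / 2)) (pi / 2))" by (rule mat_holomorphic_log[OF S]) (use has_mderiv_Phi0 in blast)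
 have X1: "?X z = Phi A0 1 d B 1 z" if z: "z \<in> sector (- (3 * pi / 2)) (- (pi / 2))" for z
 proof -
  obtain v where v: "z = exp v" "- (3 * pi / 2) < Im v" "Im v < - (pi / 2)" using z by (rule sector_logE)
  have "sector_log (- (3 * pi / 2)) (pi / 2) z = v" unfolding v(1) by (rule sector_log_exp) (use v pi_gt_zero in linarith)+
  moreover have "Phi0 a b (- v) = Phi0 (- a) b (- v - \<i> * pi) ** cup a b"
   using Phi0_shift(2)[OF irr_a(1) b_skew(2), of "- v - \<i> * pi"] by simp
  moreover have "M ** cup a b ** (dagger (clow a b) ** E) = M ** E" for M by (simp add: cancels conjP_inv flip: mm_assoc)
  ultimately show ?thesis unfolding v(1) using Phi_one[OF v(2,3)] by simp
 qed
 have X0: "?X z = Phi A0 1 d B 0 z ** ?M" if z: "z \<in> sector (- (pi / 2)) (pi / 2)" for z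
 proof -
  obtain v where v: "z = exp v" "- (pi / 2) < Im v" "Im v < pi / 2" using z by (rule sector_logE)
  have "sector_log (- (3 * pi / 2)) (pi / 2) z = v" unfolding v(1) by (rule sector_log_exp) (use v pi_gt_zero in linarith)+
  thus ?thesis unfolding v(1) using Phi_zero[OF v(2,3)] by simp
 qed
 have "conjP w ?M \<in> U_minus"
 proof (rule U_conjP(1))
  show "?M $ i $ i = 1" for i using cnj_E(1) by (simp add: diag_mm_right EEi)
  show "?M $ i $ j = 0" if "w i < w j" for i j using clow_lower[OF that] by (simp add: diag_mm_right EEi)
  show "?M ** (Ei ** cup a b) = mat 1" by (simp add: cancels conjP_inv flip: mm_assoc)
 qed
 moreover have "?X z = Phi A0 1 d B 0 z ** perm_mat w ** conjP w ?M ** matrix_inv (perm_mat w)"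
  if "z \<in> sector (- (pi / 2)) (pi / 2)" for z unfolding X0[OF that] by (simp add: cancels conjP_inv flip: mm_assoc)
 ultimately show "conjP w ?M \<in> U_minus & (\<exists>X. ?P (conjP w ?M) X)" using hol X1 by blast
 fix S assume "S \<in> U_minus & (\<exists>X. ?P S X)"
 then obtain X where X: "?P S X" by blast
 \<comment> \<open>For uniqueness, the identity theorem identifies any admissible continuation with
   the explicit one; evaluated at the sample point z = 1 it determines S because \<open>Phi0\<close>
   is invertible.\<close>
 have one: "exp 0 \<in> sector (- (pi / 2)) (pi / 2)" by (rule exp_in_sector) simp_all
 have one': "exp 0 \<in> sector (- (3 * pi / 2)) (pi / 2)" by (rule exp_in_sector) simp_all
 have "X (exp 0) = ?X (exp 0)" by (rule mat_identity_sector[OF S _ hol, of _ "- (3 * pi / 2)" "- (pi / 2)"]) (use X X1 one' in auto)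
 hence "Phi0 a b 0 ** perm_mat w ** S ** matrix_inv (perm_mat w) = Phi0 a b 0 ** ?M"
  unfolding X0[OF one] using X one Phi_zero[of 0] by simp
 thus "S = conjP w ?M" by (rule conjP_cancel)
qed

text \<open>The opposite sector is now reached at angles near pi, whereas its branch of the
  logarithm lives near - pi. Writing the point as exp(v - 2 pi i) reverses the half-turn, so
  \<open>clow\<close> appears in place of \<open>cup\<close>; the formal monodromy exp(2 pi i
  \<delta>(B)) is Ei squared because b = - B.\<close>

lemma stokes_plus_eq: "stokes_plus A0 1 d B = conjP w (Ei ** clow a b ** (E ** E))"
 unfolding stokes_plus_def d_values stokes_P_w
proof (rule the_equality)
 let ?M = "Ei ** clow a b ** (E ** E)"
 let ?Q = "diag_exp (cscale (2 * complex_of_real pi * \<i>) (diag_part B))"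
 let ?X = "\<lambda>z. Phi0 a b (- sector_log (- (pi / 2)) (3 * pi / 2) z) ** mat 1"
 let ?P = "\<lambda>S X. mat_holomorphic_on X (sector (- (pi / 2)) (3 * pi / 2)) &
  (\<forall>z\<in>sector (- (pi / 2)) (pi / 2). X z = Phi A0 1 d B 0 z) &
  (\<forall>z\<in>sector (pi / 2) (3 * pi / 2). X z = Phi A0 1 d B 1 z ** perm_mat w ** S ** matrix_inv (perm_mat w) ** ?Q)"
 have M0: "?Q = Ei ** Ei" unfolding E diag_exp_add[symmetric] diag_scale(2) ..
 have S: "3 * pi / 2 - - (pi / 2) <= 2 * pi" by simp
 have hol: "mat_holomorphic_on ?X (sector (- (pi / 2)) (3 * pi / 2))" by (rule mat_holomorphic_log[OF S]) (use has_mderiv_Phi0 in blast)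
 have X0: "?X z = Phi A0 1 d B 0 z" if z: "z \<in> sector (- (pi / 2)) (pi / 2)" for z
 proof -
  obtain v where v: "z = exp v" "- (pi / 2) < Im v" "Im v < pi / 2" using z by (rule sector_logE)
  have "sector_log (- (pi / 2)) (3 * pi / 2) z = v" unfolding v(1) by (rule sector_log_exp) (use v pi_gt_zero in linarith)+
  thus ?thesis unfolding v(1) using Phi_zero[OF v(2,3)] by simp
 qed
 have X1: "?X z = Phi A0 1 d B 1 z ** ?M ** ?Q" "?X z = Phi0 a b (- v)" "Phi A0 1 d B 1 z ** (Ei ** clow a b) = Phi0 a b (- v)"
  if v: "z = exp v" "pi / 2 < Im v" "Im v < 3 * pi / 2" for z v
 proof -
  have "sector_log (- (pi / 2)) (3 * pi / 2) z = v" unfolding v(1) by (rule sector_log_exp) (use v pi_gt_zero in linarith)+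
  thus x: "?X z = Phi0 a b (- v)" by simp
  have z': "z = exp (v - 2 * pi * \<i>)" by (simp add: v exp_diff)
  have "Phi A0 1 d B 1 z = Phi0 (- a) b (- (v - 2 * pi * \<i>) - \<i> * pi) ** E" unfolding z' by (rule Phi_one) (use v in auto)
  also have "- (v - 2 * pi * \<i>) - \<i> * pi = - v + \<i> * pi" by simp
  finally have P1: "Phi A0 1 d B 1 z = Phi0 (- a) b (- v + \<i> * pi) ** E" .
  have P0: "Phi0 a b (- v) = Phi0 (- a) b (- v + \<i> * pi) ** clow a b"
   using Phi0_shift(1)[OF irr_a(1) b_skew(2), of "- v + \<i> * pi"] by simp
  show y: "Phi A0 1 d B 1 z ** (Ei ** clow a b) = Phi0 a b (- v)" unfolding P1 P0 by (simp add: cancels conjP_inv flip: mm_assoc)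
  have "?M ** (Ei ** Ei) = Ei ** clow a b" by (simp add: cancels conjP_inv flip: mm_assoc)
  thus "?X z = Phi A0 1 d B 1 z ** ?M ** ?Q" unfolding x M0 y[symmetric] by (simp flip: mm_assoc)
 qed
 have "conjP w ?M \<in> U_plus"
 proof (rule U_conjP(2))
  have e: "?M $ i $ j = Ei $ i $ i * clow a b $ i $ j * (E $ j $ j * E $ j $ j)" for i j
   by (simp add: mm_assoc diag_mm_left diag_mm_right EEi)
  show "?M $ i $ i = 1" for i unfolding e by (rule cnj_E(2))
  show "?M $ i $ j = 0" if "w j < w i" for i j unfolding e using clow_lower[OF that] by simp
  show "?M ** (Ei ** Ei ** dagger (cup a b) ** E) = mat 1" by (simp add: cancels conjP_inv flip: mm_assoc)
 qed
 moreover have "?X z = Phi A0 1 d B 1 z ** perm_mat w ** conjP w ?M ** matrix_inv (perm_mat w) ** ?Q"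
  if z: "z \<in> sector (pi / 2) (3 * pi / 2)" for z
 proof -
  obtain v where v: "z = exp v" "pi / 2 < Im v" "Im v < 3 * pi / 2" using z by (rule sector_logE)
  show ?thesis unfolding X1(1)[OF v] by (simp add: cancels conjP_inv flip: mm_assoc)
 qed
 ultimately show "conjP w ?M \<in> U_plus & (\<exists>X. ?P (conjP w ?M) X)" using hol X0 by blast
 fix S assume "S \<in> U_plus & (\<exists>X. ?P S X)"
 then obtain X where X: "?P S X" by blast
 have v: "exp (\<i> * pi) = exp (\<i> * pi)" "pi / 2 < Im (\<i> * pi)" "Im (\<i> * pi) < 3 * pi / 2" by simp_all
 have two: "exp (\<i> * pi) \<in> sector (pi / 2) (3 * pi / 2)" by (rule exp_in_sector[OF v(2,3)])
 have two': "exp (\<i> * pi) \<in> sector (- (pi / 2)) (3 * pi / 2)" by (rule exp_in_sector) (use pi_gt_zero v in linarith)+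
 have eq: "X (exp (\<i> * pi)) = ?X (exp (\<i> * pi))"
  by (rule mat_identity_sector[OF S _ hol, of _ "- (pi / 2)" "pi / 2"]) (use X X0 two' in auto)
 define T where "T = Phi A0 1 d B 1 (exp (\<i> * pi))"
 define u where "u = - (\<i> * complex_of_real pi)"
 let ?Y = "perm_mat w ** S ** matrix_inv (perm_mat w)"
 have "T ** (Ei ** clow a b) = Phi0 a b u" using X1(3)[OF v] by (simp add: T_def u_def)
 moreover have "T = (T ** (Ei ** clow a b)) ** (dagger (cup a b) ** E)" by (simp add: cancels flip: mm_assoc)
 ultimately have T: "T = Phi0 a b u ** (dagger (cup a b) ** E)" by simp
 have "T ** ?Y ** ?Q = Phi0 a b u" using eq X two unfolding X1(2)[OF v] T_def u_def by (simp add: mm_assoc)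
 hence "Phi0 a b u ** (dagger (cup a b) ** E ** ?Y ** (Ei ** Ei)) = Phi0 a b u ** mat 1" unfolding T M0 by (simp add: mm_assoc)
 hence y: "dagger (cup a b) ** E ** ?Y ** (Ei ** Ei) = mat 1" by (rule Phi0_cancel)
 have "?Y = (Ei ** clow a b) ** (dagger (cup a b) ** E ** ?Y ** (Ei ** Ei)) ** (E ** E)" by (simp add: cancels flip: mm_assoc)
 hence Y: "?Y = ?M" unfolding y by simp
 have "Phi0 a b 0 ** perm_mat w ** S ** matrix_inv (perm_mat w) = Phi0 a b 0 ** ?Y" by (simp only: mm_assoc)
 hence "Phi0 a b 0 ** perm_mat w ** S ** matrix_inv (perm_mat w) = Phi0 a b 0 ** ?M" unfolding Y .
 thus "S = conjP w ?M" by (rule conjP_cancel)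
qed

lemma monodromy_eq:
 "monodromy_map A0 1 d B = (conjP w (cup a b), conjP w (clow a b), conjP w (diag_part B))"
proof -
 note cm = conjP_mult[OF w_perm(1), symmetric]
 have L: "matrix_inv (perm_mat w) ** diag_part B ** perm_mat w = conjP w (diag_part B)" by (simp add: conjP_def)
 have e: "diag_exp (cscale (c * complex_of_real pi * \<i>) (conjP w (diag_part B))) = conjP w (diag_exp (cscale (c * complex_of_real pi * \<i>) (diag_part B)))" for c
  by (simp add: conjP_diag_exp[OF w_perm(1)] conjP_cscale[OF w_perm(1)])
 have e1: "diag_exp (cscale (- 1 * complex_of_real pi * \<i>) (diag_part B)) = E" unfolding E diag_scale(1) ..
 have e2: "diag_exp (cscale (2 * complex_of_real pi * \<i>) (diag_part B)) = Ei ** Ei" unfolding E diag_exp_add[symmetric] diag_scale(2) ..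
 have i1: "dagger (clow a b) ** E ** (Ei ** cup a b) = mat 1" by (simp add: cancels conjP_inv flip: mm_assoc)
 hence i2: "Ei ** cup a b ** (dagger (clow a b) ** E) = mat 1" using matrix_left_right_inverse by blast
 have inv: "matrix_inv (conjP w (dagger (clow a b) ** E)) = conjP w (Ei ** cup a b)"
  by (rule inverse_eq_matrix_inv) (simp_all add: cm i1 i2 conjP_one[OF w_perm(1)])
 have "E ** (Ei ** cup a b) = cup a b" by (simp add: mm_assoc EEi)
 moreover have "E ** (Ei ** clow a b ** (E ** E)) ** (Ei ** Ei) = clow a b" by (simp add: cancels conjP_inv flip: mm_assoc)
 ultimately show ?thesis unfolding monodromy_map_def Let_def stokes_P_w L e e1 e2 stokes_minus_eq stokes_plus_eq inv by (simp add: cm)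
qed

text \<open>By \<open>bij_betw_b_plus_of\<close> there is an element of \<open>K_star\<close> over
  the matrix \<open>?p\<close>; its other two components are determined by the fixed point equations
  and turn out to be those of the monodromy data.\<close>

lemma monodromy_K_star:
 "monodromy_map A0 1 d B \<in> K_star" "b_plus_of (monodromy_map A0 1 d B) = conjP w (clow a b)" "conjP w (clow a b) \<in> K_plus"
proof -
 note cm = conjP_mult[OF w_perm(1), symmetric] and c1 = conjP_one[OF w_perm(1)] and cd = conjP_dagger[OF w_perm(1), symmetric]
 let ?p = "conjP w (clow a b)" and ?m = "conjP w (cup a b)" and ?L = "conjP w (diag_part B)"
 have dg: "clow a b $ i $ i = of_real (exp (- (pi * Im (B $ i $ i))))" for i
 proof -
  have "- (\<i> * pi * b $ i $ i) = of_real (- (pi * Im (B $ i $ i)))" using skew_diag_Re[OF B, of i] by (simp add: ab complex_eq_iff)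
  thus ?thesis unfolding clow_diag[OF irr_a(1) b_skew(2)] by (simp only: exp_of_real)
 qed
 have up: "?p $ i $ j = 0" if "j < i" for i j
 proof -
  obtain k l where "i = w k" "j = w l" using bij_is_surj[OF w_perm(1)] by (metis surjD)
  thus ?thesis using clow_lower that by (simp add: conjP_nth[OF w_perm(1)])
 qed
 have pd: "?p $ i $ i \<in> \<real> & 0 < Re (?p $ i $ i)" for i
 proof -
  obtain k where "i = w k" using bij_is_surj[OF w_perm(1)] by (metis surjD)
  thus ?thesis by (simp add: conjP_nth[OF w_perm(1)] dg)
 qed
 show Kp: "?p \<in> K_plus" using up pd by (simp add: K_plus_def upper_tri_def)
 show "b_plus_of (monodromy_map A0 1 d B) = ?p" unfolding monodromy_eq by (simp add: b_plus_of_def)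
 obtain bm L where x: "(bm, ?p, L) \<in> K_star"
 proof -
  have "?p \<in> b_plus_of ` K_star" unfolding bij_betw_imp_surj_on[OF bij_betw_b_plus_of] by (rule Kp)
  thus ?thesis using that by (auto simp: b_plus_of_def)
 qed
 have "bm = matrix_inv (dagger ?p)" using x by (simp add: K_star_def star_involution_def)
 moreover have "matrix_inv (dagger ?p) = ?m" by (rule inverse_eq_matrix_inv) (simp_all add: cd cm cup_inv c1)
 moreover have "L = ?L"
 proof (rule cmat_eqI)
  fix i j
  have Ld: "L \<in> diag_mats" and Le: "diag_part ?p = diag_exp (cscale (complex_of_real pi * \<i>) L)"
   and Ls: "- map_matrix cnj L = L" using x by (auto simp: K_star_def G_star_def star_involution_def)
  have LD: "?L \<in> diag_mats" by (rule conjP_diag[OF w_perm(1)]) simp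
  show "L $ i $ j = ?L $ i $ j"
  proof (cases "i = j")
   case False thus ?thesis using Ld LD by (simp add: diag_mats_def)
  next
   case True
   obtain k where k: "i = w k" using bij_is_surj[OF w_perm(1)] by (metis surjD)
   have "- cnj (L $ i $ i) = L $ i $ i" using arg_cong[OF Ls, of "\<lambda>M. M $ i $ i"] by simp
   hence "Re (- cnj (L $ i $ i)) = Re (L $ i $ i)" by simp
   hence Re: "Re (L $ i $ i) = 0" by simp
   have "?p $ i $ i = exp (complex_of_real pi * \<i> * L $ i $ i)"
    using arg_cong[OF Le, of "\<lambda>M. M $ i $ i"] by (simp add: diag_part_nth diag_exp_nth)
   also have "complex_of_real pi * \<i> * L $ i $ i = of_real (- (pi * Im (L $ i $ i)))" using Re by (simp add: complex_eq_iff)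
   finally have "complex_of_real (exp (- (pi * Im (B $ k $ k)))) = of_real (exp (- (pi * Im (L $ i $ i))))"
    unfolding exp_of_real k by (simp add: conjP_nth[OF w_perm(1)] dg exp_of_real)
   hence "Im (L $ i $ i) = Im (B $ k $ k)" by (simp only: of_real_eq_iff exp_inj_iff) simp
   moreover have "?L $ i $ i = B $ k $ k" unfolding k by (simp add: conjP_nth[OF w_perm(1)] diag_part_nth)
   ultimately show ?thesis using Re skew_diag_Re[OF B, of k] True by (simp add: complex_eq_iff)
  qed
 qed
 ultimately show "monodromy_map A0 1 d B \<in> K_star" unfolding monodromy_eq using x by simp
qed

end

subsection \<open>Functions that are holomorphic along complex lines\<close>

text \<open>Cauchy's inequality bounds the tail of the power series from order 2 on by a geometric
  series of ratio at most 1/2.\<close>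

lemma holomorphic_taylor_bound:
 assumes hol: "f holomorphic_on ball 0 T" and cont: "continuous_on (cball 0 T) f" and T: "0 < T"
  and M: "!!t. cmod t <= T ==> cmod (f t) <= M" and s: "cmod s <= T / 2"
 shows "cmod (f s - f 0 - deriv f 0 * s) <= 2 * M * (cmod s / T)^2" "cmod (deriv f 0) <= M / T"
proof -
 have M0: "0 <= M" using M[of 0] T by (smt (verit) norm_ge_zero norm_zero)
 have ci: "cmod ((deriv ^^ n) f 0) <= fact n * M / T ^ n" for n by (rule Cauchy_inequality[OF hol cont T]) (use M in auto)
 show "cmod (deriv f 0) <= M / T" using ci[of 1] by simp
 define q where "q = cmod s / T"
 have q: "0 <= q" "q <= 1/2" using s T by (auto simp: q_def field_simps)
 have "s \<in> ball 0 T" using s T by auto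
 hence "(\<lambda>n. (deriv ^^ n) f 0 / fact n * (s - 0) ^ n) sums f s" by (rule holomorphic_power_series[OF hol])
 hence "(\<lambda>n. (deriv ^^ n) f 0 / fact n * s ^ n) sums f s" by simp
 hence "(\<lambda>n. (deriv ^^ (n + 2)) f 0 / fact (n + 2) * s ^ (n + 2)) sums (f s - (\<Sum>n<2. (deriv ^^ n) f 0 / fact n * s ^ n))"
  by (rule sums_split_initial_segment)
 moreover have "(\<Sum>n<2. (deriv ^^ n) f 0 / fact n * s ^ n) = f 0 + deriv f 0 * s" by (simp add: numeral_2_eq_2)
 ultimately have S: "(\<lambda>n. (deriv ^^ (n + 2)) f 0 / fact (n + 2) * s ^ (n + 2)) sums (f s - f 0 - deriv f 0 * s)"
  by (simp add: algebra_simps)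
 have t: "cmod ((deriv ^^ (n + 2)) f 0 / fact (n + 2) * s ^ (n + 2)) <= M * q^2 * (1/2) ^ n" for n
 proof -
  have "cmod ((deriv ^^ (n + 2)) f 0 / fact (n + 2) * s ^ (n + 2)) <= (fact (n + 2) * M / T ^ (n + 2)) / fact (n + 2) * cmod s ^ (n + 2)"
   unfolding norm_mult norm_divide norm_power norm_fact by (intro mult_right_mono divide_right_mono ci) auto
  also have "... = M * q ^ (n + 2)" using T by (simp add: q_def power_divide)
  also have "... = M * q^2 * q ^ n" by (simp add: power_add power2_eq_square)
  also have "... <= M * q^2 * (1/2) ^ n" using q M0 by (intro mult_left_mono power_mono) auto
  finally show ?thesis .
 qed
 have "cmod (\<Sum>n. (deriv ^^ (n + 2)) f 0 / fact (n + 2) * s ^ (n + 2)) <= (\<Sum>n. M * q^2 * (1/2) ^ n)"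
  by (rule norm_suminf_le[OF t]) (intro summable_mult, simp)
 also have "... = M * q^2 * 2" by (subst suminf_mult) (simp_all add: suminf_geometric)
 finally show "cmod (f s - f 0 - deriv f 0 * s) <= 2 * M * (cmod s / T)^2" using sums_unique[OF S] by (simp add: q_def mult_ac)
qed

text \<open>Continuity together with holomorphy along complex lines. The complex scalar
  multiplication is a parameter, so that the same notion serves for matrices and for pairs of
  matrices.\<close>

definition ghol :: "(complex => 'e => 'e) => 'e set => ('e::euclidean_space => complex) => bool" where
 "ghol sc W h \<longleftrightarrow> open W & continuous_on W h & (\<forall>x v. (\<lambda>t. h (x + sc t v)) holomorphic_on {t. x + sc t v \<in> W})"

text \<open>In directions in which S contains a segment, the derivative within S is the derivative
  of a curve and hence unique. This is how derivatives on subsets without interior points are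
  compared.\<close>

lemma line_derivative:
 assumes f: "(f has_derivative f') (at x within S)" and l: "\<exists>\<delta>>0. \<forall>s. \<bar>s\<bar> < \<delta> --> x + s *\<^sub>R v \<in> S"
 shows "((\<lambda>s. f (x + s *\<^sub>R v)) has_vector_derivative f' v) (at 0)"
proof -
 obtain \<delta> where \<delta>: "0 < \<delta>" "!!s. \<bar>s\<bar> < \<delta> ==> x + s *\<^sub>R v \<in> S" using l by blast
 have "((\<lambda>s. x + s *\<^sub>R v) has_derivative (\<lambda>s. s *\<^sub>R v)) (at 0 within {-\<delta><..<\<delta>})" by (auto intro!: derivative_eq_intros)
 moreover have "(f has_derivative f') (at (x + 0 *\<^sub>R v) within (\<lambda>s. x + s *\<^sub>R v) ` {-\<delta><..<\<delta>})"
  using has_derivative_subset[OF f, of "(\<lambda>s. x + s *\<^sub>R v) ` {-\<delta><..<\<delta>}"] \<delta>(2) by fastforce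
 ultimately have "((\<lambda>s. f (x + s *\<^sub>R v)) has_derivative (\<lambda>s. f' (s *\<^sub>R v))) (at 0 within {-\<delta><..<\<delta>})"
  by (rule has_derivative_in_compose)
 thus ?thesis using \<delta>(1) linear_scale[OF has_derivative_linear[OF f], of _ v]
  by (simp add: has_vector_derivative_def at_within_open[of 0 "{-\<delta><..<\<delta>}"])
qed

locale complex_structure =
 fixes sc :: "complex => 'e::euclidean_space => 'e"
 assumes bil: "bounded_bilinear sc" and sc_real: "!!r x. sc (of_real r) x = r *\<^sub>R x"
begin

interpretation sc: bounded_bilinear sc by (rule bil)

definition dd :: "('e => complex) => 'e => 'e => complex" where
 "dd h v x = deriv (\<lambda>t. h (x + sc t v)) 0"

lemma sc_scale: "sc t (r *\<^sub>R v) = sc (t * of_real r) v"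
 using sc.scaleR_right[of t r v] sc.scaleR_left[of r t v] by (simp add: scaleR_conv_of_real mult.commute)

lemma line_cont: "continuous_on UNIV (\<lambda>t. x + sc t v)"
 by (intro continuous_intros bounded_linear.continuous_on[OF sc.bounded_linear_left])

lemma line_open: "open W ==> open {t. x + sc t v \<in> W}"
 using open_vimage[OF _ line_cont, of W x v] by (simp add: vimage_def)

lemma local_bounds:
 assumes h: "ghol sc W h" and x: "x \<in> W"
 obtains r k M where "0 < r" "0 < k" "0 <= M" "cball x (3 * r) \<subseteq> W" "!!y. y \<in> cball x (3 * r) ==> cmod (h y) <= M"
  "!!t v. norm (sc t v) <= cmod t * norm v * k"
proof -
 obtain k where k: "0 < k" "!!t v. norm (sc t v) <= norm t * norm v * k" using sc.pos_bounded by blast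
 obtain e where e: "0 < e" "cball x e \<subseteq> W" using h x unfolding ghol_def by (meson open_contains_cball)
 have "compact (h ` cball x e)"
  using h e(2) by (intro compact_continuous_image compact_cball) (auto simp: ghol_def intro: continuous_on_subset)
 then obtain M where M: "!!y. y \<in> cball x e ==> cmod (h y) <= M"
  using compact_imp_bounded bounded_iff by (metis imageI)
 have "0 <= M" using M[of x] e by (meson centre_in_cball norm_ge_zero order_trans less_imp_le)
 thus ?thesis using that[of "e / 3" k M] k e M by auto
qed

lemma line_hol:
 assumes h: "ghol sc W h" and sub: "!!t. cmod t <= T ==> x + sc t v \<in> W"
 shows "(\<lambda>t. h (x + sc t v)) holomorphic_on ball 0 T" "continuous_on (cball 0 T) (\<lambda>t. h (x + sc t v))"
proof -
 have hol: "(\<lambda>t. h (x + sc t v)) holomorphic_on {t. x + sc t v \<in> W}" using h by (simp add: ghol_def)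
 show "(\<lambda>t. h (x + sc t v)) holomorphic_on ball 0 T" by (rule holomorphic_on_subset[OF hol]) (use sub in auto)
 show "continuous_on (cball 0 T) (\<lambda>t. h (x + sc t v))"
  by (rule continuous_on_subset[OF holomorphic_on_imp_continuous_on[OF hol]]) (use sub in auto)
qed

text \<open>The line in direction v is used up to the radius T = 2 r / (k |v|), which keeps it
  inside a fixed ball; this makes the constants uniform in the base point and in the
  direction.\<close>

lemma dd_taylor:
 assumes h: "ghol sc W h" and x: "x \<in> W"
 obtains r C where "0 < r" "0 <= C" "ball x (2 * r) \<subseteq> W"
  "!!y v. y \<in> ball x r ==> norm v < r ==> cmod (h (y + v) - h y - dd h v y) <= C * (norm v)^2"
  "!!y v. y \<in> ball x r ==> cmod (dd h v y) <= C * norm v"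
proof -
 obtain r k M where b: "0 < r" "0 < k" "0 <= M" "cball x (3 * r) \<subseteq> W" "!!y. y \<in> cball x (3 * r) ==> cmod (h y) <= M"
  "!!t v. norm (sc t v) <= cmod t * norm v * k" using local_bounds[OF h x] by blast
 define r' where "r' = min r (r / k)"
 define C where "C = 2 * M * (k / (2 * r))^2 + M * k / (2 * r)"
 have r': "0 < r'" "r' <= r" "r' <= r / k" using b by (auto simp: r'_def)
 have C0: "0 <= C" using b by (simp add: C_def)
 have main: "cmod (dd h v y) <= C * norm v & (norm v < r' --> cmod (h (y + v) - h y - dd h v y) <= C * (norm v)^2)"
  if y: "y \<in> ball x r'" for y v
 proof (cases "v = 0")
  case True
  thus ?thesis by (simp add: dd_def sc.zero_right)
 next
  case False
  define T where "T = 2 * r / (k * norm v)"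
  have T: "0 < T" using b False by (simp add: T_def)
  have sub: "y + sc t v \<in> cball x (3 * r)" if "cmod t <= T" for t
  proof -
   have "norm (sc t v) <= T * norm v * k" using b(6)[of t v] that b(2) by (meson order_trans mult_right_mono norm_ge_zero less_imp_le)
   also have "... = 2 * r" using b False by (simp add: T_def)
   finally show ?thesis using y r'(2) norm_triangle_ineq[of "y - x" "sc t v"] by (simp add: dist_norm norm_minus_commute algebra_simps)
  qed
  have lh: "(\<lambda>t. h (y + sc t v)) holomorphic_on ball 0 T" "continuous_on (cball 0 T) (\<lambda>t. h (y + sc t v))"
   using line_hol[OF h, of T y v] sub b(4) by blast+
  have Mb: "cmod (h (y + sc t v)) <= M" if "cmod t <= T" for t by (rule b(5)[OF sub[OF that]])
  have T0: "cmod 0 <= T / 2" using T by simp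
  have d1: "cmod (dd h v y) <= M / T" unfolding dd_def by (rule holomorphic_taylor_bound(2)[OF lh T Mb T0])
  also have "M / T = (M * k / (2 * r)) * norm v" by (simp add: T_def)
  also have "... <= C * norm v" using b by (intro mult_right_mono) (auto simp: C_def)
  finally have 1: "cmod (dd h v y) <= C * norm v" .
  have 2: "cmod (h (y + v) - h y - dd h v y) <= C * (norm v)^2" if "norm v < r'"
  proof -
   have "k * norm v <= k * r'" using that b by (intro mult_left_mono) auto
   also have "... <= r" using r'(3) b by (simp add: field_simps)
   finally have "k * norm v <= r" .
   hence T1: "cmod 1 <= T / 2" using b False by (simp add: T_def field_simps)
   have "cmod (h (y + v) - h y - dd h v y) <= 2 * M * (cmod 1 / T)^2"
    using holomorphic_taylor_bound(1)[OF lh T Mb T1] sc_real[of 1 v] by (simp add: dd_def sc.zero_left)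
   also have "... = 2 * M * (k / (2 * r))^2 * (norm v)^2" by (simp add: T_def power_mult_distrib power_divide)
   also have "... <= C * (norm v)^2" using b by (intro mult_right_mono) (auto simp: C_def)
   finally show ?thesis .
  qed
  show ?thesis using 1 2 by blast
 qed
 have "ball x (2 * r') \<subseteq> W" using b(4) r'(2) b(1) by (force simp: subset_iff)
 thus ?thesis using that[OF r'(1) C0] main by blast
qed

lemma dd_scale: "dd h (r *\<^sub>R v) x = of_real r * dd h v x" if h: "ghol sc W h" and x: "x \<in> W"
proof -
 have op: "open {t. x + sc t v \<in> W}" using h line_open by (simp add: ghol_def)
 have "((\<lambda>t. h (x + sc t v)) has_field_derivative dd h v x) (at (0 * of_real r))"
  using h holomorphic_derivI[OF _ op, of "\<lambda>t. h (x + sc t v)" 0] x by (simp add: ghol_def dd_def sc.zero_left)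
 hence "((\<lambda>t. h (x + sc (t * of_real r) v)) has_field_derivative dd h v x * of_real r) (at 0)"
  by (rule DERIV_chain2) (auto intro!: derivative_eq_intros)
 thus ?thesis unfolding dd_def sc_scale by (simp add: DERIV_imp_deriv mult.commute)
qed

lemma ghol_limit:
 assumes W: "open W" and u: "!!x. x \<in> W ==> \<exists>r>0. \<exists>f. ball x r \<subseteq> W & (\<forall>n. ghol sc (ball x r) (f n)) &
  uniform_limit (ball x r) f L sequentially"
 shows "ghol sc W L" unfolding ghol_def
proof (intro conjI allI W)
 show "continuous_on W L"
 proof (rule continuous_at_imp_continuous_on, rule ballI)
  fix x assume "x \<in> W"
  then obtain r f where r: "0 < r" "!!n. ghol sc (ball x r) (f n)" "uniform_limit (ball x r) f L sequentially" using u by metis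
  have "continuous_on (ball x r) L"
   by (rule uniform_limit_theorem[OF always_eventually r(3)]) (use r(2) in \<open>auto simp: ghol_def\<close>)
  thus "isCont L x" using r(1) by (simp add: continuous_on_eq_continuous_at)
 qed
 fix x v
 show "(\<lambda>t. L (x + sc t v)) holomorphic_on {t. x + sc t v \<in> W}" unfolding holomorphic_on_open[OF line_open[OF W]]
 proof
  fix t0 assume "t0 \<in> {t. x + sc t v \<in> W}"
  hence x0: "x + sc t0 v \<in> W" by simp
  define y where "y = x + sc t0 v"
  obtain r f where r: "0 < r" "!!n. ghol sc (ball y r) (f n)" "uniform_limit (ball y r) f L sequentially"
   using u[OF x0] unfolding y_def by metis
  define S where "S = {t. x + sc t v \<in> ball y r}"
  have S: "open S" "t0 \<in> S" unfolding S_def y_def using r(1) by (auto intro!: line_open simp del: mem_ball)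
  have "(\<lambda>t. L (x + sc t v)) holomorphic_on S"
  proof (rule holomorphic_uniform_sequence[OF S(1), where f="\<lambda>n t. f n (x + sc t v)"])
   show "(\<lambda>t. f n (x + sc t v)) holomorphic_on S" for n using r(2) by (simp add: ghol_def S_def)
   fix t assume "t \<in> S"
   then obtain d where d: "0 < d" "cball t d \<subseteq> S" using S(1) open_contains_cball by blast
   have "uniform_limit (cball t d) (\<lambda>n t. f n (x + sc t v)) (\<lambda>t. L (x + sc t v)) sequentially"
    by (rule uniform_limit_compose'[OF r(3)]) (use d in \<open>auto simp: S_def\<close>)
   thus "\<exists>d>0. cball t d \<subseteq> S & uniform_limit (cball t d) (\<lambda>n t. f n (x + sc t v)) (\<lambda>t. L (x + sc t v)) sequentially"
    using d by blast
  qed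
  thus "\<exists>f'. ((\<lambda>t. L (x + sc t v)) has_field_derivative f') (at t0)"
   unfolding holomorphic_on_open[OF S(1)] using S(2) by blast
 qed
qed

lemma ghol_shift:
 assumes h: "ghol sc W h" and W': "open W'" "!!y. y \<in> W' ==> y + c \<in> W"
 shows "ghol sc W' (\<lambda>y. h (y + c))" unfolding ghol_def
proof (intro conjI allI W'(1))
 show "continuous_on W' (\<lambda>y. h (y + c))"
  by (rule continuous_on_compose2[of W h]) (use h W'(2) in \<open>auto simp: ghol_def intro!: continuous_intros\<close>)
 fix x v
 have e: "x + sc t v + c = x + c + sc t v" for t by (simp add: add_ac)
 have "(\<lambda>t. h (x + c + sc t v)) holomorphic_on {t. x + c + sc t v \<in> W}" using h by (simp add: ghol_def)
 thus "(\<lambda>t. h (x + sc t v + c)) holomorphic_on {t. x + sc t v \<in> W'}"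
  unfolding e by (rule holomorphic_on_subset) (use W'(2)[of "x + sc _ v", unfolded e] in auto)
qed

text \<open>By \<open>dd_taylor\<close> the difference quotients with real steps converge locally
  uniformly, and each of them is holomorphic.\<close>

lemma ghol_dd:
 assumes h: "ghol sc W h"
 shows "ghol sc W (dd h v)"
proof (rule ghol_limit)
 show "open W" using h by (simp add: ghol_def)
 fix x assume x: "x \<in> W"
 obtain r C where r: "0 < r" "0 <= C" "ball x (2 * r) \<subseteq> W"
  "!!y v. y \<in> ball x r ==> norm v < r ==> cmod (h (y + v) - h y - dd h v y) <= C * (norm v)^2"
  by (rule dd_taylor[OF h x]) blast
 \<comment> \<open>Shifting the index by N keeps every step s n v shorter than r.\<close>
 obtain N :: nat where N: "norm v / r < real N" using reals_Archimedean2 by blast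
 define s where "s n = 1 / real (Suc (n + N))" for n
 define q where "q n y = of_real (1 / s n) * (h (y + s n *\<^sub>R v) - h (y + 0))" for n y
 have s0: "0 < s n" for n by (simp add: s_def)
 have sv: "norm (s n *\<^sub>R v) < r" for n
 proof -
  have "norm v < r * real N" using N r(1) by (simp add: field_simps)
  also have "... <= r * real (Suc (n + N))" using r(1) by (intro mult_left_mono) auto
  finally show ?thesis by (simp add: s_def field_simps)
 qed
 have sub: "y + c \<in> W" if "y \<in> ball x r" "norm c < r" for y c
  using that r(3) dist_triangle[of x "y + c" y] by (auto simp: dist_norm subset_iff)
 have g: "ghol sc (ball x r) (q n)" for n
 proof -
  have "ghol sc (ball x r) (\<lambda>y. h (y + s n *\<^sub>R v))" "ghol sc (ball x r) (\<lambda>y. h (y + 0))"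
   by (rule ghol_shift[OF h open_ball sub]; use sv r(1) in simp)+
  thus ?thesis unfolding q_def ghol_def by (auto intro!: continuous_intros holomorphic_intros simp: less_imp_neq[OF s0, symmetric])
 qed
 have "uniform_limit (ball x r) q (dd h v) sequentially"
 proof (rule uniform_limitI)
  fix e :: real assume "0 < e"
  then obtain M where M: "C * (norm v)^2 / e < real M" "0 < e" using reals_Archimedean2 by blast
  have "dist (q n y) (dd h v y) < e" if n: "M <= n" and y: "y \<in> ball x r" for n y
  proof -
   have yW: "y \<in> W" using sub[OF y, of 0] r(1) by simp
   have "cmod (h (y + s n *\<^sub>R v) - h y - of_real (s n) * dd h v y) <= C * (s n * norm v)^2"
    using r(4)[OF y sv[of n]] s0[of n] by (simp add: dd_scale[OF h yW])
   hence "(1 / s n) * cmod (h (y + s n *\<^sub>R v) - h y - of_real (s n) * dd h v y) <= (1 / s n) * (C * (s n * norm v)^2)"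
    using s0[of n] by (intro mult_left_mono) auto
   also have "... = C * (norm v)^2 * s n" using s0[of n] by (simp add: power2_eq_square)
   also have "... < e"
   proof -
    have "C * (norm v)^2 < e * real M" using M by (simp add: field_simps)
    also have "... <= e * real (Suc (n + N))" using n M(2) by (intro mult_left_mono) auto
    finally show ?thesis by (simp add: s_def field_simps)
   qed
   also have "(1 / s n) * cmod (h (y + s n *\<^sub>R v) - h y - of_real (s n) * dd h v y) = cmod (of_real (1 / s n) * (h (y + s n *\<^sub>R v) - h y - of_real (s n) * dd h v y))"
    using s0[of n] by (simp only: norm_mult norm_of_real) simp
   also have "of_real (1 / s n) * (h (y + s n *\<^sub>R v) - h y - of_real (s n) * dd h v y) = q n y - dd h v y"
    using s0[of n] by (simp add: q_def algebra_simps)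
   finally show ?thesis by (simp add: dist_norm)
  qed
  thus "\<forall>\<^sub>F n in sequentially. \<forall>y\<in>ball x r. dist (q n y) (dd h v y) < e"
   unfolding eventually_sequentially by blast
 qed
 moreover have "ball x r \<subseteq> W" using sub[of _ 0] r(1) by auto
 ultimately show "\<exists>r>0. \<exists>f. ball x r \<subseteq> W & (\<forall>n. ghol sc (ball x r) (f n)) & uniform_limit (ball x r) f (dd h v) sequentially"
  using r(1) g by blast
qed

text \<open>Additivity in the direction is the point that a definition along lines does not give.
  The increment along s (v + w) is compared with the increments along s v and then s w: the three
  Taylor errors are O(s^2), and \<open>dd h w\<close> is continuous.\<close>

lemma has_derivative_dd:
 assumes h: "ghol sc W h" and x: "x \<in> W"
 shows "(h has_derivative (\<lambda>v. dd h v x)) (at x)"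
proof -
 obtain r C where r: "0 < r" "0 <= C" "ball x (2 * r) \<subseteq> W"
  "!!y v. y \<in> ball x r ==> norm v < r ==> cmod (h (y + v) - h y - dd h v y) <= C * (norm v)^2"
  "!!y v. y \<in> ball x r ==> cmod (dd h v y) <= C * norm v" by (rule dd_taylor[OF h x]) blast
 have xr: "x \<in> ball x r" using r by simp
 have add: "dd h (v + w) x = dd h v x + dd h w x" for v w
 proof -
  define b where "b = norm v + norm w + norm (v + w) + 1"
  have b0: "0 < b" by (simp add: b_def add_nonneg_pos)
  have cw: "isCont (dd h w) x" using ghol_dd[OF h, of w] x by (auto simp: ghol_def continuous_on_eq_continuous_at)
  have lim1: "((\<lambda>s::real. dd h (v + w) x - dd h v x - dd h w (x + s *\<^sub>R v)) \<longlongrightarrow> dd h (v + w) x - dd h v x - dd h w (x + 0 *\<^sub>R v)) (at_right 0)"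
   by (intro tendsto_intros isCont_tendsto_compose[OF _, of "x + 0 *\<^sub>R v" "dd h w"]) (use cw in auto)
  have "((\<lambda>s::real. dd h (v + w) x - dd h v x - dd h w (x + s *\<^sub>R v)) \<longlongrightarrow> 0) (at_right 0)"
  proof (rule Lim_null_comparison)
   show "((\<lambda>s::real. 3 * C * b^2 * s) \<longlongrightarrow> 0) (at_right 0)" by (auto intro!: tendsto_eq_intros)
   have "\<forall>\<^sub>F s::real in at_right 0. 0 < s & s < r / b"
    using eventually_at_right_real[of 0 "r / b"] r b0 by (auto simp: greaterThanLessThan_iff)
   thus "\<forall>\<^sub>F s::real in at_right 0. norm (dd h (v + w) x - dd h v x - dd h w (x + s *\<^sub>R v)) <= 3 * C * b^2 * s"
   proof eventually_elim
    case (elim s)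
    have sm: "norm (s *\<^sub>R u) < r" "C * (norm (s *\<^sub>R u))^2 <= C * (b * s)^2" if "norm u <= b" for u
    proof -
     have "s * norm u <= s * b" using that elim by (intro mult_left_mono) auto
     moreover have "s * b < r" using elim b0 by (simp add: field_simps)
     ultimately have "s * norm u < r" by linarith
     thus "norm (s *\<^sub>R u) < r" using elim by simp
     show "C * (norm (s *\<^sub>R u))^2 <= C * (b * s)^2"
      using \<open>s * norm u <= s * b\<close> elim r(2) by (intro mult_left_mono power_mono) (auto simp: mult.commute)
    qed
    have nb: "norm v <= b" "norm w <= b" "norm (v + w) <= b" by (auto simp: b_def)
    have xs: "x + s *\<^sub>R v \<in> ball x r" using sm(1)[OF nb(1)] by (simp add: dist_norm)
    have xsW: "x + s *\<^sub>R v \<in> W" using xs r by (auto simp: subset_iff)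
    let ?A = "h (x + s *\<^sub>R (v + w)) - h x - dd h (s *\<^sub>R (v + w)) x"
    let ?B = "h (x + s *\<^sub>R v) - h x - dd h (s *\<^sub>R v) x"
    let ?D = "h (x + s *\<^sub>R v + s *\<^sub>R w) - h (x + s *\<^sub>R v) - dd h (s *\<^sub>R w) (x + s *\<^sub>R v)"
    have ABD: "cmod ?A <= C * (b * s)^2" "cmod ?B <= C * (b * s)^2" "cmod ?D <= C * (b * s)^2"
     using r(4)[OF xr sm(1)[OF nb(3)]] r(4)[OF xr sm(1)[OF nb(1)]] r(4)[OF xs sm(1)[OF nb(2)]] sm(2) nb by (meson order_trans)+
    have e: "- ?A + ?B + ?D = of_real s * (dd h (v + w) x - dd h v x - dd h w (x + s *\<^sub>R v))"
     unfolding dd_scale[OF h x] dd_scale[OF h xsW] by (simp add: algebra_simps)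
    have "cmod (- ?A + ?B + ?D) <= 3 * (C * (b * s)^2)"
     using norm_triangle_ineq[of "- ?A + ?B" "?D"] norm_triangle_ineq[of "- ?A" "?B"] ABD unfolding norm_minus_cancel by linarith
    hence "s * cmod (dd h (v + w) x - dd h v x - dd h w (x + s *\<^sub>R v)) <= s * (3 * C * b^2 * s)"
     unfolding e norm_mult using elim by (simp add: power_mult_distrib power2_eq_square mult_ac)
    thus ?case using elim by (simp only: mult_le_cancel_left_pos)
   qed
  qed
  from tendsto_unique[OF _ lim1 this] show ?thesis by (simp add: diff_eq_eq add.commute)
 qed
 have bl: "bounded_linear (\<lambda>v. dd h v x)"
  by (rule bounded_linear_intro[where K=C]) (use add dd_scale[OF h x] r(5)[OF xr] in \<open>auto simp: scaleR_conv_of_real mult.commute\<close>)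
 show ?thesis unfolding has_derivative_at
 proof (intro conjI bl)
  show "(\<lambda>v. norm (h (x + v) - h x - dd h v x) / norm v) \<midarrow>0\<rightarrow> 0"
  proof (rule Lim_null_comparison)
   show "((\<lambda>v. C * norm v) \<longlongrightarrow> 0) (at 0)" by (auto intro!: tendsto_eq_intros)
   show "\<forall>\<^sub>F v in at 0. norm (norm (h (x + v) - h x - dd h v x) / norm v) <= C * norm v" unfolding eventually_at
   proof (intro exI[of _ r] conjI ballI impI r(1))
    fix v :: 'e assume "v ~= 0 & dist v 0 < r"
    thus "norm (norm (h (x + v) - h x - dd h v x) / norm v) <= C * norm v"
     using r(4)[OF xr, of v] by (simp add: divide_simps power2_eq_square mult.assoc)
   qed
  qed
 qed
qed

text \<open>By induction: in a direction v of V the derivative of f is locally the restriction of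
  \<open>dd h (\<iota> v)\<close>, which is again holomorphic. The extension h depends on the point,
  but the resulting derivatives fit together because derivatives in directions of V are unique on
  S.\<close>

theorem ghol_Ck:
 fixes \<iota> :: "'a::real_normed_vector => 'e"
 assumes \<iota>: "bounded_linear \<iota>"
  and S: "!!x v. x \<in> S ==> v \<in> V ==> \<exists>\<delta>>0. \<forall>s. \<bar>s\<bar> < \<delta> --> x + s *\<^sub>R v \<in> S"
  and f: "!!x. x \<in> S ==> \<exists>W h. ghol sc W h & \<iota> x \<in> W & (\<forall>y\<in>S. \<iota> y \<in> W --> f y = h (\<iota> y))"
 shows "Ck_on k V S f"
proof -
 have fd: "(f has_derivative (\<lambda>v. dd h (\<iota> v) (\<iota> x))) (at x within S)"
  if h: "ghol sc W h" "\<iota> x \<in> W" "\<forall>y\<in>S. \<iota> y \<in> W --> f y = h (\<iota> y)" and x: "x \<in> S" for f h W x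
 proof -
  have d: "((\<lambda>y. h (\<iota> y)) has_derivative (\<lambda>v. dd h (\<iota> v) (\<iota> x))) (at x within S)"
   by (rule has_derivative_at_withinI, rule has_derivative_compose[OF bounded_linear_imp_has_derivative[OF \<iota>]
     has_derivative_dd[OF h(1,2)]])
  have "open (\<iota> -` W)" using h(1) \<iota> by (intro open_vimage linear_continuous_on) (auto simp: ghol_def)
  then obtain e where e: "0 < e" "ball x e \<subseteq> \<iota> -` W" using h(2) open_contains_ball by (metis vimageI)
  show ?thesis
   by (rule has_derivative_transform_within[OF d e(1) x]) (use h(3) e(2) in \<open>force simp: dist_commute subset_iff\<close>)
 qed
 show ?thesis using f
 proof (induction k arbitrary: f)
  case 0
  show ?case unfolding Ck_on.simps continuous_on_eq_continuous_within
  proof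
   fix x assume x: "x \<in> S"
   then obtain W h where "ghol sc W h" "\<iota> x \<in> W" "\<forall>y\<in>S. \<iota> y \<in> W --> f y = h (\<iota> y)" using 0 by blast
   from fd[OF this x] show "continuous (at x within S) f" by (rule has_derivative_continuous)
  qed
 next
  case (Suc k)
  obtain W h where Wh: "!!x. x \<in> S ==> ghol sc (W x) (h x)" "!!x. x \<in> S ==> \<iota> x \<in> W x"
   "!!x. x \<in> S ==> \<forall>y\<in>S. \<iota> y \<in> W x --> f y = h x (\<iota> y)" using Suc.prems by metis
  have "Ck_on k V S (\<lambda>y. dd (h y) (\<iota> v) (\<iota> y))" if v: "v \<in> V" for v
  proof (rule Suc.IH)
   fix x assume x: "x \<in> S"
   have "dd (h y) (\<iota> v) (\<iota> y) = dd (h x) (\<iota> v) (\<iota> y)" if y: "y \<in> S" "\<iota> y \<in> W x" for y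
    by (rule vector_derivative_unique_at[OF line_derivative[OF fd[OF Wh(1-3)[OF y(1)] y(1)] S[OF y(1) v]]
      line_derivative[OF fd[OF Wh(1)[OF x] y(2) Wh(3)[OF x] y(1)] S[OF y(1) v]]])
   thus "\<exists>W' h'. ghol sc W' h' & \<iota> x \<in> W' & (\<forall>y\<in>S. \<iota> y \<in> W' --> dd (h y) (\<iota> v) (\<iota> y) = h' (\<iota> y))"
    using ghol_dd[OF Wh(1)[OF x]] Wh(2)[OF x] by blast
  qed
  thus ?case unfolding Ck_on.simps
   by (intro exI[of _ "\<lambda>x v. dd (h x) (\<iota> v) (\<iota> x)"]) (use fd[OF Wh(1-3)] in blast)
 qed
qed

end

subsection \<open>Holomorphic dependence of the connection matrices on the residue\<close>

lemma complex_structure_cscale: "complex_structure (cscale :: complex => 'n cmat => 'n::finite cmat)"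
 by unfold_locales (use bounded_bilinear_cscale cscale_of_real in auto)

interpretation cstr: complex_structure "cscale :: complex => 'n cmat => 'n::finite cmat"
 by (rule complex_structure_cscale)

definition mghol :: "'n::finite cmat set => ('n cmat => 'm::finite cmat) => bool" where
 "mghol W X \<longleftrightarrow> (\<forall>i j. ghol cscale W (\<lambda>x. X x $ i $ j))"

lemma mghol_iff:
 "mghol W X \<longleftrightarrow> open W & continuous_on W X &
   (\<forall>x v t. x + cscale t v \<in> W --> (\<exists>X'. has_mderiv (\<lambda>t. X (x + cscale t v)) X' t))"
proof (cases "open W")
 case W: True
 have "continuous_on W X \<longleftrightarrow> (\<forall>i j. continuous_on W (\<lambda>x. X x $ i $ j))"
 proof
  assume "\<forall>i j. continuous_on W (\<lambda>x. X x $ i $ j)"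
  hence "continuous_on W (\<lambda>x. \<chi> i j. X x $ i $ j)" by (intro continuous_on_vec_lambda) simp
  thus "continuous_on W X" by simp
 qed (auto intro!: continuous_intros)
 moreover have "(\<forall>i j. (\<lambda>t. X (x + cscale t v) $ i $ j) holomorphic_on {t. x + cscale t v \<in> W}) \<longleftrightarrow>
   (\<forall>t. x + cscale t v \<in> W --> (\<exists>X'. has_mderiv (\<lambda>t. X (x + cscale t v)) X' t))" for x v
  using mat_holomorphic_iff[OF cstr.line_open[OF W], of "\<lambda>t. X (x + cscale t v)" x v] by (simp add: mat_holomorphic_on_def)
 ultimately show ?thesis using W by (auto simp: mghol_def ghol_def)
qed (simp add: mghol_def ghol_def)

lemma mgholI:
 "open W ==> continuous_on W X ==> (!!x v t. x + cscale t v \<in> W ==> \<exists>X'. has_mderiv (\<lambda>t. X (x + cscale t v)) X' t) ==> mghol W X"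
 by (simp add: mghol_iff)

lemma mgholD:
 "mghol W X ==> open W" "mghol W X ==> continuous_on W X"
 "mghol W X ==> x + cscale t v \<in> W ==> \<exists>X'. has_mderiv (\<lambda>t. X (x + cscale t v)) X' t"
 by (auto simp: mghol_iff)

lemma mghol_entry: "mghol W X ==> ghol cscale W (\<lambda>x. X x $ i $ j)"
 by (simp add: mghol_def)

lemma mghol_const: "open W ==> mghol W (\<lambda>_. M)"
 by (intro mgholI continuous_intros) (use has_mderiv_const in auto)

lemma mghol_mult: "mghol W X ==> mghol W Y ==> mghol W (\<lambda>x. X x ** Y x)"
 by (rule mgholI) (erule mgholD, erule (1) mm.continuous_on[OF mgholD(2) mgholD(2)],
  drule (1) mgholD(3), drule (1) mgholD(3), elim exE, rule exI, erule (1) has_mderiv_mult)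

lemma mghol_add: "mghol W X ==> mghol W Y ==> mghol W (\<lambda>x. X x + Y x)"
 by (rule mgholI) (erule mgholD, erule (1) continuous_on_add[OF mgholD(2) mgholD(2)],
  drule (1) mgholD(3), drule (1) mgholD(3), elim exE, rule exI, erule (1) has_mderiv_add)

lemma mghol_sum: "open W ==> (!!k. k \<in> I ==> mghol W (X k)) ==> mghol W (\<lambda>x. \<Sum>k\<in>I. X k x)"
 by (induction I rule: infinite_finite_induct) (auto intro: mghol_add mghol_const)

lemma mghol_cscale: "mghol W X ==> mghol W (\<lambda>x. cscale c (X x))"
 using mghol_mult[OF mghol_const[of W "cscale c (mat 1)"]] mgholD(1) by fastforce

lemma mghol_id: "mghol UNIV (\<lambda>x :: 'n::finite cmat. x)"
proof (rule mgholI)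
 fix x v :: "'n cmat" and t
 have "has_mderiv (\<lambda>t. x + cscale t v) (0 + (cscale 1 v + cscale t 0)) t"
  by (intro has_mderiv_add has_mderiv_const has_mderiv_cscale) (auto intro!: derivative_eq_intros)
 thus "\<exists>X'. has_mderiv (\<lambda>t. x + cscale t v) X' t" by blast
qed auto

lemma mghol_transpose: "mghol W X ==> mghol W (\<lambda>x. transpose (X x))"
proof (rule mgholI)
 assume X: "mghol W X"
 show "open W" by (rule mgholD[OF X])
 have "continuous_on W (\<lambda>x. \<chi> i j. X x $ j $ i)" by (intro continuous_intros mgholD[OF X])
 thus "continuous_on W (\<lambda>x. transpose (X x))" by (simp add: transpose_def)
 fix x v t assume "x + cscale t v \<in> W"
 then obtain X' where "has_mderiv (\<lambda>t. X (x + cscale t v)) X' t" using mgholD(3)[OF X] by blast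
 hence "has_mderiv (\<lambda>t. transpose (X (x + cscale t v))) (transpose X') t" by (simp add: has_mderiv_iff transpose_def)
 thus "\<exists>X'. has_mderiv (\<lambda>t. transpose (X (x + cscale t v))) X' t" by blast
qed

lemma mghol_precompose:
 assumes X: "mghol W X" and L: "bounded_linear L" "!!c v. L (cscale c v) = cscale c (L v)" and W': "open W'" "L ` W' \<subseteq> W"
 shows "mghol W' (\<lambda>x. X (L x))"
proof (rule mgholI[OF W'(1)])
 show "continuous_on W' (\<lambda>x. X (L x))"
  by (rule continuous_on_compose2[OF mgholD(2)[OF X] linear_continuous_on[OF L(1)]]) (use W' in auto)
 fix x v t assume "x + cscale t v \<in> W'"
 moreover have e: "L (x + cscale t v) = L x + cscale t (L v)" for t by (simp add: linear_add[OF bounded_linear.linear[OF L(1)]] L(2))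
 ultimately have "L x + cscale t (L v) \<in> W" using W'(2) by (metis image_subset_iff)
 thus "\<exists>X'. has_mderiv (\<lambda>t. X (L (x + cscale t v))) X' t" unfolding e by (rule mgholD(3)[OF X])
qed

lemma mghol_limit:
 assumes W: "open W" and X: "!!n. mghol W (X n)"
  and u: "!!x. x \<in> W ==> \<exists>r>0. ball x r \<subseteq> W & uniform_limit (ball x r) X L sequentially"
 shows "mghol W L" unfolding mghol_def
proof (intro allI cstr.ghol_limit W)
 fix i j x assume "x \<in> W"
 then obtain r where r: "0 < r" "ball x r \<subseteq> W" "uniform_limit (ball x r) X L sequentially" using u by blast
 have "ghol cscale (ball x r) (\<lambda>x. X n x $ i $ j)" for n
  using cstr.ghol_shift[OF mghol_entry[OF X] open_ball, of x r 0] r(2) by (auto simp: subset_iff)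
 thus "\<exists>r>0. \<exists>f. ball x r \<subseteq> W & (\<forall>n. ghol cscale (ball x r) (f n)) &
   uniform_limit (ball x r) f (\<lambda>x. L x $ i $ j) sequentially"
  using r bounded_linear.uniform_limit[OF bounded_linear_entry r(3), of i j]
  by (intro exI[of _ r] conjI exI[of _ "\<lambda>n x. X n x $ i $ j"]) auto
qed

lemma mghol_fco: "mghol UNIV (\<lambda>b. fco a b m)"
proof (induction m rule: less_induct)
 case (less m)
 show ?case
 proof (cases m)
  case 0 thus ?thesis by (simp add: mghol_const)
 next
  case (Suc p)
  have "mghol UNIV (\<lambda>b. cscale (1 / of_nat (Suc p)) (b ** fco a b p + a ** (\<Sum>k\<le>p. cscale (1 / fact k) (fco a b (p - k)))))"
   by (intro mghol_cscale mghol_add mghol_mult mghol_id mghol_const mghol_sum less open_UNIV) (auto simp: Suc)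
  thus ?thesis by (simp add: Suc)
 qed
qed

lemma mghol_fsol: "mghol UNIV (\<lambda>b. fsol a b u)"
proof (rule mghol_limit[where X="\<lambda>N b. \<Sum>m<N. cscale (u ^ m) (fco a b m)"])
 show "mghol UNIV (\<lambda>b. \<Sum>m<n. cscale (u ^ m) (fco a b m))" for n by (intro mghol_sum mghol_cscale mghol_fco) auto
 fix b :: "'a cmat"
 define K where "K = norm a + norm b + 1"
 have K: "0 <= K" by (simp add: K_def)
 have "uniform_limit (ball b 1) (\<lambda>N b. \<Sum>m<N. cscale (u ^ m) (fco a b m)) (\<lambda>b. fsol a b u) sequentially"
 proof (rule uniform_limit_compose'[OF fsol_uniform_limit[OF K norm_ge_zero[of u]], of "\<lambda>b. (a, b, u)" "ball b 1", unfolded fst_conv snd_conv])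
  show "(\<lambda>b. (a, b, u)) \<in> ball b 1 \<rightarrow> {p. norm (fst p) <= K & norm (fst (snd p)) <= K & cmod (snd (snd p)) <= cmod u}"
  proof
   fix b' assume "b' \<in> ball b 1"
   hence "norm (b' - b) < 1" by (simp add: dist_norm norm_minus_commute)
   hence "norm b' <= norm b + 1" using norm_triangle_ineq[of b "b' - b"] by simp
   thus "(a, b', u) \<in> {p. norm (fst p) <= K & norm (fst (snd p)) <= K & cmod (snd (snd p)) <= cmod u}"
    by (simp add: K_def) (smt (verit) norm_ge_zero)
  qed
 qed
 thus "\<exists>r>0. ball b r \<subseteq> UNIV & uniform_limit (ball b r) (\<lambda>N b. \<Sum>m<N. cscale (u ^ m) (fco a b m)) (\<lambda>b. fsol a b u) sequentially"
  by (intro exI[of _ 1]) auto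
qed simp

lemma neg_transpose_linear:
 "bounded_linear (\<lambda>b :: 'n::finite cmat. - transpose b)" "- transpose (cscale c b) = cscale c (- transpose b)"
proof -
 show "bounded_linear (\<lambda>b :: 'n cmat. - transpose b)"
 proof (rule bounded_linear_intro[where K=1])
  show "norm (- transpose x) <= norm x * 1" for x :: "'n cmat" by simp
 qed (auto simp: vec_eq_iff transpose_def)
qed (simp add: vec_eq_iff transpose_def)

lemma mghol_isol: "mghol UNIV (\<lambda>b. isol a b u)"
 unfolding isol_def by (intro mghol_transpose mghol_precompose[OF mghol_fsol neg_transpose_linear]) auto

lemma open_tube: "open (tube :: 'n::finite cmat set)"
proof -
 have e: "tube = (\<Inter>i\<in>UNIV. {b :: 'n cmat. \<bar>Re (b $ i $ i)\<bar> < 1/8})" unfolding tube_def by auto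
 have "open {b :: 'n cmat. \<bar>Re (b $ i $ i)\<bar> < 1/8}" for i by (intro open_Collect_less continuous_intros)
 thus ?thesis unfolding e by (intro open_INT ballI finite)
qed

lemma fsol_bound:
 assumes "0 <= K" "0 <= \<rho>"
 obtains C where "0 <= C" "!!(a::'n::finite cmat) b u. norm a <= K ==> norm b <= K ==> cmod u <= \<rho> ==> norm (fsol a b u) <= C"
proof -
 obtain C where C: "!!(a::'n cmat) b u m. norm a <= K ==> norm b <= K ==> cmod u <= \<rho> ==>
  norm (cscale (u ^ m) (fco a b m)) <= C * (1/2) ^ m" by (rule fco_term_bound[OF assms, where 'n='n]) blast
 have b: "norm (fsol a b u) <= \<bar>2 * C\<bar>" if "norm a <= K" "norm b <= K" "cmod u <= \<rho>" for a b :: "'n cmat" and u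
 proof -
  have "norm (fsol a b u) <= (\<Sum>m. C * (1/2) ^ m)"
   unfolding fsol_def by (rule norm_suminf_le[OF C[OF that]]) (intro summable_mult, simp)
  also have "... = C * 2" by (subst suminf_mult) (simp_all add: suminf_geometric)
  finally show ?thesis by simp
 qed
 thus ?thesis using that[of "\<bar>2 * C\<bar>"] by simp
qed

lemma mghol_Dd: "mghol UNIV (\<lambda>b. Dd a b u)"
proof (rule mgholI)
 have e: "Dd a b u = (\<chi> i j. if i = j then exp (u * b $ i $ i + exp u * a $ i $ i) else 0)" for b
  by (rule cmat_eqI) (simp add: Dd_nth diag_mats_offdiag[OF Dd_diag(1)])
 have "continuous_on UNIV (\<lambda>b. if i = j then exp (u * b $ i $ i + exp u * a $ i $ i) else 0)" for i j :: 'a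
  by (cases "i = j") (auto intro!: continuous_intros)
 thus "continuous_on UNIV (\<lambda>b. Dd a b u)" unfolding e by (intro continuous_on_vec_lambda)
 fix x v t
 have "has_mderiv (\<lambda>t. Dd a (x + cscale t v) u)
   (\<chi> i j. if i = j then exp (u * (x $ i $ i + t * v $ i $ i) + exp u * a $ i $ i) * (u * v $ i $ i) else 0) t"
  unfolding has_mderiv_iff
 proof (intro allI)
  fix i j
  show "((\<lambda>t. Dd a (x + cscale t v) u $ i $ j) has_field_derivative
   (\<chi> i j. if i = j then exp (u * (x $ i $ i + t * v $ i $ i) + exp u * a $ i $ i) * (u * v $ i $ i) else 0) $ i $ j) (at t)"
   unfolding e by (cases "i = j") (auto intro!: derivative_eq_intros)
 qed
 thus "\<exists>X'. has_mderiv (\<lambda>t. Dd a (x + cscale t v) u) X' t" by blast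
qed simp

text \<open>\<open>C0\<close> is a limit of matrices that are entire in b. The convergence is
  locally uniform because the constants of \<open>real_limit_estimate\<close> depend only on a bound
  for b, and its error is relative to the limit, which in turn is bounded by values at the fixed
  time t0.\<close>

lemma mghol_C0:
 assumes a: "irr (a :: 'n::finite cmat)"
 shows "mghol tube (C0 a)"
proof (rule mghol_limit[OF open_tube, where X="\<lambda>n b. isol a b (of_real (real n)) ** Dd a b (of_real (real n))"])
 show "mghol tube (\<lambda>b. isol a b (of_real (real n)) ** Dd a b (of_real (real n)))" for n
  by (intro mghol_mult mghol_precompose[OF mghol_isol bounded_linear_ident] mghol_precompose[OF mghol_Dd bounded_linear_ident])
   (auto simp: open_tube)
 fix x :: "'n cmat" assume x: "x \<in> tube"
 obtain r where r: "0 < r" "r <= 1" "ball x r \<subseteq> tube"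
 proof -
  obtain e where "0 < e" "ball x e \<subseteq> tube" using open_tube x open_contains_ball by blast
  moreover have "ball x (min e 1) \<subseteq> ball x e" by auto
  ultimately show ?thesis using that[of "min e 1"] by auto
 qed
 define K where "K = norm x + 1"
 have K0: "0 <= K" by (simp add: K_def)
 have Kb: "norm b <= K" if "b \<in> ball x r" for b
  using that r(2) norm_triangle_ineq[of x "b - x"] by (simp add: K_def dist_norm norm_minus_commute)
 obtain A t0 where A: "0 <= A" "0 <= t0" and est: "\<forall>b\<in>tube. norm b <= K --> (\<forall>g.
   (\<forall>u. has_mderiv g (- (g u ** lcoef a b u)) u) -->
   (\<exists>L. lsol a b g L & norm L <= 2 * norm (g (of_real t0) ** asE 1 a b (of_real t0) ** Dd a b (of_real t0)) &
    (\<forall>t\<ge>t0. norm (g (of_real t) ** asE 1 a b (of_real t) ** Dd a b (of_real t) - L)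
      <= A * exp (- (real 1 - 1/4) * t) * norm L &
      norm (g (of_real t) ** Dd a b (of_real t) - L) <= A * exp (- t / 2) * norm L)))"
  using real_limit_estimate[OF a zero_less_one, of K] by (elim exE conjE) (rule that)
 obtain C1 where C1: "0 <= C1" "!!b :: 'n cmat. !!u. norm b <= K ==> 0 <= Re u ==> norm (asE 1 a b u - mat 1) <= C1 * exp (- Re u)"
  using asE_bound[of K 1 a] by blast
 obtain C2 where C2: "0 <= C2" "!!(a'::'n cmat) b u. norm a' <= norm a + K ==> norm b <= norm a + K ==> cmod u <= t0 ==> norm (fsol a' b u) <= C2"
  by (rule fsol_bound[of "norm a + K" t0, where 'n='n]) (use K0 A in auto)
 define N where "N = norm (mat 1 :: 'n cmat)"
 define C3 where "C3 = real (CARD('n))^2 * exp (t0 * K)"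
 define Q where "Q = 2 * (C2 * (N + C1) * C3)"
 have Q0: "0 <= Q" using C1 C2 by (simp add: Q_def C3_def N_def)
 have bd: "norm (isol a b (of_real t) ** Dd a b (of_real t) - C0 a b) <= A * exp (- t / 2) * Q"
  if b: "b \<in> ball x r" and t: "t0 <= t" for b t
 proof -
  have bt: "b \<in> tube" and bK: "norm b <= K" using b r Kb by auto
  obtain L where L: "lsol a b (isol a b) L" "norm L <= 2 * norm (isol a b (of_real t0) ** asE 1 a b (of_real t0) ** Dd a b (of_real t0))"
   "norm (isol a b (of_real t) ** Dd a b (of_real t) - L) <= A * exp (- t / 2) * norm L"
   using est[rule_format, OF bt bK, of "isol a b"] has_mderiv_isol t by blast
  have LC: "L = C0 a b" by (rule lsol_unique[OF L(1) lsol_isol[OF a bt]])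
  have "norm (isol a b (of_real t0)) <= C2"
   unfolding isol_def norm_transpose by (rule C2(2)) (use bK K0 A in \<open>auto intro: add_increasing\<close>)
  moreover have "norm (asE 1 a b (of_real t0)) <= N + C1"
  proof -
   have "C1 * exp (- t0) <= C1 * 1" using C1 A by (intro mult_left_mono) auto
   hence "norm (asE 1 a b (of_real t0) - mat 1) <= C1" using C1(2)[OF bK, of "of_real t0"] A by simp
   thus ?thesis using norm_triangle_ineq[of "mat 1" "asE 1 a b (of_real t0) - mat 1"] by (simp add: N_def)
  qed
  moreover have "norm (Dd a b (of_real t0)) <= C3" unfolding C3_def
  proof (rule norm_cmat_le_entries)
   fix i j
   show "cmod (Dd a b (of_real t0) $ i $ j) <= exp (t0 * K)"
   proof (cases "i = j")
    case True
    have "Re (b $ i $ i) <= K" using complex_Re_le_cmod[of "b $ i $ i"] cmod_entry_le[of b i i] bK by linarith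
    hence "t0 * Re (b $ i $ i) <= t0 * K" using A by (intro mult_left_mono) auto
    thus ?thesis using True by (simp add: Dd_nth norm_exp_eq_Re irrD(2)[OF a] Im_exp)
   qed (simp add: diag_mats_offdiag[OF Dd_diag(1)])
  qed
  ultimately have "norm (isol a b (of_real t0) ** asE 1 a b (of_real t0) ** Dd a b (of_real t0)) <= C2 * (N + C1) * C3"
   using C2(1) C1(1) by (intro order_trans[OF norm_matrix_mult_le mult_mono] order_trans[OF norm_matrix_mult_le mult_mono]) (auto simp: N_def)
  hence "norm L <= Q" using L(2) by (simp add: Q_def)
  thus ?thesis using order_trans[OF L(3) mult_left_mono] A LC by simp
 qed
 have "uniform_limit (ball x r) (\<lambda>n b. isol a b (of_real (real n)) ** Dd a b (of_real (real n))) (C0 a) sequentially"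
 proof (rule uniform_limitI)
  fix e :: real assume e: "0 < e"
  obtain t1 where t1: "0 <= t1" "!!t. t1 <= t ==> (A * Q) * exp (- (1/2) * t) <= e / 2"
   using exp_decay_le[of "1/2" "A * Q" "e / 2"] A Q0 e by auto
  have "\<forall>\<^sub>F n in sequentially. max t0 t1 <= real n"
   using eventually_ge_at_top[of "nat \<lceil>max t0 t1\<rceil>"] by eventually_elim linarith
  thus "\<forall>\<^sub>F n in sequentially. \<forall>b\<in>ball x r. dist (isol a b (of_real (real n)) ** Dd a b (of_real (real n))) (C0 a b) < e"
  proof eventually_elim
   case (elim n)
   show ?case
   proof
    fix b assume b: "b \<in> ball x r"
    have "norm (isol a b (of_real (real n)) ** Dd a b (of_real (real n)) - C0 a b) <= A * exp (- real n / 2) * Q"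
     by (rule bd[OF b]) (use elim in simp)
    also have "... <= e / 2" using t1(2)[of "real n"] elim by (simp add: mult_ac)
    finally show "dist (isol a b (of_real (real n)) ** Dd a b (of_real (real n))) (C0 a b) < e" using e by (simp add: dist_norm)
   qed
  qed
 qed
 thus "\<exists>r>0. ball x r \<subseteq> tube & uniform_limit (ball x r) (\<lambda>n b. isol a b (of_real (real n)) ** Dd a b (of_real (real n))) (C0 a) sequentially"
  using r by blast
qed

lemma mghol_Ci: "irr a ==> mghol tube (Ci a)"
proof -
 assume a: "irr a"
 have "mghol tube (\<lambda>b. transpose (C0 (- a) (- transpose b)))"
  by (intro mghol_transpose mghol_precompose[OF mghol_C0 neg_transpose_linear]) (use a tube_transpose open_tube in auto)
 thus ?thesis by (simp add: Ci_def[abs_def])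
qed

lemma mghol_subset: "mghol W X ==> open W' ==> W' \<subseteq> W ==> mghol W' X"
 using mghol_precompose[OF _ bounded_linear_ident, of W X W'] by simp

lemma mghol_Phi0: "irr a ==> mghol tube (\<lambda>b. Phi0 a b u)"
 unfolding Phi0_def by (intro mghol_mult mghol_C0 mghol_subset[OF mghol_fsol] open_tube) auto

lemma mghol_clow: "irr a ==> mghol tube (clow a)" "irr a ==> mghol tube (cup a)"
 unfolding clow_def[abs_def] cup_def[abs_def] by (intro mghol_mult mghol_C0 mghol_Ci mghol_subset[OF mghol_fsol] open_tube; simp)+

text \<open>This is \<open>cup\<close>^(-1) \<open>clow\<close>, see \<open>cup_Mt\<close>. The
  complex derivative of \<open>clow\<close> at a skew-Hermitian residue has only triangular values,
  so \<open>clow\<close> is in general no local coordinate on complex residues; \<open>Mt\<close> is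
  one, and at skew-Hermitian residues it is \<open>dagger (clow a b) ** clow a b\<close>.\<close>

definition Mt :: "'n cmat => 'n cmat => 'n::finite cmat" where
 "Mt a b = Ci a b ** (isol a b (\<i> * pi) ** fsol a b (- (\<i> * pi))) ** C0 a b"

lemma mghol_Mt: "irr a ==> mghol tube (Mt a)"
 unfolding Mt_def[abs_def] by (intro mghol_mult mghol_C0 mghol_Ci mghol_subset[OF mghol_fsol] mghol_subset[OF mghol_isol] open_tube; simp)

lemma cup_Mt: "irr (a :: 'n::finite cmat) ==> b \<in> tube ==> cup a b ** Mt a b = clow a b"
proof -
 assume a: "irr a" and b: "b \<in> tube"
 have "C0 a b ** (Ci a b ** X) = X" for X :: "'n cmat" by (simp add: mm_assoc Ci_C0[OF a b])
 thus ?thesis by (simp add: cup_def Mt_def clow_def flip: mm_assoc)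
qed

lemma Mt_skew: "irr a ==> dagger b = - b ==> Mt a b = dagger (clow a b) ** clow a b"
proof -
 assume a: "irr a" and b: "dagger b = - b"
 have "Mt a b = (dagger (clow a b) ** cup a b) ** Mt a b" by (simp add: cup_clow[OF a b])
 thus ?thesis using cup_Mt[OF a tube_skew[OF b]] by (simp flip: mm_assoc)
qed

lemma has_derivative_entries:
 fixes F :: "'a::real_normed_vector => 'n::finite cmat"
 assumes "!!i j. ((\<lambda>x. F x $ i $ j) has_derivative (\<lambda>v. F' v $ i $ j)) (at x within S)"
 shows "(F has_derivative F') (at x within S)" unfolding has_derivative_componentwise_within[of F]
proof
 fix e :: "'n cmat" assume "e \<in> Basis"
 then obtain i j c where e: "e = axis i (axis j c)" by (auto simp: Basis_vec_def)
 show "((\<lambda>x. F x \<bullet> e) has_derivative (\<lambda>v. F' v \<bullet> e)) (at x within S)"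
  unfolding e inner_axis by (intro has_derivative_inner_left assms)
qed

lemma Ck_on_entries:
 assumes "!!i j. Ck_on k V S (\<lambda>x. F x $ i $ j)"
 shows "Ck_on k V S (F :: 'a::real_normed_vector => 'n::finite cmat)" using assms
proof (induction k arbitrary: F)
 case 0
 have "continuous_on S (\<lambda>x. \<chi> i j. F x $ i $ j)" using 0 by (intro continuous_on_vec_lambda) simp
 thus ?case by simp
next
 case (Suc k)
 obtain f' where f': "!!i j. (\<forall>x\<in>S. ((\<lambda>x. F x $ i $ j) has_derivative f' i j x) (at x within S))"
  "!!i j v. v \<in> V ==> Ck_on k V S (\<lambda>x. f' i j x v)" using Suc.prems unfolding Ck_on.simps by metis
 have "(F has_derivative (\<lambda>v. \<chi> i j. f' i j x v)) (at x within S)" if x: "x \<in> S" for x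
  by (rule has_derivative_entries) (use f'(1) x in simp)
 moreover have "Ck_on k V S (\<lambda>x. \<chi> i j. f' i j x v)" if "v \<in> V" for v by (rule Suc.IH) (use f'(2)[OF that] in simp)
 ultimately show ?case unfolding Ck_on.simps by (intro exI[of _ "\<lambda>x v. \<chi> i j. f' i j x v"]) simp
qed

subsection \<open>Variation of the fundamental solution\<close>

lemma has_mderiv_bound:
 assumes "convex S" "!!z. z \<in> S ==> has_mderiv X (X' z) z" "!!z. z \<in> S ==> norm (X' z) <= B" "x \<in> S" "y \<in> S"
 shows "norm (X x - X y) <= B * norm (x - y)"
proof (rule differentiable_bound[OF assms(1) _ _ assms(4,5)])
 fix z assume z: "z \<in> S"
 show "(X has_derivative (\<lambda>h. cscale h (X' z))) (at z within S)"
  using assms(2)[OF z] unfolding has_mderiv_def by (rule has_derivative_at_withinI)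
 show "onorm (\<lambda>h. cscale h (X' z)) <= B"
  unfolding norm_cscale[abs_def] by (rule onorm_le) (simp add: norm_cscale mult.commute[of B] mult_left_mono[OF assms(3)[OF z]])
qed

lemma mat_primitive:
 assumes X: "!!u. has_mderiv X (X' u) u"
 shows "\<exists>Y. (\<forall>u. has_mderiv Y (X u) u) & Y 0 = 0"
proof -
 have "\<exists>g. \<forall>u. (g has_field_derivative X u $ i $ j) (at u)" for i j
 proof -
  have "(\<lambda>u. X u $ i $ j) holomorphic_on UNIV"
   using mat_holomorphic_iff[OF open_UNIV, of X] X by (auto simp: mat_holomorphic_on_def)
  thus ?thesis using holomorphic_convex_primitive'[of UNIV "\<lambda>u. X u $ i $ j"] by auto
 qed
 then obtain g where g: "!!i j u. (g i j has_field_derivative X u $ i $ j) (at u)" by metis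
 have "has_mderiv (\<lambda>u. \<chi> i j. g i j u - g i j 0) (X u) u" for u
  unfolding has_mderiv_iff by (auto intro!: derivative_eq_intros g)
 thus ?thesis by (intro exI[of _ "\<lambda>u. \<chi> i j. g i j u - g i j 0"]) (simp add: vec_eq_iff)
qed

text \<open>Variation of constants: the logarithmic derivative of the solution in the residue is a
  primitive of \<Phi>^(-1) \<beta> \<Phi>. In the proof E t, the difference quotient minus this
  primitive, has a derivative in v of size O(t).\<close>

lemma fsol_variation:
 fixes a b \<beta> :: "'n::finite cmat"
 shows "\<exists>Y. (\<forall>u. has_mderiv Y (isol a b u ** \<beta> ** fsol a b u) u) &
   (\<forall>u. has_mderiv (\<lambda>t. fsol a (b + cscale t \<beta>) u) (fsol a b u ** Y u) 0)"
proof -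
 define bt where "bt t = b + cscale t \<beta>" for t
 have "\<exists>X'. has_mderiv (\<lambda>u. isol a b u ** \<beta> ** fsol a b u) X' u" for u
  by (rule exI, (rule has_mderiv_mult has_mderiv_isol has_mderiv_fsol has_mderiv_const)+)
 then obtain X' where "!!u. has_mderiv (\<lambda>u. isol a b u ** \<beta> ** fsol a b u) (X' u) u" by metis
 from mat_primitive[OF this] obtain Y where Y: "!!u. has_mderiv Y (isol a b u ** \<beta> ** fsol a b u) u" "Y 0 = 0" by blast
 have "has_mderiv (\<lambda>t. fsol a (bt t) u) (fsol a b u ** Y u) 0" for u
 proof -
  define K where "K = norm a + norm b + norm \<beta>"
  obtain C where C: "0 <= C" "!!(a::'n cmat) b v. norm a <= K ==> norm b <= K ==> cmod v <= cmod u ==> norm (fsol a b v) <= C"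
   using fsol_bound[of K "cmod u"] by (auto simp: K_def)
  have f: "norm (fsol a (bt t) v) <= C" and i: "norm (isol a b v) <= C" if "cmod t <= 1" "cmod v <= cmod u" for t v
  proof -
   have "norm (bt t) <= norm b + cmod t * norm \<beta>" unfolding bt_def by (rule norm_triangle_le) (simp add: norm_cscale)
   also have "... <= norm b + 1 * norm \<beta>" using that by (intro add_mono mult_right_mono) auto
   finally have "norm (bt t) <= K" unfolding K_def using norm_ge_zero[of a] by linarith
   thus "norm (fsol a (bt t) v) <= C" using that by (intro C(2)) (auto simp: K_def)
   show "norm (isol a b v) <= C" unfolding isol_def norm_transpose using that by (intro C(2)) (auto simp: K_def)
  qed
  define W where "W t v = isol a b v ** fsol a (bt t) v" for t v
  have lb: "lcoef a (bt t) v = lcoef a b v + cscale t \<beta>" for t v by (simp add: lcoef_def bt_def)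
  have W': "has_mderiv (W t) (isol a b v ** cscale t \<beta> ** fsol a (bt t) v) v" for t v
  proof -
   have "has_mderiv (W t) (- (isol a b v ** lcoef a b v) ** fsol a (bt t) v + isol a b v ** (lcoef a (bt t) v ** fsol a (bt t) v)) v"
    unfolding W_def by (rule has_mderiv_mult[OF has_mderiv_isol has_mderiv_fsol])
   thus ?thesis unfolding lb by (simp add: mm.add_left mm.add_right mm.minus_left flip: mm_assoc)
  qed
  have W0: "W t 0 = mat 1" for t by (simp add: W_def)
  have mm3: "norm (A ** B ** D) <= x * y * z" if "norm A <= x" "norm B <= y" "norm D <= z" for A B D :: "'n cmat" and x y z
  proof -
   have "0 <= x" "0 <= y" using that(1,2) norm_ge_zero order_trans by blast+
   thus ?thesis by (intro order_trans[OF norm_matrix_mult_le mult_mono] that order_trans[OF norm_matrix_mult_le mult_mono]) auto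
  qed
  define S :: "complex set" where "S = cball 0 (cmod u)"
  have S: "convex S" "0 \<in> S" "u \<in> S" by (auto simp: S_def)
  define C1 where "C1 = C * norm \<beta> * C * cmod u"
  have C1: "norm (W t v - mat 1) <= cmod t * C1" if t: "cmod t <= 1" and v: "v \<in> S" for t v
  proof -
   have "norm (W t v - W t 0) <= (C * (cmod t * norm \<beta>) * C) * norm (v - 0)"
    by (rule has_mderiv_bound[OF S(1) W' mm3 v S(2)]) (use t in \<open>auto intro!: i f simp: S_def norm_cscale\<close>)
   also have "... <= (C * (cmod t * norm \<beta>) * C) * cmod u" using v C(1) by (intro mult_left_mono) (auto simp: S_def)
   finally show ?thesis by (simp add: W0 C1_def mult_ac)
  qed
  define E where "E t v = cscale (1 / t) (W t v - mat 1) - Y v" for t v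
  have E': "has_mderiv (E t) (isol a b v ** \<beta> ** fsol a b v ** (W t v - mat 1)) v" if t: "t ~= 0" for t v
  proof -
   have "has_mderiv (E t) (cscale 0 (W t v - mat 1) + cscale (1 / t) (isol a b v ** cscale t \<beta> ** fsol a (bt t) v - 0)
     - isol a b v ** \<beta> ** fsol a b v) v" unfolding E_def by (intro has_mderiv_diff has_mderiv_cscale W' has_mderiv_const Y) auto
   moreover have "fsol a b v ** W t v = fsol a (bt t) v" by (simp add: W_def)
   ultimately show ?thesis using t by (simp add: mm.diff_right cs.zero_left flip: mm_assoc)
  qed
  have E: "norm (E t u) <= C * norm \<beta> * C * C1 * cmod u * cmod t" if t: "cmod t <= 1" "t ~= 0" for t
  proof -
   have "norm (E t u - E t 0) <= (C * norm \<beta> * C * (cmod t * C1)) * norm (u - 0)"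
   proof (rule has_mderiv_bound[OF S(1) E'[OF t(2)] _ S(3,2)])
    fix v assume v: "v \<in> S"
    have "norm (isol a b v ** \<beta> ** fsol a b v) <= C * norm \<beta> * C"
     by (rule mm3) (use v i[of 0 v] f[of 0 v] in \<open>auto simp: S_def bt_def cs.zero_left\<close>)
    thus "norm (isol a b v ** \<beta> ** fsol a b v ** (W t v - mat 1)) <= C * norm \<beta> * C * (cmod t * C1)"
     by (rule order_trans[OF norm_matrix_mult_le mult_mono[OF _ C1[OF t(1) v]]]) (use C(1) in auto)
   qed
   moreover have "E t 0 = 0" by (simp add: E_def W0 Y(2) cs.zero_right)
   ultimately show ?thesis by (simp add: mult_ac)
  qed
  have "has_mderiv (\<lambda>t. W t u) (Y u) 0" unfolding has_mderiv_iff
  proof (intro allI)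
   fix i j
   have "((\<lambda>t. (E t u) $ i $ j) \<longlongrightarrow> 0) (at 0)"
   proof (rule Lim_null_comparison)
    have "\<forall>\<^sub>F t in at (0::complex). t \<in> ball 0 1 - {0}" by (intro eventually_at_in_open) auto
    thus "\<forall>\<^sub>F t in at 0. norm (E t u $ i $ j) <= C * norm \<beta> * C * C1 * cmod u * cmod t"
     by eventually_elim (rule order_trans[OF cmod_entry_le E], auto)
    show "((\<lambda>t. C * norm \<beta> * C * C1 * cmod u * cmod t) \<longlongrightarrow> 0) (at 0)"
     by (auto intro!: tendsto_eq_intros)
   qed
   hence "((\<lambda>t. (W t u $ i $ j - mat 1 $ i $ j) / t) \<longlongrightarrow> Y u $ i $ j) (at 0)"
    by (subst LIM_zero_iff[symmetric]) (simp add: E_def)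
   moreover have "W 0 u = mat 1" by (simp add: W_def bt_def cs.zero_left)
   ultimately show "((\<lambda>t. W t u $ i $ j) has_field_derivative Y u $ i $ j) (at 0)" by (simp add: DERIV_def)
  qed
  from has_mderiv_mult[OF has_mderiv_const[of "fsol a b u"] this]
  show ?thesis by (simp add: W_def mm.zero_left)
 qed
 thus ?thesis using Y(1) unfolding bt_def by blast
qed

text \<open>y is the logarithmic derivative of the canonical solution in the direction \<beta>. The
  first clause leaves a constant of integration open; the second fixes it through the normalisation
  at infinity.\<close>

definition variation :: "'n cmat => 'n cmat => 'n cmat => (complex => 'n::finite cmat) => bool" where
 "variation a b \<beta> y \<longleftrightarrow> (\<forall>u. has_mderiv y (Gi a b u ** \<beta> ** Phi0 a b u) u) &
   (\<forall>u. has_mderiv (\<lambda>t. Phi0 a (b + cscale t \<beta>) u) (Phi0 a b u ** y u) 0)"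

lemma variation_exists:
 assumes a: "irr (a :: 'n::finite cmat)" and b: "b \<in> tube"
 shows "\<exists>y. variation a b \<beta> y"
proof -
 obtain Y where Y: "!!u. has_mderiv Y (isol a b u ** \<beta> ** fsol a b u) u"
  "!!u. has_mderiv (\<lambda>t. fsol a (b + cscale t \<beta>) u) (fsol a b u ** Y u) 0"
  using fsol_variation[of a b \<beta>] by (elim exE conjE) (rule that, blast+)
 have "b + cscale 0 \<beta> \<in> tube" using b by (simp add: cs.zero_left)
 then obtain C' where C': "has_mderiv (\<lambda>t. C0 a (b + cscale t \<beta>)) C' 0" using mgholD(3)[OF mghol_C0[OF a]] by blast
 have c: "C0 a b ** (Ci a b ** X) = X" for X :: "'n cmat" by (simp add: mm_assoc Ci_C0[OF a b])
 have "has_mderiv (\<lambda>u. Ci a b ** (Y u ** C0 a b + C')) (Gi a b u ** \<beta> ** Phi0 a b u) u" for u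
  using has_mderiv_mult[OF has_mderiv_const[of "Ci a b" u] has_mderiv_add[OF has_mderiv_mult[OF Y(1)[of u] has_mderiv_const[of "C0 a b" u]] has_mderiv_const[of C' u]]]
  by (simp add: Gi_def Phi0_def mm.zero_left mm.zero_right mm_assoc)
 moreover have "has_mderiv (\<lambda>t. Phi0 a (b + cscale t \<beta>) u) (Phi0 a b u ** (Ci a b ** (Y u ** C0 a b + C'))) 0" for u
  using has_mderiv_mult[OF Y(2) C', of u] by (simp add: Phi0_def cs.zero_left c mm.add_right flip: mm_assoc)
 ultimately show ?thesis unfolding variation_def by blast
qed

lemma has_mderiv_Di_residue:
 "has_mderiv (\<lambda>t. Di a (b + cscale t \<beta>) u) (- (cscale u (diag_part \<beta>) ** Di a b u)) 0" unfolding has_mderiv_iff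
proof (intro allI)
 fix i j :: 'a
 show "((\<lambda>t. Di a (b + cscale t \<beta>) u $ i $ j) has_field_derivative (- (cscale u (diag_part \<beta>) ** Di a b u)) $ i $ j) (at 0)"
 proof (cases "i = j")
  case True
  have "((\<lambda>t. exp (- (u * (b $ i $ i + t * \<beta> $ i $ i) + exp u * a $ i $ i))) has_field_derivative
    - (u * \<beta> $ i $ i * exp (- (u * b $ i $ i + exp u * a $ i $ i)))) (at 0)" by (auto intro!: derivative_eq_intros)
  thus ?thesis using True by (simp add: Dd_nth diag_mm_left diag_part_nth mult.assoc)
 next
  case False
  thus ?thesis by (simp add: diag_mats_offdiag[OF Dd_diag(2)] diag_mm_left)
 qed
qed

lemma mghol_Di: "mghol UNIV (\<lambda>b. Di a b u)"
proof -
 have "Di a b u = Dd (- a) (- b) u" for b by (rule cmat_eqI) (simp add: Dd_def Di_def diag_exp_nth diag_part_nth)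
 thus ?thesis
  by (simp only:) (rule mghol_precompose[OF mghol_Dd], auto intro: bounded_linear_minus bounded_linear_ident simp: cs.minus_right)
qed

text \<open>In Phi0 = Hf Dd the factor \<open>Dd\<close> contributes u \<delta>(\<beta>). The
  derivative of \<open>Hf\<close> is bounded by Cauchy's estimate on a disc of residues inside the
  tube, on which Hf - 1 is uniformly O(e^(-Re u)).\<close>

lemma variation_sector:
 assumes a: "irr (a :: 'n::finite cmat)" and b: "b \<in> tube" and y: "variation a b \<beta> y" and \<epsilon>: "0 < \<epsilon>" "\<epsilon> <= pi"
 shows "\<exists>C R. 0 <= C & 0 <= R & (\<forall>u. \<bar>Im u\<bar> <= pi - \<epsilon> --> R <= Re u -->
   norm (Phi0 a b u ** y u ** Gi a b u - cscale u (diag_part \<beta>)) <= C * ((1 + cmod u) * exp (- Re u)))"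
proof -
 have "open {t. b + cscale t \<beta> \<in> tube}" by (rule cstr.line_open[OF open_tube])
 then obtain r0 where r0: "0 < r0" "ball 0 r0 \<subseteq> {t. b + cscale t \<beta> \<in> tube}"
  using b by (metis (no_types, lifting) open_contains_ball mem_Collect_eq cs.zero_left add.right_neutral)
 define r where "r = r0 / 2"
 have tube: "b + cscale t \<beta> \<in> tube" if "cmod t <= r" for t using subsetD[OF r0(2), of t] r0(1) that by (simp add: r_def)
 have r: "0 < r" using r0 by (simp add: r_def)
 define K where "K = norm b + r * norm \<beta>"
 have K: "0 <= K" using r by (simp add: K_def)
 have Kb: "norm (b + cscale t \<beta>) <= K" if "cmod t <= r" for t
  unfolding K_def by (rule norm_triangle_le) (use that in \<open>simp add: norm_cscale mult_right_mono\<close>)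
 obtain C R where S: "sector_bounds a \<epsilon> K C R" using sector_bounds_exist[OF a \<epsilon> K] by blast
 note C = sector_boundsD(1,2)[OF S] and H = sector_boundsD(3)[OF S]
 define n2 where "n2 = real (CARD('n))^2"
 define C' where "C' = n2 * (C / r) * C + 2 * (C * norm \<beta> * (C + 1))"
 have "norm (Phi0 a b u ** y u ** Gi a b u - cscale u (diag_part \<beta>)) <= C' * ((1 + cmod u) * exp (- Re u))"
  if u: "\<bar>Im u\<bar> <= pi - \<epsilon>" "R <= Re u" for u
 proof -
  define e where "e = exp (- Re u)"
  define \<delta> where "\<delta> = cscale u (diag_part \<beta>)"
  have e: "0 <= e" by (simp add: e_def)
  have h: "norm (Hi a b u) <= C" "norm (Hf a b u - mat 1) <= C * e" "norm (Hi a b u - mat 1) <= C * e"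
   and ht: "!!t. cmod t <= r ==> norm (Hf a (b + cscale t \<beta>) u - mat 1) <= C * e"
   using H[OF b _ u] H[OF tube Kb u] Kb[of 0] r by (auto simp: e_def cs.zero_left)
  define H' where "H' = Phi0 a b u ** y u ** Di a b u - Hf a b u ** \<delta>"
  have dH: "has_mderiv (\<lambda>t. Hf a (b + cscale t \<beta>) u) H' 0"
  proof -
   have "has_mderiv (\<lambda>t. Hf a (b + cscale t \<beta>) u)
    (Phi0 a b u ** y u ** Di a (b + cscale 0 \<beta>) u + Phi0 a (b + cscale 0 \<beta>) u ** (- (\<delta> ** Di a b u))) 0"
    unfolding Hf_def \<delta>_def using y by (intro has_mderiv_mult has_mderiv_Di_residue) (simp add: variation_def)
   moreover have "\<delta> ** Di a b u = Di a b u ** \<delta>"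
    by (rule cmat_eqI) (simp add: \<delta>_def diag_mm_left diag_mm_right, simp add: diag_part_nth diag_mats_offdiag[OF Dd_diag(2)])
   ultimately show ?thesis by (simp add: H'_def Hf_def cs.zero_left mm.minus_right mm_assoc)
  qed
  have H': "norm H' <= n2 * (C * e / r)" unfolding n2_def
  proof (rule norm_cmat_le_entries)
   fix i j
   define f where "f t = (Hf a (b + cscale t \<beta>) u - mat 1) $ i $ j" for t
   have mg: "mghol tube (\<lambda>b. Hf a b u)" unfolding Hf_def
    by (intro mghol_mult mghol_Phi0[OF a] mghol_subset[OF mghol_Di] open_tube) auto
   have hol: "f holomorphic_on {t. b + cscale t \<beta> \<in> tube}"
    unfolding f_def using mghol_entry[OF mg, of i j] by (auto simp: ghol_def intro!: holomorphic_intros)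
   have "norm ((deriv ^^ 1) f 0) <= fact 1 * (C * e) / r ^ 1"
   proof (rule Cauchy_inequality)
    show "f holomorphic_on ball 0 r" by (rule holomorphic_on_subset[OF hol]) (use tube in auto)
    show "continuous_on (cball 0 r) f" by (rule holomorphic_on_imp_continuous_on[OF holomorphic_on_subset[OF hol]]) (use tube in auto)
    show "norm (f x) <= C * e" if "norm (0 - x) = r" for x
     unfolding f_def by (rule order_trans[OF cmod_entry_le ht]) (use that in simp)
   qed (use r in auto)
   moreover have "(f has_field_derivative H' $ i $ j) (at 0)"
    using dH unfolding has_mderiv_iff f_def by (auto intro!: derivative_eq_intros)
   ultimately show "cmod (H' $ i $ j) <= C * e / r" by (simp add: DERIV_imp_deriv)
  qed
  have \<delta>: "norm \<delta> <= cmod u * norm \<beta>" by (simp add: \<delta>_def norm_cscale norm_diag_part_le mult_left_mono)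
  have "Phi0 a b u ** y u ** Gi a b u - \<delta> = H' ** Hi a b u + (Hf a b u - mat 1) ** \<delta> ** Hi a b u + \<delta> ** (Hi a b u - mat 1)"
   by (simp add: H'_def Hi_def mm.diff_left mm.diff_right mm.add_left flip: mm_assoc)
  also have "norm ... <= n2 * (C * e / r) * C + (C * e) * (cmod u * norm \<beta>) * C + (cmod u * norm \<beta>) * (C * e)"
   by (intro norm_triangle_mono order_trans[OF norm_matrix_mult_le mult_mono] h H' \<delta>)
    (use C e r in \<open>auto simp: n2_def\<close>)
  also have "... = (n2 * (C / r) * C) * e + (C * norm \<beta> * (C + 1)) * (cmod u * e)" by (simp add: algebra_simps)
  also have "... <= C' * ((1 + cmod u) * e)"
  proof -
   have "(n2 * (C / r) * C) * e <= (n2 * (C / r) * C) * ((1 + cmod u) * e)"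
    using C r e by (intro mult_left_mono) (auto simp: n2_def algebra_simps)
   moreover have "(C * norm \<beta> * (C + 1)) * (cmod u * e) <= (2 * (C * norm \<beta> * (C + 1))) * ((1 + cmod u) * e)"
   proof (rule mult_mono)
    have "0 <= C * norm \<beta> * (C + 1)" using C by simp
    thus "C * norm \<beta> * (C + 1) <= 2 * (C * norm \<beta> * (C + 1))" by linarith
   qed (use C e in \<open>auto simp: algebra_simps\<close>)
   ultimately show ?thesis unfolding C'_def by (simp add: distrib_right)
  qed
  finally show ?thesis by (simp add: \<delta>_def e_def)
 qed
 moreover have "0 <= C'" using C r by (simp add: C'_def n2_def)
 ultimately show ?thesis using C(2) by blast
qed

text \<open>\<open>Phi0_shift\<close> differentiated with respect to the residue.\<close>

lemma variation_shift:
 assumes a: "irr (a :: 'n::finite cmat)" and b: "b \<in> tube" and y: "variation a b \<beta> y" and y': "variation (- a) b \<beta> y'"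
 shows "has_mderiv (\<lambda>t. clow a (b + cscale t \<beta>)) c' 0 ==> clow a b ** y (u - \<i> * pi) = y' u ** clow a b + c'"
  and "has_mderiv (\<lambda>t. cup a (b + cscale t \<beta>)) c' 0 ==> cup a b ** y (u + \<i> * pi) = y' u ** cup a b + c'"
proof -
 have a': "irr (- a)" using a by simp
 have op: "open {t. b + cscale t \<beta> \<in> tube}" by (rule cstr.line_open[OF open_tube])
 have key: "c ** y v = y' u ** c + c'"
  if sh: "!!b. b \<in> tube ==> Phi0 a b v = Phi0 (- a) b u ** f b" and c: "c = f b" and c': "has_mderiv (\<lambda>t. f (b + cscale t \<beta>)) c' 0" for v f c c'
 proof -
  have "has_mderiv (\<lambda>t. Phi0 (- a) (b + cscale t \<beta>) u ** f (b + cscale t \<beta>))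
    (Phi0 (- a) b u ** y' u ** f (b + cscale 0 \<beta>) + Phi0 (- a) (b + cscale 0 \<beta>) u ** c') 0"
   using y' by (intro has_mderiv_mult c') (simp add: variation_def)
  hence "has_mderiv (\<lambda>t. Phi0 a (b + cscale t \<beta>) v) (Phi0 (- a) b u ** y' u ** f b + Phi0 (- a) b u ** c') 0"
   unfolding has_mderiv_def cs.zero_left add_0_right
   by (rule has_derivative_transform_within_open[OF _ op]) (use b in \<open>auto simp: cs.zero_left sh\<close>)
  moreover have "has_mderiv (\<lambda>t. Phi0 a (b + cscale t \<beta>) v) (Phi0 a b v ** y v) 0" using y by (simp add: variation_def)
  ultimately have "Phi0 a b v ** y v = Phi0 (- a) b u ** y' u ** f b + Phi0 (- a) b u ** c'" by (rule has_mderiv_unique[symmetric])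
  hence "Gi (- a) b u ** (Phi0 (- a) b u ** f b ** y v) = Gi (- a) b u ** (Phi0 (- a) b u ** y' u ** f b + Phi0 (- a) b u ** c')"
   by (simp add: sh[OF b])
  moreover have "Gi (- a) b u ** (Phi0 (- a) b u ** X) = X" for X :: "'n cmat" by (simp add: mm_assoc Gi_Phi0[OF a' b])
  ultimately show ?thesis by (simp add: c mm.add_right flip: mm_assoc)
 qed
 show "has_mderiv (\<lambda>t. clow a (b + cscale t \<beta>)) c' 0 ==> clow a b ** y (u - \<i> * pi) = y' u ** clow a b + c'"
  by (rule key[OF Phi0_shift(1)[OF a] refl])
 show "has_mderiv (\<lambda>t. cup a (b + cscale t \<beta>)) c' 0 ==> cup a b ** y (u + \<i> * pi) = y' u ** cup a b + c'"
  by (rule key[OF Phi0_shift(2)[OF a] refl])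
qed

text \<open>Column by column in the order of \<theta>: in column j of M c only the term with the
  diagonal entry of c survives.\<close>

lemma triangular_factor:
 fixes M c c' :: "'n::finite cmat" and \<theta> :: "'n => real"
 assumes e: "M ** c = c'" and \<theta>: "inj \<theta>" and d: "!!i. c $ i $ i ~= 0"
  and c: "!!i j. \<theta> j < \<theta> i ==> c $ i $ j = 0" and c': "!!i j. \<theta> j < \<theta> i ==> c' $ i $ j = 0"
 shows "\<theta> j < \<theta> i ==> M $ i $ j = 0"
proof (induction j rule: measure_induct_rule[where f="\<lambda>j. card {k. \<theta> k < \<theta> j}"])
 case (less j)
 have "M $ i $ k * c $ k $ j = 0" if "k ~= j" for k
 proof (cases "\<theta> k < \<theta> j")
  case True
  hence "card {l. \<theta> l < \<theta> k} < card {l. \<theta> l < \<theta> j}" by (intro psubset_card_mono) auto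
  thus ?thesis using less True by auto
 next
  case False
  moreover have "\<theta> k ~= \<theta> j" using that injD[OF \<theta>] by blast
  ultimately have "\<theta> j < \<theta> k" by linarith
  thus ?thesis by (simp add: c)
 qed
 hence "(\<Sum>k\<in>UNIV. M $ i $ k * c $ k $ j) = (\<Sum>k\<in>UNIV. if k = j then M $ i $ j * c $ j $ j else 0)"
  by (intro sum.cong) auto
 hence "c' $ i $ j = M $ i $ j * c $ j $ j" unfolding e[symmetric] mm_nth by simp
 thus ?case using c'[OF less.prems] d by simp
qed

text \<open>Half of the decay rate is given up in exchange for the factor 1 + |u|; 10 is a round
  constant above 1 + pi.\<close>

lemma exp_half_bound: "\<bar>Im u\<bar> <= pi ==> 0 <= Re u ==> (1 + cmod u) * exp (- Re u) <= 10 * exp (- Re u / 2)"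
proof -
 assume u: "\<bar>Im u\<bar> <= pi" "0 <= Re u"
 have "cmod u <= Re u + pi" using cmod_le[of u] u by simp
 hence "1 + cmod u <= 10 * (1 + Re u / 2)" using pi_less_4 u by simp
 also have "... <= 10 * exp (Re u / 2)" by (intro mult_left_mono exp_ge_add_one_self) simp
 finally have "(1 + cmod u) * exp (- Re u) <= 10 * exp (Re u / 2) * exp (- Re u)" by (intro mult_right_mono) auto
 thus ?thesis by (simp add: mult.assoc flip: exp_add)
qed

text \<open>Decay of h is available only at distance \<epsilon> from the edges. The two end pieces
  of the segment have length \<epsilon> and h is bounded on them, so \<epsilon> is chosen according
  to the desired accuracy before t is taken large.\<close>

lemma vertical_increment:
 assumes q: "!!u. (q has_field_derivative h u) (at u)"
  and C: "0 <= C" "!!u. \<bar>Im u\<bar> <= pi ==> R <= Re u ==> cmod (h u) <= C"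
  and s: "!!\<epsilon>. 0 < \<epsilon> ==> \<epsilon> <= pi ==> \<exists>C R. 0 <= C & (\<forall>u. \<bar>Im u\<bar> <= pi - \<epsilon> --> R <= Re u --> cmod (h u) <= C * exp (- Re u / 2))"
 shows "((\<lambda>t. q (of_real t + \<i> * pi) - q (of_real t - \<i> * pi)) \<longlongrightarrow> 0) at_top"
proof (rule tendstoI)
 fix e :: real assume e: "0 < e"
 define \<epsilon> where "\<epsilon> = min pi (e / (4 * (C + 1)))"
 have \<epsilon>: "0 < \<epsilon>" "\<epsilon> <= pi" using e C by (auto simp: \<epsilon>_def)
 have C\<epsilon>: "C * \<epsilon> <= e / 4"
 proof -
  have "C * \<epsilon> <= (C + 1) * (e / (4 * (C + 1)))" using C e by (intro mult_mono) (auto simp: \<epsilon>_def)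
  also have "... = e / 4" using C(1) add_nonneg_pos[OF C(1) zero_less_one] by (simp add: divide_simps)
  finally show ?thesis .
 qed
 obtain C1 R1 where C1: "0 <= C1" "!!u. \<bar>Im u\<bar> <= pi - \<epsilon> ==> R1 <= Re u ==> cmod (h u) <= C1 * exp (- Re u / 2)"
  using s[OF \<epsilon>] by blast
 obtain T where T: "!!t. T <= t ==> (C1 * (2 * pi)) * exp (- (1/2) * t) <= e / 4"
  by (rule exp_decay_le[of "1/2" "C1 * (2 * pi)" "e / 4"]) (use C1 e in auto)
 show "\<forall>\<^sub>F t in at_top. dist (q (of_real t + \<i> * pi) - q (of_real t - \<i> * pi)) 0 < e"
  using eventually_ge_at_top[of "max T (max R R1)"]
 proof eventually_elim
  case (elim t)
  define p where "p y = Complex t y" for y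
  have bd: "cmod (q (p y) - q (p x)) <= B * \<bar>y - x\<bar>"
   if S: "x <= y" "!!z. x <= z ==> z <= y ==> cmod (h (p z)) <= B" for x y B
  proof -
   have "cmod (q (p y) - q (p x)) <= B * cmod (p y - p x)"
   proof (rule field_differentiable_bound[of "cbox (p x) (p y)"])
    fix z assume z: "z \<in> cbox (p x) (p y)"
    show "(q has_field_derivative h z) (at z within cbox (p x) (p y))" by (rule DERIV_subset[OF q]) simp
    have "z = p (Im z)" using z by (simp add: p_def in_cbox_complex_iff complex_eq_iff)
    thus "cmod (h z) <= B" using S(2)[of "Im z"] z by (simp add: p_def in_cbox_complex_iff)
   qed (use S(1) in \<open>auto simp: p_def in_cbox_complex_iff\<close>)
   also have "cmod (p y - p x) = \<bar>y - x\<bar>" by (simp add: p_def cmod_def)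
   finally show ?thesis .
  qed
  have "cmod (q (p pi) - q (p (pi - \<epsilon>))) <= C * \<bar>pi - (pi - \<epsilon>)\<bar>"
   by (rule bd) (use \<epsilon> elim in \<open>auto intro!: C(2) simp: p_def\<close>)
  moreover have "cmod (q (p (\<epsilon> - pi)) - q (p (- pi))) <= C * \<bar>\<epsilon> - pi - - pi\<bar>"
   by (rule bd) (use \<epsilon> elim in \<open>auto intro!: C(2) simp: p_def\<close>)
  moreover have "cmod (q (p (pi - \<epsilon>)) - q (p (\<epsilon> - pi))) <= (C1 * exp (- t / 2)) * \<bar>pi - \<epsilon> - (\<epsilon> - pi)\<bar>"
  proof (rule bd)
   fix z assume "\<epsilon> - pi <= z" "z <= pi - \<epsilon>"
   thus "cmod (h (p z)) <= C1 * exp (- t / 2)" using C1(2)[of "p z"] elim by (simp add: p_def)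
  qed (use \<epsilon> in auto)
  moreover have "(C1 * exp (- t / 2)) * \<bar>pi - \<epsilon> - (\<epsilon> - pi)\<bar> <= (C1 * exp (- t / 2)) * (2 * pi)"
   using \<epsilon> C1 by (intro mult_left_mono) auto
  moreover have "(C1 * exp (- t / 2)) * (2 * pi) <= e / 4" using T[of t] elim by (simp add: mult_ac)
  moreover have "q (p pi) - q (p (- pi)) = (q (p pi) - q (p (pi - \<epsilon>))) + (q (p (pi - \<epsilon>)) - q (p (\<epsilon> - pi))) + (q (p (\<epsilon> - pi)) - q (p (- pi)))"
   by simp
  ultimately have "cmod (q (p pi) - q (p (- pi))) <= 3 * (e / 4)"
   using norm_triangle_ineq[of "q (p pi) - q (p (pi - \<epsilon>)) + (q (p (pi - \<epsilon>)) - q (p (\<epsilon> - pi)))" "q (p (\<epsilon> - pi)) - q (p (- pi))"]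
    norm_triangle_ineq[of "q (p pi) - q (p (pi - \<epsilon>))" "q (p (pi - \<epsilon>)) - q (p (\<epsilon> - pi))"] C\<epsilon> \<epsilon> by simp
  moreover have "p pi = of_real t + \<i> * pi" "p (- pi) = of_real t - \<i> * pi" by (simp_all add: p_def complex_eq_iff)
  ultimately show ?case using e by simp
 qed
qed

text \<open>f descends to a function of z = e^u on the punctured plane, holomorphic on two slit
  planes with different branches of the logarithm. The bound C (1 + |u|) means logarithmic growth at
  z = 0, so z times the function tends to 0 and the singularity is removable.\<close>

lemma periodic_entire:
 assumes f: "f holomorphic_on UNIV" and per: "!!u. f (u + 2 * of_real pi * \<i>) = f u"
  and bd: "!!u. Re u <= 0 ==> \<bar>Im u\<bar> <= pi ==> cmod (f u) <= C * (1 + cmod u)"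
 shows "\<exists>g. g holomorphic_on UNIV & (\<forall>u. f u = g (exp u))"
proof -
 have pern: "f (u + of_int (2 * n) * (of_real pi * \<i>)) = f u" for u n
 proof (induction n rule: int_induct[where k=0])
  case (step1 i)
  thus ?case using per[of "u + of_int (2 * i) * (of_real pi * \<i>)"] by (simp add: algebra_simps)
 next
  case (step2 i)
  thus ?case using per[of "u + of_int (2 * (i - 1)) * (of_real pi * \<i>)"] by (simp add: algebra_simps)
 qed simp
 have fexp: "f u = f v" if "exp u = exp v" for u v using that pern by (auto simp: exp_eq mult.assoc)
 define \<phi> where "\<phi> z = f (Ln z)" for z
 have "\<phi> holomorphic_on (- \<real>\<^sub>\<le>\<^sub>0)"
  unfolding \<phi>_def by (rule holomorphic_on_compose[OF _ holomorphic_on_subset[OF f], unfolded o_def]) (auto intro!: holomorphic_intros)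
 moreover have "\<phi> holomorphic_on {z. - z \<notin> \<real>\<^sub>\<le>\<^sub>0}"
 proof (rule holomorphic_transform)
  show "(\<lambda>z. f (Ln (- z) + \<i> * pi)) holomorphic_on {z. - z \<notin> \<real>\<^sub>\<le>\<^sub>0}"
   by (rule holomorphic_on_compose[OF _ holomorphic_on_subset[OF f], unfolded o_def]) (auto intro!: holomorphic_intros)
  show "f (Ln (- z) + \<i> * pi) = \<phi> z" if "z \<in> {z. - z \<notin> \<real>\<^sub>\<le>\<^sub>0}" for z
  proof -
   have "z ~= 0" using that by auto
   thus ?thesis unfolding \<phi>_def by (intro fexp) (simp add: exp_pm_pi exp_Ln)
  qed
 qed
 moreover have "open {z :: complex. - z \<notin> \<real>\<^sub>\<le>\<^sub>0}"
  using open_Compl[OF closed_nonneg_Reals_complex] by (simp add: Compl_eq)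
 ultimately have "\<phi> holomorphic_on ((- \<real>\<^sub>\<le>\<^sub>0) \<union> {z. - z \<notin> \<real>\<^sub>\<le>\<^sub>0})"
  by (intro holomorphic_on_Un) auto
 hence hol: "\<phi> holomorphic_on (UNIV - {0})" by (rule holomorphic_on_subset) (auto simp: complex_nonpos_Reals_iff complex_eq_iff)
 have "((\<lambda>z. (z - 0) * \<phi> z) \<longlongrightarrow> 0) (at 0)"
 proof (rule Lim_null_comparison)
  have ev: "\<forall>\<^sub>F z in at (0::complex). z \<in> ball 0 1 - {0}" by (intro eventually_at_in_open) auto
  have bd': "norm ((z - 0) * \<phi> z) <= \<bar>C\<bar> * (5 * cmod z + 2 * sqrt (cmod z))" if z: "z \<in> ball 0 1 - {0}" for z
  proof -
   define r where "r = cmod z"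
   have r: "0 < r" "r < 1" using z by (auto simp: r_def)
   have L: "Re (Ln z) = ln r" "\<bar>Im (Ln z)\<bar> <= pi" using z Im_Ln_le_pi[of z] mpi_less_Im_Ln[of z] by (auto simp: r_def)
   have l0: "ln r <= 0" using r by simp
   \<comment> \<open>The logarithm is bounded by r^(-1/2), through ln x \<le> x - 1 at x =
     r^(-1/2).\<close>
   have "- ln r = 2 * ln (1 / sqrt r)" using r by (simp add: ln_div ln_sqrt)
   also have "... <= 2 * (1 / sqrt r - 1)" using ln_le_minus_one[of "1 / sqrt r"] r by simp
   finally have lnr: "- ln r <= 2 / sqrt r" by simp
   have "cmod (Ln z) <= 4 + 2 / sqrt r" using cmod_le[of "Ln z"] L l0 lnr pi_less_4 by simp
   have "cmod (\<phi> z) <= C * (1 + cmod (Ln z))" unfolding \<phi>_def by (rule bd) (use L l0 in auto)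
   also have "... <= \<bar>C\<bar> * (1 + (4 + 2 / sqrt r))" using \<open>cmod (Ln z) <= _\<close> by (intro mult_mono) auto
   finally have "r * cmod (\<phi> z) <= r * (\<bar>C\<bar> * (1 + (4 + 2 / sqrt r)))" using r by (intro mult_left_mono) auto
   also have "... = \<bar>C\<bar> * (5 * r + 2 * (r / sqrt r))" by (simp add: algebra_simps)
   also have "r / sqrt r = sqrt r" using r by (simp add: real_div_sqrt)
   finally show ?thesis by (simp add: norm_mult r_def)
  qed
  show "\<forall>\<^sub>F z in at 0. norm ((z - 0) * \<phi> z) <= \<bar>C\<bar> * (5 * cmod z + 2 * sqrt (cmod z))"
   using ev by eventually_elim (rule bd')
  show "((\<lambda>z::complex. \<bar>C\<bar> * (5 * cmod z + 2 * sqrt (cmod z))) \<longlongrightarrow> 0) (at 0)"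
   by (auto intro!: tendsto_eq_intros)
 qed
 hence "\<exists>g. g holomorphic_on UNIV & (\<forall>z\<in>UNIV - {0}. g z = \<phi> z)"
  using holomorphic_on_extend_lim[OF hol] by simp
 then obtain g where g: "g holomorphic_on UNIV" "!!z. z ~= 0 ==> g z = \<phi> z" by auto
 have "f u = g (exp u)" for u unfolding g(2)[OF exp_not_eq_zero] \<phi>_def by (intro fexp) (simp add: exp_Ln)
 thus ?thesis using g(1) by blast
qed

lemma periodic_entire_matrix:
 fixes F :: "complex => 'n::finite cmat"
 assumes F: "!!u. has_mderiv F (F' u) u" and per: "!!u. F (u + 2 * of_real pi * \<i>) = F u"
  and bd: "!!u. Re u <= 0 ==> \<bar>Im u\<bar> <= pi ==> norm (F u) <= C * (1 + cmod u)"
 shows "\<exists>g g'. (\<forall>z. has_mderiv g (g' z) z) & (\<forall>u. F u = g (exp u))"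
proof -
 have "\<exists>g. g holomorphic_on UNIV & (\<forall>u. F u $ i $ j = g (exp u))" for i j
 proof (rule periodic_entire)
  show "(\<lambda>u. F u $ i $ j) holomorphic_on UNIV"
   using mat_holomorphic_iff[OF open_UNIV, of F] F by (auto simp: mat_holomorphic_on_def)
 qed (use per order_trans[OF cmod_entry_le bd] in auto)
 then obtain g where g: "!!i j. g i j holomorphic_on UNIV" "!!i j u. F u $ i $ j = g i j (exp u)" by metis
 have "mat_holomorphic_on (\<lambda>z. \<chi> i j. g i j z) UNIV" using g(1) by (simp add: mat_holomorphic_on_def)
 then obtain g' where "!!z. has_mderiv (\<lambda>z. \<chi> i j. g i j z) (g' z) z" unfolding mat_holomorphic_iff[OF open_UNIV] by auto metis
 thus ?thesis by (intro exI[of _ "\<lambda>z. \<chi> i j. g i j z"] exI[of _ g']) (auto intro: cmat_eqI simp: g(2))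
qed

text \<open>Translation by the real part of u is a unitary factor and, as Re u \<le> 0, only shrinks
  a. What remains is a value on a compact segment of the imaginary axis with coefficients bounded by
  K.\<close>

lemma Phi_left_bound:
 assumes a: "irr (a :: 'n::finite cmat)" and b: "dagger b = - b"
 shows "\<exists>C. 0 <= C & (\<forall>u. Re u <= 0 --> \<bar>Im u\<bar> <= pi --> norm (Phi0 a b u) <= C & norm (Gi a b u) <= C)"
proof -
 define K where "K = norm a + norm b"
 obtain C where C: "0 <= C" "!!(a::'n cmat) b v. norm a <= K ==> norm b <= K ==> cmod v <= pi ==> norm (fsol a b v) <= C"
  by (rule fsol_bound[of K pi, where 'n='n]) (auto simp: K_def)
 have f: "norm (fsol a b u) <= C"
  if s: "dagger a = - a" "dagger b = - b" and n: "norm a <= K" "norm b <= K" and u: "Re u <= 0" "\<bar>Im u\<bar> <= pi" for a b :: "'n cmat" and u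
 proof -
  have "u = \<i> * Im u + of_real (Re u)" by (simp add: complex_eq_iff)
  hence "fsol a b u = fsol (cscale (exp (of_real (Re u))) a) b (\<i> * Im u) ** fsol a b (of_real (Re u))"
   using fsol_shift[of a b "\<i> * Im u" "of_real (Re u)"] by simp
  hence "norm (fsol a b u) = norm (fsol (cscale (exp (of_real (Re u))) a) b (\<i> * Im u))"
   by (simp add: norm_unitary_right unitary_fsol s)
  also have "... <= C"
  proof (rule C(2)[OF _ n(2)])
   have "exp (Re u) * norm a <= 1 * norm a" using u by (intro mult_right_mono) auto
   thus "norm (cscale (exp (of_real (Re u))) a) <= K" using n by (simp add: norm_cscale)
  qed (use u in \<open>simp add: norm_mult\<close>)
  finally show ?thesis .
 qed
 have tr: "dagger (- transpose M) = - (- transpose M)" if "dagger M = - M" for M :: "'n cmat"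
 proof (rule cmat_eqI)
  fix i j show "dagger (- transpose M) $ i $ j = (- (- transpose M)) $ i $ j"
   using arg_cong[OF that, of "\<lambda>M. M $ j $ i"] by (simp add: transpose_def)
 qed
 have i: "norm (isol a b u) <= C" if "Re u <= 0" "\<bar>Im u\<bar> <= pi" for u
  unfolding isol_def norm_transpose using that a b by (intro f tr) (auto simp: K_def irr_dagger)
 have N: "norm (C0 a b) = norm (mat 1 :: 'n cmat)" "norm (Ci a b) = norm (mat 1 :: 'n cmat)"
  using unitary_C0[OF a b] by (simp_all add: norm_unitary)
 have "norm (Phi0 a b u) <= C * norm (mat 1 :: 'n cmat) & norm (Gi a b u) <= C * norm (mat 1 :: 'n cmat)"
  if u: "Re u <= 0" "\<bar>Im u\<bar> <= pi" for u
  using norm_matrix_mult_le[of "fsol a b u" "C0 a b"] norm_matrix_mult_le[of "Ci a b" "isol a b u"]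
   mult_right_mono[OF f[OF irr_dagger[OF a] b _ _ u] norm_ge_zero[of "mat 1 :: 'n cmat"]]
   mult_right_mono[OF i[OF u] norm_ge_zero[of "mat 1 :: 'n cmat"]] unfolding Phi0_def Gi_def N by (auto simp: K_def mult.commute)
 thus ?thesis using C(1) by (intro exI[of _ "C * norm (mat 1 :: 'n cmat)"]) auto
qed

lemma affine_tendsto_zero:
 assumes "((\<lambda>t. \<kappa> * complex_of_real t + c) \<longlongrightarrow> 0) at_top"
 shows "c = 0"
proof -
 have "filterlim (\<lambda>t::real. t + 1) at_top at_top" by (rule filterlim_at_top_mono[OF filterlim_ident]) auto
 from tendsto_diff[OF filterlim_compose[OF assms this] assms]
 have "((\<lambda>t::real. \<kappa>) \<longlongrightarrow> 0) at_top" by (simp add: algebra_simps)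
 hence "\<kappa> = 0" by (simp add: tendsto_const_iff)
 thus ?thesis using assms by (simp add: tendsto_const_iff)
qed

text \<open>The hypothesis on M admits precisely the entries whose weight exp(e^v (a_j - a_i)) has
  modulus at most 1.\<close>

lemma dd_skew_bound:
 fixes a b M :: "'n::finite cmat"
 assumes a: "irr a" and b: "dagger b = - b" and v: "\<bar>Im v\<bar> <= pi"
  and M: "!!i j. M $ i $ j ~= 0 ==> 0 <= Im (exp v) * (Im (a $ j $ j) - Im (a $ i $ i))"
 shows "norm (Dd (- a) b v ** M ** Di (- a) b v) <= real (CARD('n))^2 * (exp (pi * (2 * norm b)) * norm M)"
proof (rule norm_cmat_le_entries)
 fix i j
 show "cmod ((Dd (- a) b v ** M ** Di (- a) b v) $ i $ j) <= exp (pi * (2 * norm b)) * norm M"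
 proof (cases "M $ i $ j = 0")
  case True thus ?thesis by (simp add: conj_entry)
 next
  case False
  have be: "\<bar>Im (b $ k $ k)\<bar> <= norm b" for k by (rule order_trans[OF abs_Im_le_cmod cmod_entry_le])
  have "\<bar>Im v * (Im (b $ i $ i) - Im (b $ j $ j))\<bar> <= pi * (2 * norm b)"
   unfolding abs_mult by (rule mult_mono[OF v]) (use be[of i] be[of j] in auto)
  moreover have "Re (v * (b $ i $ i - b $ j $ j) + exp v * ((- a) $ i $ i - (- a) $ j $ j))
    = - (Im v * (Im (b $ i $ i) - Im (b $ j $ j))) - Im (exp v) * (Im (a $ j $ j) - Im (a $ i $ i))"
   using irrD(2)[OF a] skew_diag_Re[OF b] by (simp add: algebra_simps)
  ultimately have "Re (v * (b $ i $ i - b $ j $ j) + exp v * ((- a) $ i $ i - (- a) $ j $ j)) <= pi * (2 * norm b)"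
   using M[OF False] by linarith
  thus ?thesis unfolding conj_entry(2) norm_mult norm_exp_eq_Re mult.commute[of "cmod (M $ i $ j)"]
   by (intro mult_mono cmod_entry_le) auto
 qed
qed

lemma variation_half:
 assumes irr: "irr (a :: 'n::finite cmat)" and b_tube: "b \<in> tube" and y: "variation a b \<beta> y" and \<epsilon>: "0 < \<epsilon>" "\<epsilon> <= pi"
 shows "\<exists>C R. 0 <= C & 0 <= R & (\<forall>u. \<bar>Im u\<bar> <= pi - \<epsilon> --> R <= Re u -->
   norm (Phi0 a b u ** y u ** Gi a b u - cscale u (diag_part \<beta>)) <= C * exp (- Re u / 2))"
proof -
 obtain C R where C: "0 <= C" "0 <= R" "\<forall>u. \<bar>Im u\<bar> <= pi - \<epsilon> --> R <= Re u -->
   norm (Phi0 a b u ** y u ** Gi a b u - cscale u (diag_part \<beta>)) <= C * ((1 + cmod u) * exp (- Re u))"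
  using variation_sector[OF irr b_tube y \<epsilon>] by (elim exE conjE) (rule that)
 have "norm (Phi0 a b u ** y u ** Gi a b u - cscale u (diag_part \<beta>)) <= (C * 10) * exp (- Re u / 2)"
  if "\<bar>Im u\<bar> <= pi - \<epsilon>" "R <= Re u" for u
  using order_trans[OF C(3)[rule_format, OF that] mult_left_mono[OF exp_half_bound C(1)]] that C \<epsilon> by (simp add: mult_ac)
 thus ?thesis using C by (intro exI[of _ "C * 10"] exI[of _ R]) auto
qed

section \<open>Variation at a skew-Hermitian residue\<close>

locale skew_point =
 fixes a b :: "'n::finite cmat"
 assumes irr: "irr a" and skew: "dagger b = - b"
begin

lemma irr': "irr (- a)" using irr by simp
lemma b_tube: "b \<in> tube" by (rule tube_skew[OF skew])

abbreviation "c \<equiv> clow a b"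
abbreviation "d \<equiv> cup a b"

lemma c_d_inverse [simp]:
 "dagger c ** d = mat 1" "d ** dagger c = mat 1" "dagger d ** c = mat 1" "c ** dagger d = mat 1"
 "dagger c ** (d ** X) = X" "d ** (dagger c ** X) = X" "dagger d ** (c ** X) = X" "c ** (dagger d ** X) = X"
proof -
 show *: "dagger c ** d = mat 1" "d ** dagger c = mat 1" by (rule cup_clow[OF irr skew])+
 have "dagger d ** c = dagger (dagger c ** d)" "c ** dagger d = dagger (d ** dagger c)" by (simp_all only: dagger_mult dagger_dagger)
 with * show "dagger d ** c = mat 1" "c ** dagger d = mat 1" by (simp_all add: dagger_one)
 with * show "dagger c ** (d ** X) = X" "d ** (dagger c ** X) = X" "dagger d ** (c ** X) = X" "c ** (dagger d ** X) = X"
  by (simp_all add: mm_assoc)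
qed

lemma Gi_Phi0_simps [simp]:
 "Gi a b u ** Phi0 a b u = mat 1" "Phi0 a b u ** Gi a b u = mat 1"
 "Gi (- a) b u ** Phi0 (- a) b u = mat 1" "Phi0 (- a) b u ** Gi (- a) b u = mat 1"
 "Gi a b u ** (Phi0 a b u ** X) = X" "Phi0 a b u ** (Gi a b u ** X) = X"
 "Gi (- a) b u ** (Phi0 (- a) b u ** X) = X" "Phi0 (- a) b u ** (Gi (- a) b u ** X) = X"
 using Gi_Phi0[OF irr b_tube] Gi_Phi0[OF irr' b_tube] by (simp_all add: mm_assoc)

lemma Gi_shift: "Gi a b (u - \<i> * pi) = dagger d ** Gi (- a) b u" "Gi a b (u + \<i> * pi) = dagger c ** Gi (- a) b u"
proof -
 show "Gi a b (u - \<i> * pi) = dagger d ** Gi (- a) b u" by (rule mm_left_inverse_unique[OF _ Gi_Phi0_simps(1)])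
   (simp add: Phi0_shift[OF irr b_tube] flip: mm_assoc)
 show "Gi a b (u + \<i> * pi) = dagger c ** Gi (- a) b u" by (rule mm_left_inverse_unique[OF _ Gi_Phi0_simps(1)])
   (simp add: Phi0_shift[OF irr b_tube] flip: mm_assoc)
qed

context
 fixes \<beta> c' :: "'n cmat" and y y' :: "complex => 'n cmat"
 assumes \<beta>: "dagger \<beta> = - \<beta>" and y: "variation a b \<beta> y" and y': "variation (- a) b \<beta> y'"
  and c': "has_mderiv (\<lambda>t. clow a (b + cscale t \<beta>)) c' 0"
begin

lemma skew_line: "dagger (b + cscale (of_real s) \<beta>) = - (b + cscale (of_real s) \<beta>)"
 by (simp add: dagger_add dagger_cscale skew \<beta> cs.minus_right)

lemma real_line: "has_mderiv X X' 0 ==> ((\<lambda>s. X (of_real s)) has_vector_derivative X') (at 0)"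
proof -
 have "((of_real :: real => complex) has_vector_derivative 1) (at 0)"
  unfolding has_vector_derivative_def by (auto intro!: derivative_eq_intros simp: scaleR_conv_of_real)
 thus "has_mderiv X X' 0 ==> ((\<lambda>s. X (of_real s)) has_vector_derivative X') (at 0)"
  using has_mderiv_vector[of X X' "of_real :: real => complex" 0 1 UNIV] by simp
qed

lemma c'_triangular: "Im (a $ j $ j) < Im (a $ i $ i) ==> c' $ i $ j = 0"
proof -
 assume ij: "Im (a $ j $ j) < Im (a $ i $ i)"
 have "((\<lambda>s. clow a (b + cscale (of_real s) \<beta>) $ i $ j) has_vector_derivative c' $ i $ j) (at 0)"
  by (rule bounded_linear.has_vector_derivative[OF bounded_linear_entry real_line[OF c']])
 moreover have "clow a (b + cscale (of_real s) \<beta>) $ i $ j = 0" for s by (rule clow_triangular[OF irr skew_line ij])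
 ultimately show ?thesis using vector_derivative_unique_at[OF _ has_vector_derivative_const] by simp blast
qed

text \<open>The relation between \<open>cup\<close> and the adjoint of \<open>clow\<close> holds
  only along real multiples of \<beta> and is not holomorphic. As \<open>cup\<close> has a complex
  derivative, that derivative is already determined along the real line.\<close>

lemma cup_derivative: "has_mderiv (\<lambda>t. cup a (b + cscale t \<beta>)) (- (d ** dagger c' ** d)) 0"
proof -
 have "b + cscale 0 \<beta> \<in> tube" using b_tube by (simp add: cs.zero_left)
 then obtain d' where d': "has_mderiv (\<lambda>t. cup a (b + cscale t \<beta>)) d' 0" using mgholD(3)[OF mghol_clow(2)[OF irr]] by blast
 have "((\<lambda>s. dagger (clow a (b + cscale (of_real s) \<beta>)) ** cup a (b + cscale (of_real s) \<beta>)) has_vector_derivative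
   dagger (clow a (b + cscale (of_real 0) \<beta>)) ** d' + dagger c' ** cup a (b + cscale (of_real 0) \<beta>)) (at 0)"
  by (rule mm.has_vector_derivative[OF bounded_linear.has_vector_derivative[OF bounded_linear_dagger real_line[OF c']] real_line[OF d']])
 hence "dagger c ** d' + dagger c' ** d = 0"
  using vector_derivative_unique_at[OF _ has_vector_derivative_const] by (simp add: cup_clow[OF irr skew_line] cs.zero_left) blast
 hence "d ** (dagger c ** d' + dagger c' ** d) = 0" by (simp add: mm.zero_right)
 hence "d' = - (d ** dagger c' ** d)" by (simp add: mm.add_right mm_assoc eq_neg_iff_add_eq_0)
 with d' show ?thesis by simp
qed

lemma variation_shift_skew:
 "y (u - \<i> * pi) = dagger d ** (y' u ** c + c')" "y (u + \<i> * pi) = dagger c ** (y' u ** d - d ** dagger c' ** d)"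
 using variation_shift(1)[OF irr b_tube y y' c', of u, symmetric]
  variation_shift(2)[OF irr b_tube y y' cup_derivative, of u, symmetric] by simp_all

text \<open>Both right sides contain the same solution for - a. The values one full turn apart thus
  differ only in the constants added to y', and equality of these constants will be the dressing
  equation for X.\<close>

lemma Phi_variation_shift:
 "Phi0 a b (u - \<i> * pi) ** (y (u - \<i> * pi) - X) ** Gi a b (u - \<i> * pi)
   = Phi0 (- a) b u ** (y' u + (c' ** dagger d - c ** X ** dagger d)) ** Gi (- a) b u"
 "Phi0 a b (u + \<i> * pi) ** (y (u + \<i> * pi) - X) ** Gi a b (u + \<i> * pi)
   = Phi0 (- a) b u ** (y' u + (- (d ** dagger c') - d ** X ** dagger c)) ** Gi (- a) b u"
 unfolding Phi0_shift[OF irr b_tube] Gi_shift variation_shift_skew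
 by (simp_all add: mm.add_left mm.add_right mm.diff_left mm.diff_right mm.minus_left mm.minus_right flip: mm_assoc)

end

text \<open>When the imaginary part of u exceeds pi/2 in modulus, a half-turn leads back to the good
  range for - a, at the price of a constant: M = c' d^\<dagger> on one side, minus its adjoint on
  the other. M is a quotient of triangular matrices, hence triangular, and in the half-plane
  concerned its possible nonzero entries are just those with weights that do not grow.\<close>

lemma variation_edge:
 assumes \<beta>: "dagger \<beta> = - \<beta>" and y: "variation a b \<beta> y"
 shows "\<exists>C R. 0 <= C & 0 <= R & (\<forall>u. \<bar>Im u\<bar> <= pi --> R <= Re u -->
   norm (Phi0 a b u ** y u ** Gi a b u - cscale u (diag_part \<beta>)) <= C)"
proof -
 have "b + cscale 0 \<beta> \<in> tube" using b_tube by (simp add: cs.zero_left)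
 then obtain c' where c': "has_mderiv (\<lambda>t. clow a (b + cscale t \<beta>)) c' 0" using mgholD(3)[OF mghol_clow(1)[OF irr]] by blast
 obtain y' where y': "variation (- a) b \<beta> y'" using variation_exists[OF irr' b_tube] by blast
 have p2: "0 < pi / 2" "pi / 2 <= pi" by auto
 obtain C1 R1 where C1: "0 <= C1" "0 <= R1" "\<forall>u. \<bar>Im u\<bar> <= pi - pi / 2 --> R1 <= Re u -->
   norm (Phi0 a b u ** y u ** Gi a b u - cscale u (diag_part \<beta>)) <= C1 * exp (- Re u / 2)"
  using variation_half[OF irr b_tube y p2] by (elim exE conjE) (rule that)
 obtain C2 R2 where C2: "0 <= C2" "0 <= R2" "\<forall>u. \<bar>Im u\<bar> <= pi - pi / 2 --> R2 <= Re u -->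
   norm (Phi0 (- a) b u ** y' u ** Gi (- a) b u - cscale u (diag_part \<beta>)) <= C2 * exp (- Re u / 2)"
  using variation_half[OF irr' b_tube y' p2] by (elim exE conjE) (rule that)
 obtain C3 R3 where S: "sector_bounds (- a) (pi / 2) (norm b) C3 R3" using sector_bounds_exist[OF irr' p2 norm_ge_zero] by blast
 note C3 = sector_boundsD(1,2)[OF S] and H = sector_boundsD(3)[OF S b_tube order_refl]
 define M where "M = c' ** dagger d"
 have Mc: "M ** c = c'" by (simp add: M_def flip: mm_assoc)
 have inj: "inj (\<lambda>i. Im (a $ i $ i))" using irrD(2,3)[OF irr] by (auto simp: inj_def complex_eq_iff)
 have c0: "c $ i $ i ~= 0" for i by (simp add: clow_diag[OF irr b_tube])
 have M: "M $ i $ j = 0" if "Im (a $ j $ j) < Im (a $ i $ i)" for i j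
  using triangular_factor[OF Mc inj c0 clow_triangular[OF irr skew] c'_triangular[OF \<beta> y y' c'] that] .
 have dM: "d ** dagger c' = dagger M" by (simp add: M_def dagger_mult dagger_dagger)
 define C4 where "C4 = C3 * (real (CARD('n))^2 * (exp (pi * (2 * norm b)) * norm M)) * C3"
 have conj: "norm (Phi0 (- a) b v ** L ** Gi (- a) b v) <= C4"
  if v: "\<bar>Im v\<bar> <= pi / 2" "R3 <= Re v" and L: "norm L = norm M"
   "!!i j. L $ i $ j ~= 0 ==> 0 <= Im (exp v) * (Im (a $ j $ j) - Im (a $ i $ i))" for v and L :: "'n cmat"
 proof -
  have "norm (Hf (- a) b v) <= C3" "norm (Hi (- a) b v) <= C3" using H[of v] v by auto
  moreover have "norm (Dd (- a) b v ** L ** Di (- a) b v) <= real (CARD('n))^2 * (exp (pi * (2 * norm b)) * norm M)"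
   unfolding L(1)[symmetric] by (rule dd_skew_bound[OF irr skew _ L(2)]) (use v in auto)
  moreover have "Phi0 (- a) b v ** L ** Gi (- a) b v = Hf (- a) b v ** (Dd (- a) b v ** L ** Di (- a) b v) ** Hi (- a) b v"
   unfolding Hf_def Hi_def by (simp flip: mm_assoc)
  ultimately show ?thesis unfolding C4_def
   using C3 by (simp only:) (rule order_trans[OF norm_matrix_mult_le mult_mono[OF order_trans[OF norm_matrix_mult_le mult_mono]]], auto)
 qed
 define R where "R = max R1 (max R2 R3)"
 define C where "C = C1 + C2 + C4 + pi * norm \<beta>"
 have C4: "0 <= C4" using C3 by (simp add: C4_def)
 have eb: "C * exp (- Re u / 2) <= C" if "0 <= C" "0 <= Re u" for C u using mult_left_mono[of "exp (- Re u / 2)" 1 C] that by simp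
 have edge: "norm (Phi0 (- a) b v ** (y' v + L) ** Gi (- a) b v - cscale (v + p) (diag_part \<beta>)) <= C"
  if v: "\<bar>Im v\<bar> <= pi / 2" "R <= Re v" and p: "cmod p = pi" and L: "norm (Phi0 (- a) b v ** L ** Gi (- a) b v) <= C4" for v p L
 proof -
  have e: "Phi0 (- a) b v ** (y' v + L) ** Gi (- a) b v - cscale (v + p) (diag_part \<beta>)
    = (Phi0 (- a) b v ** y' v ** Gi (- a) b v - cscale v (diag_part \<beta>)) + (Phi0 (- a) b v ** L ** Gi (- a) b v + - cscale p (diag_part \<beta>))"
   by (simp add: mm.add_left mm.add_right cs.add_left)
  have "norm (Phi0 (- a) b v ** y' v ** Gi (- a) b v - cscale v (diag_part \<beta>)) <= C2"
   by (rule order_trans[OF C2(3)[rule_format] eb[OF C2(1)]]) (use v C2 in \<open>auto simp: R_def\<close>)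
  moreover have "norm (- cscale p (diag_part \<beta>)) <= pi * norm \<beta>" by (simp add: norm_cscale p norm_diag_part_le)
  ultimately have "norm (Phi0 (- a) b v ** (y' v + L) ** Gi (- a) b v - cscale (v + p) (diag_part \<beta>)) <= C2 + (C4 + pi * norm \<beta>)"
   unfolding e by (intro norm_triangle_mono L)
  thus ?thesis using C1 by (simp add: C_def)
 qed
 have "norm (Phi0 a b u ** y u ** Gi a b u - cscale u (diag_part \<beta>)) <= C" if u: "\<bar>Im u\<bar> <= pi" "R <= Re u" for u
 proof -
  consider "\<bar>Im u\<bar> <= pi / 2" | "Im u < - (pi / 2)" | "pi / 2 < Im u" by linarith
  thus ?thesis
  proof cases
   case 1
   hence "norm (Phi0 a b u ** y u ** Gi a b u - cscale u (diag_part \<beta>)) <= C1"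
    by (intro order_trans[OF C1(3)[rule_format] eb[OF C1(1)]]) (use u C1 in \<open>auto simp: R_def\<close>)
   thus ?thesis using C2 C4 by (simp add: C_def add_increasing2)
  next
   case 2
   define v where "v = u + \<i> * pi"
   have v: "\<bar>Im v\<bar> <= pi / 2" "R <= Re v" "0 <= Im v" "u = v - \<i> * pi" using 2 u by (auto simp: v_def)
   have "0 <= Im (exp v)" using v by (auto simp: Im_exp intro!: mult_nonneg_nonneg sin_ge_zero)
   hence "norm (Phi0 (- a) b v ** M ** Gi (- a) b v) <= C4"
    by (intro conj) (use v M in \<open>auto simp: R_def intro!: mult_nonneg_nonneg, meson not_le_imp_less\<close>)
   from edge[OF v(1,2) _ this, of "- (\<i> * pi)"] Phi_variation_shift(1)[OF \<beta> y y' c', of v 0]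
   show ?thesis using v(4) by (simp add: M_def norm_mult mm.zero_left mm.zero_right)
  next
   case 3
   define v where "v = u - \<i> * pi"
   have v: "\<bar>Im v\<bar> <= pi / 2" "R <= Re v" "Im v <= 0" "- pi <= Im v" "u = v + \<i> * pi" using 3 u by (auto simp: v_def)
   have "sin (- Im v) \<ge> 0" using v by (intro sin_ge_zero) auto
   hence le: "Im (exp v) <= 0" by (simp add: Im_exp mult_le_0_iff)
   have "norm (Phi0 (- a) b v ** (- dagger M) ** Gi (- a) b v) <= C4"
   proof (rule conj)
    fix i j assume "(- dagger M) $ i $ j ~= 0"
    hence "Im (a $ j $ j) <= Im (a $ i $ i)" using M[of i j] M[of j i] by force
    thus "0 <= Im (exp v) * (Im (a $ j $ j) - Im (a $ i $ i))" using le by (intro mult_nonpos_nonpos) auto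
   qed (use v in \<open>auto simp: R_def\<close>)
   from edge[OF v(1,2) _ this, of "\<i> * pi"] Phi_variation_shift(2)[OF \<beta> y y' c', of v 0]
   show ?thesis using v(5) by (simp add: dM norm_mult mm.zero_left mm.zero_right)
  qed
 qed
 moreover have "0 <= C" using C1 C2 C4 by (simp add: C_def)
 moreover have "0 <= R" using C1 by (simp add: R_def)
 ultimately show ?thesis by blast
qed

end

text \<open>Consequently p(e^u) is a primitive, with respect to u, of f(e^u) - f(0).\<close>

lemma pole_quotient_primitive:
 assumes "f holomorphic_on UNIV"
 shows "\<exists>p p'. (\<forall>z. (p has_field_derivative p' z) (at z)) & (\<forall>z. z * p' z = f z - f (0::complex))"
proof -
 define p' where "p' z = (if z = 0 then deriv f 0 else (f z - f 0) / (z - 0))" for z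
 have "p' holomorphic_on UNIV" unfolding p'_def by (rule pole_lemma[OF assms]) simp
 then obtain p where "\<forall>z. (p has_field_derivative p' z) (at z)" using holomorphic_convex_primitive'[of UNIV p'] by auto
 moreover have "z * p' z = f z - f 0" for z by (simp add: p'_def)
 ultimately show ?thesis by blast
qed

context skew_point
begin

text \<open>By cyclicity of the trace, conjugation by \<open>Phi0\<close> is moved onto \<Delta>. On
  the real axis \<open>Dd\<close> is unitary, so the conjugate of \<Delta> stays bounded, and its
  trace against the diagonal matrix \<delta>(\<gamma>) does not depend on u.\<close>

lemma real_variation_limit:
 assumes y: "variation a b \<gamma> y"
 shows "((\<lambda>t. trace (y (of_real t) ** \<Delta>) - of_real t * trace (diag_part \<gamma> ** \<Delta>)) \<longlongrightarrow> 0) at_top"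
proof -
 have p2: "0 < pi / 2" "pi / 2 <= pi" by auto
 obtain C R where C: "0 <= C" "0 <= R" "\<forall>u. \<bar>Im u\<bar> <= pi - pi / 2 --> R <= Re u -->
   norm (Phi0 a b u ** y u ** Gi a b u - cscale u (diag_part \<gamma>)) <= C * exp (- Re u / 2)"
  using variation_half[OF irr b_tube y p2] by (elim exE conjE) (rule that)
 obtain C3 R3 where S: "sector_bounds a (pi / 2) (norm b) C3 R3" using sector_bounds_exist[OF irr p2 norm_ge_zero] by blast
 note C3 = sector_boundsD(1,2)[OF S] and H = sector_boundsD(3)[OF S b_tube order_refl]
 obtain K where K: "0 <= K" "!!M :: 'n cmat. cmod (trace M) <= norm M * K"
  using bounded_linear.nonneg_bounded[OF bounded_linear_trace] by blast
 define Q where "Q = ((C * (C3 * norm \<Delta> * C3)) + 10 * (norm \<gamma> * (C3 * norm \<Delta> * C3 + norm \<Delta> * C3))) * K"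
 have "cmod (trace (y (of_real t) ** \<Delta>) - of_real t * trace (diag_part \<gamma> ** \<Delta>)) <= Q * exp (- (1/2) * t)"
  if t: "max R R3 <= t" for t
 proof -
  define u where "u = complex_of_real t"
  have t0: "0 <= t" using t C by simp
  define N where "N = Phi0 a b u ** \<Delta> ** Gi a b u"
  define D where "D = Dd a b u ** \<Delta> ** Di a b u"
  define E where "E = Phi0 a b u ** y u ** Gi a b u - cscale u (diag_part \<gamma>)"
  have E: "norm E <= C * exp (- t / 2)" unfolding E_def using C(3)[rule_format, of u] t by (simp add: u_def)
  have h: "norm (Hf a b u) <= C3" "norm (Hi a b u) <= C3" "norm (Hf a b u - mat 1) <= C3 * exp (- t)" "norm (Hi a b u - mat 1) <= C3 * exp (- t)"
   using H[of u] t by (auto simp: u_def)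
  have D: "norm D = norm \<Delta>"
   using unitary_Dd[OF irr skew, of t] by (simp add: D_def u_def norm_unitary_left norm_unitary_right unitary_dagger)
  have ND: "N = Hf a b u ** D ** Hi a b u" unfolding N_def D_def Hf_def Hi_def by (simp flip: mm_assoc)
  have N: "norm N <= C3 * norm \<Delta> * C3"
   unfolding ND by (rule order_trans[OF norm_matrix_mult_le mult_mono[OF order_trans[OF norm_matrix_mult_le mult_mono]]])
    (use h C3 D in auto)
  have "N - D = (Hf a b u - mat 1) ** D ** Hi a b u + D ** (Hi a b u - mat 1)" by (simp add: ND mm.diff_left mm.diff_right)
  also have "norm ... <= (C3 * exp (- t)) * norm \<Delta> * C3 + norm \<Delta> * (C3 * exp (- t))"
   by (rule norm_triangle_mono[OF order_trans[OF norm_matrix_mult_le mult_mono[OF order_trans[OF norm_matrix_mult_le mult_mono]]]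
     order_trans[OF norm_matrix_mult_le mult_mono]]) (use h C3 D in auto)
  finally have ND': "norm (N - D) <= (C3 * norm \<Delta> * C3 + norm \<Delta> * C3) * exp (- t)" by (simp add: algebra_simps)
  have "trace (y u ** \<Delta>) = trace (Phi0 a b u ** (y u ** \<Delta> ** Gi a b u))" by (subst trace_mm_commute) (simp flip: mm_assoc)
  also have "Phi0 a b u ** (y u ** \<Delta> ** Gi a b u) = E ** N + cscale u (diag_part \<gamma> ** N)"
   by (simp add: E_def N_def mm.diff_left flip: mm_assoc)
  finally have 1: "trace (y u ** \<Delta>) = trace (E ** N) + u * trace (diag_part \<gamma> ** N)" by (simp add: trace_add trace_cscale)
  have "diag_part \<gamma> ** D = Dd a b u ** (diag_part \<gamma> ** \<Delta> ** Di a b u)"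
  proof -
   have "diag_part \<gamma> ** Dd a b u = Dd a b u ** diag_part \<gamma>"
    by (rule cmat_eqI) (simp add: diag_mm_left, simp add: diag_part_nth diag_mats_offdiag[OF Dd_diag(1)])
   thus ?thesis by (simp add: D_def mm_assoc)
  qed
  hence 2: "trace (diag_part \<gamma> ** D) = trace (diag_part \<gamma> ** \<Delta>)"
   by (simp add: trace_mm_commute[of "Dd a b u"] flip: mm_assoc)
  have "trace (y u ** \<Delta>) - u * trace (diag_part \<gamma> ** \<Delta>) = trace (E ** N + cscale u (diag_part \<gamma> ** (N - D)))"
   unfolding 1 2[symmetric] by (simp add: trace_add trace_cscale mm.diff_right trace_sub algebra_simps)
  also have "cmod ... <= norm (E ** N + cscale u (diag_part \<gamma> ** (N - D))) * K" by (rule K)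
  also have "... <= ((C * exp (- t / 2)) * (C3 * norm \<Delta> * C3) + t * (norm \<gamma> * ((C3 * norm \<Delta> * C3 + norm \<Delta> * C3) * exp (- t)))) * K"
  proof (intro mult_right_mono norm_triangle_mono K)
   show "norm (E ** N) <= (C * exp (- t / 2)) * (C3 * norm \<Delta> * C3)"
    by (rule order_trans[OF norm_matrix_mult_le mult_mono[OF E N]]) (use C in auto)
   have "norm (diag_part \<gamma> ** (N - D)) <= norm \<gamma> * ((C3 * norm \<Delta> * C3 + norm \<Delta> * C3) * exp (- t))"
    by (rule order_trans[OF norm_matrix_mult_le mult_mono[OF norm_diag_part_le ND']]) auto
   thus "norm (cscale u (diag_part \<gamma> ** (N - D))) <= t * (norm \<gamma> * ((C3 * norm \<Delta> * C3 + norm \<Delta> * C3) * exp (- t)))"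
    using t0 by (simp add: norm_cscale u_def mult_left_mono)
  qed
  also have "... = ((C * (C3 * norm \<Delta> * C3)) * exp (- t / 2) + (norm \<gamma> * (C3 * norm \<Delta> * C3 + norm \<Delta> * C3)) * (t * exp (- t))) * K"
   by (simp add: mult_ac)
  also have "... <= ((C * (C3 * norm \<Delta> * C3)) * exp (- t / 2) + (norm \<gamma> * (C3 * norm \<Delta> * C3 + norm \<Delta> * C3)) * (10 * exp (- t / 2))) * K"
  proof -
   have "t * exp (- t) <= (1 + cmod u) * exp (- Re u)" using t0 by (simp add: u_def mult_right_mono)
   also have "... <= 10 * exp (- t / 2)" using exp_half_bound[of u] t0 by (simp add: u_def)
   finally show ?thesis using K C3 by (intro mult_right_mono add_left_mono mult_left_mono) auto
  qed
  finally show ?thesis by (simp add: Q_def u_def algebra_simps)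
 qed
 hence "\<forall>\<^sub>F t in at_top. norm (trace (y (of_real t) ** \<Delta>) - of_real t * trace (diag_part \<gamma> ** \<Delta>)) <= Q * exp (- (1/2) * t)"
  using eventually_ge_at_top[of "max R R3"] by (rule eventually_mono[rotated]) blast
 thus ?thesis by (rule Lim_null_comparison) (rule tendsto_mult_right_zero[OF exp_decay_tendsto], simp)
qed

text \<open>The hypothesis \<open>dress\<close> is the equation of the dressing vector of X with c'
  = c Z. The matrix G0 depends only on \<beta> and X, so one G0 serves all \<gamma>; these enter
  through the variation x in the direction \<gamma>.\<close>

lemma dressing_variation:
 assumes \<beta>: "dagger \<beta> = - \<beta>" and X: "dagger X = - X" and c': "has_mderiv (\<lambda>t. clow a (b + cscale t \<beta>)) c' 0"
  and dress: "c' ** dagger d + d ** dagger c' = c ** X ** dagger d - d ** X ** dagger c"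
 shows "\<exists>G0. \<beta> = - (b ** G0 - G0 ** b) &
  (\<forall>\<gamma> e'. dagger \<gamma> = - \<gamma> --> has_mderiv (\<lambda>t. clow a (b + cscale t \<gamma>)) e' 0 -->
    trace (\<gamma> ** G0) = of_real (Im (trace (dagger d ** e' ** X)) / pi))"
proof -
 obtain y where y: "variation a b \<beta> y" using variation_exists[OF irr b_tube] by blast
 obtain y' where y': "variation (- a) b \<beta> y'" using variation_exists[OF irr' b_tube] by blast
 define F where "F u = Phi0 a b u ** (y u - X) ** Gi a b u" for u
 have F': "has_mderiv F (lcoef a b u ** F u - F u ** lcoef a b u + \<beta>) u" for u
 proof -
  have "has_mderiv F ((lcoef a b u ** Phi0 a b u ** (y u - X) + Phi0 a b u ** (Gi a b u ** \<beta> ** Phi0 a b u - 0)) ** Gi a b u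
    + Phi0 a b u ** (y u - X) ** (- (Gi a b u ** lcoef a b u))) u"
   unfolding F_def using y by (intro has_mderiv_mult has_mderiv_diff has_mderiv_const has_mderiv_Phi0 has_mderiv_Gi[OF irr b_tube])
    (simp add: variation_def)
  thus ?thesis by (simp add: F_def mm.add_left mm.minus_right diff_add_eq flip: mm_assoc)
 qed
 have per: "F (u + 2 * of_real pi * \<i>) = F u" for u
 proof -
  have "c' ** dagger d - c ** X ** dagger d = - (d ** dagger c') - d ** X ** dagger c" using dress by (simp add: algebra_simps)
  hence "F (v + \<i> * pi) = F (v - \<i> * pi)" for v unfolding F_def Phi_variation_shift[OF \<beta> y y' c'] by simp
  from this[of "u + \<i> * pi"] show ?thesis by (simp add: algebra_simps)
 qed
 obtain C where C: "0 <= C" "!!u. Re u <= 0 ==> \<bar>Im u\<bar> <= pi ==> norm (Phi0 a b u) <= C" "!!u. Re u <= 0 ==> \<bar>Im u\<bar> <= pi ==> norm (Gi a b u) <= C"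
  using Phi_left_bound[OF irr skew] by blast
 define C' where "C' = C * (norm (y 0) + norm X + C * norm \<beta> * C) * C"
 have bd: "norm (F u) <= C' * (1 + cmod u)" if u: "Re u <= 0" "\<bar>Im u\<bar> <= pi" for u
 proof -
  have "norm (y u - y 0) <= (C * norm \<beta> * C) * norm (u - 0)"
  proof (rule has_mderiv_bound)
   show "convex ({u. Re u <= 0} \<inter> ({u. Im u <= pi} \<inter> {u. - pi <= Im u}))"
    by (intro convex_Int convex_halfspace_Re_le convex_halfspace_Im_le convex_halfspace_Im_ge)
   show "has_mderiv y (Gi a b z ** \<beta> ** Phi0 a b z) z" for z using y by (simp add: variation_def)
   show "norm (Gi a b z ** \<beta> ** Phi0 a b z) <= C * norm \<beta> * C"
    if "z \<in> {u. Re u <= 0} \<inter> ({u. Im u <= pi} \<inter> {u. - pi <= Im u})" for z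
    by (rule order_trans[OF norm_matrix_mult_le mult_mono[OF order_trans[OF norm_matrix_mult_le mult_mono]]]) (use C that in auto)
  qed (use u in auto)
  hence "norm (y u - X) <= norm (y 0) + norm X + C * norm \<beta> * C * cmod u"
   using norm_triangle_ineq4[of "y u" X] norm_triangle_sub[of "y u" "y 0"] by simp
  also have "... <= (norm (y 0) + norm X + C * norm \<beta> * C) * (1 + cmod u)" using C by (simp add: algebra_simps)
  finally have "norm (F u) <= C * ((norm (y 0) + norm X + C * norm \<beta> * C) * (1 + cmod u)) * C" unfolding F_def
   by (intro order_trans[OF norm_matrix_mult_le mult_mono[OF order_trans[OF norm_matrix_mult_le mult_mono]]])
    (use C u in \<open>auto intro!: mult_nonneg_nonneg add_nonneg_nonneg\<close>)
  thus ?thesis by (simp add: C'_def mult_ac)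
 qed
 obtain g g' where g: "!!z. has_mderiv g (g' z) z" "!!u. F u = g (exp u)" using periodic_entire_matrix[OF F' per bd] by blast
 have hol: "(\<lambda>z. g z $ i $ j) holomorphic_on UNIV" for i j
  using mat_holomorphic_iff[OF open_UNIV, of g] g(1) by (auto simp: mat_holomorphic_on_def)
 \<comment> \<open>The differential equation of F in the variable z = e^u, at z = 0: both the
   derivative term and the term with a carry a factor z.\<close>
 have "b ** g 0 - g 0 ** b + \<beta> = 0"
 proof (rule cmat_eqI)
  fix i j
  define k where "k z = (lcoef a b (Ln z) ** g z - g z ** lcoef a b (Ln z) + \<beta>) $ i $ j" for z
  define k1 where "k1 z = ((cscale z a + b) ** g z - g z ** (cscale z a + b) + \<beta>) $ i $ j" for z
  have kk: "k1 z = z * deriv (\<lambda>z. g z $ i $ j) z" if "z ~= 0" for z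
  proof -
   have "has_mderiv F (cscale (exp (Ln z)) (g' (exp (Ln z)))) (Ln z)" unfolding g(2) by (rule has_mderiv_chain[OF g(1) DERIV_exp])
   from has_mderiv_unique[OF this F'] that
   have "cscale z (g' z) = (cscale z a + b) ** g z - g z ** (cscale z a + b) + \<beta>" by (simp add: g(2) lcoef_def)
   moreover have "deriv (\<lambda>z. g z $ i $ j) z = g' z $ i $ j" using g(1) by (intro DERIV_imp_deriv) (simp add: has_mderiv_iff)
   ultimately show ?thesis unfolding k1_def by (metis cscale_nth)
  qed
  have "isCont (\<lambda>z. z * deriv (\<lambda>z. g z $ i $ j) z) 0"
   using holomorphic_on_imp_continuous_on[OF holomorphic_deriv[OF hol open_UNIV]] by (auto intro!: continuous_intros simp: continuous_on_eq_continuous_at)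
  hence "((\<lambda>z. z * deriv (\<lambda>z. g z $ i $ j) z) \<longlongrightarrow> 0) (at 0)" by (simp add: isCont_def)
  moreover have "\<forall>\<^sub>F z in at 0. k1 z = z * deriv (\<lambda>z. g z $ i $ j) z" by (auto simp: eventually_at_filter kk)
  ultimately have k1: "(k1 \<longlongrightarrow> 0) (at 0)" by (subst tendsto_cong)
  have "isCont k1 0" unfolding k1_def by (rule bounded_linear.isCont[OF bounded_linear_entry])
    (rule has_mderiv_continuous[OF g(1)] isCont_add isCont_diff mm.isCont cs.isCont continuous_ident continuous_const)+
  hence "k1 0 = 0" using LIM_unique[OF _ k1] by (simp add: isCont_def)
  thus "(b ** g 0 - g 0 ** b + \<beta>) $ i $ j = (0 :: 'n cmat) $ i $ j" by (simp add: k1_def cs.zero_left)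
 qed
 hence "\<beta> = - (b ** g 0 - g 0 ** b)" by (simp only: eq_neg_iff_add_eq_0 add.commute)
 moreover have "trace (\<gamma> ** g 0) = of_real (Im (trace (dagger d ** e' ** X)) / pi)"
  if \<gamma>: "dagger \<gamma> = - \<gamma>" and e': "has_mderiv (\<lambda>t. clow a (b + cscale t \<gamma>)) e' 0" for \<gamma> e'
 proof -
  obtain x where x: "variation a b \<gamma> x" using variation_exists[OF irr b_tube] by blast
  obtain x' where x': "variation (- a) b \<gamma> x'" using variation_exists[OF irr' b_tube] by blast
  interpret m: skew_point "- a" b using irr' skew by unfold_locales
  define f where "f z = trace (\<gamma> ** g z)" for z
  have bl: "bounded_linear (\<lambda>M. trace (\<gamma> ** M))"
   by (rule bounded_linear_compose[OF bounded_linear_trace mm.bounded_linear_right])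
  have fh: "f holomorphic_on UNIV" unfolding f_def trace_def mm_nth by (intro holomorphic_intros hol)
  obtain p p' where p: "!!z. (p has_field_derivative p' z) (at z)" "!!z. z * p' z = f z - f 0"
   using pole_quotient_primitive[OF fh] by (elim exE conjE) (rule that, blast+)
  define \<kappa> where "\<kappa> = trace (\<gamma> ** diag_part \<beta>)"
  \<comment> \<open>A primitive of h: f(0) u + p(e^u) integrates Tr(\<gamma> F), the trace of x X
    integrates Tr(\<gamma> \<Phi> X \<Phi>^(-1)), and the quadratic term removes the growing part u
    \<delta>(\<beta>).\<close>
  define q where "q u = f 0 * u + p (exp u) + trace (x u ** X) - \<kappa> * (u * u) / 2" for u
  define h where "h u = trace (\<gamma> ** (Phi0 a b u ** y u ** Gi a b u - cscale u (diag_part \<beta>)))" for u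
  have tr: "((\<lambda>u. trace (x u ** X)) has_field_derivative trace (Gi a b u ** \<gamma> ** Phi0 a b u ** X)) (at u)" for u
  proof -
   have "has_mderiv (\<lambda>u. x u ** X) (Gi a b u ** \<gamma> ** Phi0 a b u ** X + x u ** 0) u"
    using x by (intro has_mderiv_mult has_mderiv_const) (simp add: variation_def)
   thus ?thesis unfolding trace_def has_mderiv_iff by (auto intro!: DERIV_sum simp: mm.zero_right)
  qed
  have q: "(q has_field_derivative h u) (at u)" for u
  proof -
   have "(q has_field_derivative f 0 * 1 + p' (exp u) * exp u + trace (Gi a b u ** \<gamma> ** Phi0 a b u ** X) - \<kappa> * (u + u) / 2) (at u)"
    unfolding q_def by (intro derivative_intros DERIV_chain2[OF p(1)] tr) (auto intro!: derivative_eq_intros)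
   moreover have "p' (exp u) * exp u = trace (\<gamma> ** F u) - f 0" using p(2)[of "exp u"] by (simp add: f_def g(2) mult.commute)
   moreover have "trace (Gi a b u ** \<gamma> ** Phi0 a b u ** X) = trace (\<gamma> ** (Phi0 a b u ** X ** Gi a b u))"
    using trace_mm_commute[of "Gi a b u" "\<gamma> ** Phi0 a b u ** X"] by (simp add: mm_assoc)
   moreover have "\<gamma> ** F u = \<gamma> ** (Phi0 a b u ** y u ** Gi a b u) - \<gamma> ** (Phi0 a b u ** X ** Gi a b u)"
    by (simp add: F_def mm.diff_left mm.diff_right)
   ultimately show ?thesis by (simp add: h_def mm.diff_right trace_sub trace_cscale mult.commute[of u] \<kappa>_def)
  qed
  obtain K where K: "0 <= K" "!!M :: 'n cmat. cmod (trace (\<gamma> ** M)) <= norm M * K"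
   using bounded_linear.nonneg_bounded[OF bl] by blast
  have "((\<lambda>t. q (of_real t + \<i> * pi) - q (of_real t - \<i> * pi)) \<longlongrightarrow> 0) at_top"
  proof -
   obtain C R where C: "0 <= C" "0 <= R" "\<forall>u. \<bar>Im u\<bar> <= pi --> R <= Re u -->
     norm (Phi0 a b u ** y u ** Gi a b u - cscale u (diag_part \<beta>)) <= C"
    using variation_edge[OF \<beta> y] by (elim exE conjE) (rule that)
   show ?thesis
   proof (rule vertical_increment[OF q, of "C * K" R])
    show "cmod (h u) <= C * K" if "\<bar>Im u\<bar> <= pi" "R <= Re u" for u
     unfolding h_def by (rule order_trans[OF K(2) mult_right_mono[OF C(3)[rule_format, OF that] K(1)]])
    fix \<epsilon> :: real assume \<epsilon>: "0 < \<epsilon>" "\<epsilon> <= pi"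
    obtain C R where C: "0 <= C" "0 <= R" "\<forall>u. \<bar>Im u\<bar> <= pi - \<epsilon> --> R <= Re u -->
      norm (Phi0 a b u ** y u ** Gi a b u - cscale u (diag_part \<beta>)) <= C * exp (- Re u / 2)"
     using variation_half[OF irr b_tube y \<epsilon>] by (elim exE conjE) (rule that)
    have "cmod (h u) <= (C * K) * exp (- Re u / 2)" if "\<bar>Im u\<bar> <= pi - \<epsilon>" "R <= Re u" for u
     unfolding h_def using order_trans[OF K(2) mult_right_mono[OF C(3)[rule_format, OF that] K(1)]] by (simp add: mult_ac)
    thus "\<exists>C R. 0 <= C & (\<forall>u. \<bar>Im u\<bar> <= pi - \<epsilon> --> R <= Re u --> cmod (h u) <= C * exp (- Re u / 2))"
     using C K by (intro exI[of _ "C * K"] exI[of _ R]) auto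
   qed (use C K in auto)
  qed
  define \<tau> where "\<tau> = trace (dagger d ** e' ** X)"
  define \<Delta> where "\<Delta> = d ** X ** dagger c - c ** X ** dagger d"
  \<comment> \<open>Over a full turn p(e^u) cancels and f(0) u contributes 2 pi i f(0). The
    constants in \<open>variation_shift_skew\<close> contribute \<open>cnj \<tau>\<close> at the
    upper end and \<tau> at the lower one.\<close>
  have inc: "q (of_real t + \<i> * pi) - q (of_real t - \<i> * pi)
    = (2 * pi * \<i> * f 0 + (cnj \<tau> - \<tau>)) + (trace (x' (of_real t) ** \<Delta>) - 2 * pi * \<i> * \<kappa> * of_real t)" for t
  proof -
   define v where "v = complex_of_real t"
   have up: "trace (x (v + \<i> * pi) ** X) = trace (x' v ** (d ** X ** dagger c)) + cnj \<tau>"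
   proof -
    have "cnj \<tau> = - trace (X ** (dagger e' ** d))"
     unfolding \<tau>_def cnj_trace by (simp add: dagger_mult dagger_dagger X mm.minus_left linear_neg[OF bounded_linear.linear[OF bounded_linear_trace]])
    moreover have "x (v + \<i> * pi) ** X = dagger c ** (x' v ** d ** X) - dagger e' ** d ** X"
     unfolding variation_shift_skew[OF \<gamma> x x' e'] by (simp add: mm.diff_left mm.diff_right flip: mm_assoc)
    ultimately show ?thesis by (simp add: trace_sub trace_mm_commute[of "dagger c"] trace_mm_commute[of X] flip: mm_assoc)
   qed
   have lo: "trace (x (v - \<i> * pi) ** X) = trace (x' v ** (c ** X ** dagger d)) + \<tau>"
   proof -
    have "x (v - \<i> * pi) ** X = dagger d ** (x' v ** c ** X) + dagger d ** e' ** X"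
     unfolding variation_shift_skew[OF \<gamma> x x' e'] by (simp add: mm.add_left mm.add_right flip: mm_assoc)
    thus ?thesis by (simp add: \<tau>_def trace_add trace_mm_commute[of "dagger d" "x' v ** (c ** X)"] flip: mm_assoc)
   qed
   have e: "exp (v + \<i> * pi) = exp (v - \<i> * pi)" by (simp add: exp_pm_pi)
   show ?thesis unfolding q_def v_def[symmetric] up lo e \<Delta>_def by (simp add: mm.diff_right trace_sub) (simp add: field_simps)
  qed
  have "((\<lambda>t. (trace (diag_part \<gamma> ** \<Delta>) - 2 * pi * \<i> * \<kappa>) * of_real t + (2 * pi * \<i> * f 0 + (cnj \<tau> - \<tau>))) \<longlongrightarrow> 0) at_top"
   using tendsto_diff[OF \<open>(_ \<longlongrightarrow> 0) at_top\<close>[unfolded inc] m.real_variation_limit[OF x', of \<Delta>]] by (simp add: algebra_simps)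
  \<comment> \<open>An affine function of t that tends to 0 vanishes. Its constant term has 2 pi i
    f(0) against 2 i Im \<tau>, which is where the division by pi comes from.\<close>
  hence "2 * pi * \<i> * f 0 + (cnj \<tau> - \<tau>) = 0" by (rule affine_tendsto_zero)
  hence "2 * pi * \<i> * f 0 = \<tau> - cnj \<tau>" by algebra
  hence "2 * pi * \<i> * f 0 = 2 * \<i> * of_real (Im \<tau>)" by (simp add: complex_diff_cnj)
  thus ?thesis by (simp add: f_def \<tau>_def field_simps)
 qed
 ultimately show ?thesis by blast
qed

end

subsection \<open>Injectivity and properness\<close>

definition mdd :: "('n::finite cmat => 'm::finite cmat) => 'n cmat => 'n cmat => 'm cmat" where
 "mdd X x v = mat_deriv (\<lambda>t. X (x + cscale t v)) 0"

lemma mdd_has_mderiv: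
 assumes "mghol W X" "x \<in> W" shows "has_mderiv (\<lambda>t. X (x + cscale t v)) (mdd X x v) 0"
proof -
 have "x + cscale 0 v \<in> W" using assms by (simp add: cs.zero_left)
 then obtain X' where X': "has_mderiv (\<lambda>t. X (x + cscale t v)) X' 0" using mgholD(3)[OF assms(1)] by blast
 thus ?thesis unfolding mdd_def by (simp add: has_mderiv_mat_deriv)
qed

lemma mdd_entry: "mdd X x v $ i $ j = cstr.dd (\<lambda>x. X x $ i $ j) v x"
 by (simp add: mdd_def mat_deriv_def cstr.dd_def)

lemma mdd_has_derivative: "mghol W X ==> x \<in> W ==> (X has_derivative mdd X x) (at x)"
 by (rule has_derivative_entries) (simp add: mdd_entry cstr.has_derivative_dd[OF mghol_entry])

lemma mdd_cscale:
 assumes "mghol W X" "x \<in> W" shows "mdd X x (cscale c v) = cscale c (mdd X x v)"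
proof -
 have "has_mderiv (\<lambda>t. X (x + cscale (t * c) v)) (cscale c (mdd X x v)) 0"
  by (rule has_mderiv_chain[of "\<lambda>t. X (x + cscale t v)"])
   (use mdd_has_mderiv[OF assms] in \<open>auto intro!: derivative_eq_intros\<close>)
 thus ?thesis using has_mderiv_unique[OF mdd_has_mderiv[OF assms, of "cscale c v"]] by simp
qed

lemma mdd_linear: "mghol W X ==> x \<in> W ==> bounded_linear (mdd X x)"
 using mdd_has_derivative has_derivative_bounded_linear by blast

lemma mdd_continuous: "mghol W X ==> continuous_on W (\<lambda>x. mdd X x v)"
proof -
 assume X: "mghol W X"
 have "continuous_on W (\<lambda>x. \<chi> i j. cstr.dd (\<lambda>x. X x $ i $ j) v x)"
  using cstr.ghol_dd[OF mghol_entry[OF X]] by (intro continuous_on_vec_lambda) (simp add: ghol_def)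
 thus ?thesis by (simp add: mdd_entry[symmetric])
qed

text \<open>Testing with G^\<dagger> - G and with i (G^\<dagger> + G), both skew-Hermitian, gives
  Tr(G^\<dagger> G) = 0.\<close>

lemma trace_skew_zero:
 assumes "!!\<gamma>. dagger \<gamma> = - \<gamma> ==> trace (\<gamma> ** G) = 0" shows "G = (0 :: 'n::finite cmat)"
proof -
 have "trace ((dagger G - G) ** G) = 0" "trace (cscale \<i> (dagger G + G) ** G) = 0"
  by (rule assms; simp add: dagger_minus dagger_add dagger_cscale dagger_dagger vec_eq_iff add.commute)+
 hence "trace (dagger G ** G) - trace (G ** G) = 0" "trace (dagger G ** G) + trace (G ** G) = 0"
  by (simp_all add: mm.diff_left mm.add_left trace_sub trace_add trace_cscale)
 hence "trace (dagger G ** G) = 0" by algebra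
 thus ?thesis using norm_sq_trace[of G] by simp
qed

lemma skew_hermitian_decomposition:
 fixes \<beta> :: "'n::finite cmat"
 obtains \<beta>1 \<beta>2 where "dagger \<beta>1 = - \<beta>1" "dagger \<beta>2 = - \<beta>2" "\<beta> = \<beta>1 + cscale \<i> \<beta>2"
proof
 show "dagger (cscale (1/2) (\<beta> - dagger \<beta>)) = - cscale (1/2) (\<beta> - dagger \<beta>)"
  "dagger (cscale (- (\<i>/2)) (\<beta> + dagger \<beta>)) = - cscale (- (\<i>/2)) (\<beta> + dagger \<beta>)"
  by (simp_all add: vec_eq_iff algebra_simps)
 show "\<beta> = cscale (1/2) (\<beta> - dagger \<beta>) + cscale \<i> (cscale (- (\<i>/2)) (\<beta> + dagger \<beta>))"
  by (rule cmat_eqI) (simp add: field_simps)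
qed

context skew_point
begin

lemma clow_mdd: "has_mderiv (\<lambda>t. clow a (b + cscale t \<beta>)) (mdd (clow a) b \<beta>) 0"
 by (rule mdd_has_mderiv[OF mghol_clow(1)[OF irr] b_tube])

text \<open>\<open>dressing_variation\<close> for X = 0: all traces of G0 against skew-Hermitian
  matrices vanish, so G0 = 0, and \<beta> is a commutator with G0.\<close>

lemma mdd_clow_injective:
 assumes \<beta>: "dagger \<beta> = - \<beta>" and z: "mdd (clow a) b \<beta> = 0"
 shows "\<beta> = 0"
proof -
 have d0: "dagger (0 :: 'n cmat) = - 0" by (simp add: vec_eq_iff)
 obtain G0 where G0: "\<beta> = - (b ** G0 - G0 ** b)" "!!\<gamma> e'. dagger \<gamma> = - \<gamma> ==> has_mderiv (\<lambda>t. clow a (b + cscale t \<gamma>)) e' 0 ==>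
    trace (\<gamma> ** G0) = of_real (Im (trace (dagger d ** e' ** 0)) / pi)"
  using dressing_variation[OF \<beta> d0 clow_mdd] z d0 by (simp add: mm.zero_left mm.zero_right) blast
 have "G0 = 0" using G0(2)[OF _ clow_mdd] by (intro trace_skew_zero) (simp add: mm.zero_right trace_0[unfolded mat_0])
 thus ?thesis using G0(1) by (simp add: mm.zero_left mm.zero_right)
qed

lemma clow_diag_real: "c $ i $ i = of_real (exp (pi * Im (b $ i $ i)))"
proof -
 have "- (\<i> * pi * b $ i $ i) = of_real (pi * Im (b $ i $ i))" using skew_diag_Re[OF skew, of i] by (simp add: complex_eq_iff)
 thus ?thesis unfolding clow_diag[OF irr b_tube] by (simp only: exp_of_real)
qed

lemma inj_weight: "inj (\<lambda>i. Im (a $ i $ i))"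
 using irrD(2,3)[OF irr] by (auto simp: inj_def complex_eq_iff)

text \<open>M is a logarithmic derivative in the triangular group. Its diagonal is real because the
  diagonal of \<open>clow\<close> is exp(- pi i b_ii) with imaginary b_ii.\<close>

lemma mdd_clow_factor:
 assumes \<beta>: "dagger \<beta> = - \<beta>"
 obtains M where "mdd (clow a) b \<beta> = M ** c" "!!i j. Im (a $ j $ j) < Im (a $ i $ i) ==> M $ i $ j = 0" "!!i. Im (M $ i $ i) = 0"
proof
 let ?c' = "mdd (clow a) b \<beta>"
 define M where "M = ?c' ** dagger d"
 show Mc: "?c' = M ** c" by (simp add: M_def flip: mm_assoc)
 obtain y where y: "variation a b \<beta> y" using variation_exists[OF irr b_tube] by blast
 obtain y' where y': "variation (- a) b \<beta> y'" using variation_exists[OF irr' b_tube] by blast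
 have c0: "c $ i $ i ~= 0" for i by (simp add: clow_diag[OF irr b_tube])
 show M: "M $ i $ j = 0" if "Im (a $ j $ j) < Im (a $ i $ i)" for i j
  using triangular_factor[OF Mc[symmetric] inj_weight c0 clow_triangular[OF irr skew] c'_triangular[OF \<beta> y y' clow_mdd] that] .
 fix i
 have "M $ i $ k * c $ k $ i = 0" if "k ~= i" for k
 proof -
  have "Im (a $ k $ k) ~= Im (a $ i $ i)" using that injD[OF inj_weight] by blast
  thus ?thesis using M[of k i] clow_triangular[OF irr skew, of i k] by (cases "Im (a $ k $ k) < Im (a $ i $ i)") auto
 qed
 hence "(\<Sum>k\<in>UNIV. M $ i $ k * c $ k $ i) = (\<Sum>k\<in>UNIV. if k = i then M $ i $ i * c $ i $ i else 0)"
  by (intro sum.cong) auto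
 hence e: "?c' $ i $ i = M $ i $ i * c $ i $ i" unfolding Mc mm_nth by simp
 have "((\<lambda>t. exp (- (\<i> * pi * (b + cscale t \<beta>) $ i $ i))) has_field_derivative - (\<i> * pi * \<beta> $ i $ i) * exp (- (\<i> * pi * b $ i $ i))) (at 0)"
  by (auto intro!: derivative_eq_intros)
 hence "((\<lambda>t. clow a (b + cscale t \<beta>) $ i $ i) has_field_derivative - (\<i> * pi * \<beta> $ i $ i) * exp (- (\<i> * pi * b $ i $ i))) (at 0)"
  by (rule has_field_derivative_transform_within_open[OF _ cstr.line_open[OF open_tube, of b \<beta>]])
   (use b_tube in \<open>auto simp: cs.zero_left clow_diag[OF irr]\<close>)
 moreover have "((\<lambda>t. clow a (b + cscale t \<beta>) $ i $ i) has_field_derivative ?c' $ i $ i) (at 0)"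
  using clow_mdd by (simp add: has_mderiv_iff)
 ultimately have "?c' $ i $ i = - (\<i> * pi * \<beta> $ i $ i) * exp (- (\<i> * pi * b $ i $ i))" by (rule DERIV_unique[symmetric])
 hence "M $ i $ i * c $ i $ i = - (\<i> * pi * \<beta> $ i $ i) * c $ i $ i" unfolding e by (simp add: clow_diag[OF irr b_tube])
 hence "M $ i $ i = - (\<i> * pi * \<beta> $ i $ i)" unfolding mult_cancel_right using c0[of i] by blast
 thus "Im (M $ i $ i) = 0" using skew_diag_Re[OF \<beta>, of i] by simp
qed

lemma mdd_Mt_skew:
 assumes \<beta>: "dagger \<beta> = - \<beta>"
 shows "mdd (Mt a) b \<beta> = dagger (mdd (clow a) b \<beta>) ** c + dagger c ** mdd (clow a) b \<beta>"
proof -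
 obtain y where y: "variation a b \<beta> y" using variation_exists[OF irr b_tube] by blast
 obtain y' where y': "variation (- a) b \<beta> y'" using variation_exists[OF irr' b_tube] by blast
 note rl = real_line[OF \<beta> y y' clow_mdd]
 have "((\<lambda>s. dagger (clow a (b + cscale (of_real s) \<beta>)) ** clow a (b + cscale (of_real s) \<beta>)) has_vector_derivative
   dagger (clow a (b + cscale (of_real 0) \<beta>)) ** mdd (clow a) b \<beta> + dagger (mdd (clow a) b \<beta>) ** clow a (b + cscale (of_real 0) \<beta>)) (at 0)"
  by (rule mm.has_vector_derivative[OF bounded_linear.has_vector_derivative[OF bounded_linear_dagger rl[OF clow_mdd]] rl[OF clow_mdd]])
 moreover have "((\<lambda>s. Mt a (b + cscale (of_real s) \<beta>)) has_vector_derivative mdd (Mt a) b \<beta>) (at 0)"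
  by (rule rl[OF mdd_has_mderiv[OF mghol_Mt[OF irr] b_tube]])
 ultimately show ?thesis using vector_derivative_unique_at
  unfolding Mt_skew[OF irr skew_line[OF \<beta> y y' clow_mdd]] by (fastforce simp: cs.zero_left add.commute)
qed

text \<open>In skew-Hermitian directions the derivative is Hermitian, so the contributions of
  \<beta>1 and i \<beta>2 vanish separately. For each of them c^\<dagger> (M^\<dagger> + M) c = 0; a
  triangular M with real diagonal and M^\<dagger> + M = 0 is zero, and
  \<open>mdd_clow_injective\<close> finishes.\<close>

lemma mdd_Mt_injective:
 assumes z: "mdd (Mt a) b \<beta> = 0"
 shows "\<beta> = 0"
proof -
 obtain \<beta>1 \<beta>2 where \<beta>: "dagger \<beta>1 = - \<beta>1" "dagger \<beta>2 = - \<beta>2" "\<beta> = \<beta>1 + cscale \<i> \<beta>2"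
  by (rule skew_hermitian_decomposition)
 note lin = mdd_linear[OF mghol_Mt[OF irr] b_tube]
 define P R where PR: "P = mdd (Mt a) b \<beta>1" "R = mdd (Mt a) b \<beta>2"
 have e1: "P + cscale \<i> R = 0"
  using z by (simp add: PR \<beta>(3) linear_add[OF bounded_linear.linear[OF lin]] mdd_cscale[OF mghol_Mt[OF irr] b_tube])
 have "dagger (mdd (Mt a) b \<beta>') = mdd (Mt a) b \<beta>'" if "dagger \<beta>' = - \<beta>'" for \<beta>'
  by (simp add: mdd_Mt_skew[OF that] dagger_add dagger_mult dagger_dagger add.commute)
 hence "P - cscale \<i> R = dagger (P + cscale \<i> R)" using \<beta>(1,2) by (simp add: PR dagger_add dagger_cscale cs.minus_left)
 hence e2: "P - cscale \<i> R = 0" unfolding e1 by (simp add: vec_eq_iff)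
 have "cscale 2 P = (P + cscale \<i> R) + (P - cscale \<i> R)" by (simp add: vec_eq_iff)
 hence "cscale (1/2) (cscale 2 P) = 0" unfolding e1 e2 by (simp add: cs.zero_right)
 hence P0: "P = 0" by simp
 hence "cscale (- \<i>) (cscale \<i> R) = 0" using e1 by (simp add: cs.zero_right)
 hence R0: "R = 0" by simp
 have z1: "\<beta>' = 0" if \<beta>': "dagger \<beta>' = - \<beta>'" and z: "mdd (Mt a) b \<beta>' = 0" for \<beta>'
 proof -
  obtain M where M: "mdd (clow a) b \<beta>' = M ** c" "!!i j. Im (a $ j $ j) < Im (a $ i $ i) ==> M $ i $ j = 0" "!!i. Im (M $ i $ i) = 0"
   by (rule mdd_clow_factor[OF \<beta>']) blast
  have "dagger c ** (dagger M + M) ** c = 0"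
   using z unfolding mdd_Mt_skew[OF \<beta>'] M(1) by (simp add: dagger_mult mm.add_left mm.add_right mm_assoc)
  hence "d ** (dagger c ** (dagger M + M) ** c) ** dagger d = 0" by (simp add: mm.zero_left mm.zero_right)
  hence s: "dagger M + M = 0" by (simp flip: mm_assoc)
  have "M = 0"
  proof (rule cmat_eqI)
   fix i j
   have sij: "cnj (M $ j $ i) + M $ i $ j = 0" for i j using arg_cong[OF s, of "\<lambda>M. M $ i $ j"] by simp
   consider "i = j" | "Im (a $ j $ j) < Im (a $ i $ i)" | "Im (a $ i $ i) < Im (a $ j $ j)"
    using injD[OF inj_weight, of i j] by fastforce
   thus "M $ i $ j = (0 :: 'n cmat) $ i $ j"
   proof cases
    case 1 thus ?thesis using sij[of i i] M(3)[of i] by (simp add: complex_eq_iff)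
   next
    case 2 thus ?thesis using M(2) by simp
   next
    case 3 thus ?thesis using M(2)[of i j] sij[of i j] by simp
   qed
  qed
  thus ?thesis using mdd_clow_injective[OF \<beta>'] M(1) by (simp add: mm.zero_left)
 qed
 from P0 R0 show ?thesis using z1[OF \<beta>(1)] z1[OF \<beta>(2)] \<beta>(3) by (simp add: PR cs.zero_right)
qed

end

text \<open>Equality of \<open>clow\<close> entails equality of \<open>cup\<close> and, through the
  diagonal, of \<delta>(b); hence the exponential factors cancel in the quotient F. A half-turn
  takes F for a to F for - a with no constant in between, which yields the periodicity and also the
  decay right up to the edges. Once F = 1, the two differential equations have the same
  coefficients.\<close>

lemma clow_injective:
 fixes a :: "'n::finite cmat"
 assumes a: "irr a" and b: "dagger b = - b" and b2: "dagger b2 = - b2" and e: "clow a b = clow a b2"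
 shows "b = b2"
proof -
 interpret p: skew_point a b using a b by unfold_locales
 interpret q: skew_point a b2 using a b2 by unfold_locales
 have d: "cup a b = cup a b2" using mm_left_inverse_unique[OF p.c_d_inverse(1) q.c_d_inverse(2)[folded e]] by simp
 have "b $ i $ i = b2 $ i $ i" for i
 proof -
  have "exp (pi * Im (b $ i $ i)) = exp (pi * Im (b2 $ i $ i))"
   using p.clow_diag_real[of i] q.clow_diag_real[of i] e by (metis of_real_eq_iff)
  thus ?thesis using skew_diag_Re[OF b] skew_diag_Re[OF b2] by (simp add: complex_eq_iff)
 qed
 hence "diag_part b = diag_part b2" by (intro cmat_eqI) (simp add: diag_part_nth)
 hence D: "Dd s b u = Dd s b2 u" for s u by (simp add: Dd_def)
 define F where "F s u = Phi0 s b2 u ** Gi s b u" for s u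
 have FH: "F s u = Hf s b2 u ** Hi s b u" for s u unfolding F_def Hf_def Hi_def D by (simp flip: mm_assoc)
 have F': "has_mderiv (F a) (lcoef a b2 u ** F a u - F a u ** lcoef a b u) u" for u
  using has_mderiv_mult[OF has_mderiv_Phi0[of a b2 u] has_mderiv_Gi[OF a p.b_tube, of u]]
  unfolding F_def by (simp add: mm.minus_right mm_assoc)
 have sh: "F a (u - \<i> * pi) = F (- a) u" "F a (u + \<i> * pi) = F (- a) u" for u
  unfolding F_def p.Gi_shift Phi0_shift[OF a q.b_tube] e[symmetric] d[symmetric] by (simp_all flip: mm_assoc)
 have per: "F a (u + 2 * of_real pi * \<i>) = F a u" for u
  using sh(1)[of "u + \<i> * pi"] sh(2)[of "u + \<i> * pi"] by (simp add: algebra_simps)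
 obtain C1 where C1: "0 <= C1" "!!u. Re u <= 0 ==> \<bar>Im u\<bar> <= pi ==> norm (Phi0 a b2 u) <= C1" using Phi_left_bound[OF a b2] by blast
 obtain C2 where C2: "0 <= C2" "!!u. Re u <= 0 ==> \<bar>Im u\<bar> <= pi ==> norm (Gi a b u) <= C2" using Phi_left_bound[OF a b] by blast
 have bd: "norm (F a u) <= (C1 * C2) * (1 + cmod u)" if "Re u <= 0" "\<bar>Im u\<bar> <= pi" for u
 proof -
  have "norm (F a u) <= C1 * C2" unfolding F_def by (rule order_trans[OF norm_matrix_mult_le mult_mono]) (use C1 C2 that in auto)
  also have "... <= (C1 * C2) * (1 + cmod u)" using mult_left_mono[of 1 "1 + cmod u" "C1 * C2"] C1 C2 by simp
  finally show ?thesis .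
 qed
 obtain g g' where g: "!!z. has_mderiv g (g' z) z" "!!u. F a u = g (exp u)" using periodic_entire_matrix[OF F' per bd] by blast
 have p2: "0 < pi / 2" "pi / 2 <= pi" by auto
 define K where "K = norm b + norm b2"
 have K: "0 <= K" by (simp add: K_def)
 have half: "\<exists>C R. 0 <= C & (\<forall>u. \<bar>Im u\<bar> <= pi / 2 --> R <= Re u --> norm (F s u - mat 1) <= C * exp (- Re u))"
  if s: "irr s" for s
 proof -
  obtain C R where S: "sector_bounds s (pi / 2) K C R" using sector_bounds_exist[OF s p2 K] by blast
  note C = sector_boundsD(1,2)[OF S] and H = sector_boundsD(3)[OF S]
  have "norm (F s u - mat 1) <= (C * C + C) * exp (- Re u)" if u: "\<bar>Im u\<bar> <= pi / 2" "R <= Re u" for u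
  proof -
   have h: "norm (Hi s b u) <= C" "norm (Hf s b2 u - mat 1) <= C * exp (- Re u)" "norm (Hi s b u - mat 1) <= C * exp (- Re u)"
    using H[OF p.b_tube _ _ u(2)] H[OF q.b_tube _ _ u(2)] u(1) by (auto simp: K_def)
   have "F s u - mat 1 = (Hf s b2 u - mat 1) ** Hi s b u + (Hi s b u - mat 1)" by (simp add: FH mm.diff_left)
   also have "norm ... <= (C * exp (- Re u)) * C + C * exp (- Re u)"
    by (intro norm_triangle_mono order_trans[OF norm_matrix_mult_le mult_mono] h) (use C in auto)
   finally show ?thesis by (simp add: algebra_simps)
  qed
  thus ?thesis using C by (intro exI[of _ "C * C + C"] exI[of _ R]) auto
 qed
 obtain C3 R3 where C3: "0 <= C3" "!!u. \<bar>Im u\<bar> <= pi / 2 ==> R3 <= Re u ==> norm (F a u - mat 1) <= C3 * exp (- Re u)"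
  using half[OF a] by blast
 obtain C4 R4 where C4: "0 <= C4" "!!u. \<bar>Im u\<bar> <= pi / 2 ==> R4 <= Re u ==> norm (F (- a) u - mat 1) <= C4 * exp (- Re u)"
  using half[OF p.irr'] by blast
 define C R where "C = C3 + C4" and "R = max R3 R4"
 have right: "norm (F a u - mat 1) <= C * exp (- Re u)" if u: "\<bar>Im u\<bar> <= pi" "R <= Re u" for u
 proof -
  have m: "C3 * exp (- Re u) <= C * exp (- Re u)" "C4 * exp (- Re u) <= C * exp (- Re u)"
   using C3(1) C4(1) by (simp_all add: C_def mult_right_mono)
  consider "\<bar>Im u\<bar> <= pi / 2" | "Im u < - (pi / 2)" | "pi / 2 < Im u" by linarith
  thus ?thesis
  proof cases
   case 1 thus ?thesis using C3(2)[of u] u by (intro order_trans[OF _ m(1)]) (simp add: R_def)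
  next
   case 2 thus ?thesis using C4(2)[of "u + \<i> * pi"] sh(1)[of "u + \<i> * pi"] u by (intro order_trans[OF _ m(2)]) (simp add: R_def)
  next
   case 3 thus ?thesis using C4(2)[of "u - \<i> * pi"] sh(2)[of "u - \<i> * pi"] u by (intro order_trans[OF _ m(2)]) (simp add: R_def)
  qed
 qed
 have "g z $ i $ j = (mat 1 :: 'n cmat) $ i $ j" for z i j
 proof (rule Liouville_weak[of "\<lambda>z. g z $ i $ j"])
  show "(\<lambda>z. g z $ i $ j) holomorphic_on UNIV"
   using mat_holomorphic_iff[OF open_UNIV, of g] g(1) by (auto simp: mat_holomorphic_on_def)
  have "((\<lambda>z. g z $ i $ j - mat 1 $ i $ j) \<longlongrightarrow> 0) at_infinity"
  proof (rule Lim_null_comparison)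
   show "\<forall>\<^sub>F z in at_infinity. norm (g z $ i $ j - mat 1 $ i $ j) <= C * norm (inverse z)"
    unfolding eventually_at_infinity
   proof (intro exI[of _ "exp R"] allI impI)
    fix z :: complex assume z: "exp R <= norm z"
    hence z0: "z ~= 0" using exp_gt_zero[of R] by auto
    have "R <= Re (Ln z)" using z z0 by (metis Re_Ln exp_gt_zero ln_exp ln_le_cancel_iff zero_less_norm_iff)
    hence "norm (F a (Ln z) - mat 1) <= C * exp (- Re (Ln z))"
     by (intro right) (use z0 Im_Ln_le_pi[OF z0] mpi_less_Im_Ln[OF z0] in auto)
    hence "norm (g z - mat 1) <= C * norm (inverse z)" using z0 by (simp add: g(2) exp_Ln exp_minus norm_inverse)
    thus "norm (g z $ i $ j - mat 1 $ i $ j) <= C * norm (inverse z)"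
     using order_trans[OF cmod_entry_le[of "g z - mat 1" i j]] by simp
   qed
   show "((\<lambda>z. C * norm (inverse z :: complex)) \<longlongrightarrow> 0) at_infinity"
    using tendsto_mult_right_zero[OF tendsto_norm_zero[OF tendsto_inverse_0]] .
  qed
  thus "((\<lambda>z. g z $ i $ j) \<longlongrightarrow> mat 1 $ i $ j) at_infinity" by (simp add: LIM_zero_iff)
 qed
 hence F1: "F a u = mat 1" for u unfolding g(2) by (intro cmat_eqI)
 have "has_mderiv (F a) 0 0" unfolding F1[abs_def] by (rule has_mderiv_const)
 from has_mderiv_unique[OF this F'[of 0]] show ?thesis by (simp add: F1 lcoef_def)
qed

section \<open>Bounding the residue by the connection matrices\<close>

lemma fsol_zero_limit:
 fixes a b :: "'n::finite cmat"
 shows "((\<lambda>t. fsol (cscale (exp (- of_real t)) a) b u) \<longlongrightarrow> fsol 0 b u) at_top"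
proof -
 define K where "K = norm a + norm b"
 obtain C where C: "0 <= C" "!!(a::'n cmat) b v. norm a <= K ==> norm b <= K ==> cmod v <= cmod u ==> norm (fsol a b v) <= C"
  by (rule fsol_bound[of K "cmod u", where 'n='n]) (auto simp: K_def)
 define as where "as t = cscale (exp (- complex_of_real t)) a" for t
 define W where "W t v = isol 0 b v ** fsol (as t) b v" for t v
 define S :: "complex set" where "S = cball 0 (cmod u)"
 define C' where "C' = C * (exp (cmod u) * norm a) * C * cmod u"
 have as: "norm (as t) = exp (- t) * norm a" for t by (simp add: as_def norm_cscale)
 have W: "norm (W t u - mat 1) <= C' * exp (- 1 * t)" if t: "0 <= t" for t
 proof -
  have asK: "norm (as t) <= K"
  proof -
   have "exp (- t) * norm a <= 1 * norm a" using t by (intro mult_right_mono) auto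
   thus ?thesis unfolding as K_def using norm_ge_zero[of b] by linarith
  qed
  have "norm (W t u - W t 0) <= (C * (exp (cmod u) * (exp (- t) * norm a)) * C) * norm (u - 0)"
  proof (rule has_mderiv_bound)
   show "convex S" "u \<in> S" "0 \<in> S" by (auto simp: S_def)
   fix v assume v: "v \<in> S"
   have "has_mderiv (W t) (- (isol 0 b v ** lcoef 0 b v) ** fsol (as t) b v + isol 0 b v ** (lcoef (as t) b v ** fsol (as t) b v)) v"
    unfolding W_def by (rule has_mderiv_mult[OF has_mderiv_isol has_mderiv_fsol])
   thus "has_mderiv (W t) (isol 0 b v ** cscale (exp v) (as t) ** fsol (as t) b v) v"
    by (simp add: lcoef_def cs.zero_right mm.add_left mm.add_right mm.minus_left flip: mm_assoc)
   have "norm (cscale (exp v) (as t)) <= exp (cmod u) * (exp (- t) * norm a)" unfolding norm_cscale as norm_exp_eq_Re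
    using v complex_Re_le_cmod[of v] by (intro mult_right_mono) (auto simp: S_def)
   moreover have "norm (isol 0 b v) <= C" unfolding isol_def norm_transpose using v by (intro C(2)) (auto simp: K_def S_def)
   moreover have "norm (fsol (as t) b v) <= C" using v by (intro C(2) asK) (auto simp: K_def S_def)
   ultimately show "norm (isol 0 b v ** cscale (exp v) (as t) ** fsol (as t) b v) <= C * (exp (cmod u) * (exp (- t) * norm a)) * C"
    using C(1) by (intro order_trans[OF norm_matrix_mult_le] mult_mono) (auto intro!: order_trans[OF norm_matrix_mult_le] mult_mono)
  qed
  thus ?thesis by (simp add: W_def C'_def mult_ac)
 qed
 have "((\<lambda>t. W t u - mat 1) \<longlongrightarrow> 0) at_top"
 proof (rule Lim_null_comparison)
  show "\<forall>\<^sub>F t in at_top. norm (W t u - mat 1) <= C' * exp (- 1 * t)"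
   using eventually_ge_at_top[of 0] by eventually_elim (rule W)
  show "((\<lambda>t. C' * exp (- 1 * t)) \<longlongrightarrow> 0) at_top" by (rule tendsto_mult_right_zero[OF exp_decay_tendsto]) simp
 qed
 hence "((\<lambda>t. W t u) \<longlongrightarrow> mat 1) at_top" by (simp add: LIM_zero_iff)
 from mm.tendsto[OF tendsto_const[of "fsol 0 b u"] this] show ?thesis by (simp add: W_def as_def)
qed

text \<open>The solution at u + t is computed in two orders. Since e^u = 1, the translation by u
  leaves a unchanged, and the factors belonging to the real number t are unitary.\<close>

lemma norm_fsol_scaled:
 assumes a: "dagger a = - a" and b: "dagger b = - b" and e: "exp u = 1"
 shows "norm (fsol (cscale (exp (of_real t)) a) b u) = norm (fsol a b u)"
proof -
 have "fsol (cscale (exp (of_real t)) a) b u ** fsol a b (of_real t) = fsol a b (of_real t) ** fsol a b u"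
  using fsol_shift[of a b u "of_real t"] fsol_shift[of a b "of_real t" u] by (simp add: e add.commute)
 thus ?thesis using norm_unitary_right norm_unitary_left unitary_fsol[OF a b, of t] by metis
qed

text \<open>Rescaling $a$ by $e^t$ translates $u$ by $t$, which is a unitary change of the initial value; let $t \to -\infty$.\<close>

lemma norm_fsol_zero_le:
 assumes "dagger a = - a" "dagger b = - b" "exp u = 1"
 shows "norm (fsol 0 b u) <= norm (fsol a b u)"
proof (rule tendsto_upperbound[OF tendsto_norm[OF fsol_zero_limit[of a b u]]])
 show "\<forall>\<^sub>F t in at_top. norm (fsol (cscale (exp (- complex_of_real t)) a) b u) <= norm (fsol a b u)"
  using norm_fsol_scaled[OF assms, of "- _"] by (intro always_eventually) (simp flip: of_real_minus)
qed simp

primrec mpow :: "'n cmat => nat => 'n::finite cmat" where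
 "mpow b 0 = mat 1" | "mpow b (Suc m) = b ** mpow b m"

lemma mpow_add: "mpow b (m + k) = mpow b m ** mpow b k"
 by (induction m) (simp_all add: mm_assoc)

text \<open>So \<open>fsol 0 b u\<close> is the matrix exponential of u b.\<close>

lemma fco_zero: "fco 0 b m = cscale (1 / fact m) (mpow b m)"
 by (induction m) (simp_all add: mm.zero_left mult_ac)

lemma dagger_mpow: "dagger b = - b ==> dagger (mpow b m) = cscale ((- 1) ^ m) (mpow b m)"
proof (induction m)
 case (Suc m)
 have "mpow b m ** b = b ** mpow b m" using mpow_add[of b m 1] mpow_add[of b 1 m] by simp
 thus ?case using Suc by (simp add: dagger_mult mm.minus_right cs.minus_left)
qed (simp add: dagger_one)

text \<open>The right side is the trace of exp(2 pi i b) + exp(- 2 pi i b). Odd terms cancel, even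
  terms are nonnegative multiples of squared norms because b is skew-Hermitian, and the term of
  order 2 is the left side.\<close>

lemma fsol_zero_trace:
 fixes b :: "'n::finite cmat"
 assumes b: "dagger b = - b"
 shows "4 * pi^2 * (norm b)^2 <= Re (trace (fsol 0 b (2 * pi * \<i>)) + trace (fsol 0 b (- (2 * pi * \<i>))))"
proof -
 define s where "s m = Re ((2 * pi * \<i>) ^ m * trace (fco 0 b m) + (- (2 * pi * \<i>)) ^ m * trace (fco 0 b m))" for m
 have "(\<lambda>m. u ^ m * trace (fco 0 b m)) sums trace (fsol 0 b u)" for u
  using bounded_linear.sums[OF bounded_linear_trace fsol_sums[of u 0 b]] by (simp add: trace_cscale)
 hence S: "s sums Re (trace (fsol 0 b (2 * pi * \<i>)) + trace (fsol 0 b (- (2 * pi * \<i>))))"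
  unfolding s_def by (intro sums_Re sums_add)
 have ev: "s (2 * k) = 2 * ((2 * pi) ^ (2 * k) * (norm (mpow b k))^2 / fact (2 * k))" for k
 proof -
  have "trace (mpow b (k + k)) = (- 1) ^ k * of_real ((norm (mpow b k))^2)"
   unfolding norm_sq_trace mpow_add dagger_mpow[OF b] by (simp add: trace_cscale power_mult_distrib[symmetric])
  hence "trace (fco 0 b (2 * k)) = (- 1) ^ k * of_real ((norm (mpow b k))^2) / fact (2 * k)"
   by (simp add: fco_zero trace_cscale mult_2)
  moreover have "(2 * pi * \<i>) ^ (2 * k) = (- 1) ^ k * of_real ((2 * pi) ^ (2 * k))"
  proof -
   have "\<i> ^ (2 * k) = (- 1) ^ k" by (simp add: power_mult)
   thus ?thesis unfolding power_mult_distrib[of "complex_of_real (2 * pi)"] by (simp only: of_real_power mult.commute)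
  qed
  moreover have "(- (2 * pi * \<i>)) ^ (2 * k) = (2 * pi * \<i>) ^ (2 * k)" by simp
  moreover have "((- 1) ^ k * x) * ((- 1) ^ k * y / f) = x * y / f" for x y f :: complex
  proof -
   have "((- 1) ^ k * x) * ((- 1) ^ k * y / f) = ((- 1) ^ k * (- 1) ^ k) * (x * y / f)" by simp
   thus ?thesis by (simp flip: power_mult_distrib)
  qed
  ultimately have "(2 * pi * \<i>) ^ (2 * k) * trace (fco 0 b (2 * k)) + (- (2 * pi * \<i>)) ^ (2 * k) * trace (fco 0 b (2 * k))
    = of_real (2 * ((2 * pi) ^ (2 * k) * (norm (mpow b k))^2 / fact (2 * k)))"
   by (simp only: of_real_mult of_real_divide of_real_fact of_real_numeral of_real_add mult_2)
  thus ?thesis unfolding s_def by (simp only: Re_complex_of_real)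
 qed
 have nn: "0 <= s m" for m
 proof (cases "even m")
  case True thus ?thesis using ev by (auto elim!: evenE)
 next
  case False thus ?thesis by (simp add: s_def)
 qed
 have "s 2 = 4 * pi^2 * (norm b)^2" using ev[of 1] by (simp add: power2_eq_square)
 moreover have "s 2 <= suminf s" using sum_le_suminf[OF sums_summable[OF S], of "{2}"] nn by simp
 ultimately show ?thesis using sums_unique[OF S] by simp
qed

text \<open>Conjugated by the unitary \<open>C0\<close>, the solution at 2 pi i becomes d^\<dagger>
  d, and at - 2 pi i it becomes c^\<dagger> c. By \<open>norm_fsol_zero_le\<close> their norms
  dominate those of exp(2 pi i b) and exp(- 2 pi i b), whose traces control the norm of b.\<close>

lemma residue_bound:
 fixes a :: "'n::finite cmat"
 assumes a: "irr a"
 shows "\<exists>K. 0 <= K & (\<forall>b. dagger b = - b --> (norm b)^2 <= K * ((norm (clow a b))^2 + (norm (cup a b))^2))"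
proof -
 obtain K where K: "0 <= K" "!!M :: 'n cmat. cmod (trace M) <= norm M * K"
  using bounded_linear.nonneg_bounded[OF bounded_linear_trace] by blast
 have "(norm b)^2 <= K * ((norm (clow a b))^2 + (norm (cup a b))^2)" if b: "dagger b = - b" for b
 proof -
  interpret skew_point a b using a b by unfold_locales
  have U: "unitary (C0 a b)" "unitary (Ci a b)" using unitary_C0[OF a b] by (simp_all add: unitary_dagger)
  have C: "C0 a b ** (Ci a b ** X) = X" for X :: "'n cmat" by (simp add: mm_assoc Ci_C0[OF a b_tube])
  have n: "norm (Ci a b ** fsol a b u ** C0 a b) = norm (fsol a b u)" for u
   by (simp add: norm_unitary_left[OF U(2)] norm_unitary_right[OF U(1)])
  have e1: "exp (2 * pi * \<i>) = 1" using exp_two_pi_i by simp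
  hence e: "exp (2 * pi * \<i>) = 1" "exp (- (2 * pi * \<i>)) = 1" by (simp_all only: exp_minus inverse_1)
  have "c ** (Ci a b ** fsol a b (2 * pi * \<i>) ** C0 a b) = d" using fsol_shift[of a b "- (\<i> * pi)" "2 * pi * \<i>"]
   by (simp add: clow_def cup_def C e mm_assoc[symmetric])
  hence "dagger d ** (c ** (Ci a b ** fsol a b (2 * pi * \<i>) ** C0 a b)) = dagger d ** d" by (rule arg_cong)
  hence "norm (dagger d ** d) = norm (fsol a b (2 * pi * \<i>))" unfolding n[symmetric] by (simp only: c_d_inverse)
  hence 1: "norm (fsol a b (2 * pi * \<i>)) <= (norm d)^2"
   using norm_matrix_mult_le[of "dagger d" d] by (simp add: power2_eq_square)
  have "d ** (Ci a b ** fsol a b (- (2 * pi * \<i>)) ** C0 a b) = c"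
   using fsol_shift[of a b "\<i> * pi" "- (2 * pi * \<i>)", unfolded e cscale_one]
   by (simp add: clow_def cup_def C e mm_assoc[symmetric])
  hence "dagger c ** (d ** (Ci a b ** fsol a b (- (2 * pi * \<i>)) ** C0 a b)) = dagger c ** c" by (rule arg_cong)
  hence "norm (dagger c ** c) = norm (fsol a b (- (2 * pi * \<i>)))" unfolding n[symmetric] by (simp only: c_d_inverse)
  hence 2: "norm (fsol a b (- (2 * pi * \<i>))) <= (norm c)^2"
   using norm_matrix_mult_le[of "dagger c" c] by (simp add: power2_eq_square)
  have t: "cmod (trace (fsol 0 b u)) <= x * K" if "exp u = 1" "norm (fsol a b u) <= x" for u x
   using order_trans[OF K(2) mult_right_mono[OF order_trans[OF norm_fsol_zero_le[OF irr_dagger[OF a] b that(1)] that(2)] K(1)]] .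
  have "1 * (norm b)^2 <= 4 * pi^2 * (norm b)^2"
  proof (rule mult_right_mono)
   have "1 * 1 <= pi * pi" using pi_gt3 by (intro mult_mono) auto
   thus "1 <= 4 * pi^2" by (simp add: power2_eq_square)
  qed simp
  also note fsol_zero_trace[OF b]
  also have "Re (trace (fsol 0 b (2 * pi * \<i>)) + trace (fsol 0 b (- (2 * pi * \<i>)))) <= (norm d)^2 * K + (norm c)^2 * K"
   by (intro order_trans[OF complex_Re_le_cmod] norm_triangle_mono t e 1 2)
  finally show ?thesis by (simp add: algebra_simps)
 qed
 thus ?thesis using K by blast
qed

subsection \<open>The diffeomorphism\<close>

lemma subspace_lie_k: "subspace (lie_k :: 'n::finite cmat set)"
 by (rule subspaceI) (auto simp: lie_k_def dagger_add dagger_scaleR vec_eq_iff)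

lemma subspace_lie_K_star: "subspace (lie_K_star :: 'n::{finite,wellorder} cmat set)"
 by (rule subspaceI) (auto simp: lie_K_star_def upper_tri_def complex_is_Real_iff)

text \<open>The comparison of dimensions required by invariance of domain, and also by surjectivity
  of the derivative.\<close>

lemma dim_lie_K_star: "dim (lie_K_star :: 'n::{finite,wellorder} cmat set) <= dim (lie_k :: 'n cmat set)"
proof -
 \<comment> \<open>Z - Z^\<dagger> forgets the real diagonal of Z; the last term restores it as an
   imaginary diagonal.\<close>
 define L :: "'n cmat => 'n cmat" where "L Z = Z - dagger Z + cscale \<i> (diag_part Z)" for Z
 have lin: "linear L" by (rule linearI; rule cmat_eqI; simp add: L_def diag_part_nth algebra_simps)
 have "inj_on L lie_K_star" unfolding linear_injective_on_subspace_0[OF lin subspace_lie_K_star]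
 proof (intro ballI impI cmat_eqI)
  fix Z :: "'n cmat" and i j :: 'n assume Z: "Z \<in> lie_K_star" and z: "L Z = 0"
  have e: "Z $ i $ j - cnj (Z $ j $ i) + \<i> * diag_part Z $ i $ j = 0" for i j using arg_cong[OF z, of "\<lambda>M. M $ i $ j"] by (simp add: L_def)
  consider "i = j" | "i < j" | "j < i" using linorder_less_linear[of i j] by blast
  thus "Z $ i $ j = (0 :: 'n cmat) $ i $ j"
  proof cases
   case 1 thus ?thesis using e[of i i] Z by (auto simp: lie_K_star_def diag_part_nth complex_is_Real_iff complex_eq_iff)
  next
   case 2 thus ?thesis using e[of i j] Z less_imp_neq[OF 2] by (auto simp: lie_K_star_def upper_tri_def diag_part_nth)
  next
   case 3 thus ?thesis using Z by (auto simp: lie_K_star_def upper_tri_def)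
  qed
 qed
 hence "dim (L ` lie_K_star) = dim (lie_K_star :: 'n cmat set)"
  by (intro dim_image_eq lin) (simp add: span_eq_iff[THEN iffD2, OF subspace_lie_K_star])
 moreover have "L ` lie_K_star \<subseteq> lie_k"
 proof
  fix Y assume "Y \<in> L ` lie_K_star"
  then obtain Z where Z: "Z \<in> lie_K_star" "Y = L Z" by blast
  have "cnj (diag_part Z $ j $ i) = diag_part Z $ i $ j" for i j
   using Z(1) by (auto simp: diag_part_nth lie_K_star_def complex_is_Real_iff complex_eq_iff)
  thus "Y \<in> lie_k" unfolding lie_k_def Z(2) L_def mem_Collect_eq by (intro cmat_eqI) (simp add: algebra_simps)
 qed
 ultimately show ?thesis using dim_subset by metis
qed

lemma K_plus_subset: "K_plus \<subseteq> lie_K_star" by (auto simp: K_plus_def lie_K_star_def)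

lemma K_plus_convex: "convex K_plus"
proof (rule convexI)
 fix x y :: "'n::{finite,wellorder} cmat" and u v :: real
 assume xy: "x \<in> K_plus" "y \<in> K_plus" and uv: "0 <= u" "0 <= v" "u + v = 1"
 have "0 < u * Re (x $ i $ i) + v * Re (y $ i $ i)" for i
  using xy uv by (cases "u = 0") (auto simp: K_plus_def less_imp_le intro!: add_pos_nonneg mult_pos_pos mult_nonneg_nonneg)
 thus "u *\<^sub>R x + v *\<^sub>R y \<in> K_plus" using xy by (auto simp: K_plus_def upper_tri_def complex_is_Real_iff)
qed

lemma K_plus_line:
 assumes "x \<in> K_plus" "v \<in> lie_K_star"
 shows "\<exists>\<delta>>0. \<forall>s. \<bar>s\<bar> < \<delta> --> x + s *\<^sub>R v \<in> K_plus"
proof -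
 have "open {s::real. 0 < Re ((x + s *\<^sub>R v) $ i $ i)}" for i by (intro open_Collect_less continuous_intros)
 hence "open (\<Inter>i\<in>UNIV. {s::real. 0 < Re ((x + s *\<^sub>R v) $ i $ i)})" by (intro open_INT ballI finite)
 moreover have "0 \<in> (\<Inter>i\<in>UNIV. {s::real. 0 < Re ((x + s *\<^sub>R v) $ i $ i)})" using assms by (auto simp: K_plus_def)
 ultimately obtain \<delta> where "0 < \<delta>" "!!s. \<bar>s\<bar> < \<delta> ==> \<forall>i. 0 < Re ((x + s *\<^sub>R v) $ i $ i)"
  unfolding open_dist by (fastforce simp: dist_real_def)
 thus ?thesis using assms by (intro exI[of _ \<delta>]) (auto simp: K_plus_def lie_K_star_def upper_tri_def complex_is_Real_iff)
qed

lemma mderiv_compose: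
 assumes "mghol V g" "has_mderiv m m' t" "m t \<in> V"
 shows "has_mderiv (\<lambda>t. g (m t)) (mdd g (m t) m') t"
 using has_derivative_compose[OF assms(2)[unfolded has_mderiv_def] mdd_has_derivative[OF assms(1,3)]]
 by (simp add: has_mderiv_def mdd_cscale[OF assms(1,3)])

text \<open>The real inverse function theorem supplies g; its derivative is the inverse of a complex
  linear map and therefore complex linear itself.\<close>

lemma mghol_local_inverse:
 fixes f :: "'n::finite cmat => 'n cmat"
 assumes f: "mghol U f" and x0: "x0 \<in> U" and inj: "!!v. mdd f x0 v = 0 ==> v = 0"
 obtains U' V g where "open U'" "x0 \<in> U'" "f ` U' = V" "f x0 \<in> V" "mghol V g" "!!x. x \<in> U' ==> g (f x) = x"
proof -
 note bl = mdd_linear[OF f]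
 define f' where "f' x = Blinfun (mdd f x)" for x
 have f': "blinfun_apply (f' x) = mdd f x" if "x \<in> U" for x by (simp add: f'_def bounded_linear_Blinfun_apply bl that)
 have lin: "linear (mdd f x0)" using bounded_linear.linear[OF bl[OF x0]] .
 hence "inj (mdd f x0)" using inj by (simp add: linear_injective_0)
 then obtain l where l: "linear l" "l \<circ> mdd f x0 = id" using linear_injective_left_inverse[OF lin] by blast
 have "Blinfun l o\<^sub>L f' x0 = id_blinfun"
  using l by (intro blinfun_eqI) (simp add: f'[OF x0] bounded_linear_Blinfun_apply linear_conv_bounded_linear[symmetric] pointfree_idE)
 moreover have "continuous_on U f'"
  by (rule continuous_on_blinfun_componentwise) (use mdd_continuous[OF f] in \<open>simp add: f' cong: continuous_on_cong\<close>)
 ultimately obtain U' V g g' where g: "open U'" "U' \<subseteq> U" "x0 \<in> U'" "open V" "f x0 \<in> V" "homeomorphism U' V f g"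
   "!!y. y \<in> V ==> (g has_derivative (g' y)) (at y)" "!!y. y \<in> V ==> g' y = inv (blinfun_apply (f'(g y)))"
   "!!y. y \<in> V ==> bij (blinfun_apply (f'(g y)))"
  using inverse_function_theorem[OF mgholD(1)[OF f], of f f' x0 "Blinfun l"] mdd_has_derivative[OF f] f' x0 by metis
 have gV: "g y \<in> U" if "y \<in> V" for y using g(2,6) that by (auto simp: homeomorphism_def)
 have "mghol V g"
 proof (rule mgholI[OF g(4)])
  show "continuous_on V g" using g(6) by (simp add: homeomorphism_def)
  fix x v t assume xt: "x + cscale t v \<in> V"
  let ?y = "x + cscale t v"
  have "has_mderiv (\<lambda>t. x + cscale t v) v t"
   using has_mderiv_add[OF has_mderiv_const[of x t] has_mderiv_cscale[OF DERIV_ident has_mderiv_const[of v t]]] by (simp add: cs.zero_right)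
  from has_derivative_compose[OF this[unfolded has_mderiv_def] g(7)[OF xt]]
  have "((\<lambda>t. g (x + cscale t v)) has_derivative (\<lambda>h. g' ?y (cscale h v))) (at t)" .
  moreover have "g' ?y (cscale h v) = cscale h (g' ?y v)" for h
  proof -
   have b: "bij (mdd f (g ?y))" and e: "g' ?y = inv (mdd f (g ?y))" using g(8,9)[OF xt] f' gV[OF xt] by simp_all
   have "mdd f (g ?y) (cscale h (g' ?y v)) = cscale h v"
    unfolding mdd_cscale[OF f gV[OF xt]] e by (simp add: surj_f_inv_f bij_is_surj[OF b])
   thus ?thesis unfolding e by (metis b bij_is_inj inv_f_f)
  qed
  ultimately show "\<exists>X'. has_mderiv (\<lambda>t. g (x + cscale t v)) X' t" unfolding has_mderiv_def by auto
 qed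
 thus ?thesis using that[OF g(1,3) _ g(5)] g(6) by (auto simp: homeomorphism_def)
qed

text \<open>x = ci - x (y - c) ci, where the second term is absorbed into the left side.\<close>

lemma inverse_norm_bound:
 fixes c y x ci :: "'n::finite cmat"
 assumes c: "c ** ci = mat 1" and x: "x ** y = mat 1" and n: "norm (y - c) * norm ci <= 1/2"
 shows "norm x <= 2 * norm ci"
proof -
 have "x = ci - x ** ((y - c) ** ci)" using c x by (simp add: mm.diff_left mm.diff_right mm_assoc)
 hence "norm x <= norm ci + norm (x ** ((y - c) ** ci))" using norm_triangle_ineq4 by metis
 also have "norm (x ** ((y - c) ** ci)) <= norm x * (1/2)"
  by (rule order_trans[OF norm_matrix_mult_le mult_left_mono[OF order_trans[OF norm_matrix_mult_le n]]]) simp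
 finally show ?thesis by simp
qed

section \<open>The monodromy map in the coordinate b_+\<close>

locale monodromy =
 fixes a :: "'n::{finite,wellorder} cmat" and w :: "'n => 'n"
 assumes irr: "irr a" and w: "bij w" and w_order: "w i < w j \<longleftrightarrow> Im (a $ i $ i) < Im (a $ j $ j)"
begin

text \<open>By \<open>monodromy_K_star\<close> this is b_+ of the monodromy data, since b = - B. The
  order of w is expressed through a = - A0, which reverses the comparison of imaginary
  parts.\<close>

definition F :: "'n cmat => 'n cmat" where "F B = conjP w (clow a (- B))"

definition un :: "'n cmat => 'n cmat" where "un M = perm_mat w ** M ** matrix_inv (perm_mat w)"

lemma un_conjP [simp]: "un (conjP w M) = M" "conjP w (un M) = M"
 using conjP_inverse[OF w, of M] perm_mat_inv[OF w] by (simp_all add: un_def conjP_def) (simp add: mm_assoc[symmetric], simp add: mm_assoc)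

lemma un_mult: "un (M ** N) = un M ** un N" by (metis un_conjP conjP_mult[OF w])
lemma un_dagger: "un (dagger M) = dagger (un M)" by (metis un_conjP conjP_dagger[OF w])
lemma un_one: "un (mat 1) = mat 1" by (metis un_conjP conjP_one[OF w])
lemma bounded_linear_un: "bounded_linear un"
 unfolding un_def by (intro bounded_linear_compose[OF mm.bounded_linear_left] mm.bounded_linear_right)

lemma skew_pointI: "B \<in> lie_k ==> skew_point a (- B)"
 using irr by (simp add: skew_point_def lie_k_def dagger_uminus)

lemma upper_triI: "(!!i j. Im (a $ j $ j) < Im (a $ i $ i) ==> M $ i $ j = 0) ==> upper_tri (conjP w M)"
 unfolding upper_tri_def
proof (intro allI impI)
 fix i j :: 'n assume M: "!!i j. Im (a $ j $ j) < Im (a $ i $ i) ==> M $ i $ j = 0" and ij: "j < i"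
 obtain k l where "i = w k" "j = w l" using bij_is_surj[OF w] by (metis surjD)
 thus "conjP w M $ i $ j = 0" using M[of l k] ij by (simp add: conjP_nth[OF w] w_order)
qed

lemma conjP_diag_nth: "conjP w M $ i $ i = M $ inv w i $ inv w i"
 by (metis conjP_nth[OF w] w bij_inv_eq_iff)

lemma F_K_plus: "B \<in> lie_k ==> F B \<in> K_plus"
proof -
 assume "B \<in> lie_k"
 then interpret skew_point a "- B" by (rule skew_pointI)
 show ?thesis unfolding K_plus_def F_def using clow_triangular[OF irr skew]
  by (auto intro!: upper_triI simp: conjP_diag_nth clow_diag_real)
qed

lemma F_tube: "lie_k \<subseteq> tube" using tube_skew by (auto simp: lie_k_def)

lemma mghol_F: "mghol tube F"
proof -
 have t: "uminus ` tube \<subseteq> (tube :: 'n cmat set)" by (auto simp: tube_def)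
 show ?thesis unfolding F_def[abs_def] conjP_def
  by (intro mghol_mult mghol_const open_tube mghol_precompose[OF mghol_clow(1)[OF irr] _ _ _ t] bounded_linear_minus bounded_linear_ident)
   (simp add: cs.minus_right)
qed

lemma F_inj: "inj_on F lie_k"
proof (rule inj_onI)
 fix B B' assume "B \<in> lie_k" "B' \<in> lie_k" and e: "F B = F B'"
 hence "clow a (- B) = clow a (- B')" unfolding F_def by (metis un_conjP(1))
 hence "- B = - B'" by (rule clow_injective[OF irr, rotated 2]) (use \<open>B \<in> lie_k\<close> \<open>B' \<in> lie_k\<close> in \<open>simp_all add: lie_k_def dagger_uminus\<close>)
 thus "B = B'" by simp
qed

lemma F_open: "openin (top_of_set lie_k) S ==> openin (top_of_set K_plus) (F ` S)"
proof -
 assume S: "openin (top_of_set lie_k) S"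
 hence sub: "S \<subseteq> lie_k" by (rule openin_imp_subset)
 have "openin (top_of_set lie_K_star) (F ` S)"
 proof (rule invariance_of_domain_subspaces[OF S subspace_lie_k subspace_lie_K_star dim_lie_K_star])
  show "continuous_on S F" by (rule continuous_on_subset[OF mgholD(2)[OF mghol_F] order_trans[OF sub F_tube]])
  show "F \<in> S \<rightarrow> lie_K_star" by (intro Pi_I subsetD[OF K_plus_subset] F_K_plus subsetD[OF sub])
  show "inj_on F S" by (rule inj_on_subset[OF F_inj sub])
 qed
 thus ?thesis by (rule openin_subset_trans[OF _ _ K_plus_subset]) (use sub F_K_plus in auto)
qed

text \<open>Along a sequence of values converging in \<open>K_plus\<close> the matrices
  \<open>clow\<close> are bounded, and since the limit is invertible, so are their inverse adjoints
  \<open>cup\<close>. \<open>residue_bound\<close> then confines the residues to a compact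
  set.\<close>

lemma F_closed: "closedin (top_of_set K_plus) (F ` lie_k)"
 unfolding closedin_limpt
proof (intro conjI allI impI; (elim conjE)?)
 show "F ` lie_k \<subseteq> K_plus" using F_K_plus by auto
 fix p assume lim: "p islimpt F ` lie_k" and p: "p \<in> K_plus"
 obtain q where q: "p ** q = mat 1" using K_plus_inverse[OF p] by metis
 obtain P where P: "!!n::nat. P n \<in> F ` lie_k" "P \<longlonglongrightarrow> p" using lim unfolding islimpt_sequential by blast
 have "\<forall>n. \<exists>B. B \<in> lie_k & P n = F B" using P(1) by auto
 from choice[OF this] obtain B where B: "!!n. B n \<in> lie_k" "!!n. P n = F (B n)" by blast
 define c where "c n = clow a (- B n)" for n
 have c: "c \<longlonglongrightarrow> un p"
  using bounded_linear.tendsto[OF bounded_linear_un P(2)] by (simp add: c_def[abs_def] B(2) F_def)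
 have uq: "un p ** un q = mat 1" using q by (simp add: un_one flip: un_mult)
 obtain K where K: "0 <= K" "!!b. dagger b = - b ==> (norm b)^2 <= K * ((norm (clow a b))^2 + (norm (cup a b))^2)"
  using residue_bound[OF irr] by blast
 define M where "M = K * ((norm (un p) + 1)^2 + (2 * norm (un q))^2)"
 \<comment> \<open>The radius around the limit within which the norm of the inverse at most
   doubles.\<close>
 define e where "e = min 1 (1 / (2 * (norm (un q) + 1)))"
 have e: "0 < e" by (simp add: e_def add_nonneg_pos)
 have "\<forall>\<^sub>F n in sequentially. dist (c n) (un p) < e" by (rule tendstoD[OF c e])
 then obtain N where N: "!!n. N <= n ==> norm (c n - un p) < e" unfolding eventually_sequentially dist_norm by blast
 have bd: "(norm (B n))^2 <= M" if n: "N <= n" for n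
 proof -
  interpret s: skew_point a "- B n" by (rule skew_pointI[OF B(1)])
  have 1: "norm (c n) <= norm (un p) + 1" using norm_triangle_sub[of "c n" "un p"] N[OF n] by (simp add: e_def)
  have "norm (c n - un p) * norm (un q) <= (1 / (2 * (norm (un q) + 1))) * (norm (un q) + 1)"
   using N[OF n] by (intro mult_mono) (auto simp: e_def)
  also have "... = 1/2" using add_nonneg_pos[OF norm_ge_zero[of "un q"] zero_less_one] by (simp add: divide_simps)
  finally have "norm (dagger (cup a (- B n))) <= 2 * norm (un q)" by (rule inverse_norm_bound[OF uq, rotated]) (simp add: c_def)
  hence "M \<ge> K * ((norm (c n))^2 + (norm (cup a (- B n)))^2)"
   unfolding M_def using 1 K(1) by (intro mult_left_mono add_mono power_mono) auto
  thus ?thesis using K(2)[OF s.skew] by (simp add: c_def)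
 qed
 define S where "S = lie_k \<inter> cball (0 :: 'n cmat) (sqrt M)"
 have "compact S" unfolding S_def using closed_subspace[OF subspace_lie_k] by (intro closed_Int_compact) auto
 moreover have "\<forall>n. B (n + N) \<in> S" using bd B(1) by (auto simp: S_def intro!: real_le_rsqrt)
 ultimately obtain B0 r where r: "B0 \<in> S" "strict_mono r" "((\<lambda>n. B (n + N)) \<circ> r) \<longlonglongrightarrow> B0" unfolding compact_def by metis
 have "isCont F B0" using mgholD(2)[OF mghol_F] open_tube F_tube r(1) continuous_on_eq_continuous_at[OF open_tube] by (auto simp: S_def)
 hence "(\<lambda>n. F (B (r n + N))) \<longlonglongrightarrow> F B0" using isCont_tendsto_compose r(3) by (force simp: o_def)
 moreover have "(\<lambda>n. P (r n + N)) \<longlonglongrightarrow> p"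
  using LIMSEQ_subseq_LIMSEQ[OF LIMSEQ_ignore_initial_segment[OF P(2), of N] r(2)] by (simp add: o_def)
 ultimately have "p = F B0" unfolding B(2) using LIMSEQ_unique by blast
 thus "p \<in> F ` lie_k" using r(1) by (auto simp: S_def)
qed

lemma F_image: "F ` lie_k = K_plus"
proof -
 have "connected (K_plus :: 'n cmat set)" by (rule convex_connected[OF K_plus_convex])
 moreover have "openin (top_of_set K_plus) (F ` lie_k)" by (rule F_open) simp
 moreover have "F ` lie_k ~= {}" using subspace_0[OF subspace_lie_k] by auto
 ultimately show ?thesis using F_closed unfolding connected_clopen by blast
qed

lemma F_bij: "bij_betw F lie_k K_plus" using F_inj F_image by (simp add: bij_betw_def)

abbreviation "G \<equiv> inv_into lie_k F"

lemma G_F: "B \<in> lie_k ==> G (F B) = B" by (rule inv_into_f_f[OF F_inj])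
lemma F_G: "p \<in> K_plus ==> F (G p) = p" "p \<in> K_plus ==> G p \<in> lie_k"
 using F_image by (auto simp: f_inv_into_f inv_into_into)

lemma G_continuous: "continuous_on K_plus G"
 by (rule continuous_on_inverse_open_map[OF _ F_image G_F F_open]) (rule continuous_on_subset[OF mgholD(2)[OF mghol_F] F_tube])

lemma F_smooth: "smooth_on lie_k lie_k F"
 unfolding smooth_on_def
proof (intro allI Ck_on_entries)
 fix k i j
 show "Ck_on k lie_k lie_k (\<lambda>B. F B $ i $ j)"
 proof (rule cstr.ghol_Ck[OF bounded_linear_ident])
  show "\<exists>\<delta>>0. \<forall>s. \<bar>s\<bar> < \<delta> --> x + s *\<^sub>R v \<in> lie_k" if "x \<in> lie_k" "v \<in> lie_k" for x v :: "'n cmat"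
   using that subspace_lie_k by (intro exI[of _ 1]) (auto simp: subspace_def)
  show "\<exists>W h. ghol cscale W h & x \<in> W & (\<forall>y\<in>lie_k. y \<in> W --> F y $ i $ j = h y)" if "x \<in> lie_k" for x
   using mghol_entry[OF mghol_F, of i j] that F_tube by blast
 qed
qed

lemma Mt_F: "B \<in> lie_k ==> Mt a (- B) = un (dagger (F B) ** F B)"
 using Mt_skew[OF irr, of "- B"] by (simp add: F_def un_mult un_dagger lie_k_def dagger_uminus)

text \<open>A matrix $p \in K^*$ enters holomorphic functions through the pair $(p, p^\dagger)$, in which both entries vary independently.\<close>

definition pscale :: "complex => 'n cmat \<times> 'n cmat => 'n cmat \<times> 'n cmat" where
 "pscale t x = (cscale t (fst x), cscale t (snd x))"

lemma complex_structure_pscale: "complex_structure pscale"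
proof (rule complex_structure.intro)
 show "bounded_bilinear pscale"
 proof (rule bounded_bilinear.intro)
  show "\<exists>K. \<forall>t x. norm (pscale t x) <= norm t * norm x * K"
  proof (intro exI allI)
   fix t x
   have "norm (pscale t x) <= norm (cscale t (fst x)) + norm (cscale t (snd x))" unfolding pscale_def by (rule norm_Pair_le)
   also have "... = cmod t * (norm (fst x) + norm (snd x))" by (simp add: norm_cscale distrib_left)
   also have "... <= cmod t * (norm x * 2)" using norm_fst_le[of "fst x" "snd x"] norm_snd_le[of "snd x" "fst x"] by (intro mult_left_mono) auto
   finally show "norm (pscale t x) <= norm t * norm x * 2" by simp
  qed
 qed (auto simp: pscale_def cs.add_left cs.add_right cs.scaleR_left cs.scaleR_right)
qed (simp add: pscale_def cscale_of_real scaleR_prod_def)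

text \<open>Near x, and up to the permutation, G y = - g(y^\<dagger> y) for a holomorphic local
  inverse g of \<open>Mt\<close>. As a function of the independent pair (y, y^\<dagger>) this is
  holomorphic, so \<open>ghol_Ck\<close> applies.\<close>

lemma G_smooth: "smooth_on lie_K_star K_plus G"
 unfolding smooth_on_def
proof (intro allI Ck_on_entries)
 fix k i j
 interpret ps: complex_structure pscale by (rule complex_structure_pscale)
 show "Ck_on k lie_K_star K_plus (\<lambda>p. G p $ i $ j)"
 proof (rule ps.ghol_Ck[where \<iota>="\<lambda>p. (p, dagger p)"])
  show "bounded_linear (\<lambda>p :: 'n cmat. (p, dagger p))" by (intro bounded_linear_Pair bounded_linear_ident bounded_linear_dagger)
  show "\<exists>\<delta>>0. \<forall>s. \<bar>s\<bar> < \<delta> --> x + s *\<^sub>R v \<in> K_plus" if "x \<in> K_plus" "v \<in> lie_K_star" for x v :: "'n cmat"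
   by (rule K_plus_line[OF that])
  fix x :: "'n cmat" assume x: "x \<in> K_plus"
  interpret s: skew_point a "- G x" by (rule skew_pointI[OF F_G(2)[OF x]])
  obtain U' V g where g: "open U'" "- G x \<in> U'" "Mt a ` U' = V" "Mt a (- G x) \<in> V" "mghol V g" "!!b. b \<in> U' ==> g (Mt a b) = b"
   by (rule mghol_local_inverse[OF mghol_Mt[OF irr] s.b_tube]) (erule s.mdd_Mt_injective, rule that, assumption+)
  \<comment> \<open>Continuity of the inverse selects the branch: for y near x the residue - G y
    stays in U', where g inverts \<open>Mt\<close>.\<close>
  have "continuous_on K_plus (\<lambda>p. - G p)" by (intro continuous_intros G_continuous)
  then obtain N where N: "open N" "x \<in> N" "!!y. y \<in> K_plus ==> y \<in> N ==> - G y \<in> U'"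
   using g(1,2) x unfolding continuous_on_topological by metis
  define m where "m q = un (snd q ** fst q)" for q :: "'n cmat \<times> 'n cmat"
  define W where "W = (fst -` N) \<inter> (m -` V)"
  have mc: "continuous_on A m" for A unfolding m_def
   by (intro bounded_linear.continuous_on[OF bounded_linear_un] mm.continuous_on continuous_intros)
  have W: "open W" unfolding W_def by (intro open_Int open_vimage N(1) mgholD(1)[OF g(5)] mc continuous_intros)
  have mM: "m (y, dagger y) = Mt a (- G y)" if "y \<in> K_plus" for y using Mt_F[OF F_G(2)[OF that]] that by (simp add: m_def F_G(1))
  have "ghol pscale W (\<lambda>q. - g (m q) $ i $ j)" unfolding ghol_def
  proof (intro conjI allI W)
   show "continuous_on W (\<lambda>q. - g (m q) $ i $ j)"
    by (intro continuous_intros continuous_on_compose2[OF mgholD(2)[OF g(5)] mc]) (auto simp: W_def)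
   fix q v
   show "(\<lambda>t. - g (m (q + pscale t v)) $ i $ j) holomorphic_on {t. q + pscale t v \<in> W}"
   proof (rule holomorphic_on_minus, unfold holomorphic_on_open[OF ps.line_open[OF W]], intro ballI)
    fix t assume t: "t \<in> {t. q + pscale t v \<in> W}"
    have l: "has_mderiv (\<lambda>t. A + cscale t A') A' t" for A A' :: "'n cmat"
     using has_mderiv_add[OF has_mderiv_const[of A t] has_mderiv_cscale[OF DERIV_ident has_mderiv_const[of A' t]]] by (simp add: cs.zero_right)
    have me: "m (q + pscale t v) = perm_mat w ** ((snd q + cscale t (snd v)) ** (fst q + cscale t (fst v))) ** matrix_inv (perm_mat w)" for t
     by (simp add: m_def un_def pscale_def)
    note md = has_mderiv_mult[OF has_mderiv_mult[OF has_mderiv_const[of "perm_mat w"] has_mderiv_mult[OF l[of "snd q" "snd v"] l[of "fst q" "fst v"]]] has_mderiv_const[of "matrix_inv (perm_mat w)"], folded me]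
    from mderiv_compose[OF g(5) md] t
    show "\<exists>f'. ((\<lambda>t. g (m (q + pscale t v)) $ i $ j) has_field_derivative f') (at t)"
     by (auto simp: W_def has_mderiv_iff)
   qed
  qed
  moreover have "(x, dagger x) \<in> W" using N(2) g(4) mM[OF x] by (simp add: W_def)
  moreover have "G y $ i $ j = - g (m (y, dagger y)) $ i $ j" if "y \<in> K_plus" "(y, dagger y) \<in> W" for y
   using N(3)[of y] that g(6)[of "- G y"] by (simp add: mM W_def)
  ultimately show "\<exists>W h. ghol pscale W h & (x, dagger x) \<in> W & (\<forall>y\<in>K_plus. (y, dagger y) \<in> W --> G y $ i $ j = h (y, dagger y))"
   by (intro exI[of _ W] exI[of _ "\<lambda>q. - g (m q) $ i $ j"]) blast
 qed
qed

end

subsection \<open>The Poisson structures\<close>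

lemma hermitian_upper_part:
 fixes H :: "'n::{finite,wellorder} cmat"
 assumes H: "dagger H = H"
 shows "\<exists>!W. W \<in> lie_K_star & W + dagger W = H"
proof (rule ex1I)
 have h: "cnj (H $ j $ i) = H $ i $ j" for i j using arg_cong[OF H, of "\<lambda>M. M $ i $ j"] by simp
 define W :: "'n cmat" where "W = (\<chi> i j. if i < j then H $ i $ j else if i = j then of_real (Re (H $ i $ i) / 2) else 0)"
 have "W + dagger W = H"
 proof (rule cmat_eqI)
  fix i j show "(W + dagger W) $ i $ j = H $ i $ j"
   using h[of i j] h[of i i] by (cases i j rule: linorder_cases) (auto simp: W_def complex_eq_iff)
 qed
 thus "W \<in> lie_K_star & W + dagger W = H" by (auto simp: W_def lie_K_star_def upper_tri_def)
 fix V assume V: "V \<in> lie_K_star & V + dagger V = H"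
 show "V = W"
 proof (rule cmat_eqI)
  fix i j
  have "V $ i $ j + cnj (V $ j $ i) = H $ i $ j" using V by auto
  thus "V $ i $ j = W $ i $ j" using V
   by (cases i j rule: linorder_cases) (auto simp: W_def lie_K_star_def upper_tri_def complex_is_Real_iff complex_eq_iff)
 qed
qed

lemma lie_K_star_mult: "A \<in> lie_K_star ==> M \<in> lie_K_star ==> A ** M \<in> lie_K_star"
proof -
 assume AM: "A \<in> lie_K_star" "M \<in> lie_K_star"
 have z: "A $ i $ k * M $ k $ j = 0" if "k < i \<or> j < k" for i j k using AM that by (auto simp: lie_K_star_def upper_tri_def)
 have "(A ** M) $ i $ j = 0" if "j < i" for i j
  unfolding mm_nth by (rule sum.neutral) (use that z in \<open>metis le_less_trans not_le_imp_less\<close>)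
 moreover have "(A ** M) $ i $ i = A $ i $ i * M $ i $ i" for i
 proof -
  have "(A ** M) $ i $ i = (\<Sum>k\<in>UNIV. if k = i then A $ i $ i * M $ i $ i else 0)"
   unfolding mm_nth using z by (intro sum.cong refl) (metis neq_iff)
  thus ?thesis by simp
 qed
 ultimately show ?thesis using AM by (auto simp: lie_K_star_def upper_tri_def)
qed

lemma K_plus_inverse_lie:
 assumes "P \<in> K_plus"
 obtains Q where "P ** Q = mat 1" "Q ** P = mat 1" "Q \<in> lie_K_star"
proof -
 obtain Q where Q: "P ** Q = mat 1" "Q ** P = mat 1" "upper_tri Q" "!!i. Q $ i $ i * P $ i $ i = 1"
  using K_plus_inverse[OF assms] by blast
 have "Q $ i $ i \<in> \<real>" for i
 proof -
  have "Q $ i $ i = inverse (P $ i $ i)" using inverse_unique[of "P $ i $ i" "Q $ i $ i"] Q(4)[of i] by (simp add: mult.commute)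
  thus ?thesis using assms by (simp add: K_plus_def)
 qed
 thus ?thesis using that[of Q] Q by (simp add: lie_K_star_def)
qed

text \<open>For W = P Z P^(-1) the defining equation becomes W + W^\<dagger> = H with H Hermitian,
  and conjugation by P preserves \<open>lie_K_star\<close>; so \<open>hermitian_upper_part\<close>
  gives existence and uniqueness.\<close>

lemma dressing_field_eq:
 fixes P :: "'n::{finite,wellorder} cmat"
 assumes P: "P \<in> K_plus" and Q: "P ** Q = mat 1" "Q ** P = mat 1" and X: "X \<in> lie_k"
 shows "\<exists>Z\<in>lie_K_star. dressing_field X P = P ** Z &
   P ** Z ** Q + dagger Q ** dagger Z ** dagger P = P ** X ** Q - dagger Q ** X ** dagger P"
proof -
 have d: "dagger P ** dagger Q = mat 1" "dagger Q ** dagger P = mat 1" using Q by (simp_all add: dagger_one flip: dagger_mult)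
 have inv: "matrix_inv P = Q" "matrix_inv (dagger P) = dagger Q" by (rule inverse_eq_matrix_inv; fact)+
 define H where "H = P ** X ** Q - dagger Q ** X ** dagger P"
 have "dagger X = - X" using X by (simp add: lie_k_def)
 hence "dagger H = H" by (simp add: H_def dagger_minus dagger_mult dagger_dagger mm.minus_left mm.minus_right mm_assoc)
 then obtain W where W: "W \<in> lie_K_star" "W + dagger W = H" and W1: "!!V. V \<in> lie_K_star ==> V + dagger V = H ==> V = W"
  using hermitian_upper_part[of H] by blast
 obtain Q' where Q': "P ** Q' = mat 1" "Q' \<in> lie_K_star" using K_plus_inverse_lie[OF P] by metis
 have Qm: "Q \<in> lie_K_star" using mm_left_inverse_unique[OF Q'(1) Q(2)] Q'(2) by simp
 have Pm: "P \<in> lie_K_star" using P K_plus_subset by blast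
 have c: "P ** (Q ** M) = M" "Q ** (P ** M) = M" "dagger Q ** (dagger P ** M) = M" for M :: "'n cmat" by (simp_all add: mm_assoc Q d)
 have eq: "P ** Z ** Q + dagger Q ** dagger Z ** dagger P = H \<longleftrightarrow> (P ** Z ** Q) + dagger (P ** Z ** Q) = H" for Z
  by (simp add: dagger_mult mm_assoc)
 have "(THE Z. Z \<in> lie_K_star & P ** Z ** Q + dagger Q ** dagger Z ** dagger P = H) = Q ** W ** P" unfolding eq
 proof (rule the_equality)
  show "Q ** W ** P \<in> lie_K_star & P ** (Q ** W ** P) ** Q + dagger (P ** (Q ** W ** P) ** Q) = H"
   using W lie_K_star_mult[OF lie_K_star_mult[OF Qm W(1)] Pm] by (simp add: c Q flip: mm_assoc)
  fix Z assume Z: "Z \<in> lie_K_star & P ** Z ** Q + dagger (P ** Z ** Q) = H"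
  hence "P ** Z ** Q = W" using W1 lie_K_star_mult[OF lie_K_star_mult[OF Pm] Qm] by blast
  thus "Z = Q ** W ** P" by (auto simp: c Q simp flip: mm_assoc)
 qed
 hence "dressing_field X P = P ** (Q ** W ** P)" unfolding dressing_field_def inv H_def by simp
 moreover have "P ** (Q ** W ** P) ** Q + dagger Q ** dagger (Q ** W ** P) ** dagger P = H"
  unfolding eq using W by (simp add: c Q flip: mm_assoc)
 ultimately show ?thesis using lie_K_star_mult[OF lie_K_star_mult[OF Qm W(1)] Pm] unfolding H_def by blast
qed

lemma trace_riesz:
 fixes l :: "'n::finite cmat => real"
 assumes l: "linear l" shows "\<exists>N. \<forall>Z. l Z = Re (trace (Z ** N))"
proof -
 define x where "x = (\<Sum>e\<in>Basis. l e *\<^sub>R e)"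
 have "l Z = Re (trace (Z ** dagger x))" for Z
 proof -
  have "l Z = l (\<Sum>e\<in>Basis. (Z \<bullet> e) *\<^sub>R e)" by (simp add: euclidean_representation)
  also have "... = Z \<bullet> x" by (simp add: x_def linear_sum[OF l] linear_scale[OF l] inner_sum_right mult.commute)
  also have "... = Re (trace (Z ** dagger x))" by (simp add: inner_vec_def trace_def mm_nth inner_complex_def)
  finally show ?thesis .
 qed
 thus ?thesis by blast
qed

text \<open>The functional is Re Tr(Z N) for some N. Since Z is upper triangular with real diagonal,
  only the lower triangle of N and the real part of its diagonal matter; X carries i times these and
  is completed to a skew-Hermitian matrix.\<close>

lemma pairing_exists:
 fixes l :: "'n::{finite,wellorder} cmat => real"
 assumes l: "linear l"
 shows "\<exists>X\<in>lie_k. \<forall>Z\<in>lie_K_star. Im (trace (Z ** X)) = l Z"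
proof -
 obtain N where N: "!!Z. l Z = Re (trace (Z ** N))" using trace_riesz[OF l] by blast
 define X :: "'n cmat" where "X = (\<chi> i j. if j < i then \<i> * N $ i $ j else if i < j then - cnj (\<i> * N $ j $ i) else \<i> * of_real (Re (N $ i $ i)))"
 have "X \<in> lie_k" unfolding lie_k_def mem_Collect_eq by (rule cmat_eqI) (auto simp: X_def)
 moreover have "Im (trace (Z ** X)) = l Z" if Z: "Z \<in> lie_K_star" for Z
 proof -
  have "Im (Z $ i $ j * X $ j $ i) = Re (Z $ i $ j * N $ j $ i)" for i j
   using Z by (cases i j rule: linorder_cases) (auto simp: X_def lie_K_star_def upper_tri_def complex_is_Real_iff)
  thus ?thesis by (simp add: N trace_def mm_nth Im_sum Re_sum del: times_complex.sel)
 qed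
 ultimately show ?thesis by blast
qed

text \<open>The test matrix Z turns the pairing into a sum of squares of the lower triangular and
  diagonal entries of X.\<close>

lemma pairing_unique:
 fixes X :: "'n::{finite,wellorder} cmat"
 assumes X: "X \<in> lie_k" and z: "!!Z. Z \<in> lie_K_star ==> Im (trace (Z ** X)) = 0"
 shows "X = 0"
proof -
 have x: "cnj (X $ j $ i) = - (X $ i $ j)" for i j
 proof -
  have "dagger X = - X" using X by (simp add: lie_k_def)
  from arg_cong[OF this, of "\<lambda>M. M $ i $ j"] show ?thesis by simp
 qed
 define Z :: "'n cmat" where "Z = (\<chi> i j. if i < j then \<i> * cnj (X $ j $ i) else if i = j then of_real (Im (X $ i $ i)) else 0)"
 have "Z \<in> lie_K_star" by (auto simp: Z_def lie_K_star_def upper_tri_def)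
 define s where "s i j = (if i < j then (cmod (X $ j $ i))^2 else if i = j then (Im (X $ i $ i))^2 else 0)" for i j
 have "Im (Z $ i $ j * X $ j $ i) = s i j" for i j unfolding s_def cmod_power2 by (auto simp: Z_def power2_eq_square)
 hence "(\<Sum>i\<in>UNIV. \<Sum>j\<in>UNIV. s i j) = 0"
  using z[OF \<open>Z \<in> lie_K_star\<close>] by (simp add: trace_def mm_nth Im_sum del: times_complex.sel)
 moreover have s0: "0 <= s i j" for i j by (simp add: s_def)
 ultimately have s: "s i j = 0" for i j
  using sum_nonneg_eq_0_iff[of UNIV "\<lambda>i. \<Sum>j\<in>UNIV. s i j"] sum_nonneg_eq_0_iff[of UNIV "s i"] by (simp add: sum_nonneg)
 show ?thesis
 proof (rule cmat_eqI)
  fix i j show "X $ i $ j = (0 :: 'n cmat) $ i $ j" using s[of i j] s[of j i] x[of i j] x[of i i]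
   by (cases i j rule: linorder_cases) (auto simp: s_def complex_eq_iff)
 qed
qed

lemma covector_to_k_eq:
 fixes P :: "'n::{finite,wellorder} cmat"
 assumes \<alpha>: "linear \<alpha>"
 shows "covector_to_k P \<alpha> \<in> lie_k" "Z \<in> lie_K_star ==> Im (trace (Z ** covector_to_k P \<alpha>)) = \<alpha> (P ** Z)"
proof -
 have "linear (\<lambda>Z. \<alpha> (P ** Z))" using linear_compose[OF bounded_linear.linear[OF mm.bounded_linear_right[of P]] \<alpha>] by (simp add: o_def)
 then obtain X where X: "X \<in> lie_k" "!!Z. Z \<in> lie_K_star ==> Im (trace (Z ** X)) = \<alpha> (P ** Z)"
  using pairing_exists by blast
 have "covector_to_k P \<alpha> = X" unfolding covector_to_k_def
 proof (rule the_equality)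
  fix Y assume Y: "Y \<in> lie_k & (\<forall>Z\<in>lie_K_star. Im (trace (Z ** Y)) = \<alpha> (P ** Z))"
  have "Y - X = 0"
   by (rule pairing_unique) (use X Y in \<open>auto simp: mm.diff_right trace_sub subspace_diff[OF subspace_lie_k]\<close>)
  thus "Y = X" by simp
 qed (use X in auto)
 thus "covector_to_k P \<alpha> \<in> lie_k" "Z \<in> lie_K_star ==> Im (trace (Z ** covector_to_k P \<alpha>)) = \<alpha> (P ** Z)" using X by auto
qed

lemma k_covector_eq:
 assumes R: "R \<in> lie_k" "!!C. C \<in> lie_k ==> of_real (\<alpha> C) = trace (C ** R)"
 shows "k_covector \<alpha> = R" unfolding k_covector_def
proof (rule the_equality)
 fix Y assume Y: "Y \<in> lie_k & (\<forall>C\<in>lie_k. of_real (\<alpha> C) = trace (C ** Y))"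
 have "Y - R = 0"
 proof (rule trace_skew_zero)
  fix C :: "'a cmat" assume "dagger C = - C"
  hence "C \<in> lie_k" by (simp add: lie_k_def)
  hence "trace (C ** Y) = of_real (\<alpha> C)" "trace (C ** R) = of_real (\<alpha> C)" using Y R(2) by simp_all
  thus "trace (C ** (Y - R)) = 0" by (simp add: mm.diff_right trace_sub)
 qed
 thus "Y = R" by simp
qed (use R in auto)

context monodromy
begin

lemma mdd_F: "B \<in> lie_k ==> mdd F B C = conjP w (mdd (clow a) (- B) (- C))"
proof -
 assume "B \<in> lie_k"
 then interpret s: skew_point a "- B" by (rule skew_pointI)
 have "has_mderiv (\<lambda>t. conjP w (clow a (- B + cscale t (- C)))) (conjP w (mdd (clow a) (- B) (- C))) 0"
  using has_derivative_compose[OF s.clow_mdd[of "- C", unfolded has_mderiv_def] bounded_linear_imp_has_derivative[OF bounded_linear_conjP[of w]]]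
  by (simp add: has_mderiv_def conjP_cscale[OF w])
 moreover have "conjP w (clow a (- B + cscale t (- C))) = F (B + cscale t C)" for t by (simp add: F_def cs.minus_right)
 ultimately show ?thesis using has_mderiv_unique[OF mdd_has_mderiv[OF mghol_F, of B C]] F_tube \<open>B \<in> lie_k\<close> by auto
qed

lemma lie_k_line: "B \<in> lie_k ==> C \<in> lie_k ==> \<exists>\<delta>>0. \<forall>s. \<bar>s\<bar> < \<delta> --> B + s *\<^sub>R C \<in> lie_k"
 using subspace_lie_k by (intro exI[of _ 1]) (auto simp: subspace_def)

lemma F_derivative: "B \<in> lie_k ==> (F has_derivative mdd F B) (at B within S)"
 using mdd_has_derivative[OF mghol_F] F_tube has_derivative_at_withinI by blast

lemma mdd_F_lie_K_star:
 assumes B: "B \<in> lie_k" and C: "C \<in> lie_k" shows "mdd F B C \<in> lie_K_star"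
proof -
 have v: "((\<lambda>s. F (B + s *\<^sub>R C)) has_vector_derivative mdd F B C) (at 0)"
  by (rule line_derivative[OF F_derivative[OF B] lie_k_line[OF B C]])
 have k: "F (B + s *\<^sub>R C) \<in> K_plus" for s using B C subspace_lie_k by (intro F_K_plus) (auto simp: subspace_def)
 have z: "l (mdd F B C) = 0" if "bounded_linear l" "!!M. M \<in> K_plus ==> l M = 0" for l :: "'n cmat => 'b::real_normed_vector"
 proof -
  have "((\<lambda>s. l (F (B + s *\<^sub>R C))) has_vector_derivative l (mdd F B C)) (at 0)"
   by (rule bounded_linear.has_vector_derivative[OF that(1) v])
  hence "((\<lambda>s. 0) has_vector_derivative l (mdd F B C)) (at 0)" unfolding that(2)[OF k] .
  from vector_derivative_unique_at[OF this has_vector_derivative_const] show ?thesis .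
 qed
 have "mdd F B C $ i $ j = 0" if "j < i" for i j
  by (rule z[OF bounded_linear_entry]) (use that in \<open>auto simp: K_plus_def upper_tri_def\<close>)
 moreover have "Im (mdd F B C $ i $ i) = 0" for i
  by (rule z[OF bounded_linear_compose[OF bounded_linear_Im bounded_linear_entry]]) (auto simp: K_plus_def complex_is_Real_iff)
 ultimately show ?thesis by (simp add: lie_K_star_def upper_tri_def complex_is_Real_iff)
qed

text \<open>The derivative is injective on \<open>lie_k\<close> by
  \<open>mdd_clow_injective\<close>, and its image lies in \<open>lie_K_star\<close>, whose
  dimension is not larger.\<close>

lemma mdd_F_surj:
 assumes B: "B \<in> lie_k" and V: "V \<in> lie_K_star" shows "\<exists>C\<in>lie_k. mdd F B C = V"
proof -
 interpret s: skew_point a "- B" by (rule skew_pointI[OF B])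
 have lin: "linear (mdd F B)" using bounded_linear.linear[OF mdd_linear[OF mghol_F]] F_tube B by blast
 have "inj_on (mdd F B) lie_k" unfolding linear_injective_on_subspace_0[OF lin subspace_lie_k]
 proof (intro ballI impI)
  fix C :: "'n cmat" assume C: "C \<in> lie_k" "mdd F B C = 0"
  have "mdd (clow a) (- B) (- C) = un (mdd F B C)" by (simp add: mdd_F[OF B])
  hence "mdd (clow a) (- B) (- C) = 0" by (simp add: C(2) linear_0[OF bounded_linear.linear[OF bounded_linear_un]])
  hence "- C = 0" by (rule s.mdd_clow_injective[rotated]) (use C in \<open>simp add: lie_k_def dagger_uminus\<close>)
  thus "C = 0" by simp
 qed
 hence "dim (mdd F B ` lie_k) = dim (lie_k :: 'n cmat set)"
  by (intro dim_image_eq lin) (simp add: span_eq_iff[THEN iffD2, OF subspace_lie_k])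
 hence "lie_K_star = mdd F B ` lie_k" using dim_lie_K_star mdd_F_lie_K_star[OF B]
  by (intro subspace_dim_equal[symmetric] linear_subspace_image lin subspace_lie_k subspace_lie_K_star) auto
 hence "V \<in> mdd F B ` lie_k" using V by simp
 thus ?thesis by (metis imageE)
qed

text \<open>\<open>frechet_derivative\<close> within a subset is a choice outside the tangent space,
  so the chain rule for the chosen derivatives is asserted in tangent directions only.\<close>

lemma pullback_derivative:
 assumes f: "smooth_on lie_K_star K_plus f" and B: "B \<in> lie_k"
 shows "linear (frechet_derivative f (at (F B) within K_plus))"
  and "C \<in> lie_k ==> frechet_derivative (f \<circ> F) (at B within lie_k) C = frechet_derivative f (at (F B) within K_plus) (mdd F B C)"
proof -
 let ?D = "frechet_derivative f (at (F B) within K_plus)" and ?E = "frechet_derivative (f \<circ> F) (at B within lie_k)"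
 have "Ck_on (Suc 0) lie_K_star K_plus f" using f unfolding smooth_on_def by blast
 hence D: "(f has_derivative ?D) (at (F B) within K_plus)"
  unfolding Ck_on.simps using F_K_plus[OF B] by (auto simp: frechet_derivative_works[symmetric] differentiable_def)
 show "linear ?D" by (rule has_derivative_linear[OF D])
 have 1: "(f \<circ> F has_derivative ?D \<circ> mdd F B) (at B within lie_k)"
  by (rule diff_chain_within[OF F_derivative[OF B]]) (use D in \<open>simp add: F_image\<close>)
 hence 2: "(f \<circ> F has_derivative ?E) (at B within lie_k)" unfolding frechet_derivative_works[symmetric] by (rule differentiableI)
 show "?E C = ?D (mdd F B C)" if C: "C \<in> lie_k"
  using vector_derivative_unique_at[OF line_derivative[OF 2 lie_k_line[OF B C]] line_derivative[OF 1 lie_k_line[OF B C]]] by simp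
qed

text \<open>C is the tangent vector that F sends to the dressing vector of \<alpha>. By
  \<open>dressing_variation\<close> with \<beta> = - C, the covector of the pulled back function is
  R = - pi G0, and pi C = [B, R]. So F carries the Hamiltonian vector [B, R] to pi times the
  dressing vector.\<close>

lemma hamiltonian_lift:
 assumes B: "B \<in> lie_k" and P: "P = F B" and \<alpha>: "linear \<alpha>" and E: "!!C. C \<in> lie_k ==> E C = \<alpha> (mdd F B C)"
 shows "\<exists>C\<in>lie_k. \<exists>R. k_covector E = R & (\<forall>\<gamma>\<in>lie_k. of_real (E \<gamma>) = trace (\<gamma> ** R)) &
  mdd F B C = dressing_field (covector_to_k P \<alpha>) P & pi *\<^sub>R C = B ** R - R ** B"
proof -
 interpret s: skew_point a "- B" by (rule skew_pointI[OF B])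
 define Q where "Q = conjP w (dagger s.d)"
 have Pk: "P \<in> K_plus" unfolding P by (rule F_K_plus[OF B])
 have PQ: "P ** Q = mat 1" "Q ** P = mat 1" by (simp_all add: P Q_def F_def conjP_one[OF w] flip: conjP_mult[OF w])
 define X where "X = covector_to_k P \<alpha>"
 have X: "X \<in> lie_k" "!!Z. Z \<in> lie_K_star ==> Im (trace (Z ** X)) = \<alpha> (P ** Z)"
  unfolding X_def using covector_to_k_eq[OF \<alpha>] by auto
 obtain Z where Z: "Z \<in> lie_K_star" "dressing_field X P = P ** Z"
  "P ** Z ** Q + dagger Q ** dagger Z ** dagger P = P ** X ** Q - dagger Q ** X ** dagger P"
  using dressing_field_eq[OF Pk PQ X(1)] by blast
 have PZ: "P ** Z \<in> lie_K_star" using lie_K_star_mult Z(1) Pk K_plus_subset by blast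
 obtain C where C: "C \<in> lie_k" "mdd F B C = P ** Z" using mdd_F_surj[OF B PZ] by blast
 have skew: "dagger (- C) = - (- C)" if "C \<in> lie_k" for C :: "'n cmat" using that by (simp add: lie_k_def dagger_uminus)
 define c' where "c' = mdd (clow a) (- B) (- C)"
 have uP: "un P = s.c" "un Q = dagger s.d" by (simp_all add: P Q_def F_def)
 have uZ: "c' = s.c ** un Z" using arg_cong[OF C(2), of un] by (simp add: mdd_F[OF B] c'_def un_mult uP)
 have dress: "c' ** dagger s.d + s.d ** dagger c' = s.c ** un X ** dagger s.d - s.d ** un X ** dagger s.c"
 proof -
  have "un (P ** Z ** Q + dagger Q ** dagger Z ** dagger P) = un (P ** X ** Q - dagger Q ** X ** dagger P)" by (simp only: Z(3))
  thus ?thesis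
   by (simp add: linear_add[OF bounded_linear.linear[OF bounded_linear_un]] linear_diff[OF bounded_linear.linear[OF bounded_linear_un]]
     un_mult un_dagger uP uZ dagger_dagger dagger_mult mm_assoc)
 qed
 have uX: "dagger (un X) = - un X"
  using X(1) linear_neg[OF bounded_linear.linear[OF bounded_linear_un], of X] by (simp add: lie_k_def flip: un_dagger)
 obtain G0 where G0: "- C = - (- B ** G0 - G0 ** - B)" "!!\<gamma> e'. dagger \<gamma> = - \<gamma> ==>
   has_mderiv (\<lambda>t. clow a (- B + cscale t \<gamma>)) e' 0 ==> trace (\<gamma> ** G0) = of_real (Im (trace (dagger s.d ** e' ** un X)) / pi)"
  using s.dressing_variation[OF skew[OF C(1)] uX s.clow_mdd[of "- C", folded c'_def] dress] by (elim exE conjE) (rule that, blast+)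
 have tr: "of_real (E \<gamma>) = trace (\<gamma> ** (- (pi *\<^sub>R G0)))" if \<gamma>: "\<gamma> \<in> lie_k" for \<gamma>
 proof -
  define e where "e = mdd (clow a) (- B) (- \<gamma>)"
  have mF: "mdd F B \<gamma> = conjP w e" by (simp add: mdd_F[OF B] e_def)
  have PP: "P ** (Q ** M) = M" for M :: "'n cmat" by (simp add: mm_assoc PQ)
  obtain Q' where Q': "P ** Q' = mat 1" "Q' \<in> lie_K_star" using K_plus_inverse_lie[OF Pk] by metis
  have "Q \<in> lie_K_star" using mm_left_inverse_unique[OF Q'(1) PQ(2)] Q'(2) by simp
  \<comment> \<open>The left-trivialised tangent vector, the argument on which the pairing with X is
    defined.\<close>
  hence "Q ** mdd F B \<gamma> \<in> lie_K_star" using lie_K_star_mult mdd_F_lie_K_star[OF B \<gamma>] by blast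
  from X(2)[OF this] have "E \<gamma> = Im (trace (Q ** mdd F B \<gamma> ** X))" by (simp add: E[OF \<gamma>] PP)
  also have "Q ** mdd F B \<gamma> ** X = conjP w (dagger s.d ** e ** un X)" by (simp add: mF Q_def conjP_mult[OF w])
  also have "trace (conjP w M) = trace M" for M :: "'n cmat"
  proof -
   have "trace (conjP w M) = trace (perm_mat w ** (matrix_inv (perm_mat w) ** M))" unfolding conjP_def by (rule trace_mm_commute)
   thus ?thesis by (simp add: mm_assoc perm_mat_inv[OF w])
  qed
  finally have e1: "E \<gamma> = Im (trace (dagger s.d ** e ** un X))" .
  have e2: "trace (- \<gamma> ** G0) = of_real (Im (trace (dagger s.d ** e ** un X)) / pi)"
   unfolding e_def by (rule G0(2)[OF skew[OF \<gamma>] s.clow_mdd])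
  have "trace (\<gamma> ** G0) = - trace (- \<gamma> ** G0)"
   by (simp add: mm.minus_left linear_neg[OF bounded_linear.linear[OF bounded_linear_trace]])
  hence "trace (\<gamma> ** G0) = - (of_real (E \<gamma>) / pi)" unfolding e1 e2 by simp
  thus ?thesis
   by (simp add: mm.minus_right trace_cscale linear_neg[OF bounded_linear.linear[OF bounded_linear_trace]] flip: cscale_of_real)
 qed
 \<comment> \<open>G0 is skew-Hermitian because its traces against skew-Hermitian matrices are real;
   this places R in \<open>lie_k\<close>.\<close>
 have "dagger G0 + G0 = 0"
 proof (rule trace_skew_zero)
  fix \<gamma> :: "'n cmat" assume \<gamma>: "dagger \<gamma> = - \<gamma>"
  hence t: "trace (\<gamma> ** G0) = of_real (Im (trace (dagger s.d ** mdd (clow a) (- B) \<gamma> ** un X)) / pi)" by (rule G0(2)) (rule s.clow_mdd)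
  hence "cnj (trace (\<gamma> ** G0)) = trace (\<gamma> ** G0)" by simp
  moreover have "cnj (trace (\<gamma> ** G0)) = - trace (\<gamma> ** dagger G0)"
   unfolding cnj_trace by (simp add: dagger_mult \<gamma> mm.minus_right linear_neg[OF bounded_linear.linear[OF bounded_linear_trace]] trace_mm_commute)
  ultimately have "trace (\<gamma> ** G0) = - trace (\<gamma> ** dagger G0)" by metis
  thus "trace (\<gamma> ** (dagger G0 + G0)) = 0" by (simp add: mm.add_right trace_add)
 qed
 hence "dagger G0 = - G0" by (simp only: eq_neg_iff_add_eq_0)
 hence "- (pi *\<^sub>R G0) \<in> lie_k" by (simp add: lie_k_def dagger_uminus dagger_scaleR)
 hence kf: "k_covector E = - (pi *\<^sub>R G0)" by (rule k_covector_eq) (rule tr)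
 moreover have "pi *\<^sub>R C = B ** - (pi *\<^sub>R G0) - - (pi *\<^sub>R G0) ** B"
 proof -
  have "C = - (B ** G0) + G0 ** B" using arg_cong[OF G0(1), of uminus] by (simp add: mm.minus_left mm.minus_right)
  thus ?thesis by (simp add: mm.minus_left mm.minus_right mm.scaleR_left mm.scaleR_right scaleR_diff_right)
 qed
 ultimately show ?thesis using C tr Z(2) by (intro bexI[of _ C] exI[of _ "- (pi *\<^sub>R G0)"]) (auto simp: X_def)
qed

text \<open>Tr(B [R, S]) = Tr([B, R] S) = pi Tr(C S), which is pi times the derivative of the second
  pulled back function along C, hence pi times the derivative of the second function along the
  dressing vector.\<close>

lemma F_poisson: "poisson_map lie_k k_dual_poisson lie_K_star K_plus (\<lambda>b \<alpha> \<beta>. pi * K_star_poisson b \<alpha> \<beta>) F"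
 unfolding poisson_map_def
proof (intro allI impI ballI)
 fix f h :: "'n cmat => real" and B :: "'n cmat"
 assume f: "smooth_on lie_K_star K_plus f" and h: "smooth_on lie_K_star K_plus h" and B: "B \<in> lie_k"
 define E where "E f = frechet_derivative (f \<circ> F) (at B within lie_k)" for f :: "'n cmat => real"
 define D where "D f = frechet_derivative f (at (F B) within K_plus)" for f :: "'n cmat => real"
 have lift: "\<exists>C\<in>lie_k. \<exists>R. k_covector (E f) = R & (\<forall>\<gamma>\<in>lie_k. of_real (E f \<gamma>) = trace (\<gamma> ** R)) &
  mdd F B C = dressing_field (covector_to_k (F B) (D f)) (F B) & pi *\<^sub>R C = B ** R - R ** B"
  if "smooth_on lie_K_star K_plus f" for f
  unfolding E_def D_def by (rule hamiltonian_lift[OF B refl pullback_derivative(1)[OF that B]]) (rule pullback_derivative(2)[OF that B])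
 obtain C R where C: "C \<in> lie_k" "k_covector (E f) = R"
  "mdd F B C = dressing_field (covector_to_k (F B) (D f)) (F B)" "pi *\<^sub>R C = B ** R - R ** B" using lift[OF f] by blast
 obtain S where S: "k_covector (E h) = S" "!!\<gamma>. \<gamma> \<in> lie_k ==> of_real (E h \<gamma>) = trace (\<gamma> ** S)"
  using lift[OF h] by blast
 have "trace (B ** (R ** S - S ** R)) = trace ((pi *\<^sub>R C) ** S)" using trace_mm_commute[of "B ** S" R]
  by (simp add: C(4) mm.diff_left mm.diff_right trace_sub mm_assoc)
 also have "... = of_real (pi * E h C)" using S(2)[OF C(1)] by (simp add: mm.scaleR_left trace_cscale flip: cscale_of_real)
 also have "E h C = D h (dressing_field (covector_to_k (F B) (D f)) (F B))" using pullback_derivative(2)[OF h B C(1)] C(3) by (simp add: E_def D_def)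
 finally show "poisson_bracket lie_k k_dual_poisson (f \<circ> F) (h \<circ> F) B = poisson_bracket K_plus (\<lambda>b \<alpha> \<beta>. pi * K_star_poisson b \<alpha> \<beta>) f h (F B)"
  unfolding poisson_bracket_def k_dual_poisson_def Let_def K_star_poisson_def E_def[symmetric] D_def[symmetric] C(2) S(1)
  by (simp only: Re_complex_of_real)
qed

end

section \<open>Transfer from \<open>F\<close> to \<open>monodromy_map\<close>\<close>

lemma Ck_on_cong: "(!!x. x \<in> S ==> f x = g x) ==> Ck_on k V S f ==> Ck_on k V S g"
proof (cases k)
 case 0
 thus "(!!x. x \<in> S ==> f x = g x) ==> Ck_on k V S f ==> Ck_on k V S g" by (simp cong: continuous_on_cong)
next
 case (Suc m)
 assume e: "!!x. x \<in> S ==> f x = g x" and "Ck_on k V S f"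
 then obtain f' where f': "!!x. x \<in> S ==> (f has_derivative f' x) (at x within S)" "\<forall>v\<in>V. Ck_on m V S (\<lambda>x. f' x v)"
  unfolding Suc Ck_on.simps by blast
 have "\<forall>x\<in>S. (g has_derivative f' x) (at x within S)" by (intro ballI has_derivative_transform[OF _ _ f'(1)]) (simp_all add: e)
 with f'(2) show "Ck_on k V S g" unfolding Suc Ck_on.simps by blast
qed

lemma frechet_derivative_cong:
 assumes "x \<in> S" "!!y. y \<in> S ==> f y = g y"
 shows "frechet_derivative f (at x within S) = frechet_derivative g (at x within S)"
proof -
 have "(f has_derivative D) (at x within S) = (g has_derivative D) (at x within S)" for D
  using has_derivative_transform[OF assms(1), of f g D] has_derivative_transform[OF assms(1), of g f D] assms(2) by auto
 thus ?thesis by (simp add: frechet_derivative_def)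
qed

lemma inv_into_cong: "(!!x. x \<in> S ==> f x = g x) ==> inv_into S f = inv_into S g"
 unfolding inv_into_def by (intro ext arg_cong[where f=Eps]) auto

theorem theorem2:
 fixes A0 :: "'n::{finite,wellorder} cmat" and l :: nat and d :: "int \<Rightarrow> real"
 assumes "A0 \<in> diag_mats" and "dagger A0 = - A0" and "inj (\<lambda>i. A0 $ i $ i)"
  and "anti_stokes_labelling A0 l d" and "d 0 < 0" and "0 < d 1"
 shows "bij_betw (monodromy_map A0 l d) lie_k K_star \<and>
  diffeo lie_k lie_k lie_K_star K_plus (b_plus_of \<circ> monodromy_map A0 l d) \<and>
  poisson_map lie_k k_dual_poisson
   lie_K_star K_plus (\<lambda>b \<alpha> \<beta>. pi * K_star_poisson b \<alpha> \<beta>)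
   (b_plus_of \<circ> monodromy_map A0 l d)"
proof -
 have l: "l = 1" and d: "!!k. d k = of_int k * pi - pi / 2" by (rule labelling_imaginary[OF assms])+
 define w where "w = stokes_perm A0 1 d"
 \<comment> \<open>The facts about - A0 and the permutation were proved in a context with a fixed
   skew-Hermitian residue; 0 serves as this residue.\<close>
 have z: "dagger (0 :: 'n cmat) = - 0" by (simp add: vec_eq_iff)
 interpret monodromy "- A0" w
  by unfold_locales (use irr_a(1)[OF assms(1-3) z refl refl d w_def refl refl] w_perm[OF assms(1-3) z refl refl d w_def refl refl] in simp_all)
 let ?m = "monodromy_map A0 1 d"
 have m: "?m B \<in> K_star" "F B = (b_plus_of \<circ> ?m) B" if "B \<in> lie_k" for B
  using monodromy_K_star[OF assms(1-3) _ refl refl d w_def refl refl, of B] that by (simp_all add: lie_k_def F_def)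
 have F: "bij_betw (b_plus_of \<circ> ?m) lie_k K_plus" using F_bij bij_betw_cong[of lie_k F "b_plus_of \<circ> ?m"] m(2) by metis
 have "bij_betw ?m lie_k K_star" using bij_betw_comp_iff2[OF bij_betw_b_plus_of, of ?m lie_k] m(1) F by blast
 moreover have "diffeo lie_k lie_k lie_K_star K_plus (b_plus_of \<circ> ?m)"
 proof -
  have "inv_into lie_k (b_plus_of \<circ> ?m) = G" by (rule inv_into_cong[OF m(2), symmetric])
  moreover have "smooth_on lie_k lie_k (b_plus_of \<circ> ?m)"
   unfolding smooth_on_def by (intro allI Ck_on_cong[OF m(2)]) (use F_smooth in \<open>simp_all add: smooth_on_def\<close>)
  ultimately show ?thesis unfolding diffeo_def using F G_smooth by simp
 qed
 moreover have "poisson_map lie_k k_dual_poisson lie_K_star K_plus (\<lambda>b \<alpha> \<beta>. pi * K_star_poisson b \<alpha> \<beta>) (b_plus_of \<circ> ?m)"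
  unfolding poisson_map_def
 proof (intro allI impI ballI)
  fix f h :: "'n cmat => real" and B :: "'n cmat"
  assume "smooth_on lie_K_star K_plus f" "smooth_on lie_K_star K_plus h" and B: "B \<in> lie_k"
  hence "poisson_bracket lie_k k_dual_poisson (f \<circ> F) (h \<circ> F) B = poisson_bracket K_plus (\<lambda>b \<alpha> \<beta>. pi * K_star_poisson b \<alpha> \<beta>) f h (F B)"
   using F_poisson unfolding poisson_map_def by blast
  moreover have "frechet_derivative (k \<circ> (b_plus_of \<circ> ?m)) (at B within lie_k) = frechet_derivative (k \<circ> F) (at B within lie_k)" for k :: "'n cmat => real"
   by (rule frechet_derivative_cong[OF B]) (simp add: m(2))
  ultimately show "poisson_bracket lie_k k_dual_poisson (f \<circ> (b_plus_of \<circ> ?m)) (h \<circ> (b_plus_of \<circ> ?m)) B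
   = poisson_bracket K_plus (\<lambda>b \<alpha> \<beta>. pi * K_star_poisson b \<alpha> \<beta>) f h ((b_plus_of \<circ> ?m) B)"
   using m(2)[OF B] by (simp add: poisson_bracket_def)
 qed
 ultimately show ?thesis unfolding l by blast
qed

end
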